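(* Let $(M, ds^2_{\rm K})$ be a smooth $n$-dimensional Riemannian manifold, $V: M\to\mathbb{R}$ smooth, $E\in\mathbb{R}$, $f=2(E-V)$, with Hill region $\mathcal{H}=\{f\ge 0\}$, Hill boundary $\partial\mathcal{H}=\{f=0\}$ and Jacobi--Maupertuis (JM) metric $ds^2_{\rm JM}=f\,ds^2_{\rm K}$. Let $q_0\in\partial\mathcal{H}$ be a regular point ($df(q_0)\ne 0$), and let $A$ be a cylinder set about $q_0$ whose height $\epsilon$ is sufficiently small. Then for every $q\in A$ with $q\notin\partial\mathcal{H}$, with brake point $q_*\in\partial\mathcal{H}\cap A$ and first conjugate locus $C(q)\subset A$, the following hold. (i) $C(q)$ is a smooth hypersurface which intersects the Hill boundary tangentially at $q_*$ and in no other point. (ii) As a singularity of the exponential map at $q$, $C(q)$ represents the fold singularity. (iii) Every geodesic arc through $q$ in $A$ lies entirely on the side of $C(q)$ closest to $q$. (iv) With the single exception of the brake orbit $[q,q_*]$, if a geodesic arc through $q$ in $A$ touches $C(q)$, then it touches $C(q)$ tangentially. (v) Every geodesic through $q$ whose initial tangent vector $v$ is sufficiently close to the "straight down" direction $-\partial/\partial y$ touches $C(q)$.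
   Context: Newton's equations are $\nabla_{\dot\gamma}\dot\gamma=-\nabla V(\gamma)$, with $\nabla$ the Levi-Civita connection (respectively the gradient) of $ds^2_{\rm K}$. Solutions of energy $\frac12\|\dot\gamma\|^2+V(\gamma)=E$ satisfy $\|\dot\gamma\|^2=f(\gamma)$. They are, up to reparameterization, the geodesics of $ds^2_{\rm JM}$ in $\{f>0\}$, and "JM geodesic" (or "geodesic") means such a curve. A solution with $\gamma(t_0)\in\partial\mathcal{H}$ has $\dot\gamma(t_0)=0$ and $\gamma(t_0+t)=\gamma(t_0-t)$. It is called a brake orbit with brake point $\gamma(t_0)$, and it counts as a JM geodesic. Seifert (cylinder) coordinates near a regular boundary point $q_0$: coordinates $(x,y)$ on $\mathcal{H}$ near $q_0$, with $x=(x_1,\dots,x_{n-1})\in\mathbb{R}^{n-1}$ and $y\ge 0$, centered at $q_0$ (so $q_0$ is $(0,0)$). The Hill boundary is $\{y=0\}$, the curves $x=\text{const}$ are reparameterized brake orbits with brake point on $\{y=0\}$, and the JM metric has the form $ds^2_{\rm JM}=y\,(dy^2+\sum g_{ij}(x,y)\,dx_i\,dx_j)$ with $g_{ij}$ smooth and $g_{ij}(0,0)=\delta_{ij}$. A cylinder set (cylinder neighborhood) $A$ of height $\epsilon$ is the set of points with coordinates $(x,y)\in W\times[0,\epsilon]$, where $W\subset\mathbb{R}^{n-1}$ is a neighborhood of $0$. "Straight down" is the direction $-\partial/\partial y$. For $q=(x,y)\in A$, $q_*=(x,0)$ is the brake point of the brake orbit connecting $q$ to the boundary, and $[q,q_*]$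 denotes the vertical segment of this brake orbit between $q$ and $q_*$. Exponential map and conjugate locus: for $q\in A$ with $y(q)>0$, consider the map $(v,t)\mapsto\gamma_v(t)$, where $v$ ranges over the $(n-1)$-sphere $\{v\in T_qM:\|v\|_{\rm K}^2=f(q)\}$, $t>0$, and $\gamma_v$ solves Newton's equations with $\gamma_v(0)=q$, $\dot\gamma_v(0)=v$, restricted to those $(v,t)$ for which the arc $\gamma_v([0,t])$ lies in $A$. A point $\gamma_v(t)$ is conjugate to $q$ along this arc if $(v,t)$ is a critical point of this map. $C(q)$ is the first conjugate locus of $q$ for the JM metric restricted to $A$, i.e. the set of (first) conjugate points of $q$ along geodesic arcs lying in $A$. Fold: a smooth map between manifolds of the same dimension $n$ represents a fold singularity if its set of critical points is a smooth hypersurface in the domain, along which the differential has rank $n-1$ and its kernel is transverse to the tangent space of that hypersurface. The side of $C(q)$ closest to $q$ is the closure of the connected component of $A\setminus C(q)$ that contains $q$.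
   Formalization: The base W of the cylinder set is taken to be an open neighborhood of 0 with compact closure inside the coordinate domain (for closed W part (v) fails at the edge; otherwise no uniform height need exist), and C(q) may have boundary on the top face y = ε. *)

theory Defs
  imports "HOL-Analysis.Analysis"
begin

primrec Ck_on :: "nat \<Rightarrow> 'a::euclidean_space set \<Rightarrow> ('a \<Rightarrow> 'b::real_normed_vector) \<Rightarrow> bool" where
  "Ck_on 0 X h \<longleftrightarrow> continuous_on X h"
| "Ck_on (Suc m) X h \<longleftrightarrow> (\<forall>z\<in>X. h differentiable (at z)) \<and>
     (\<forall>w. Ck_on m X (\<lambda>z. frechet_derivative h (at z) w))"

text \<open>Only meant for open sets \<open>X\<close>.\<close>
definition smooth_on :: "'a::euclidean_space set \<Rightarrow> ('a \<Rightarrow> 'b::real_normed_vector) \<Rightarrow> bool" where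
  "smooth_on X h \<longleftrightarrow> (\<forall>m. Ck_on m X h)"

text \<open>Velocities at \<open>z\<close> of curves in \<open>X\<close>; for an embedded submanifold \<open>X\<close> this is the usual
  tangent space.\<close>
definition tangent_space :: "'a::euclidean_space set \<Rightarrow> 'a \<Rightarrow> 'a set" where
  "tangent_space X z = {w. \<exists>\<alpha> \<delta>. 0 < \<delta> \<and> (\<forall>s. \<bar>s\<bar> < \<delta> \<longrightarrow> \<alpha> s \<in> X) \<and> \<alpha> (0::real) = z \<and>
     (\<alpha> has_vector_derivative w) (at 0)}"

text \<open>\<open>\<Sigma>\<close> is an embedded smooth hypersurface (without boundary, not necessarily closed) of the
  embedded submanifold \<open>X\<close>: locally the zero set of a smooth function that is regular along
  \<open>X\<close>.\<close>
definition smooth_hypersurface :: "'a::euclidean_space set \<Rightarrow> 'a set \<Rightarrow> bool" where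
  "smooth_hypersurface X \<Sigma> \<longleftrightarrow> \<Sigma> \<subseteq> X \<and>
     (\<forall>z\<in>\<Sigma>. \<exists>N (h :: 'a \<Rightarrow> real). open N \<and> z \<in> N \<and> smooth_on N h \<and>
        \<Sigma> \<inter> N = {y \<in> X \<inter> N. h y = 0} \<and>
        (\<forall>y\<in>\<Sigma> \<inter> N. \<exists>w\<in>tangent_space X y. frechet_derivative h (at y) w \<noteq> 0))"

text \<open>\<open>Y\<close> is the part \<open>u \<le> 0\<close> of the hypersurface \<open>\<Sigma>\<close>, and \<open>\<Sigma>\<close> is transverse to \<open>u = 0\<close>; so
  \<open>Y\<close> is a smooth hypersurface whose only possible boundary lies on \<open>u = 0\<close>. The hypersurface
  \<open>\<Sigma>\<close> is a witness that provides tangent spaces at these boundary points as well.\<close>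
definition hypersurface_upto ::
  "'a::euclidean_space set \<Rightarrow> ('a \<Rightarrow> real) \<Rightarrow> 'a set \<Rightarrow> 'a set \<Rightarrow> bool" where
  "hypersurface_upto X u Y \<Sigma> \<longleftrightarrow> smooth_hypersurface X \<Sigma> \<and> Y = {z \<in> \<Sigma>. u z \<le> 0} \<and>
     (\<forall>z\<in>\<Sigma>. u z = 0 \<longrightarrow> u differentiable (at z) \<and>
        (\<exists>w\<in>tangent_space \<Sigma> z. frechet_derivative u (at z) w \<noteq> 0))"

text \<open>A map \<open>F\<close> is given on a subset \<open>D\<close> of the manifold \<open>X\<close>, where \<open>X\<close> has the dimension of the
  target. Its differential at \<open>z\<close> is the derivative of \<open>F\<close> restricted to the tangent space of
  \<open>X\<close>.\<close>
definition crit_set ::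
  "'a::euclidean_space set \<Rightarrow> 'a set \<Rightarrow> ('a \<Rightarrow> 'b::euclidean_space) \<Rightarrow> 'a set" where
  "crit_set X D F = {z \<in> D. frechet_derivative F (at z) ` tangent_space X z \<noteq> UNIV}"

text \<open>Fold singularity. The function \<open>u\<close> describes the boundary of the domain \<open>D\<close>, as in
  \<open>hypersurface_upto\<close>. Transversality means that the kernel and the tangent space of the
  critical hypersurface together span.\<close>
definition represents_fold ::
  "'a::euclidean_space set \<Rightarrow> 'a set \<Rightarrow> ('a \<Rightarrow> real) \<Rightarrow> ('a \<Rightarrow> 'b::euclidean_space) \<Rightarrow> bool" where
  "represents_fold X D u F \<longleftrightarrow> (\<exists>N. open N \<and> D \<subseteq> N \<and> smooth_on N F) \<and>
     (\<exists>\<Sigma>. hypersurface_upto X u (crit_set X D F) \<Sigma> \<and>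
        (\<forall>z\<in>crit_set X D F.
           dim (frechet_derivative F (at z) ` tangent_space X z) = DIM('b) - 1 \<and>
           {a + b | a b. a \<in> tangent_space X z \<and> frechet_derivative F (at z) a = 0 \<and>
              b \<in> tangent_space \<Sigma> z} = tangent_space X z))"

text \<open>The points of the manifold are all elements of a topological type. A chart is a domain
  together with a coordinate map, whose values outside the domain are irrelevant.\<close>
type_synonym ('p, 'n) chart = "'p set \<times> ('p \<Rightarrow> real ^ 'n)"

definition chart_img :: "('p, 'n::finite) chart \<Rightarrow> (real ^ 'n) set" where
  "chart_img c = snd c ` fst c"

definition chart_inv :: "('p, 'n::finite) chart \<Rightarrow> real ^ 'n \<Rightarrow> 'p" where
  "chart_inv c = inv_into (fst c) (snd c)"

definition is_chart :: "('p::topological_space, 'n::finite) chart \<Rightarrow> bool" where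
  "is_chart c \<longleftrightarrow> open (fst c) \<and> open (chart_img c) \<and>
     homeomorphism (fst c) (chart_img c) (snd c) (chart_inv c)"

definition compatible :: "('p, 'n::finite) chart \<Rightarrow> ('p, 'n) chart \<Rightarrow> bool" where
  "compatible c c' \<longleftrightarrow>
     smooth_on (snd c ` (fst c \<inter> fst c')) (snd c' \<circ> chart_inv c) \<and>
     smooth_on (snd c' ` (fst c \<inter> fst c')) (snd c \<circ> chart_inv c')"

text \<open>The metric is given by its matrix of components at every point of every chart of the
  maximal atlas.\<close>
record ('p, 'n) mech_system =
  sys_atlas :: "('p, 'n) chart set"
  sys_metric :: "('p, 'n) chart \<Rightarrow> 'p \<Rightarrow> real ^ 'n ^ 'n"
  sys_potential :: "'p \<Rightarrow> real"
  sys_energy :: real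

definition charts :: "('p::topological_space, 'n::finite) mech_system \<Rightarrow> ('p, 'n) chart set" where
  "charts S = {c. is_chart c \<and> (\<forall>c'\<in>sys_atlas S. compatible c c')}"

definition smooth_manifold :: "('p::topological_space, 'n::finite) mech_system \<Rightarrow> bool" where
  "smooth_manifold S \<longleftrightarrow> (\<Union>c\<in>sys_atlas S. fst c) = UNIV \<and> (\<forall>c\<in>sys_atlas S. is_chart c) \<and>
     (\<forall>c\<in>sys_atlas S. \<forall>c'\<in>sys_atlas S. compatible c c')"

definition transition_jacobian ::
  "('p, 'n::finite) chart \<Rightarrow> ('p, 'n) chart \<Rightarrow> 'p \<Rightarrow> real ^ 'n ^ 'n" where
  "transition_jacobian c c' p = matrix (frechet_derivative (snd c' \<circ> chart_inv c) (at (snd c p)))"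

definition riemannian_metric :: "('p::topological_space, 'n::finite) mech_system \<Rightarrow> bool" where
  "riemannian_metric S \<longleftrightarrow>
     (\<forall>c\<in>charts S. smooth_on (chart_img c) (sys_metric S c \<circ> chart_inv c) \<and>
        (\<forall>p\<in>fst c. transpose (sys_metric S c p) = sys_metric S c p \<and>
           (\<forall>v. v \<noteq> 0 \<longrightarrow> v \<bullet> (sys_metric S c p *v v) > 0))) \<and>
     (\<forall>c\<in>charts S. \<forall>c'\<in>charts S. \<forall>p\<in>fst c \<inter> fst c'.
        sys_metric S c p =
          transpose (transition_jacobian c c' p) ** sys_metric S c' p ** transition_jacobian c c' p)"

definition smooth_potential :: "('p::topological_space, 'n::finite) mech_system \<Rightarrow> bool" where
  "smooth_potential S \<longleftrightarrow> (\<forall>c\<in>charts S. smooth_on (chart_img c) (sys_potential S \<circ> chart_inv c))"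

definition mechanical_system :: "('p::topological_space, 'n::finite) mech_system \<Rightarrow> bool" where
  "mechanical_system S \<longleftrightarrow> smooth_manifold S \<and> riemannian_metric S \<and> smooth_potential S"

definition partial :: "'n::finite \<Rightarrow> (real ^ 'n \<Rightarrow> real) \<Rightarrow> real ^ 'n \<Rightarrow> real" where
  "partial i h z = frechet_derivative h (at z) (axis i 1)"

text \<open>Christoffel symbols of the Levi-Civita connection of a metric with component matrix
  \<open>g z\<close>.\<close>
definition christoffel ::
  "(real ^ 'n \<Rightarrow> real ^ 'n ^ 'n) \<Rightarrow> real ^ 'n \<Rightarrow> 'n::finite \<Rightarrow> 'n \<Rightarrow> 'n \<Rightarrow> real" where
  "christoffel g z l i j = (1 / 2) * (\<Sum>m\<in>UNIV. matrix_inv (g z) $ l $ m *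
     (partial i (\<lambda>y. g y $ j $ m) z + partial j (\<lambda>y. g y $ i $ m) z
        - partial m (\<lambda>y. g y $ i $ j) z))"

definition gradient ::
  "(real ^ 'n \<Rightarrow> real ^ 'n ^ 'n) \<Rightarrow> (real ^ 'n \<Rightarrow> real) \<Rightarrow> real ^ 'n \<Rightarrow> real ^ 'n::finite" where
  "gradient g h z = matrix_inv (g z) *v (\<chi> m. partial m h z)"

text \<open>Components, in the chart \<open>c\<close>, of the velocity and of the covariant acceleration of a
  curve.\<close>
definition velocity :: "('p, 'n::finite) chart \<Rightarrow> (real \<Rightarrow> 'p) \<Rightarrow> real \<Rightarrow> real ^ 'n" where
  "velocity c \<gamma> t = vector_derivative (snd c \<circ> \<gamma>) (at t)"

definition covariant_acceleration ::
  "('p, 'n::finite) mech_system \<Rightarrow> ('p, 'n) chart \<Rightarrow> (real \<Rightarrow> 'p) \<Rightarrow> real \<Rightarrow> real ^ 'n" where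
  "covariant_acceleration S c \<gamma> t = vector_derivative (velocity c \<gamma>) (at t) +
     (\<chi> l. \<Sum>i\<in>UNIV. \<Sum>j\<in>UNIV. christoffel (sys_metric S c \<circ> chart_inv c) (snd c (\<gamma> t)) l i j *
        velocity c \<gamma> t $ i * velocity c \<gamma> t $ j)"

definition newton_solution ::
  "('p::topological_space, 'n::finite) mech_system \<Rightarrow> real set \<Rightarrow> (real \<Rightarrow> 'p) \<Rightarrow> bool" where
  "newton_solution S J \<gamma> \<longleftrightarrow> open J \<and> is_interval J \<and> continuous_on J \<gamma> \<and>
     (\<forall>t\<in>J. \<forall>c\<in>charts S. \<gamma> t \<in> fst c \<longrightarrow>
        (snd c \<circ> \<gamma>) differentiable (at t) \<and> velocity c \<gamma> differentiable (at t) \<and>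
        covariant_acceleration S c \<gamma> t =
          - gradient (sys_metric S c \<circ> chart_inv c) (sys_potential S \<circ> chart_inv c)
              (snd c (\<gamma> t)))"

definition has_energy ::
  "('p::topological_space, 'n::finite) mech_system \<Rightarrow> real set \<Rightarrow> (real \<Rightarrow> 'p) \<Rightarrow> bool" where
  "has_energy S J \<gamma> \<longleftrightarrow> (\<forall>t\<in>J. \<forall>c\<in>charts S. \<gamma> t \<in> fst c \<longrightarrow>
     (1 / 2) * (velocity c \<gamma> t \<bullet> (sys_metric S c (\<gamma> t) *v velocity c \<gamma> t))
       + sys_potential S (\<gamma> t) = sys_energy S)"

definition hill_fun :: "('p, 'n::finite) mech_system \<Rightarrow> 'p \<Rightarrow> real" where
  "hill_fun S p = 2 * (sys_energy S - sys_potential S p)"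

definition hill_region :: "('p, 'n::finite) mech_system \<Rightarrow> 'p set" where
  "hill_region S = {p. hill_fun S p \<ge> 0}"

definition hill_boundary :: "('p, 'n::finite) mech_system \<Rightarrow> 'p set" where
  "hill_boundary S = {p. hill_fun S p = 0}"

definition regular_boundary_point ::
  "('p::topological_space, 'n::finite) mech_system \<Rightarrow> 'p \<Rightarrow> bool" where
  "regular_boundary_point S q \<longleftrightarrow> q \<in> hill_boundary S \<and>
     (\<forall>c\<in>charts S. q \<in> fst c \<longrightarrow>
        (\<exists>w. frechet_derivative (hill_fun S \<circ> chart_inv c) (at (snd c q)) w \<noteq> 0))"

definition jm_metric ::
  "('p, 'n::finite) mech_system \<Rightarrow> ('p, 'n) chart \<Rightarrow> 'p \<Rightarrow> real ^ 'n ^ 'n" where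
  "jm_metric S c p = hill_fun S p *\<^sub>R sys_metric S c p"

text \<open>The coordinate \<open>y\<close> is the component with a distinguished index \<open>k\<close>, and \<open>x\<close> consists of the
  remaining components. The space of the \<open>x\<close> is identified with the hyperplane of vectors whose
  \<open>k\<close>-th component vanishes.\<close>
definition x_part :: "'n \<Rightarrow> real ^ 'n \<Rightarrow> real ^ 'n::finite" where
  "x_part k z = z - (z $ k) *\<^sub>R axis k 1"

definition brake_point :: "('p, 'n::finite) chart \<Rightarrow> 'n \<Rightarrow> 'p \<Rightarrow> 'p" where
  "brake_point c k q = chart_inv c (x_part k (snd c q))"

definition vertical_segment :: "('p, 'n::finite) chart \<Rightarrow> 'n \<Rightarrow> 'p \<Rightarrow> 'p set" where
  "vertical_segment c k q =
     {p \<in> fst c. x_part k (snd c p) = x_part k (snd c q) \<and> 0 \<le> snd c p $ k \<and>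
        snd c p $ k \<le> snd c q $ k}"

text \<open>A solution of the given energy has zero velocity on the Hill boundary, so the curve
  \<open>\<gamma>\<close> below is a brake orbit. It is only required where the coordinate domain contains the whole
  segment down to \<open>y = 0\<close>.\<close>
definition seifert_chart ::
  "('p::topological_space, 'n::finite) mech_system \<Rightarrow> 'p \<Rightarrow> 'n \<Rightarrow> ('p, 'n) chart \<Rightarrow> bool" where
  "seifert_chart S q0 k c \<longleftrightarrow> c \<in> charts S \<and> q0 \<in> fst c \<and> snd c q0 = 0 \<and>
     fst c \<inter> hill_region S = {p \<in> fst c. snd c p $ k \<ge> 0} \<and>
     fst c \<inter> hill_boundary S = {p \<in> fst c. snd c p $ k = 0} \<and>
     (\<exists>g :: real ^ 'n \<Rightarrow> real ^ 'n ^ 'n. smooth_on (chart_img c) g \<and>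
        (\<forall>i j. i \<noteq> k \<and> j \<noteq> k \<longrightarrow> g 0 $ i $ j = (if i = j then 1 else 0)) \<and>
        (\<forall>p\<in>fst c \<inter> hill_region S.
           jm_metric S c p $ k $ k = snd c p $ k \<and>
           (\<forall>i. i \<noteq> k \<longrightarrow> jm_metric S c p $ i $ k = 0 \<and> jm_metric S c p $ k $ i = 0) \<and>
           (\<forall>i j. i \<noteq> k \<and> j \<noteq> k \<longrightarrow>
              jm_metric S c p $ i $ j = snd c p $ k * g (snd c p) $ i $ j))) \<and>
     (\<forall>q\<in>fst c \<inter> hill_region S.
        (\<forall>s\<in>{0..snd c q $ k}. x_part k (snd c q) + s *\<^sub>R axis k 1 \<in> chart_img c) \<longrightarrow>
        (\<exists>J \<gamma> T. newton_solution S J \<gamma> \<and> has_energy S J \<gamma> \<and> 0 \<le> T \<and> {0..T} \<subseteq> J \<and>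
           \<gamma> 0 = brake_point c k q \<and> \<gamma> ` {0..T} = vertical_segment c k q))"

text \<open>The base of a cylinder set: an open neighbourhood of the origin in the hyperplane, whose
  closure is compact and contained in the coordinate domain.\<close>
definition cylinder_base :: "('p, 'n::finite) chart \<Rightarrow> 'n \<Rightarrow> (real ^ 'n) set \<Rightarrow> bool" where
  "cylinder_base c k W \<longleftrightarrow> openin (top_of_set {x. x $ k = 0}) W \<and> 0 \<in> W \<and>
     bounded W \<and> closure W \<subseteq> chart_img c"

definition cylinder_set ::
  "('p, 'n::finite) chart \<Rightarrow> 'n \<Rightarrow> (real ^ 'n) set \<Rightarrow> real \<Rightarrow> 'p set \<Rightarrow> bool" where
  "cylinder_set c k W \<epsilon> A \<longleftrightarrow> A \<subseteq> fst c \<and>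
     snd c ` A = {x + y *\<^sub>R axis k 1 | x y. x \<in> W \<and> 0 \<le> y \<and> y \<le> \<epsilon>}"

text \<open>Arcs are parametrised by Newtonian time, on a closed subinterval of the domain of a
  solution.\<close>
definition geodesic_arc ::
  "('p::topological_space, 'n::finite) mech_system \<Rightarrow> 'p set \<Rightarrow> (real \<Rightarrow> 'p) \<Rightarrow> real \<Rightarrow> real \<Rightarrow> bool"
where
  "geodesic_arc S A \<gamma> a b \<longleftrightarrow> (\<exists>J. newton_solution S J \<gamma> \<and> has_energy S J \<gamma> \<and> {a..b} \<subseteq> J) \<and>
     \<gamma> ` {a..b} \<subseteq> A"

definition energy_sphere ::
  "('p, 'n::finite) mech_system \<Rightarrow> ('p, 'n) chart \<Rightarrow> 'p \<Rightarrow> (real ^ 'n) set" where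
  "energy_sphere S c q = {v. v \<bullet> (sys_metric S c q *v v) = hill_fun S q}"

text \<open>The point \<open>\<gamma>\<^sub>v(t)\<close>, where tangent vectors at \<open>q\<close> are given by their components in the chart
  \<open>c\<close>. It is unique by uniqueness of solutions of Newton's equations, and unspecified if the
  solution does not exist up to time \<open>t\<close>.\<close>
definition newton_exp ::
  "('p::topological_space, 'n::finite) mech_system \<Rightarrow> ('p, 'n) chart \<Rightarrow> 'p \<Rightarrow> (real ^ 'n) \<times> real \<Rightarrow> 'p"
where
  "newton_exp S c q = (\<lambda>(v, t). THE p. \<exists>J \<gamma>. newton_solution S J \<gamma> \<and> 0 \<in> J \<and> t \<in> J \<and>
     \<gamma> 0 = q \<and> velocity c \<gamma> 0 = v \<and> \<gamma> t = p)"

definition exp_manifold ::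
  "('p, 'n::finite) mech_system \<Rightarrow> ('p, 'n) chart \<Rightarrow> 'p \<Rightarrow> ((real ^ 'n) \<times> real) set" where
  "exp_manifold S c q = energy_sphere S c q \<times> {0<..}"

definition exp_domain ::
  "('p::topological_space, 'n::finite) mech_system \<Rightarrow> ('p, 'n) chart \<Rightarrow> 'p set \<Rightarrow> 'p \<Rightarrow>
    ((real ^ 'n) \<times> real) set" where
  "exp_domain S c A q = {(v, t) \<in> exp_manifold S c q. \<exists>J \<gamma>. newton_solution S J \<gamma> \<and>
     0 \<in> J \<and> t \<in> J \<and> \<gamma> 0 = q \<and> velocity c \<gamma> 0 = v \<and> \<gamma> ` {0..t} \<subseteq> A}"

definition exp_crit ::
  "('p::topological_space, 'n::finite) mech_system \<Rightarrow> ('p, 'n) chart \<Rightarrow> 'p set \<Rightarrow> 'p \<Rightarrow>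
    ((real ^ 'n) \<times> real) set" where
  "exp_crit S c A q =
     crit_set (exp_manifold S c q) (exp_domain S c A q) (snd c \<circ> newton_exp S c q)"

definition conjugate_locus ::
  "('p::topological_space, 'n::finite) mech_system \<Rightarrow> ('p, 'n) chart \<Rightarrow> 'p set \<Rightarrow> 'p \<Rightarrow> 'p set" where
  "conjugate_locus S c A q = {newton_exp S c q (v, t) | v t. (v, t) \<in> exp_crit S c A q \<and>
     (\<forall>t'. 0 < t' \<and> t' < t \<longrightarrow> (v, t') \<notin> exp_crit S c A q)}"

definition closest_side :: "'p::topological_space set \<Rightarrow> 'p set \<Rightarrow> 'p \<Rightarrow> 'p set" where
  "closest_side A C q = A \<inter> closure (connected_component_set (A - C) q)"

end

theory Submission
 imports Defs
begin

text \<open>For \<open>q = x + \<mu> s\<^sup>2 e\<close> with \<open>\<mu>\<close> the height of the cylinder and \<open>s \<in> (0, 1]\<close>, a velocity \<open>v\<close> and a time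
 \<open>t\<close> are encoded by \<open>w = t v / (\<mu> s)\<close>, which turns the energy sphere times \<open>t > 0\<close> into the punctured vector
 space, trajectories into rays, and the exponential map into \<open>w \<mapsto> x + \<mu> (s \<xi>(w), \<eta>(w))\<close>. Division of the
 horizontal part by \<open>s\<close> is possible because trajectories from the boundary are vertical. This map depends smoothly on
 \<open>(\<mu>, x, s, w)\<close> and at \<open>\<mu> = 0\<close> it is \<open>\<xi> = w\<^sub>x\<close>, \<open>\<eta> = s\<^sup>2 + s w\<^sub>y + K(w, w) / (4 h)\<close>: free fall in a constant
 field. All that is used of this fold (the function \<open>\<kappa>\<close> that vanishes at the critical points is transverse to the
 kernel and crosses zero once on each ray, and \<open>\<eta>\<close> is uniformly convex relative to its tangent planes along the
 fold) is stable under perturbation, uniformly over a compact set of \<open>(x, s, w)\<close>, hence holds for small \<open>\<mu>\<close>.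
 Convexity then makes the caustic a graph below every trajectory.\<close>

text \<open>Compactness alone does not suffice, because the unperturbed fold degenerates at s = 0:
  with \<kappa> = s + w_y / 2 the zero on a ray lies at w_y = -2 s, and the derivative of \<kappa>
  along the ray at this zero is only -s. An error of size \<mu> could destroy the single crossing
  for q close to the boundary, while \<mu> must not depend on q. The remedy is an exact statement:
  for every small \<mu> the function \<kappa> vanishes at s = 0, w_y = 0. Indeed for s = 0 the
  trajectory is the brake orbit whatever w is, so that w enters through the time only, and a
  vertical variation of the initial velocity stays vertical. Starting from these exact zeros, the
  mean value theorem gives increments proportional to s and w_y. The other estimates hold with a
  fixed margin at \<mu> = 0, also for s = 0. Time enters the rescaled equation only as t^2 / \<mu>,
  which by the energy condition is quadratic in w; square roots appear only in the return to (v, t).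
  The hypersurface is the image of an open part of the fold that continues above the top of the
  cylinder, so that it has tangent spaces where the locus leaves A.\<close>

notation has_vector_derivative (infix "hvd" 50)
notation scaleR (infixr "*R" 75)

abbreviation FD :: "('a::real_normed_vector \<Rightarrow> 'b::real_normed_vector) \<Rightarrow> 'a \<Rightarrow> 'a \<Rightarrow> 'b" where
 "FD f z \<equiv> frechet_derivative f (at z)"

section \<open>Calculus of smooth maps\<close>

lemma Ck_on_imp_continuous_on: "Ck_on m X h ==> continuous_on X h"
 by (cases m) (auto intro!: continuous_at_imp_continuous_on differentiable_imp_continuous_within)

lemma Ck_on_has_derivative:
 "Ck_on (Suc m) X h ==> z : X ==> (h has_derivative FD h z) (at z)"
 by (simp add: frechet_derivative_works)

lemma Ck_on_frechet_derivative:
 "Ck_on (Suc m) X h ==> Ck_on m X (%z. FD h z w)"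
 by simp

text \<open>\<open>Ck_on\<close> asks for continuity only at the bottom of the recursion; there it
  follows from differentiability.\<close>

lemma Ck_on_SucD: "Ck_on (Suc m) X h ==> Ck_on m X h"
proof (induction m arbitrary: h)
 case 0
 then show ?case using Ck_on_imp_continuous_on[OF 0] by simp
next
 case (Suc m)
 have "Ck_on m X (%z. FD h z w)" for w
  using Suc.IH[of "%z. FD h z w"] Suc.prems by simp
 then show ?case using Suc.prems by simp
qed

lemma Ck_on_le: "Ck_on n X h ==> m <= n ==> Ck_on m X h"
proof (induction n)
 case (Suc n)
 then show ?case using Ck_on_SucD by (metis le_Suc_eq)
qed simp

lemma Ck_on_subset: "Ck_on m X h ==> Y <= X ==> Ck_on m Y h"
proof (induction m arbitrary: h)
 case 0
 then show ?case using continuous_on_subset by auto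
next
 case (Suc m)
 then show ?case by (metis Ck_on.simps(2) subsetD)
qed

lemma frechet_derivative_cong:
 assumes "open X" "z : X" "!!z. z : X ==> f z = g z"
 shows "FD f z = FD g z"
proof -
 have "(f has_derivative D) (at z) \<longleftrightarrow> (g has_derivative D) (at z)" for D
  using assms has_derivative_transform_within_open by metis
 then show ?thesis by (simp add: frechet_derivative_def)
qed

lemma Ck_on_cong:
 "open X ==> Ck_on m X f ==> (!!z. z : X ==> f z = g z) ==> Ck_on m X g"
proof (induction m arbitrary: f g)
 case 0
 then show ?case by (simp cong: continuous_on_cong)
next
 case (Suc m)
 have "(g has_derivative FD f z) (at z)" if "z : X" for z
  using Ck_on_has_derivative[OF Suc.prems(2) that] Suc.prems(1,3) that
   has_derivative_transform_within_open by blast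
 moreover have "Ck_on m X (%z. FD g z w)" for w
  by (rule Suc.IH[of "%z. FD f z w"])
   (use Suc.prems frechet_derivative_cong[OF Suc.prems(1) _ Suc.prems(3)] in \<open>auto simp: fun_eq_iff\<close>)
 ultimately show ?case by (auto simp: differentiable_def)
qed

text \<open>By uniqueness of derivatives any formula for the derivative on the open set may replace
  \<open>frechet_derivative\<close>. The closure properties below are inductions on the order that
  exhibit such a formula.\<close>

lemma Ck_on_SucI:
 assumes "open X" "!!z. z : X ==> (h has_derivative h' z) (at z)" "!!w. Ck_on m X (%z. h' z w)"
 shows "Ck_on (Suc m) X h"
proof -
 have "Ck_on m X (%z. FD h z w)" for w
  by (rule Ck_on_cong[OF assms(1) assms(3)[of w]])
   (simp add: frechet_derivative_at[OF assms(2)])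
 then show ?thesis using assms(2) by (auto simp: differentiable_def)
qed

lemma Ck_on_local:
 assumes "open X" "!!z. z : X ==> \<exists>N. open N & z : N & Ck_on m N h"
 shows "Ck_on m X h"
 using assms(2)
proof (induction m arbitrary: h)
 case 0
 then show ?case
  by (metis Ck_on.simps(1) assms(1) continuous_on_eq_continuous_at)
next
 case (Suc m)
 have "h differentiable (at z)" if "z : X" for z
  using Suc.prems[OF that] by auto
 moreover have "Ck_on m X (%z. FD h z w)" for w
  by (rule Suc.IH) (use Suc.prems in fastforce)
 ultimately show ?case by simp
qed

lemma Ck_on_const: "open X ==> Ck_on m X (%z. c)"
 by (induction m arbitrary: c) (auto intro!: Ck_on_SucI[where h' = "%_ _. 0"] simp del: Ck_on.simps(2))

lemma Ck_on_bounded_linear: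
 assumes "open X" "bounded_linear L"
 shows "Ck_on m X f ==> Ck_on m X (%z. L (f z))"
proof (induction m arbitrary: f)
 case 0
 then show ?case using assms by (simp add: bounded_linear.continuous_on)
next
 case (Suc m)
 show ?case
 proof (rule Ck_on_SucI[OF assms(1)])
  show "((%z. L (f z)) has_derivative (%w. L (FD f z w))) (at z)"
   if "z : X" for z
   by (rule bounded_linear.has_derivative[OF assms(2) Ck_on_has_derivative[OF Suc.prems that]])
  show "Ck_on m X (%z. L (FD f z w))" for w
   by (rule Suc.IH[OF Ck_on_frechet_derivative[OF Suc.prems]])
 qed
qed

lemma Ck_on_ident: "open X ==> Ck_on m X (%z. z)"
proof (cases m)
 case (Suc n)
 assume "open X"
 then show ?thesis unfolding Suc
  by (intro Ck_on_SucI[where h' = "%_ w. w"] Ck_on_const) (auto intro: derivative_intros)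
qed simp

lemma Ck_on_add:
 assumes "open X"
 shows "Ck_on m X f ==> Ck_on m X g ==> Ck_on m X (%z. f z + g z)"
proof (induction m arbitrary: f g)
 case 0
 then show ?case by (simp add: continuous_on_add)
next
 case (Suc m)
 show ?case
  by (rule Ck_on_SucI[OF assms has_derivative_add[OF
     Ck_on_has_derivative[OF Suc.prems(1)] Ck_on_has_derivative[OF Suc.prems(2)]]
     Suc.IH[OF Ck_on_frechet_derivative[OF Suc.prems(1)] Ck_on_frechet_derivative[OF Suc.prems(2)]]])
qed

lemma (in bounded_bilinear) Ck_on_prod:
 assumes "open X"
 shows "Ck_on m X f ==> Ck_on m X g ==> Ck_on m X (%z. prod (f z) (g z))"
proof (induction m arbitrary: f g)
 case 0
 then show ?case by (simp add: continuous_on)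
next
 case (Suc m)
 note f = Suc.prems(1) and g = Suc.prems(2)
 show ?case
 proof (rule Ck_on_SucI[OF assms])
  show "((%z. prod (f z) (g z)) has_derivative
    (%w. prod (f z) (FD g z w) + prod (FD f z w) (g z))) (at z)"
   if "z : X" for z
   by (rule FDERIV[OF Ck_on_has_derivative[OF f that] Ck_on_has_derivative[OF g that]])
  show "Ck_on m X (%z. prod (f z) (FD g z w) + prod (FD f z w) (g z))" for w
   by (intro Ck_on_add assms Suc.IH Ck_on_SucD[OF f] Ck_on_SucD[OF g]
     Ck_on_frechet_derivative[OF f] Ck_on_frechet_derivative[OF g])
 qed
qed

lemmas Ck_on_scaleR = bounded_bilinear.Ck_on_prod[OF bounded_bilinear_scaleR]
lemmas Ck_on_mult = bounded_bilinear.Ck_on_prod[OF bounded_bilinear_mult]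
lemmas Ck_on_inner = bounded_bilinear.Ck_on_prod[OF bounded_bilinear_inner]

lemma Ck_on_minus: "open X ==> Ck_on m X f ==> Ck_on m X (%z. - f z)"
 by (rule Ck_on_bounded_linear[OF _ bounded_linear_minus[OF bounded_linear_ident]])

lemma Ck_on_diff:
 "open X ==> Ck_on m X f ==> Ck_on m X g ==> Ck_on m X (%z. f z - g z)"
 using Ck_on_add[of X m f "%z. - g z"] Ck_on_minus[of X m g] by simp

lemma Ck_on_sum:
 assumes "open X" "!!i. i : I ==> Ck_on m X (f i)"
 shows "Ck_on m X (%z. \<Sum>i\<in>I. f i z)"
 using assms(2)
proof (induction I rule: infinite_finite_induct)
qed (auto intro!: Ck_on_const Ck_on_add assms(1))

lemma Ck_on_prod_real:
 fixes f :: "'i => 'a::euclidean_space => real"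
 assumes "open X" "!!i. i : I ==> Ck_on m X (f i)"
 shows "Ck_on m X (%z. \<Prod>i\<in>I. f i z)"
 using assms(2)
proof (induction I rule: infinite_finite_induct)
qed (auto intro!: Ck_on_const Ck_on_mult assms(1))

lemma linear_Basis_expansion:
 fixes f :: "'a::euclidean_space => 'b::real_vector"
 assumes "linear f"
 shows "f u = (\<Sum>b\<in>Basis. (u \<bullet> b) *R f b)"
proof -
 have "f u = f (\<Sum>b\<in>Basis. (u \<bullet> b) *R b)" by (simp add: euclidean_representation)
 also have "\<dots> = (\<Sum>b\<in>Basis. (u \<bullet> b) *R f b)"
  using linear_sum[OF assms, of "%b. (u \<bullet> b) *R b" Basis] linear_scale[OF assms] by simp
 finally show ?thesis .
qed

text \<open>In the chain rule both the base point and the direction of the derivative of g vary with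
  z. Expanding the direction in the basis leaves sums of products of scalar functions with
  derivatives of g in fixed directions composed with f, and the induction covers these because it
  runs over all g at once.\<close>

lemma Ck_on_compose:
 fixes g :: "'b::euclidean_space => 'c::real_normed_vector"
 assumes "open X" "open Y" "!!z. z : X ==> f z : Y"
 shows "Ck_on m Y g ==> Ck_on m X f ==> Ck_on m X (%z. g (f z))"
proof (induction m arbitrary: g)
 case 0
 then show ?case
  using assms(3) by (simp add: continuous_on_compose2 image_subset_iff)
next
 case (Suc m)
 note g = Suc.prems(1) and f = Suc.prems(2)
 show ?case
 proof (rule Ck_on_SucI[OF assms(1)])
  fix z assume z: "z : X"
  have "(g has_derivative FD g (f z)) (at (f z))"
   using Ck_on_has_derivative[OF g assms(3)[OF z]] .
  from has_derivative_compose[OF Ck_on_has_derivative[OF f z] this]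
  have "((%z. g (f z)) has_derivative (%w. FD g (f z) (FD f z w))) (at z)" .
  moreover have "linear (FD g (f z))"
   using Ck_on_has_derivative[OF g assms(3)[OF z]] has_derivative_linear by blast
  ultimately show "((%z. g (f z)) has_derivative (%w. \<Sum>b\<in>Basis. (FD f z w \<bullet> b) *R
    FD g (f z) b)) (at z)"
   by (metis (no_types, lifting) ext has_derivative_eq_rhs linear_Basis_expansion)
 next
  fix w
  have "Ck_on m X (%z. FD g (f z) b)" for b
   by (rule Suc.IH[OF Ck_on_frechet_derivative[OF g] Ck_on_SucD[OF f]])
  moreover have "Ck_on m X (%z. FD f z w \<bullet> b)" for b
   by (rule Ck_on_bounded_linear[OF assms(1) bounded_linear_inner_left Ck_on_frechet_derivative[OF f]])
  ultimately show "Ck_on m X (%z. \<Sum>b\<in>Basis. (FD f z w \<bullet> b) *R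
    FD g (f z) b)"
   by (intro Ck_on_sum Ck_on_scaleR assms(1))
 qed
qed

lemma Ck_on_Pair:
 assumes "open X" "Ck_on m X f" "Ck_on m X g"
 shows "Ck_on m X (%z. (f z,g z))"
proof -
 have "Ck_on m X (%z. (f z,0) + (0,g z))"
  by (intro Ck_on_add assms(1) Ck_on_bounded_linear[OF assms(1) _ assms(2)]
    Ck_on_bounded_linear[OF assms(1) _ assms(3)])
   (auto intro!: bounded_linear_Pair bounded_linear_ident bounded_linear_zero)
 then show ?thesis by simp
qed

text \<open>The derivative of 1 / f is a polynomial in 1 / f and the derivative of f, so the order
  can be raised one step at a time.\<close>

lemma Ck_on_inverse:
 fixes f :: "'a::euclidean_space => real"
 assumes "open X" "!!z. z : X ==> f z ~= 0"
 shows "Ck_on m X f ==> Ck_on m X (%z. inverse (f z))"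
proof (induction m)
 case 0
 then show ?case using assms by (simp add: continuous_on_inverse)
next
 case (Suc m)
 show ?case
 proof (rule Ck_on_SucI[OF assms(1)])
  show "((%z. inverse (f z)) has_derivative
    (%w. - (inverse (f z) * FD f z w * inverse (f z)))) (at z)" if "z : X" for z
   using Deriv.has_derivative_inverse[OF assms(2)[OF that] Ck_on_has_derivative[OF Suc.prems that]] .
  show "Ck_on m X (%z. - (inverse (f z) * FD f z w * inverse (f z)))" for w
   by (intro Ck_on_minus Ck_on_mult assms(1) Ck_on_frechet_derivative[OF Suc.prems]
     Suc.IH[OF Ck_on_SucD[OF Suc.prems]])
 qed
qed

lemma Ck_on_vec_lambda:
 fixes f :: "'a::euclidean_space => 'n::finite => 'b::real_normed_vector"
 assumes "open X" "!!i. Ck_on m X (%z. f z i)"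
 shows "Ck_on m X (%z. \<chi> i. f z i)"
proof -
 have lin: "bounded_linear (%x::'b. (\<chi> j. if j = i then x else 0))" for i :: 'n
 proof (rule bounded_linear_intro[of _ 1])
  fix x :: 'b
  have "norm (\<chi> j. if j = i then x else 0) <= (\<Sum>j\<in>UNIV. norm ((\<chi> j. if j = i then x else 0) $ j))"
   unfolding norm_vec_def by (rule L2_set_le_sum) simp
  then show "norm (\<chi> j. if j = i then x else 0) <= norm x * 1"
   by (simp add: if_distrib cong: if_cong)
 qed (simp_all add: vec_eq_iff)
 have "Ck_on m X (%z. \<Sum>i\<in>UNIV. (\<chi> j. if j = i then f z i else 0))"
  by (intro Ck_on_sum assms(1) Ck_on_bounded_linear[OF assms(1) lin assms(2)])
 moreover have "(\<Sum>i\<in>UNIV. (\<chi> j. if j = i then f z i else 0)) = (\<chi> i. f z i)" for z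
  by (simp add: vec_eq_iff)
 ultimately show ?thesis by simp
qed

lemma Ck_on_vec_nth: "open X ==> Ck_on m X f ==> Ck_on m X (%z. f z $ i)"
 by (rule Ck_on_bounded_linear[OF _ bounded_linear_vec_nth])

lemma Ck_on_fst: "open X ==> Ck_on m X f ==> Ck_on m X (%z. fst (f z))"
 by (rule Ck_on_bounded_linear[OF _ bounded_linear_fst])

lemma Ck_on_snd: "open X ==> Ck_on m X f ==> Ck_on m X (%z. snd (f z))"
 by (rule Ck_on_bounded_linear[OF _ bounded_linear_snd])

lemma Ck_on_det:
 fixes M :: "'a::euclidean_space => real^'n^'n"
 assumes "open X" "!!i j. Ck_on m X (%z. M z $ i $ j)"
 shows "Ck_on m X (%z. det (M z))"
 unfolding det_def by (intro Ck_on_sum Ck_on_mult Ck_on_const Ck_on_prod_real assms)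

lemma matrix_inv_mult:
 fixes A :: "real^'n^'n"
 assumes "det A ~= 0"
 shows "A ** matrix_inv A = mat 1" "matrix_inv A ** A = mat 1"
proof -
 have "invertible A" using assms by (simp add: invertible_det_nz)
 then have "A ** matrix_inv A = mat 1 & matrix_inv A ** A = mat 1"
  unfolding invertible_def matrix_inv_def by (rule someI_ex)
 then show "A ** matrix_inv A = mat 1" "matrix_inv A ** A = mat 1" by auto
qed

text \<open>Cramer's rule for the columns of the inverse. The entries become quotients of
  polynomials in the entries of A, so that the inverse is as smooth as the matrix.\<close>

lemma matrix_inv_component_cramer:
 fixes A :: "real^'n^'n"
 assumes "det A ~= 0"
 shows "matrix_inv A $ i $ j = det (\<chi> p q. if q = i then (if p = j then 1 else 0) else A $ p $ q) / det A"
proof -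
 have "A *v (matrix_inv A *v axis j 1) = axis j 1"
  by (simp add: matrix_vector_mul_assoc matrix_inv_mult(1)[OF assms])
 then have "matrix_inv A *v axis j 1 = (\<chi> k. det (\<chi> i ja. if ja = k then axis j 1 $ i else A $ i $ ja) / det A)"
  using cramer[OF assms] by blast
 moreover have "matrix_inv A $ i $ j = (matrix_inv A *v axis j 1) $ i"
  by (simp add: matrix_vector_mult_basis column_def)
 ultimately show ?thesis by (simp add: axis_def cong: if_cong)
qed

lemma Ck_on_matrix_inv:
 fixes M :: "'a::euclidean_space => real^'n^'n"
 assumes X: "open X" and M: "!!i j. Ck_on m X (%z. M z $ i $ j)" and det: "!!z. z : X ==> det (M z) ~= 0"
 shows "Ck_on m X (%z. matrix_inv (M z) $ i $ j)"
proof -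
 have "Ck_on m X (%z. det (\<chi> p q. if q = i then (if p = j then 1 else 0) else M z $ p $ q))"
 proof (rule Ck_on_det[OF X])
  show "Ck_on m X (%z. (\<chi> p q. if q = i then (if p = j then 1 else 0) else M z $ p $ q) $ i' $ j')" for i' j'
   by (cases "j' = i") (auto intro: Ck_on_const X M)
 qed
 from Ck_on_mult[OF X this Ck_on_inverse[OF X det Ck_on_det[OF X M]]]
 have "Ck_on m X (%z. det (\<chi> p q. if q = i then (if p = j then 1 else 0) else M z $ p $ q) * inverse (det (M z)))"
  by blast
 then show ?thesis
  by (rule Ck_on_cong[OF X]) (simp add: matrix_inv_component_cramer[OF det] divide_inverse)
qed

lemma smooth_onI: "(!!m. Ck_on m X h) ==> smooth_on X h"
 by (simp add: smooth_on_def)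

lemma smooth_onD: "smooth_on X h ==> Ck_on m X h"
 by (simp add: smooth_on_def)

lemma smooth_on_continuous_on: "smooth_on X h ==> continuous_on X h"
 using Ck_on_imp_continuous_on smooth_onD by blast

lemma smooth_on_has_derivative:
 "smooth_on X h ==> z : X ==> (h has_derivative FD h z) (at z)"
 using Ck_on_has_derivative smooth_onD by blast

lemma smooth_on_linear_derivative:
 "smooth_on X h ==> z : X ==> linear (FD h z)"
 using smooth_on_has_derivative has_derivative_linear by blast

lemma smooth_on_frechet_derivative:
 "smooth_on X h ==> smooth_on X (%z. FD h z w)"
 by (metis Ck_on_frechet_derivative smooth_on_def)

lemma smooth_on_subset: "smooth_on X h ==> Y <= X ==> smooth_on Y h"
 unfolding smooth_on_def using Ck_on_subset by blast

lemma smooth_on_cong: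
 "open X ==> smooth_on X f ==> (!!z. z : X ==> f z = g z) ==> smooth_on X g"
 unfolding smooth_on_def using Ck_on_cong by blast

lemma smooth_on_local:
 assumes "open X" "!!z. z : X ==> \<exists>N. open N & z : N & smooth_on N h"
 shows "smooth_on X h"
 using Ck_on_local[OF assms(1)] assms(2) by (metis smooth_on_def)

lemma smooth_on_compose:
 fixes g :: "'b::euclidean_space => 'c::real_normed_vector"
 assumes "open X" "open Y" "!!z. z : X ==> f z : Y" "smooth_on Y g" "smooth_on X f"
 shows "smooth_on X (%z. g (f z))"
 by (rule smooth_onI, rule Ck_on_compose[OF assms(1,2) _ smooth_onD[OF assms(4)] smooth_onD[OF assms(5)]])
  (rule assms(3))

lemma smooth_on_const: "open X ==> smooth_on X (%z. c)"
 and smooth_on_ident: "open X ==> smooth_on X (%z. z)"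
 by (simp_all add: smooth_on_def Ck_on_const Ck_on_ident)

lemma smooth_on_add: "open X ==> smooth_on X f ==> smooth_on X g ==> smooth_on X (%z. f z + g z)"
 and smooth_on_diff: "open X ==> smooth_on X f ==> smooth_on X g ==> smooth_on X (%z. f z - g z)"
 and smooth_on_minus: "open X ==> smooth_on X f ==> smooth_on X (%z. - f z)"
 and smooth_on_Pair: "open X ==> smooth_on X f' ==> smooth_on X g' ==> smooth_on X (%z. (f' z,g' z))"
 and smooth_on_fst: "open X ==> smooth_on X p ==> smooth_on X (%z. fst (p z))"
 and smooth_on_snd: "open X ==> smooth_on X p ==> smooth_on X (%z. snd (p z))"
 by (simp_all add: smooth_on_def Ck_on_add Ck_on_diff Ck_on_minus Ck_on_Pair Ck_on_fst Ck_on_snd)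

lemma smooth_on_scaleR:
 "open X ==> smooth_on X f ==> smooth_on X g ==> smooth_on X (%z. f z *R g z)"
 by (simp add: smooth_on_def Ck_on_scaleR)

lemma smooth_on_mult:
 fixes f g :: "'a::euclidean_space => real"
 shows "open X ==> smooth_on X f ==> smooth_on X g ==> smooth_on X (%z. f z * g z)"
 by (simp add: smooth_on_def Ck_on_mult)

lemma smooth_on_inner:
 "open X ==> smooth_on X f ==> smooth_on X g ==> smooth_on X (%z. f z \<bullet> g z)"
 by (simp add: smooth_on_def Ck_on_inner)

lemma smooth_on_sum:
 "open X ==> (!!i. i : I ==> smooth_on X (f i)) ==> smooth_on X (%z. \<Sum>i\<in>I. f i z)"
 by (simp add: smooth_on_def Ck_on_sum)

lemma smooth_on_vec_nth: "open X ==> smooth_on X f ==> smooth_on X (%z. f z $ i)"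
 by (simp add: smooth_on_def Ck_on_vec_nth)

lemma smooth_on_vec_lambda: "open X ==> (!!i. smooth_on X (%z. f z i)) ==> smooth_on X (%z. \<chi> i. f z i)"
 by (simp add: smooth_on_def Ck_on_vec_lambda)

lemma smooth_on_inverse:
 fixes f :: "'a::euclidean_space => real"
 shows "open X ==> (!!z. z : X ==> f z ~= 0) ==> smooth_on X f ==> smooth_on X (%z. inverse (f z))"
 by (simp add: smooth_on_def Ck_on_inverse)

lemma smooth_on_matrix_inv:
 fixes M :: "'a::euclidean_space => real^'n^'n"
 shows "open X ==> smooth_on X M ==> (!!z. z : X ==> det (M z) ~= 0) ==>
  smooth_on X (%z. matrix_inv (M z) $ i $ j)"
 by (simp add: smooth_on_def Ck_on_matrix_inv Ck_on_vec_nth)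

lemma smooth_on_matrix_vector_mult:
 fixes M :: "'a::euclidean_space => real^'n^'m"
 assumes "open X" "!!i j. smooth_on X (%z. M z $ i $ j)" "smooth_on X v"
 shows "smooth_on X (%z. M z *v v z)"
 unfolding matrix_vector_mult_def
 by (intro smooth_on_vec_lambda smooth_on_sum smooth_on_mult smooth_on_vec_nth assms)

lemma smooth_on_frechet_derivative_apply:
 assumes X: "open X" and f: "smooth_on X f" and v: "smooth_on X v"
 shows "smooth_on X (%z. FD f z (v z))"
proof (rule smooth_on_cong[OF X])
 show "smooth_on X (%z. \<Sum>b\<in>Basis. (v z \<bullet> b) *R FD f z b)"
  by (intro smooth_on_sum smooth_on_scaleR smooth_on_inner smooth_on_const X v smooth_on_frechet_derivative f)
 fix z assume "z : X"
 then have "linear (FD f z)" by (rule smooth_on_linear_derivative[OF f])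
 then show "(\<Sum>b\<in>Basis. (v z \<bullet> b) *R FD f z b) = FD f z (v z)"
  by (rule linear_Basis_expansion[symmetric])
qed

lemmas smooth_intros = smooth_on_add smooth_on_diff smooth_on_minus smooth_on_Pair smooth_on_fst
 smooth_on_snd smooth_on_scaleR smooth_on_mult smooth_on_inner smooth_on_sum smooth_on_vec_nth
 smooth_on_vec_lambda smooth_on_const smooth_on_ident smooth_on_matrix_vector_mult

section \<open>Smooth local inverses and symmetry of the second derivative\<close>

lemma det_nonzero_of_kernel:
 fixes A :: "real^'n^'n"
 assumes "!!v. A *v v = 0 ==> v = 0"
 shows "det A ~= 0"
proof -
 have "inj ((*v) A)"
  by (metis assms linear_injective_0 matrix_vector_mul_linear)
 then show ?thesis
  by (metis invertible_det_nz invertible_left_inverse matrix_left_invertible_injective)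
qed

text \<open>The inverse function theorem gives a differentiable g whose derivative at y is the
  inverse of the derivative of f at g y. This formula is C^m as soon as g is, which lifts g from C^m
  to C^(m+1).\<close>

lemma smooth_inverse_function:
 fixes f :: "real^'n => real^'n"
 assumes U: "open U" and f: "smooth_on U f" and x0: "x0 : U"
  and inj: "!!v. FD f x0 v = 0 ==> v = 0"
 obtains V W g where "open V" "open W" "x0 : W" "W <= U" "f x0 : V" "homeomorphism W V f g" "smooth_on V g"
proof -
 let ?D = "%x. FD f x"
 \<comment> \<open>The inverse function theorem wants the derivative to be continuous in operator
   norm; for bounded linear maps on a Euclidean space this can be checked on basis vectors.\<close>
 define f' where "f' x = Blinfun (?D x)" for x
 have bl: "bounded_linear (?D x)" if "x : U" for x
  using smooth_on_has_derivative[OF f that] has_derivative_bounded_linear by blast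
 have app: "blinfun_apply (f' x) = ?D x" if "x : U" for x
  using bl[OF that] by (simp add: f'_def bounded_linear_Blinfun_apply)
 have cont: "continuous_on U f'"
 proof (rule continuous_on_blinfun_componentwise)
  fix i :: "real^'n"
  show "continuous_on U (%x. blinfun_apply (f' x) i)"
   using smooth_on_continuous_on[OF smooth_on_frechet_derivative[OF f, of i]]
   by (rule continuous_on_eq) (simp add: app)
 qed
 define M where "M x = matrix (?D x)" for x
 have M: "M x *v v = ?D x v" if "x : U" for x v
  unfolding M_def using bl[OF that] by (simp add: bounded_linear.linear matrix_works)
 have "det (M x0) ~= 0"
  by (rule det_nonzero_of_kernel) (use inj M x0 in auto)
 then obtain B where B: "B ** M x0 = mat 1"
  using matrix_inv_mult(2) by blast
 have "blinfun_apply (Blinfun ((*v) B) o\<^sub>L f' x0) v = v" for v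
  using app[OF x0] M[OF x0, symmetric] B
  by (simp add: bounded_linear_Blinfun_apply matrix_vector_mul_assoc)
 then have invb: "Blinfun ((*v) B) o\<^sub>L f' x0 = id_blinfun"
  by (intro blinfun_eqI) simp
 have derb: "(f has_derivative blinfun_apply (f' x)) (at x)" if "x : U" for x
  using smooth_on_has_derivative[OF f that] app[OF that] by simp
 obtain W V g g' where W: "open W" "W <= U" "x0 : W" and V: "open V" "f x0 : V"
  and hom: "homeomorphism W V f g"
  and g': "!!y. y : V ==> (g has_derivative (g' y)) (at y)"
  and inv: "!!y. y : V ==> g' y = inv (blinfun_apply (f'(g y)))"
  and bij: "!!y. y : V ==> bij (blinfun_apply (f'(g y)))"
 proof (rule inverse_function_theorem[OF U _ cont x0 invb])
  show "(f has_derivative blinfun_apply (f' x)) (at x)" if "x : U" for x by (rule derb[OF that])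
 next
  fix W V g g'
  assume *: "open W" "W <= U" "x0 : W" "open V" "f x0 : V" "homeomorphism W V f g"
   "!!y. y : V ==> (g has_derivative (g' y)) (at y)"
   "!!y. y : V ==> g' y = inv (blinfun_apply (f'(g y)))"
   "!!y. y : V ==> bij (blinfun_apply (f'(g y)))"
  show thesis by (rule that[of W V g g']) (fact *)+
 qed
 have gW: "g y : W" if "y : V" for y
  using homeomorphism_image2[OF hom] that by blast
 have gU: "g y : U" if "y : V" for y using gW[OF that] W by blast
 have det: "det (M (g y)) ~= 0" if "y : V" for y
 proof (rule det_nonzero_of_kernel)
  fix v assume "M (g y) *v v = 0"
  then have "?D (g y) v = ?D (g y) 0" using M[OF gU[OF that]] by (metis matrix_vector_mult_0_right)
  then show "v = 0" using bij[OF that] app[OF gU[OF that]] by (metis bij_pointE)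
 qed
 have g'_eq: "g' y w = matrix_inv (M (g y)) *v w" if "y : V" for y w
 proof -
  have "?D (g y) (matrix_inv (M (g y)) *v w) = w"
   using M[OF gU[OF that], symmetric] matrix_inv_mult(1)[OF det[OF that]]
   by (simp add: matrix_vector_mul_assoc)
  then show ?thesis
   using inv[OF that] bij[OF that] app[OF gU[OF that]] by (metis bij_inv_eq_iff)
 qed
 have Msmooth: "Ck_on m U (%x. M x $ i $ j)" for m i j
  unfolding M_def matrix_def
  using Ck_on_vec_nth[OF U smooth_onD[OF smooth_on_frechet_derivative[OF f]]] by simp
 have "Ck_on m V g" for m
 proof (induction m)
  case 0
  then show ?case using hom by (simp add: homeomorphism_def)
 next
  case (Suc m)
  show ?case
  proof (rule Ck_on_SucI[OF V(1) g'])
   fix w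
   have "Ck_on m V (%y. matrix_inv (M (g y)) $ i $ j)" for i j
    by (rule Ck_on_matrix_inv[OF V(1) _ det]) (rule Ck_on_compose[OF V(1) U gU Msmooth Suc])
   then have "Ck_on m V (%y. matrix_inv (M (g y)) *v w)"
    unfolding matrix_vector_mult_def
    by (intro Ck_on_vec_lambda Ck_on_sum Ck_on_mult Ck_on_const V(1))
   then show "Ck_on m V (%y. g' y w)"
    by (rule Ck_on_cong[OF V(1)]) (simp add: g'_eq)
  qed
 qed
 then show ?thesis
  using that[OF V(1) W(1,3,2) V(2) hom] smooth_onI by blast
qed

text \<open>The mean value theorem applied twice: in direction u to the difference of f across the
  edge h v, then in direction v to the derivative of f along u.\<close>

lemma second_difference:
 fixes f :: "'a::euclidean_space => real"
 assumes f: "Ck_on (Suc (Suc 0)) X f" and h: "0 < h"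
  and X: "!!s t. s : {0..h} ==> t : {0..h} ==> z + s *R u + t *R v : X"
 shows "\<exists>s\<in>{0..h}. \<exists>t\<in>{0..h}. f (z + h *R u + h *R v) - f (z + h *R u) - f (z + h *R v) + f z =
  h * h * FD (%y. FD f y u) (z + s *R u + t *R v) v"
proof -
 let ?D = "%y. FD f y"
 let ?D2 = "%y. FD (%y. ?D y u) y"
 have D: "((%s. f (y + s *R w)) has_real_derivative ?D (y + s *R w) w) (at s)"
  if "y + s *R w : X" for y w s
 proof -
  have "((%s. f (y + s *R w)) has_derivative (%r. ?D (y + s *R w) (r *R w))) (at s)"
   by (rule has_derivative_compose[where f = "%s. y + s *R w", OF _ Ck_on_has_derivative[OF f that]]) (auto intro!: derivative_eq_intros)
  then show ?thesis
   using linear_scale[OF has_derivative_linear[OF Ck_on_has_derivative[OF f that]]]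
   by (simp add: has_field_derivative_def mult_commute_abs)
 qed
 have D2: "((%s. ?D (y + s *R w) u) has_real_derivative ?D2 (y + s *R w) w) (at s)"
  if "y + s *R w : X" for y w s
 proof -
  note d = Ck_on_has_derivative[OF Ck_on_frechet_derivative[OF f] that]
  have "((%s. ?D (y + s *R w) u) has_derivative (%r. ?D2 (y + s *R w) (r *R w))) (at s)"
   by (rule has_derivative_compose[where f = "%s. y + s *R w", OF _ d]) (auto intro!: derivative_eq_intros)
  then show ?thesis
   using linear_scale[OF has_derivative_linear[OF d]]
   by (simp add: has_field_derivative_def mult_commute_abs)
 qed
 define \<phi> where "\<phi> s = f ((z + h *R v) + s *R u) - f (z + s *R u)" for s
 have X': "(z + h *R v) + s *R u : X" "z + s *R u : X" if "s : {0..h}" for s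
  using X[OF that, of h] X[OF that, of 0] h by (simp_all add: algebra_simps)
 have "DERIV \<phi> s :> ?D ((z + h *R v) + s *R u) u - ?D (z + s *R u) u" if "0 <= s" "s <= h" for s
  unfolding \<phi>_def using X' that by (intro DERIV_diff D) auto
 from MVT2[OF h this] obtain s where s: "0 < s" "s < h"
  "\<phi> h - \<phi> 0 = (h - 0) * (?D ((z + h *R v) + s *R u) u - ?D (z + s *R u) u)" by blast
 have "DERIV (%t. ?D ((z + s *R u) + t *R v) u) t :> ?D2 ((z + s *R u) + t *R v) v" if "0 <= t" "t <= h" for t
  using X[of s t] s that by (intro D2) auto
 from MVT2[OF h this] obtain t where t: "0 < t" "t < h"
  "?D ((z + s *R u) + h *R v) u - ?D ((z + s *R u) + 0 *R v) u = (h - 0) * ?D2 ((z + s *R u) + t *R v) v" by blast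
 have "f (z + h *R u + h *R v) - f (z + h *R u) - f (z + h *R v) + f z = \<phi> h - \<phi> 0"
  by (simp add: \<phi>_def algebra_simps)
 also have "\<dots> = h * h * ?D2 (z + s *R u + t *R v) v"
  using s(3) t(3) by (simp add: algebra_simps)
 finally show ?thesis using s t by (intro bexI[of _ s] bexI[of _ t]) auto
qed

text \<open>The second difference is symmetric in u and v. So the value of one mixed derivative at
  some point near z equals the value of the other at another such point, and continuity excludes a
  gap at z.\<close>

lemma frechet_derivative_commute_real:
 fixes f :: "'a::euclidean_space => real"
 assumes X: "open X" and f: "Ck_on (Suc (Suc 0)) X f" and z: "z : X"
 shows "FD (%y. FD f y u) z v =
  FD (%y. FD f y v) z u" (is "?A z = ?B z")
proof (rule ccontr)
 assume ne: "?A z ~= ?B z"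
 define e where "e = \<bar>?A z - ?B z\<bar> / 2"
 have e: "e > 0" using ne by (simp add: e_def)
 have "continuous (at z) ?A" "continuous (at z) ?B"
  using f X z by (simp_all add: continuous_on_eq_continuous_at)
 then obtain d1 d2 where d12: "d1 > 0" "!!y. dist y z < d1 ==> dist (?A y) (?A z) < e"
  "d2 > 0" "!!y. dist y z < d2 ==> dist (?B y) (?B z) < e"
  unfolding continuous_at_eps_delta using e by metis
 obtain d3 where d3: "d3 > 0" "!!y. dist y z < d3 ==> y : X" using X z unfolding open_dist by blast
 define d where "d = min d1 (min d2 d3)"
 have d: "d > 0" "!!y. dist y z < d ==> y : X & dist (?A y) (?A z) < e & dist (?B y) (?B z) < e"
  using d12 d3 by (auto simp: d_def)
 \<comment> \<open>Small enough for the parallelogram with edges h u and h v at z to stay within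
   distance d of z; the summand 1 avoids division by zero.\<close>
 define h where "h = d / (2 * (norm u + norm v + 1))"
 have h: "h > 0" using d(1) by (simp add: h_def add_nonneg_pos)
 have hd: "h * (norm u + norm v) < d"
 proof -
  have "h * (norm u + norm v) < h * (2 * (norm u + norm v + 1))"
   using h by (intro mult_strict_left_mono) (smt (verit) norm_ge_zero)+
  also have "\<dots> = d" by (simp add: h_def) (smt (verit) norm_ge_zero)
  finally show ?thesis .
 qed
 have close: "dist (z + s *R u + t *R v) z < d" if "s : {0..h}" "t : {0..h}" for s t
 proof -
  have "dist (z + s *R u + t *R v) z <= norm (s *R u) + norm (t *R v)"
   by (simp add: dist_norm norm_triangle_le add.assoc del: norm_scaleR)
  also have "\<dots> <= h * norm u + h * norm v"
   using that by (intro add_mono) (auto intro: mult_right_mono)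
  finally show ?thesis using hd by (simp add: distrib_left)
 qed
 obtain s t where st: "s : {0..h}" "t : {0..h}"
  "f (z + h *R u + h *R v) - f (z + h *R u) - f (z + h *R v) + f z = h * h * ?A (z + s *R u + t *R v)"
  using second_difference[OF f h, of z u v] close d(2) by blast
 have close': "dist (z + s *R v + t *R u) z < d" if "s : {0..h}" "t : {0..h}" for s t
  using close[OF that(2,1)] by (simp add: algebra_simps)
 obtain s' t' where st': "s' : {0..h}" "t' : {0..h}"
  "f (z + h *R v + h *R u) - f (z + h *R v) - f (z + h *R u) + f z = h * h * ?B (z + s' *R v + t' *R u)"
  using second_difference[OF f h, of z v u] close' d(2) by blast
 have "h * h * ?A (z + s *R u + t *R v) = h * h * ?B (z + s' *R v + t' *R u)"
  using st(3) st'(3) by (simp add: algebra_simps)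
 then have "?A (z + s *R u + t *R v) = ?B (z + s' *R v + t' *R u)" using h by simp
 moreover have "dist (?A (z + s *R u + t *R v)) (?A z) < e" using d(2)[OF close[OF st(1,2)]] by blast
 moreover have "dist (?B (z + s' *R v + t' *R u)) (?B z) < e" using d(2)[OF close'[OF st'(1,2)]] by blast
 ultimately show False unfolding e_def dist_real_def by (smt (verit) field_sum_of_halves)
qed

lemma frechet_derivative_commute:
 fixes f :: "'a::euclidean_space => 'b::euclidean_space"
 assumes X: "open X" and f: "Ck_on (Suc (Suc 0)) X f" and z: "z : X"
 shows "FD (%y. FD f y u) z v =
  FD (%y. FD f y v) z u"
proof (rule euclidean_eqI)
 fix b :: 'b
 have inner: "FD (%y. g y \<bullet> b) y w = FD g y w \<bullet> b"
  if "Ck_on (Suc 0) X g" "y : X" for g :: "'a => 'b" and y w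
 proof -
  have "((%y. g y \<bullet> b) has_derivative (%w. FD g y w \<bullet> b)) (at y)"
   by (rule bounded_linear.has_derivative[OF bounded_linear_inner_left Ck_on_has_derivative[OF that]])
  then show ?thesis by (metis frechet_derivative_at)
 qed
 have 2: "FD (%y. FD (%y. f y \<bullet> b) y u) z v =
   FD (%y. FD f y u) z v \<bullet> b" for u v
 proof -
  have "FD (%y. FD (%y. f y \<bullet> b) y u) z =
    FD (%y. FD f y u \<bullet> b) z"
   by (rule frechet_derivative_cong[OF X z inner[OF Ck_on_SucD[OF f]]])
  then show ?thesis using inner[OF Ck_on_frechet_derivative[OF f] z] by simp
 qed
 have "Ck_on (Suc (Suc 0)) X (%y. f y \<bullet> b)"
  by (rule Ck_on_bounded_linear[OF X bounded_linear_inner_left f])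
 from frechet_derivative_commute_real[OF X this z, of u v]
 show "FD (%y. FD f y u) z v \<bullet> b =
  FD (%y. FD f y v) z u \<bullet> b"
  by (simp add: 2)
qed

lemma Ck_on_frechet_derivative_apply:
 fixes F :: "'b::euclidean_space => 'c::real_normed_vector"
 assumes X: "open X" and Y: "open Y" and g: "!!z. z : X ==> g z : Y"
  and F: "Ck_on (Suc m) Y F" and "Ck_on m X g" "Ck_on m X v"
 shows "Ck_on m X (%z. FD F (g z) (v z))"
proof (rule Ck_on_cong[OF X])
 have "Ck_on m X (%z. FD F (g z) b)" for b
  by (rule Ck_on_compose[OF X Y g Ck_on_frechet_derivative[OF F] assms(5)])
 then show "Ck_on m X (%z. \<Sum>b\<in>Basis. (v z \<bullet> b) *R FD F (g z) b)"
  by (intro Ck_on_sum Ck_on_scaleR Ck_on_inner Ck_on_const X assms(6))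
 fix z assume "z : X"
 then show "(\<Sum>b\<in>Basis. (v z \<bullet> b) *R FD F (g z) b) = FD F (g z) (v z)"
  using linear_Basis_expansion[OF has_derivative_linear[OF Ck_on_has_derivative[OF F g]]] by metis
qed

section \<open>Smooth dependence of solutions of differential equations on parameters\<close>

lemma has_vector_derivative_imp_continuous_on:
 "(!!t. t : S ==> (e hvd e' t) (at t within S)) ==> continuous_on S e"
 by (meson continuous_on_eq_continuous_within has_vector_derivative_continuous)

text \<open>The mean value inequality on a convex set of reals. With B = 0 it is the way in which
  functions are shown to be constant, for instance the energy.\<close>

lemma vector_derivative_bound:
 fixes e :: "real => 'a::real_normed_vector"
 assumes "convex S" "!!t. t : S ==> (e hvd e' t) (at t within S)"
  "!!t. t : S ==> norm (e' t) <= B" "s : S" "t : S"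
 shows "norm (e s - e t) <= B * \<bar>s - t\<bar>"
proof -
 have "onorm (%h. h *R e' r) <= B" if "r : S" for r
  using assms(3)[OF that] onorm_scaleR_left[of "%x::real. x" "e' r"] onorm_id[where 'a = real]
  by (simp add: bounded_linear_ident)
 then have "norm (e s - e t) <= B * norm (s - t)"
  using assms(2,4,5)
  by (intro differentiable_bound[OF assms(1), where f' = "%t h. h *R e' t"])
   (simp_all add: has_vector_derivative_def)
 then show ?thesis by simp
qed

text \<open>On intervals shorter than \<open>1 / (2 L)\<close> the supremum of a solution can be absorbed, so no exponential
 weight is needed.\<close>
lemma short_time_gronwall:
 fixes e :: "real => 'a::real_normed_vector"
 assumes len: "!!t. t : {a..b} ==> \<bar>t - s\<bar> <= ell" and s: "s : {a..b}" and t: "t : {a..b}"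
  and L: "0 <= L" "ell * L <= 1 / 2" and c: "0 <= c"
  and der: "!!t. t : {a..b} ==> (e hvd e' t) (at t within {a..b})"
  and bd: "!!t. t : {a..b} ==> norm (e' t) <= L * norm (e t) + c"
 shows "norm (e t) <= 2 * (norm (e s) + ell * c)"
proof -
 have "continuous_on {a..b} e"
  using has_vector_derivative_imp_continuous_on[OF der] .
 then have cont: "continuous_on {a..b} (%t. norm (e t))" by (rule continuous_on_norm)
 obtain m where m: "m : {a..b}" "!!t. t : {a..b} ==> norm (e t) <= norm (e m)"
  using continuous_attains_sup[OF compact_Icc _ cont] s by blast
 let ?M = "norm (e m)"
 have "norm (e' t) <= L * ?M + c" if "t : {a..b}" for t
  using bd[OF that] mult_left_mono[OF m(2)[OF that] L(1)] by linarith
 from vector_derivative_bound[OF _ der this m(1) s]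
 have "norm (e m - e s) <= (L * ?M + c) * \<bar>m - s\<bar>" by simp
 also have "\<dots> <= (L * ?M + c) * ell"
  using len[OF m(1)] L c by (intro mult_left_mono) auto
 also have "\<dots> = ell * L * ?M + ell * c" by (simp add: algebra_simps)
 also have "\<dots> <= 1 / 2 * ?M + ell * c"
  using mult_right_mono[OF L(2), of ?M] by simp
 finally have "norm (e m - e s) <= 1 / 2 * ?M + ell * c" .
 moreover have "?M <= norm (e s) + norm (e m - e s)" by (rule norm_triangle_sub)
 ultimately have "?M <= 2 * (norm (e s) + ell * c)" by simp
 then show ?thesis using m(2)[OF t] by linarith
qed

text \<open>Since \<delta> L <= 1 / 2, the integral operator contracts the supremum distance by 1 /
  2, so the fixed point is a solution on the whole given interval.\<close>

lemma picard_short_time: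
 fixes f :: "real => 'a::euclidean_space => 'a"
 assumes \<delta>: "0 < \<delta>" "\<delta> * L <= 1 / 2" "0 <= L"
  and cont: "continuous_on ({-\<delta>..\<delta>} \<times> UNIV) (%(t,y). f t y)"
  and lip: "!!t y z. t : {-\<delta>..\<delta>} ==> norm (f t y - f t z) <= L * norm (y - z)"
 obtains y where "y 0 = p"
  "!!t. t : {-\<delta>..\<delta>} ==> (y hvd f t (y t)) (at t within {-\<delta>..\<delta>})"
proof -
 let ?I = "{-\<delta>..\<delta>}"
 \<comment> \<open>Time is clamped to the interval because the fixed point is sought in the complete
   space of bounded continuous functions on the whole line.\<close>
 define cl where "cl t = max (-\<delta>) (min \<delta> t)" for t :: real
 have cl: "cl t : ?I" for t using \<delta>(1) by (auto simp: cl_def)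
 have cl_id: "cl t = t" if "t : ?I" for t using that by (auto simp: cl_def)
 have cont_cl: "continuous_on UNIV cl" unfolding cl_def by (intro continuous_intros)
 \<comment> \<open>The integral from 0 to t, written as a difference of integrals from -\<delta> so
   that t may have either sign.\<close>
 define G where "G y t = p + (integral {-\<delta>..t} (%s. f s (y s)) - integral {-\<delta>..0} (%s. f s (y s)))"
  for y :: "real => 'a" and t
 have G0: "G y 0 = p" for y by (simp add: G_def)
 have cf: "continuous_on ?I (%s. f s (y s))" if "continuous_on UNIV y" for y
 proof -
  have "continuous_on ?I (%s. (case (s,y s) of (t,y) => f t y))"
   by (rule continuous_on_compose2[OF cont])
    (use that in \<open>auto intro!: continuous_intros intro: continuous_on_subset\<close>)
  then show ?thesis by simp
 qed
 have G': "(G y hvd f t (y t)) (at t within ?I)" if "continuous_on UNIV y" "t : ?I" for y t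
  unfolding G_def
  by (rule derivative_eq_intros integral_has_vector_derivative[OF cf[OF that(1)] that(2)] refl)+ simp
 have Gc: "continuous_on ?I (G y)" if "continuous_on UNIV y" for y
  using has_vector_derivative_imp_continuous_on[OF G'[OF that]] .
 define \<Phi> where "\<Phi> y = Bcontfun (%t. G (apply_bcontfun y) (cl t))" for y
 have mem: "(%t. G (apply_bcontfun y) (cl t)) : bcontfun" for y
 proof -
  have "continuous_on UNIV (%t. G (apply_bcontfun y) (cl t))"
   using continuous_on_compose2[OF Gc[of "apply_bcontfun y"] cont_cl] cl by blast
  moreover have "bounded (G (apply_bcontfun y) ` ?I)"
   by (rule compact_imp_bounded[OF compact_continuous_image[OF Gc compact_Icc]]) simp
  then have "bounded (range (%t. G (apply_bcontfun y) (cl t)))"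
   by (rule bounded_subset) (use cl in auto)
  ultimately show ?thesis by (simp add: bcontfun_def)
 qed
 have \<Phi>: "apply_bcontfun (\<Phi> y) t = G (apply_bcontfun y) (cl t)" for y t
  unfolding \<Phi>_def using Bcontfun_inverse[OF mem] by simp
 have contr: "dist (\<Phi> y) (\<Phi> z) <= 1 / 2 * dist y z" for y z
 proof (rule dist_bound)
  fix t
  let ?y = "apply_bcontfun y" and ?z = "apply_bcontfun z"
  let ?e = "%t. G ?y t - G ?z t"
  have "norm (?e (cl t) - ?e 0) <= L * dist y z * \<bar>cl t - 0\<bar>"
  proof (rule vector_derivative_bound[of ?I])
   show "(?e hvd f t (?y t) - f t (?z t)) (at t within ?I)" if "t : ?I" for t
    using G'[of ?y, OF _ that] G'[of ?z, OF _ that] by (auto intro!: derivative_intros)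
   show "norm (f t (?y t) - f t (?z t)) <= L * dist y z" if "t : ?I" for t
    using lip[OF that, of "?y t" "?z t"] mult_left_mono[OF dist_bounded[of y t z] \<delta>(3)]
    by (simp add: dist_norm)
  qed (use cl \<delta> in auto)
  also have "\<dots> <= L * dist y z * \<delta>"
   using cl[of t] \<delta>(3) by (intro mult_left_mono) auto
  also have "\<dots> <= 1 / 2 * dist y z"
   using mult_right_mono[OF \<delta>(2), of "dist y z"] by (simp add: mult_ac)
  finally show "dist (apply_bcontfun (\<Phi> y) t) (apply_bcontfun (\<Phi> z) t) <= 1 / 2 * dist y z"
   by (simp add: \<Phi> G0 dist_norm)
 qed
 have "\<exists>!y. \<Phi> y = y"
 proof (rule banach_fix_type)
  show "\<forall>y z. dist (\<Phi> y) (\<Phi> z) <= 1 / 2 * dist y z" by (intro allI contr)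
 qed simp_all
 then obtain y where y: "\<Phi> y = y" by (elim ex1E)
 have yG: "apply_bcontfun y t = G (apply_bcontfun y) t" if "t : ?I" for t
  using \<Phi>[of y t] y cl_id[OF that] by simp
 show ?thesis
 proof
  show "apply_bcontfun y 0 = p" using yG[of 0] \<delta>(1) G0 by simp
  show "(apply_bcontfun y hvd f t (apply_bcontfun y t)) (at t within ?I)" if "t : ?I" for t
   by (rule has_vector_derivative_transform[OF that _ G'[OF _ that]]) (use yG in auto)
 qed
qed

lemma continuous_at_distE:
 assumes "continuous (at x) f" "0 < e"
 obtains d where "0 < d" "!!y. dist y x < d ==> dist (f y) (f x) < e"
 using assms unfolding continuous_at_eps_delta by blast

text \<open>Uniform continuity at the points of C where the second point may lie outside C; the
  radius is a Lebesgue number of a cover by balls. The lemma also serves merely to thicken a compact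
  set inside an open one.\<close>

lemma compact_uniform_neighbourhood:
 fixes G :: "'a::euclidean_space => 'b::metric_space"
 assumes \<Omega>: "open \<Omega>" and G: "continuous_on \<Omega> G" and C: "compact C" "C <= \<Omega>" and e: "0 < e"
 obtains d where "0 < d" "!!z z'. z : C ==> dist z' z < d ==> z' : \<Omega> & dist (G z') (G z) < e"
proof -
 have "\<exists>r>0. ball x r <= \<Omega> & (\<forall>y\<in>ball x r. dist (G y) (G x) < e / 2)" if x: "x : \<Omega>" for x
 proof -
  have "continuous (at x) G" using G \<Omega> x continuous_on_eq_continuous_at by blast
  then obtain r1 where r1: "r1 > 0" "!!y. dist y x < r1 ==> dist (G y) (G x) < e / 2"
   using continuous_at_distE[OF _ half_gt_zero[OF e]] by blast
  obtain r2 where r2: "r2 > 0" "ball x r2 <= \<Omega>" using openE[OF \<Omega> x] by blast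
  show ?thesis
   by (rule exI[of _ "min r1 r2"]) (use r1 r2 in \<open>auto simp: dist_commute\<close>)
 qed
 then obtain r where r: "!!x. x : \<Omega> ==> r x > 0 & ball x (r x) <= \<Omega> & (\<forall>y\<in>ball x (r x). dist (G y) (G x) < e / 2)"
  by metis
 have cover: "C <= \<Union>((%x. ball x (r x)) ` C)" using C(2) r by force
 obtain d where d: "d > 0" "!!z. z : C ==> \<exists>B \<in> (%x. ball x (r x)) ` C. ball z d <= B"
  by (rule Heine_Borel_lemma[OF C(1) cover]) auto
 show ?thesis
 proof (rule that[OF d(1)])
  fix z z' assume z: "z : C" "dist z' z < d"
  then obtain x where x: "x : C" "ball z d <= ball x (r x)" using d(2) by blast
  have "z : ball z d" "z' : ball z d" using z d(1) by (auto simp: dist_commute)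
  then have "z : ball x (r x)" "z' : ball x (r x)" using x(2) by blast+
  moreover from this have "dist (G z) (G x) < e / 2" "dist (G z') (G x) < e / 2"
   using r x(1) C(2) by blast+
  moreover have "ball x (r x) <= \<Omega>" using r x(1) C(2) by blast
  ultimately show "z' : \<Omega> & dist (G z') (G z) < e"
   using dist_triangle_half_l[of "G z'" "G x" e "G z"] by (auto simp: dist_commute)
 qed
qed

text \<open>Continuity of the finitely many derivatives along basis vectors controls the change of
  the derivative in operator norm, and the mean value inequality on a ball turns this into a
  first-order estimate uniform in z.\<close>

lemma compact_uniform_linearization:
 fixes G :: "'a::euclidean_space => 'b::real_normed_vector"
 assumes \<Omega>: "open \<Omega>" and G: "Ck_on (Suc 0) \<Omega> G" and C: "compact C" "C <= \<Omega>" and e: "0 < e"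
 obtains d where "0 < d" "!!z z'. z : C ==> dist z' z < d ==>
  z' : \<Omega> & norm (G z' - G z - FD G z (z' - z)) <= e * norm (z' - z)"
proof -
 let ?D = "%z. FD G z"
 have bl: "bounded_linear (?D z)" if "z : \<Omega>" for z
  using Ck_on_has_derivative[OF G that] has_derivative_bounded_linear by blast
 have "\<exists>d>0. \<forall>z\<in>C. \<forall>z'. dist z' z < d \<longrightarrow> z' : \<Omega> & dist (?D z' b) (?D z b) < e / DIM('a)" for b
 proof -
  have "continuous_on \<Omega> (%z. ?D z b)" using G by simp
  moreover have "e / DIM('a) > 0" using e by simp
  ultimately obtain d where "0 < d" "!!z z'. z : C ==> dist z' z < d ==> z' : \<Omega> & dist (?D z' b) (?D z b) < e / DIM('a)"
   by (rule compact_uniform_neighbourhood[OF \<Omega> _ C]) blast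
  then show ?thesis by blast
 qed
 then obtain d where d: "!!b. d b > 0"
  "!!b z z'. z : C ==> dist z' z < d b ==> z' : \<Omega> & dist (?D z' b) (?D z b) < e / DIM('a)"
  by metis
 define d0 where "d0 = Min (d ` Basis)"
 have d0: "d0 > 0" "!!b. b : Basis ==> d0 <= d b" using d(1) by (auto simp: d0_def)
 have dist0: "z' : \<Omega>" "dist (?D z' b) (?D z b) < e / DIM('a)"
  if "z : C" "dist z' z < d0" "b : Basis" for z z' b
  using d(2)[OF that(1), of z' b] that d0(2) by force+
 show ?thesis
 proof (rule that[OF d0(1)])
  fix z z' assume z: "z : C" "dist z' z < d0"
  have in\<Omega>: "y : \<Omega>" if "y : ball z d0" for y
   using dist0(1)[OF z(1), of y "SOME b. b : Basis"] that SOME_Basis by (auto simp: dist_commute)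
  have on: "onorm (?D y - ?D z) <= e" if "y : ball z d0" for y
  proof -
   have "bounded_linear (?D y - ?D z)"
    using bounded_linear_sub[OF bl[OF in\<Omega>[OF that]] bl] z(1) C(2) by (auto simp: fun_diff_def)
   then have "onorm (?D y - ?D z) <= (\<Sum>b\<in>Basis. norm ((?D y - ?D z) b))"
    by (rule onorm_componentwise)
   also have "\<dots> <= (\<Sum>b\<in>(Basis::'a set). e / DIM('a))"
    using dist0(2)[OF z(1), of y] that
    by (intro sum_mono) (auto simp: dist_norm norm_minus_commute intro: less_imp_le)
   finally show ?thesis by simp
  qed
  have "norm (G z' - G z - ?D z (z' - z)) <= norm (z' - z) * e"
  proof (rule differentiable_bound_linearization[where S = "ball z d0"])
   fix t :: real assume "t : {0..1}"
   moreover have "z' : ball z d0" using z by (simp add: dist_commute)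
   ultimately show "z + t *R (z' - z) : ball z d0"
    using convexD_alt[OF convex_ball, of z z d0 z' t] d0(1) by (simp add: algebra_simps)
  next
   show "(G has_derivative ?D x) (at x within ball z d0)" if "x : ball z d0" for x
    using Ck_on_has_derivative[OF G in\<Omega>[OF that]] has_derivative_at_withinI by blast
  qed (use on d0(1) in auto)
  then show "z' : \<Omega> & norm (G z' - G z - ?D z (z' - z)) <= e * norm (z' - z)"
   using in\<Omega>[of z'] z by (simp add: mult.commute dist_commute)
 qed
qed

section \<open>Dependence of short-time solutions on parameters\<close>

definition ode_family ::
 "'p::euclidean_space set => real => real => 'a::euclidean_space set => ('p \<times> real \<times> 'a => 'a) => ('p \<times> real => 'a) => bool"
where
 "ode_family N \<delta> L B F y \<longleftrightarrow>
   (\<forall>p\<in>N. \<forall>t\<in>{-\<delta><..<\<delta>}. y (p,t) : B & ((%t. y (p,t)) hvd F (p,t,y (p,t))) (at t) &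
    (\<forall>u\<in>B. \<forall>v\<in>B. norm (F (p,t,u) - F (p,t,v)) <= L * norm (u - v)))"

text \<open>The solutions y are part of the data, since the induction on smoothness replaces them by
  their derivatives. The Lipschitz estimate is stated for pairs of points because B need not be
  convex; together with \<delta> L <= 1 / 2 it gives Gronwall's bound on the whole interval.\<close>

locale short_ode_family =
 fixes N :: "'p::euclidean_space set" and \<delta> L :: real and B :: "'a::euclidean_space set"
  and F :: "'p \<times> real \<times> 'a => 'a" and y :: "'p \<times> real => 'a"
 assumes N: "open N" and B: "open B" and \<delta>: "0 < \<delta>" "\<delta> * L <= 1 / 2" and L: "0 <= L"
  and fam: "ode_family N \<delta> L B F y"
begin

abbreviation "I \<equiv> {-\<delta><..<\<delta>}"
abbreviation "\<Omega> \<equiv> N \<times> I \<times> B"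

lemma open_dom: "open \<Omega>" "open (N \<times> I)"
 by (intro open_Times N B open_greaterThanLessThan)+

lemma y_in: "p : N ==> t : I ==> y (p,t) : B"
 and y_der: "p : N ==> t : I ==> ((%t. y (p,t)) hvd F (p,t,y (p,t))) (at t)"
 and lip: "p : N ==> t : I ==> u : B ==> v : B ==> norm (F (p,t,u) - F (p,t,v)) <= L * norm (u - v)"
 using fam unfolding ode_family_def by blast+

lemma y_cont: "p : N ==> continuous_on I (%t. y (p,t))"
 using y_der by (meson continuous_at_imp_continuous_on has_vector_derivative_continuous)

lemma graph_compact:
 assumes "p : N" "\<delta>' < \<delta>"
 shows "compact ((%t. (p,t,y (p,t))) ` {-\<delta>'..\<delta>'})" "(%t. (p,t,y (p,t))) ` {-\<delta>'..\<delta>'} <= \<Omega>"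
proof -
 have sub: "{-\<delta>'..\<delta>'} <= I" using assms(2) by auto
 show "compact ((%t. (p,t,y (p,t))) ` {-\<delta>'..\<delta>'})"
  by (intro compact_continuous_image continuous_intros compact_Icc continuous_on_subset[OF y_cont[OF assms(1)] sub])
 show "(%t. (p,t,y (p,t))) ` {-\<delta>'..\<delta>'} <= \<Omega>"
  using y_in[OF assms(1)] assms sub by auto
qed

lemma gronwall:
 assumes \<delta>': "0 < \<delta>'" "\<delta>' < \<delta>" and c: "0 <= c"
  and der: "!!t. t : I ==> \<bar>t\<bar> <= \<delta>' ==> (e hvd e' t) (at t within {-\<delta>'..\<delta>'})"
  and bd: "!!t. t : I ==> \<bar>t\<bar> <= \<delta>' ==> norm (e' t) <= L * norm (e t) + c"
  and t: "\<bar>t\<bar> <= \<delta>'"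
 shows "norm (e t) <= 2 * (norm (e 0) + \<delta> * c)"
 by (rule short_time_gronwall[where a = "-\<delta>'" and b = \<delta>' and s = 0 and ell = \<delta>, OF _ _ _ L \<delta>(2) c der bd])
  (use \<delta>' t in auto)

text \<open>Along the compact graph of the solution for p0 the right-hand sides for p and p0 differ
  by at most e1. Gronwall's bound turns this defect and the initial difference into a bound on the
  difference of the solutions.\<close>

lemma family_continuous:
 assumes F: "continuous_on \<Omega> F" and y0: "continuous_on N (%p. y (p,0))"
 shows "continuous_on (N \<times> I) y"
proof -
 have "continuous (at (p0,t0)) y" if p0: "p0 : N" and t0: "t0 : I" for p0 t0
  unfolding continuous_at_eps_delta
 proof (intro allI impI)
  fix e :: real assume e: "e > 0"
  define \<delta>' where "\<delta>' = (\<bar>t0\<bar> + \<delta>) / 2"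
  have \<delta>': "0 < \<delta>'" "\<delta>' < \<delta>" "\<bar>t0\<bar> < \<delta>'" using t0 \<delta>(1) by (auto simp: \<delta>'_def abs_if)
  \<comment> \<open>Gronwall's bound for initial error and defect e1 is 2 (e1 + \<delta> e1) = e /
    4, which leaves e / 2 for the change of time.\<close>
  define e1 where "e1 = e / 8 / (1 + \<delta>)"
  have e1: "e1 > 0" "2 * (e1 + \<delta> * e1) < e / 2"
  proof -
   show "e1 > 0" using e \<delta>(1) by (simp add: e1_def)
   have "e1 * (1 + \<delta>) = e / 8"
    using nonzero_divide_eq_eq[THEN iffD1, OF _ e1_def[symmetric]] \<delta>(1) by simp
   then show "2 * (e1 + \<delta> * e1) < e / 2" using e by (simp add: algebra_simps)
  qed
  obtain d1 where d1: "d1 > 0" "!!z z'. z : (%t. (p0,t,y (p0,t))) ` {-\<delta>'..\<delta>'} ==> dist z' z < d1 ==>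
    z' : \<Omega> & dist (F z') (F z) < e1"
   using compact_uniform_neighbourhood[OF open_dom(1) F graph_compact[OF p0 \<delta>'(2)] e1(1)] by blast
  have "continuous (at p0) (%p. y (p,0))" using y0 N p0 continuous_on_eq_continuous_at by blast
  then obtain d2 where d2: "d2 > 0" "!!p. dist p p0 < d2 ==> dist (y (p,0)) (y (p0,0)) < e1"
   using continuous_at_distE[OF _ e1(1)] by blast
  have "continuous (at t0) (%t. y (p0,t))"
   using y_cont[OF p0] t0 continuous_on_eq_continuous_at open_greaterThanLessThan by blast
  then obtain d3 where d3: "d3 > 0" "!!t. dist t t0 < d3 ==> dist (y (p0,t)) (y (p0,t0)) < e / 2"
   using continuous_at_distE[OF _ half_gt_zero[OF e]] by blast
  obtain d4 where d4: "d4 > 0" "!!p. dist p p0 < d4 ==> p : N" using N p0 unfolding open_dist by blast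
  define d where "d = min (min d1 d2) (min (min d3 d4) (\<delta>' - \<bar>t0\<bar>))"
  have d: "d > 0" "d <= d1" "d <= d2" "d <= d3" "d <= d4" "d <= \<delta>' - \<bar>t0\<bar>" using d1 d2 d3 d4 \<delta>' by (auto simp: d_def)
  show "\<exists>d>0. \<forall>x'. dist x' (p0,t0) < d \<longrightarrow> dist (y x') (y (p0,t0)) < e"
  proof (intro exI[of _ d] conjI allI impI d(1))
   fix x' assume x': "dist x' (p0,t0) < d"
   obtain p t where pt: "x' = (p,t)" by (cases x')
   have p: "dist p p0 < d" and t: "dist t t0 < d"
    using x' dist_fst_le[of x' "(p0,t0)"] dist_snd_le[of x' "(p0,t0)"] by (auto simp: pt)
   have pN: "p : N" using d4(2) p d by force
   have tI: "\<bar>t\<bar> <= \<delta>'" using t d by (auto simp: dist_real_def)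
   have "norm (y (p,t) - y (p0,t)) <= 2 * (norm (y (p,0) - y (p0,0)) + \<delta> * e1)"
   proof (rule gronwall[OF \<delta>'(1,2) _ _ _ tI, where e = "%t. y (p,t) - y (p0,t)"])
    fix t assume t: "t : I" "\<bar>t\<bar> <= \<delta>'"
    show "((%t. y (p,t) - y (p0,t)) hvd F (p,t,y (p,t)) - F (p0,t,y (p0,t))) (at t within {-\<delta>'..\<delta>'})"
     by (intro has_vector_derivative_diff has_vector_derivative_at_within[OF y_der] pN p0 t(1))
    have "dist (p,t,y (p0,t)) (p0,t,y (p0,t)) < d1" using p d by (simp add: dist_Pair_Pair)
    moreover have "t : {-\<delta>'..\<delta>'}" using t by auto
    ultimately have "norm (F (p,t,y (p0,t)) - F (p0,t,y (p0,t))) < e1"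
     using d1(2)[OF imageI, of t "(p,t,y (p0,t))"] by (simp add: dist_norm)
    moreover have "norm (F (p,t,y (p,t)) - F (p,t,y (p0,t))) <= L * norm (y (p,t) - y (p0,t))"
     by (rule lip[OF pN t(1) y_in[OF pN t(1)] y_in[OF p0 t(1)]])
    ultimately show "norm (F (p,t,y (p,t)) - F (p0,t,y (p0,t))) <= L * norm (y (p,t) - y (p0,t)) + e1"
     using norm_triangle_ineq[of "F (p,t,y (p,t)) - F (p,t,y (p0,t))" "F (p,t,y (p0,t)) - F (p0,t,y (p0,t))"]
     by simp
   qed (use e1 in auto)
   moreover have "norm (y (p,0) - y (p0,0)) < e1" using d2(2) p d by (force simp: dist_norm)
   ultimately have "norm (y (p,t) - y (p0,t)) <= 2 * (e1 + \<delta> * e1)" by simp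
   then have "norm (y (p,t) - y (p0,t)) < e / 2" using e1(2) by (rule le_less_trans)
   moreover have "norm (y (p0,t) - y (p0,t0)) < e / 2" using d3(2) t d by (force simp: dist_norm)
   ultimately show "dist (y x') (y (p0,t0)) < e"
    using norm_triangle_ineq[of "y (p,t) - y (p0,t)" "y (p0,t) - y (p0,t0)"] by (simp add: pt dist_norm)
  qed
 qed
 then show ?thesis by (auto intro: continuous_at_imp_continuous_on)
qed

text \<open>The derivative in the state direction inherits the Lipschitz constant. Hence the
  variational equation is again a family with the same L, on the same time interval.\<close>

lemma partial_derivative_bound:
 assumes F: "Ck_on (Suc 0) \<Omega> F" and p: "p : N" and t: "t : I" and u: "u : B"
 shows "norm (FD F (p,t,u) (0,0,v)) <= L * norm v"
proof (rule field_le_epsilon)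
 fix e :: real assume e: "e > 0"
 let ?D = "FD F (p,t,u)"
 have z: "(p,t,u) : \<Omega>" using p t u by simp
 have lin: "linear ?D" using Ck_on_has_derivative[OF F z] has_derivative_linear by blast
 show "norm (?D (0,0,v)) <= L * norm v + e"
 proof (cases "v = 0")
  case True
  then show ?thesis using linear_0[OF lin] e by (simp add: zero_prod_def)
 next
  case False
  then have "e / norm v > 0" using e by simp
  moreover have "compact {(p,t,u)}" "{(p,t,u)} <= \<Omega>" using z by auto
  ultimately obtain d where d: "d > 0" "!!y z'. y : {(p,t,u)} ==> dist z' y < d ==>
    z' : \<Omega> & norm (F z' - F y - FD F y (z' - y)) <= e / norm v * norm (z' - y)"
   using compact_uniform_linearization[OF open_dom(1) F] by blast
  define s where "s = d / (2 * norm v)"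
  have s: "s > 0" "s * norm v < d" using d(1) False by (auto simp: s_def)
  let ?z = "(p,t,u + s *R v)"
  have diff: "?z - (p,t,u) = s *R (0,0,v)" by simp
  have nrm: "norm (?z - (p,t,u)) = s * norm v" using s by (simp add: norm_Pair)
  have *: "?z : \<Omega>" "norm (F ?z - F (p,t,u) - ?D (?z - (p,t,u))) <= e / norm v * norm (?z - (p,t,u))"
   using d(2)[OF singletonI, of ?z] s nrm unfolding dist_norm by auto
  have "s * norm (?D (0,0,v)) = norm (?D (?z - (p,t,u)))"
   unfolding diff linear_scale[OF lin] using s by simp
  also have "\<dots> <= norm (F ?z - F (p,t,u)) + e / norm v * (s * norm v)"
   using *(2) norm_triangle_ineq4[of "F ?z - F (p,t,u)" "F ?z - F (p,t,u) - ?D (?z - (p,t,u))"] nrm s False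
   by simp
  also have "\<dots> <= L * norm (s *R v) + e / norm v * (s * norm v)"
   using lip[OF p t, of "u + s *R v" u] *(1) u by auto
  also have "\<dots> = s * (L * norm v + e)" using s False by (simp add: algebra_simps)
  finally show ?thesis using s by simp
 qed
qed

text \<open>W w solves the variational equation along the solution for p0 in direction w. What
  remains of the difference of the solutions satisfies a linear differential inequality with a
  defect that is small compared with w, and Gronwall's bound carries this over to the remainder,
  uniformly in t.\<close>

lemma family_linearization:
 assumes F: "Ck_on (Suc 0) \<Omega> F" and y0: "Ck_on (Suc 0) N (%p. y (p,0))"
  and p0: "p0 : N" and \<delta>': "0 < \<delta>'" "\<delta>' < \<delta>"
 obtains W where "!!w. W w 0 = FD (%p. y (p,0)) p0 w"
  "!!w t. W w t = (\<Sum>b\<in>Basis. (w \<bullet> b) *R W b t)"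
  "!!w t. t : {-\<delta>'..\<delta>'} ==> (W w has_vector_derivative
    FD F (p0,t,y (p0,t)) (w,0,W w t)) (at t within {-\<delta>'..\<delta>'})"
  "!!e. 0 < e ==> \<exists>d>0. \<forall>w. \<forall>t\<in>{-\<delta>'..\<delta>'}. norm w < d \<longrightarrow>
    p0 + w : N & norm (y (p0 + w,t) - y (p0,t) - W w t) <= e * norm w"
proof -
 let ?J = "{-\<delta>'..\<delta>'}"
 let ?D = "%t. FD F (p0,t,y (p0,t))"
 let ?D\<^sub>0 = "FD (%p. y (p,0)) p0"
 have J: "?J <= I" "t : ?J ==> t : I" for t using \<delta>' by auto
 have z: "(p0,t,y (p0,t)) : \<Omega>" if "t : I" for t using p0 that y_in by auto
 have lin: "linear (?D t)" if "t : I" for t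
  using Ck_on_has_derivative[OF F z[OF that]] has_derivative_linear by blast
 have lin0: "linear ?D\<^sub>0" using Ck_on_has_derivative[OF y0 p0] has_derivative_linear by blast
 have D_diff: "?D t (w,0,u) - ?D t (w',0,u') = ?D t (w - w',0,u - u')" if "t : I" for t w w' u u'
  using linear_diff[OF lin[OF that], of "(w,0,u)" "(w',0,u')"] by simp
 have Dcont: "continuous_on (I \<times> UNIV) (%z. ?D (fst z) (b,0,snd z))" for b
 proof -
  have "Ck_on 0 (I \<times> (UNIV::'a set)) (%z. FD F (p0,fst z,y (p0,fst z)) (b,0,snd z))"
  proof (rule Ck_on_frechet_derivative_apply[OF _ open_dom(1) _ F])
   have "continuous_on (I \<times> (UNIV::'a set)) (%z. y (p0,fst z))"
    by (rule continuous_on_compose2[OF y_cont[OF p0]]) (auto intro!: continuous_intros)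
   then show "Ck_on 0 (I \<times> (UNIV::'a set)) (%z. (p0,fst z,y (p0,fst z)))"
    by (auto intro!: continuous_intros)
  qed (use z in \<open>auto intro!: continuous_intros open_Times\<close>)
  then show ?thesis by simp
 qed
 have "\<exists>w. w 0 = ?D\<^sub>0 b & (\<forall>t\<in>?J. (w hvd ?D t (b,0,w t)) (at t within ?J))" for b
 proof -
  obtain w where w: "w 0 = ?D\<^sub>0 b" "!!t. t : ?J ==> (w hvd ?D t (b,0,w t)) (at t within ?J)"
  proof (rule picard_short_time[of \<delta>' L "%t v. ?D t (b,0,v)" "?D\<^sub>0 b"])
   show "\<delta>' * L <= 1 / 2" using \<delta>' \<delta>(2) L mult_right_mono[of \<delta>' \<delta> L] by linarith
   show "continuous_on (?J \<times> UNIV) (%(t,v). ?D t (b,0,v))"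
    using continuous_on_subset[OF Dcont[of b], of "?J \<times> UNIV"] J by (auto simp: case_prod_unfold)
   fix t v v' assume "t : ?J"
   then show "norm (?D t (b,0,v) - ?D t (b,0,v')) <= L * norm (v - v')"
    using partial_derivative_bound[OF F p0 J(2) y_in[OF p0 J(2)], where v = "v - v'"] D_diff[OF J(2)] by simp
  qed (use \<delta>' L in auto)
  then show ?thesis by blast
 qed
 then obtain Wb where Wb: "!!b. Wb b 0 = ?D\<^sub>0 b"
  "!!b t. t : ?J ==> (Wb b hvd ?D t (b,0,Wb b t)) (at t within ?J)"
  by metis
 \<comment> \<open>Solutions for the basis vectors are extended linearly, which makes W linear in w
   by construction.\<close>
 define W where "W w t = (\<Sum>b\<in>Basis. (w \<bullet> b) *R Wb b t)" for w t
 have W_basis: "W b t = Wb b t" if "b : Basis" for b t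
 proof -
  have "W b t = (\<Sum>b'\<in>Basis. if b' = b then Wb b t else 0)"
   unfolding W_def by (rule sum.cong) (use that in \<open>auto simp: inner_Basis\<close>)
  then show ?thesis using that by simp
 qed
 have W_sum: "W w t = (\<Sum>b\<in>Basis. (w \<bullet> b) *R W b t)" for w t
  using W_basis by (simp add: W_def)
 have W0: "W w 0 = ?D\<^sub>0 w" for w
  using linear_Basis_expansion[OF lin0, of w] by (simp add: W_def Wb(1))
 have W': "(W w hvd ?D t (w,0,W w t)) (at t within ?J)" if t: "t : ?J" for w t
 proof -
  have "(W w hvd (\<Sum>b\<in>Basis. (w \<bullet> b) *R ?D t (b,0,Wb b t))) (at t within ?J)"
   unfolding W_def
   by (intro has_vector_derivative_sum bounded_linear.has_vector_derivative[OF bounded_linear_scaleR_right] Wb(2)[OF t])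
  moreover have "(\<Sum>b\<in>Basis. (w \<bullet> b) *R ?D t (b,0,Wb b t)) = ?D t (\<Sum>b\<in>Basis. (w \<bullet> b) *R (b,0,Wb b t))"
   by (simp only: linear_sum[OF lin[OF J(2)[OF t]]] linear_scale[OF lin[OF J(2)[OF t]]])
  moreover have "(\<Sum>b\<in>Basis. (w \<bullet> b) *R (b,0,Wb b t)) = (w,(0::real),W w t)"
   by (simp add: W_def prod_eq_iff fst_sum snd_sum euclidean_representation)
  ultimately show ?thesis by simp
 qed
 have est: "\<exists>d>0. \<forall>w. \<forall>t\<in>?J. norm w < d \<longrightarrow> p0 + w : N & norm (y (p0 + w,t) - y (p0,t) - W w t) <= e * norm w"
  if e: "0 < e" for e
 proof -
  have "continuous_on ?J (%t. ?D t (b,0,0))" for b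
  proof -
   have "continuous_on ?J (%t. (t,0::'a))" by (intro continuous_intros)
   from continuous_on_compose2[OF Dcont[of b] this] show ?thesis using J(1) by auto
  qed
  then have "continuous_on ?J (%t. \<Sum>b\<in>Basis. norm (?D t (b,0,0)))"
   by (intro continuous_on_sum continuous_on_norm)
  moreover have "?J ~= {}" using \<delta>' by auto
  ultimately obtain M where M: "!!t. t : ?J ==> (\<Sum>b\<in>Basis. norm (?D t (b,0,0))) <= M"
   using continuous_attains_sup[OF compact_Icc] by blast
  have M0: "0 <= M" using M[of 0] \<delta>' sum_nonneg[of Basis "%b. norm (?D 0 (b,0,0))"] by force
  have DM: "norm (?D t (w,0,0)) <= M * norm w" if t: "t : ?J" for t w
  proof -
   have "?D t (w,0,0) = (\<Sum>b\<in>Basis. (w \<bullet> b) *R ?D t (b,0,0))"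
   proof -
    have "linear (%w. ?D t (w,0,0))"
     using lin[OF J(2)[OF t]] linear_compose[of "%w. (w,0,0)" "?D t"]
     by (auto simp: o_def linear_iff)
    then show ?thesis by (rule linear_Basis_expansion)
   qed
   also have "norm \<dots> <= (\<Sum>b\<in>Basis. norm w * norm (?D t (b,0,0)))"
    by (rule order_trans[OF norm_sum sum_mono]) (auto intro!: mult_right_mono Basis_le_norm)
   also have "\<dots> = norm w * (\<Sum>b\<in>Basis. norm (?D t (b,0,0)))" by (simp add: sum_distrib_left)
   also have "\<dots> <= norm w * M" using M[OF t] by (intro mult_left_mono) auto
   finally show ?thesis by (simp add: mult.commute)
  qed
  obtain C0 where C0: "C0 > 0" "!!w. norm (?D\<^sub>0 w) <= C0 * norm w"
   using bounded_linear.pos_bounded[OF has_derivative_bounded_linear[OF Ck_on_has_derivative[OF y0 p0]]]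
   by (metis mult.commute)
  \<comment> \<open>A Lipschitz constant of y in the parameter near p0: C0 + 1 comes from the
    initial values, M + 1 from the explicit dependence of F on the parameter.\<close>
  define C1 where "C1 = 2 * ((C0 + 1) + \<delta> * (M + 1))"
  have C1: "C1 > 0" using C0 M0 \<delta>(1) by (auto simp: C1_def intro!: add_pos_nonneg mult_nonneg_nonneg)
  define e1 where "e1 = e / 2 / (1 + \<delta> * (1 + C1))"
  have e1: "e1 > 0" "2 * (e1 + \<delta> * (e1 * (1 + C1))) = e"
  proof -
   have *: "1 + \<delta> * (1 + C1) > 0" using \<delta>(1) C1 by (simp add: add_pos_pos)
   then show "e1 > 0" using e by (simp add: e1_def)
   have "e1 * (1 + \<delta> * (1 + C1)) = e / 2"
    using nonzero_divide_eq_eq[THEN iffD1, OF _ e1_def[symmetric]] * by simp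
   then show "2 * (e1 + \<delta> * (e1 * (1 + C1))) = e" by (simp add: algebra_simps)
  qed
  define e2 where "e2 = min e1 1"
  have e2: "e2 > 0" "e2 <= e1" "e2 <= 1" using e1 by (auto simp: e2_def)
  obtain d1 where d1: "d1 > 0" "!!z z'. z : (%t. (p0,t,y (p0,t))) ` ?J ==> dist z' z < d1 ==> z' : \<Omega> &
    norm (F z' - F z - FD F z (z' - z)) <= e2 * norm (z' - z)"
   using compact_uniform_linearization[OF open_dom(1) F graph_compact[OF p0 \<delta>'(2)] e2(1)] by blast
  obtain d2 where d2: "d2 > 0" "!!w. norm w < d2 ==> p0 + w : N & norm (y (p0 + w,0) - y (p0,0) - ?D\<^sub>0 w) <= e2 * norm w"
  proof -
   have "compact {p0}" "{p0} <= N" using p0 by auto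
   then obtain d where d: "d > 0" "!!q p. q : {p0} ==> dist p q < d ==>
     p : N & norm (y (p,0) - y (q,0) - FD (%p. y (p,0)) q (p - q)) <= e2 * norm (p - q)"
    using compact_uniform_linearization[OF N y0 _ _ e2(1)] by blast
   show ?thesis
    by (rule that[OF d(1)]) (use d(2)[OF singletonI, of "p0 + w" for w] in \<open>simp add: dist_norm\<close>)
  qed
  define d where "d = min d2 (d1 / (1 + C1))"
  have d: "d > 0" "d <= d2" "d * (1 + C1) <= d1"
  proof -
   show "d > 0" "d <= d2" using d1(1) d2(1) C1 by (auto simp: d_def)
   have "d <= d1 / (1 + C1)" by (simp add: d_def)
   then show "d * (1 + C1) <= d1" using C1 by (simp add: pos_le_divide_eq)
  qed
  show ?thesis
  proof (intro exI[of _ d] conjI d(1) allI ballI impI)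
   fix w :: 'p and t assume t: "t : ?J" and w: "norm w < d"
   have wN: "p0 + w : N" and w0: "norm (y (p0 + w,0) - y (p0,0) - ?D\<^sub>0 w) <= e2 * norm w"
    using d2(2)[of w] w d(2) by auto
   show "p0 + w : N" by (rule wN)
   have wd1: "(1 + C1) * norm w < d1 \<or> w = 0"
   proof -
    have "(1 + C1) * norm w < (1 + C1) * d" using w C1 by (intro mult_strict_left_mono) auto
    then show ?thesis using d(3) by (simp add: mult.commute)
   qed
   have wd1: "(1 + C1) * norm w < d1" using wd1 d1(1) by auto
   have wd1': "norm w < d1" using wd1 C1 mult_right_mono[of 1 "1 + C1" "norm w"] by simp
   have lip1: "norm (y (p0 + w,t) - y (p0,t)) <= C1 * norm w" if t: "t : ?J" for t
   proof -
    have "norm (y (p0 + w,t) - y (p0,t)) <= 2 * (norm (y (p0 + w,0) - y (p0,0)) + \<delta> * ((M + 1) * norm w))"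
    proof (rule gronwall[OF \<delta>', where e = "%t. y (p0 + w,t) - y (p0,t)"])
     fix t assume t: "t : I" "\<bar>t\<bar> <= \<delta>'"
     then have tJ: "t : ?J" by auto
     show "((%t. y (p0 + w,t) - y (p0,t)) hvd F (p0 + w,t,y (p0 + w,t)) - F (p0,t,y (p0,t))) (at t within ?J)"
      by (intro has_vector_derivative_diff has_vector_derivative_at_within[OF y_der] wN p0 t(1))
     let ?z = "(p0,t,y (p0,t))" and ?z' = "(p0 + w,t,y (p0,t))"
     have diff: "?z' - ?z = (w,0,0)" by (simp add: zero_prod_def)
     have "dist ?z' ?z < d1" using wd1' by (simp add: dist_Pair_Pair dist_norm)
     then have "norm (F ?z' - F ?z - ?D t (w,0,0)) <= e2 * norm (w,0::real,0::'a)"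
      using d1(2)[OF imageI[OF tJ], of ?z'] unfolding diff by blast
     moreover have "norm (w,0::real,0::'a) = norm w" by (simp add: norm_Pair)
     moreover have "e2 * norm w <= 1 * norm w" using e2 by (intro mult_right_mono) auto
     ultimately have "norm (F ?z' - F ?z) <= (M + 1) * norm w"
      using DM[OF tJ, of w] norm_triangle_sub[of "F ?z' - F ?z" "?D t (w,0,0)"]
      by (simp add: algebra_simps)
     moreover have "norm (F (p0 + w,t,y (p0 + w,t)) - F ?z') <= L * norm (y (p0 + w,t) - y (p0,t))"
      by (rule lip[OF wN t(1) y_in[OF wN t(1)] y_in[OF p0 t(1)]])
     ultimately show "norm (F (p0 + w,t,y (p0 + w,t)) - F ?z) <= L * norm (y (p0 + w,t) - y (p0,t)) + (M + 1) * norm w"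
      using norm_triangle_ineq[of "F (p0 + w,t,y (p0 + w,t)) - F ?z'" "F ?z' - F ?z"] by simp
    qed (use t M0 in auto)
    also have "norm (y (p0 + w,0) - y (p0,0)) <= (C0 + 1) * norm w"
     using w0 C0(2)[of w] mult_right_mono[OF e2(3), of "norm w"]
      norm_triangle_sub[of "y (p0 + w,0) - y (p0,0)" "?D\<^sub>0 w"] by (simp add: algebra_simps)
    finally show ?thesis by (simp add: C1_def algebra_simps)
   qed
   have "norm (y (p0 + w,t) - y (p0,t) - W w t) <=
     2 * (norm (y (p0 + w,0) - y (p0,0) - W w 0) + \<delta> * (e2 * ((1 + C1) * norm w)))"
   proof (rule gronwall[OF \<delta>', where e = "%t. y (p0 + w,t) - y (p0,t) - W w t"])
    fix t assume t: "t : I" "\<bar>t\<bar> <= \<delta>'"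
    then have tJ: "t : ?J" by auto
    show "((%t. y (p0 + w,t) - y (p0,t) - W w t) has_vector_derivative
      F (p0 + w,t,y (p0 + w,t)) - F (p0,t,y (p0,t)) - ?D t (w,0,W w t)) (at t within ?J)"
     by (intro has_vector_derivative_diff has_vector_derivative_at_within[OF y_der] W' tJ wN p0 t(1))
    let ?z = "(p0,t,y (p0,t))" and ?z' = "(p0 + w,t,y (p0 + w,t))"
    let ?dy = "y (p0 + w,t) - y (p0,t)"
    have diff: "?z' - ?z = (w,0,?dy)" by simp
    have nrm: "norm (w,0::real,?dy) <= (1 + C1) * norm w"
     using lip1[OF tJ] norm_Pair_le[of w "(0::real,?dy)"] norm_Pair_le[of "0::real" ?dy]
     by (simp add: algebra_simps)
    then have "dist ?z' ?z < d1" using wd1 unfolding dist_norm diff by linarith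
    then have "norm (F ?z' - F ?z - ?D t (w,0,?dy)) <= e2 * norm (w,0::real,?dy)"
     using d1(2)[OF imageI[OF tJ], of ?z'] unfolding diff by blast
    also have "\<dots> <= e2 * ((1 + C1) * norm w)" using nrm e2 by (intro mult_left_mono) auto
    finally have "norm (F ?z' - F ?z - ?D t (w,0,?dy)) <= e2 * ((1 + C1) * norm w)" .
    moreover have "norm (?D t (w,0,?dy) - ?D t (w,0,W w t)) <= L * norm (?dy - W w t)"
     using partial_derivative_bound[OF F p0 t(1) y_in[OF p0 t(1)], of "?dy - W w t"] D_diff[OF t(1)] by simp
    ultimately show "norm (F ?z' - F ?z - ?D t (w,0,W w t)) <= L * norm (?dy - W w t) + e2 * ((1 + C1) * norm w)"
     using norm_triangle_ineq[of "F ?z' - F ?z - ?D t (w,0,?dy)" "?D t (w,0,?dy) - ?D t (w,0,W w t)"] by simp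
   qed (use t e2 C1 in auto)
   also have "\<dots> <= 2 * (e1 * norm w + \<delta> * (e1 * ((1 + C1) * norm w)))"
   proof -
    have "norm (y (p0 + w,0) - y (p0,0) - W w 0) <= e1 * norm w"
     using w0 mult_right_mono[OF e2(2), of "norm w"] by (simp add: W0)
    moreover have "\<delta> * (e2 * ((1 + C1) * norm w)) <= \<delta> * (e1 * ((1 + C1) * norm w))"
     using e2(2) \<delta>(1) C1 by (intro mult_left_mono mult_right_mono) auto
    ultimately show ?thesis by simp
   qed
   also have "\<dots> = 2 * (e1 + \<delta> * (e1 * (1 + C1))) * norm w" by (simp add: algebra_simps)
   finally show "norm (y (p0 + w,t) - y (p0,t) - W w t) <= e * norm w" by (simp only: e1(2))
  qed
 qed
 show ?thesis by (rule that[OF W0 W_sum W' est])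
qed

text \<open>The joint derivative in (p, t) consists of the linearisation V in the parameter and of F
  in time. The last conclusion holds for all t near t0 and thus allows the parameter derivative of y
  to be differentiated in t, which yields the variational equation.\<close>

lemma family_has_derivative:
 assumes F: "Ck_on (Suc 0) \<Omega> F" and y0: "Ck_on (Suc 0) N (%p. y (p,0))"
  and p0: "p0 : N" and t0: "t0 : I"
 obtains V where "(y has_derivative (%(w,\<tau>). V w t0 + \<tau> *R F (p0,t0,y (p0,t0)))) (at (p0,t0))"
  "!!t w. \<bar>t\<bar> <= \<bar>t0\<bar> ==> FD y (p0,t) (w,0) = V w t"
  "!!w. (V w hvd FD F (p0,t0,y (p0,t0)) (w,0,V w t0)) (at t0)"
  "!!w. V w 0 = FD (%p. y (p,0)) p0 w"
  "!!w. \<forall>\<^sub>F t in nhds t0. FD y (p0,t) (w,0) = V w t"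
proof -
 define \<delta>' where "\<delta>' = (\<bar>t0\<bar> + \<delta>) / 2"
 have \<delta>': "0 < \<delta>'" "\<delta>' < \<delta>" "\<bar>t0\<bar> < \<delta>'" using t0 \<delta>(1) by (auto simp: \<delta>'_def abs_if)
 let ?J = "{-\<delta>'..\<delta>'}"
 obtain W where W0: "!!w. W w 0 = FD (%p. y (p,0)) p0 w"
  and W_sum: "!!w t. W w t = (\<Sum>b\<in>Basis. (w \<bullet> b) *R W b t)"
  and W': "!!w t. t : ?J ==> (W w has_vector_derivative
    FD F (p0,t,y (p0,t)) (w,0,W w t)) (at t within ?J)"
  and est: "!!e. 0 < e ==> \<exists>d>0. \<forall>w. \<forall>t\<in>?J. norm w < d \<longrightarrow>
    p0 + w : N & norm (y (p0 + w,t) - y (p0,t) - W w t) <= e * norm w"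
 proof (rule family_linearization[OF F y0 p0 \<delta>'(1,2)])
  fix W
  assume *: "!!w. W w 0 = FD (%p. y (p,0)) p0 w"
   "!!w t. W w t = (\<Sum>b\<in>Basis. (w \<bullet> b) *R W b t)"
   "!!w t. t : ?J ==> (W w has_vector_derivative
    FD F (p0,t,y (p0,t)) (w,0,W w t)) (at t within ?J)"
   "!!e. 0 < e ==> \<exists>d>0. \<forall>w. \<forall>t\<in>?J. norm w < d \<longrightarrow>
    p0 + w : N & norm (y (p0 + w,t) - y (p0,t) - W w t) <= e * norm w"
  show thesis by (rule that[of W]) (fact *)+
 qed
 have W'_at: "(W w hvd FD F (p0,t,y (p0,t)) (w,0,W w t)) (at t)"
  if "\<bar>t\<bar> < \<delta>'" for w t
 proof -
  have "t : ?J" "-\<delta>' < t" "t < \<delta>'" using that by auto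
  then show ?thesis using W'[of t w] by (simp only: at_within_Icc_at)
 qed
 have der: "(y has_derivative (%(w,\<tau>). W w t + \<tau> *R F (p0,t,y (p0,t)))) (at (p0,t))" if t: "\<bar>t\<bar> < \<delta>'" for t
  unfolding has_derivative_at_alt
 proof (intro conjI allI impI)
  let ?F = "F (p0,t,y (p0,t))"
  have "bounded_linear (%z::'p \<times> real. (\<Sum>b\<in>Basis. (fst z \<bullet> b) *R W b t) + snd z *R ?F)"
   by (intro bounded_linear_add bounded_linear_sum bounded_linear_scaleR_const
     bounded_linear_compose[OF bounded_linear_inner_left bounded_linear_fst] bounded_linear_snd)
  then show "bounded_linear (%(w,\<tau>). W w t + \<tau> *R ?F)"
   by (subst W_sum) (simp add: case_prod_unfold)
  fix e :: real assume e: "0 < e"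
  then have e3: "e / 3 > 0" by simp
  from est[OF e3] obtain d1 where d1: "d1 > 0" "!!w t. t : ?J ==> norm w < d1 ==> norm (y (p0 + w,t) - y (p0,t) - W w t) <= e / 3 * norm w"
   by blast
  have tI: "t : I" using t \<delta>' by auto
  obtain d2 where d2: "d2 > 0" "!!t'. norm (t' - t) < d2 ==> norm (y (p0,t') - y (p0,t) - (t' - t) *R ?F) <= e / 3 * norm (t' - t)"
   using y_der[OF p0 tI] e3 unfolding has_vector_derivative_def has_derivative_at_alt by metis
  have "continuous (at t) (%t'. \<Sum>b\<in>Basis. norm (W b t' - W b t))"
   by (intro continuous_intros has_vector_derivative_continuous[OF W'_at[OF t]])
  from continuous_at_distE[OF this e3] obtain d3 where d3: "d3 > 0" "!!t'. dist t' t < d3 ==> \<bar>\<Sum>b\<in>Basis. norm (W b t' - W b t)\<bar> < e / 3"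
   by (auto simp: dist_real_def)
  define d where "d = min (min d1 d2) (min d3 (\<delta>' - \<bar>t\<bar>))"
  have d: "d > 0" "d <= d1" "d <= d2" "d <= d3" "d <= \<delta>' - \<bar>t\<bar>" using d1 d2 d3 t by (auto simp: d_def)
  show "\<exists>d>0. \<forall>z. norm (z - (p0,t)) < d \<longrightarrow> norm (y z - y (p0,t) - (case z - (p0,t) of (w,\<tau>) => W w t + \<tau> *R ?F)) <= e * norm (z - (p0,t))"
  proof (intro exI[of _ d] conjI d(1) allI impI)
   fix z assume z: "norm (z - (p0,t)) < d"
   define w \<tau> where "w = fst z - p0" and "\<tau> = snd z - t"
   have z_eq: "z = (p0 + w,t + \<tau>)" by (simp add: w_def \<tau>_def)
   have zdiff: "z - (p0,t) = (w,\<tau>)" by (simp add: z_eq)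
   let ?n = "norm (z - (p0,t))"
   have wn: "norm w <= ?n" "\<bar>\<tau>\<bar> <= ?n"
    using norm_fst_le[of w \<tau>] norm_snd_le[of \<tau> w] unfolding zdiff by auto
   have "norm w < d1" using wn(1) z d(2) by linarith
   moreover have "t + \<tau> : ?J" using wn(2) z d(5) by (auto simp: abs_if split: if_splits)
   ultimately have 1: "norm (y (p0 + w,t + \<tau>) - y (p0,t + \<tau>) - W w (t + \<tau>)) <= e / 3 * ?n"
    using order_trans[OF d1(2) mult_left_mono[OF wn(1)]] e by simp
   have 2: "norm (y (p0,t + \<tau>) - y (p0,t) - \<tau> *R ?F) <= e / 3 * ?n"
   proof -
    have "norm ((t + \<tau>) - t) < d2" using wn(2) z d(3) by simp
    from d2(2)[OF this] have "norm (y (p0,t + \<tau>) - y (p0,t) - \<tau> *R ?F) <= e / 3 * \<bar>\<tau>\<bar>" by simp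
    also have "\<dots> <= e / 3 * ?n" using wn(2) e by (intro mult_left_mono) auto
    finally show ?thesis .
   qed
   have "W w (t + \<tau>) - W w t = (\<Sum>b\<in>Basis. (w \<bullet> b) *R (W b (t + \<tau>) - W b t))"
    by (subst (1 2) W_sum) (simp add: sum_subtractf scaleR_diff_right)
   also have "norm \<dots> <= (\<Sum>b\<in>Basis. norm w * norm (W b (t + \<tau>) - W b t))"
    by (rule order_trans[OF norm_sum sum_mono]) (auto intro!: mult_right_mono Basis_le_norm)
   also have "\<dots> = norm w * (\<Sum>b\<in>Basis. norm (W b (t + \<tau>) - W b t))" by (simp add: sum_distrib_left)
   also have "\<dots> <= ?n * (e / 3)"
    using d3(2)[of "t + \<tau>"] wn z d(4) by (intro mult_mono sum_nonneg) (auto simp: dist_real_def)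
   finally have 3: "norm (W w (t + \<tau>) - W w t) <= e / 3 * ?n" by (simp add: mult.commute)
   have "y z - y (p0,t) - (W w t + \<tau> *R ?F) =
     (y (p0 + w,t + \<tau>) - y (p0,t + \<tau>) - W w (t + \<tau>)) + (y (p0,t + \<tau>) - y (p0,t) - \<tau> *R ?F)
     + (W w (t + \<tau>) - W w t)" by (simp add: z_eq algebra_simps)
   then have "norm (y z - y (p0,t) - (W w t + \<tau> *R ?F)) <= e / 3 * ?n + e / 3 * ?n + e / 3 * ?n"
    using 1 2 3 by (metis (no_types, lifting) add_mono norm_triangle_le)
   then show "norm (y z - y (p0,t) - (case z - (p0,t) of (w,\<tau>) => W w t + \<tau> *R ?F)) <= e * ?n"
    unfolding zdiff by simp
  qed
 qed
 have fd: "FD y (p0,t) (w,0) = W w t" if "\<bar>t\<bar> < \<delta>'" for t w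
  using frechet_derivative_at[OF der[OF that]] by (metis (no_types, lifting) add.right_neutral case_prod_conv scaleR_zero_left)
 have "\<forall>\<^sub>F t in nhds t0. t : {-\<delta>'<..<\<delta>'}"
  by (rule eventually_nhds_in_open) (use \<delta>'(3) in auto)
 then have ev: "\<forall>\<^sub>F t in nhds t0. FD y (p0,t) (w,0) = W w t" for w
  by eventually_elim (use fd in auto)
 show ?thesis
  by (rule that[OF der[OF \<delta>'(3)] fd W'_at[OF \<delta>'(3)] W0 ev]) (use \<delta>'(3) in auto)
qed

end

text \<open>Induction over all families at once: the derivative of y in a parameter direction solves
  the variational equation, a family with the same N, \<delta> and L and with state set UNIV, whose
  right-hand side has one derivative less. The interval does not shrink with the order, so C^m for
  all m gives smoothness.\<close>

theorem ode_family_Ck: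
 fixes F :: "'p::euclidean_space \<times> real \<times> 'a::euclidean_space => 'a"
 assumes N: "open N" and \<delta>: "0 < \<delta>" "\<delta> * L <= 1 / 2" and L: "0 <= L"
 shows "open B ==> ode_family N \<delta> L B F y ==> Ck_on m (N \<times> {-\<delta><..<\<delta>} \<times> B) F ==>
  Ck_on m N (%p. y (p,0)) ==> Ck_on m (N \<times> {-\<delta><..<\<delta>}) y"
proof (induction m arbitrary: B F y)
 case 0
 interpret short_ode_family N \<delta> L B F y
  by unfold_locales (use N \<delta> L 0 in auto)
 show ?case using family_continuous 0 by simp
next
 case (Suc m)
 note F = Suc.prems(3) and y0 = Suc.prems(4)
 interpret short_ode_family N \<delta> L B F y
  by unfold_locales (use N \<delta> L Suc.prems in auto)
 have F1: "Ck_on (Suc 0) \<Omega> F" by (rule Ck_on_le[OF F]) simp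
 have y01: "Ck_on (Suc 0) N (%p. y (p,0))" by (rule Ck_on_le[OF y0]) simp
 have y: "Ck_on m (N \<times> I) y"
  by (rule Suc.IH[OF Suc.prems(1,2) Ck_on_SucD[OF F] Ck_on_SucD[OF y0]])
 have fd: "y differentiable (at (p,t)) &
   FD y (p,t) (w,\<tau>) = FD y (p,t) (w,0) + \<tau> *R F (p,t,y (p,t)) &
   ((%t. FD y (p,t) (w,0)) has_vector_derivative
    FD F (p,t,y (p,t)) (w,0,FD y (p,t) (w,0))) (at t) &
   FD y (p,0) (w,0) = FD (%p. y (p,0)) p w"
  if p: "p : N" and t: "t : I" for p t w \<tau>
 proof -
  obtain V where V: "(y has_derivative (%(w,\<tau>). V w t + \<tau> *R F (p,t,y (p,t)))) (at (p,t))"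
   "!!t' w. \<bar>t'\<bar> <= \<bar>t\<bar> ==> FD y (p,t') (w,0) = V w t'"
   "!!w. (V w hvd FD F (p,t,y (p,t)) (w,0,V w t)) (at t)"
   "!!w. V w 0 = FD (%p. y (p,0)) p w"
   "!!w. \<forall>\<^sub>F t' in nhds t. FD y (p,t') (w,0) = V w t'"
  proof (rule family_has_derivative[OF F1 y01 p t])
   fix V
   assume *: "(y has_derivative (%(w,\<tau>). V w t + \<tau> *R F (p,t,y (p,t)))) (at (p,t))"
    "!!t' w. \<bar>t'\<bar> <= \<bar>t\<bar> ==> FD y (p,t') (w,0) = V w t'"
    "!!w. (V w hvd FD F (p,t,y (p,t)) (w,0,V w t)) (at t)"
    "!!w. V w 0 = FD (%p. y (p,0)) p w"
    "!!w. \<forall>\<^sub>F t' in nhds t. FD y (p,t') (w,0) = V w t'"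
   show thesis by (rule that[of V]) (fact *)+
  qed
  have "y differentiable (at (p,t))" using V(1) by (auto simp: differentiable_def)
  moreover have "FD y (p,t) (w,\<tau>) = FD y (p,t) (w,0) + \<tau> *R F (p,t,y (p,t))"
   by (simp add: frechet_derivative_at[OF V(1), symmetric])
  moreover have "((%t. FD y (p,t) (w,0)) has_vector_derivative
    FD F (p,t,y (p,t)) (w,0,FD y (p,t) (w,0))) (at t)"
   using V(3)[of w] V(2)[of t w] V(5)[of w]
    has_vector_derivative_cong_ev[where x = t and S = UNIV and g = "V w"
     and f = "%t. FD y (p,t) (w,0)"] by simp
  moreover have "FD y (p,0) (w,0) = FD (%p. y (p,0)) p w"
   using V(2)[of 0 w] V(4) by simp
  ultimately show ?thesis by blast
 qed
 note fd_ode = fd[THEN conjunct2, THEN conjunct2, THEN conjunct1]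
 have fd_eq: "FD y (p,t) (w,\<tau>) = FD y (p,t) (w,0) + \<tau> *R F (p,t,y (p,t))"
  if "p : N" "t : I" for p t w \<tau>
  by (rule fd[OF that, THEN conjunct2, THEN conjunct1])
 have fd_init: "FD y (p,0) (w,0) = FD (%p. y (p,0)) p w" if "p : N" for p w
  by (rule fd[OF that, of 0, THEN conjunct2, THEN conjunct2, THEN conjunct2]) (use \<delta>(1) in auto)
 have "Ck_on m (N \<times> I) (%z. FD y z w)" for w
 proof -
  let ?V = "%z. FD y z (fst w,0)"
  let ?F = "%(p,t,v). FD F (p,t,y (p,t)) (fst w,0,v)"
  have z: "(p,t,y (p,t)) : \<Omega>" if "p : N" "t : I" for p t using that y_in by auto
  have "Ck_on m (N \<times> I) ?V"
  proof (rule Suc.IH[of UNIV ?F])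
   show "ode_family N \<delta> L UNIV ?F ?V"
    unfolding ode_family_def
   proof (intro ballI conjI)
    fix p t u v assume p: "p : N" and t: "t : I"
    show "((%t. ?V (p,t)) hvd ?F (p,t,?V (p,t))) (at t)"
     using fd_ode[OF p t, of "fst w"] by simp
    have lin: "linear (FD F (p,t,y (p,t)))"
     using Ck_on_has_derivative[OF F z[OF p t]] has_derivative_linear by blast
    show "norm (?F (p,t,u) - ?F (p,t,v)) <= L * norm (u - v)"
     using partial_derivative_bound[OF F1 p t y_in[OF p t], of "u - v"]
      linear_diff[OF lin, of "(fst w,0,u)" "(fst w,0,v)"] by simp
   qed simp
   have "Ck_on m (N \<times> I \<times> (UNIV::'a set)) (%z. FD F (fst z,fst (snd z),y (fst z,fst (snd z))) (fst w,0,snd (snd z)))"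
   proof (rule Ck_on_frechet_derivative_apply[OF _ open_dom(1) _ F])
    show op: "open (N \<times> I \<times> (UNIV::'a set))" by (intro open_Times N) auto
    have "Ck_on m (N \<times> I \<times> (UNIV::'a set)) (%z. y (fst z,fst (snd z)))"
     by (rule Ck_on_compose[OF op open_dom(2) _ y])
      (auto intro!: Ck_on_Pair Ck_on_fst Ck_on_snd Ck_on_ident op)
    then show "Ck_on m (N \<times> I \<times> (UNIV::'a set)) (%z. (fst z,fst (snd z),y (fst z,fst (snd z))))"
     by (intro Ck_on_Pair Ck_on_fst Ck_on_snd Ck_on_ident op)
    show "Ck_on m (N \<times> I \<times> (UNIV::'a set)) (%z. (fst w,0,snd (snd z)))"
     by (intro Ck_on_Pair Ck_on_const Ck_on_snd Ck_on_ident op)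
   qed (use z in auto)
   then show "Ck_on m (N \<times> I \<times> UNIV) ?F" by (simp add: case_prod_unfold)
   have "Ck_on m N (%p. FD (%p. y (p,0)) p (fst w))"
    by (rule Ck_on_frechet_derivative[OF y0])
   then show "Ck_on m N (%p. ?V (p,0))"
    by (rule Ck_on_cong[OF N]) (simp add: fd_init)
  qed simp
  moreover have "Ck_on m (N \<times> I) (%z. F (fst z,snd z,y z))"
   by (rule Ck_on_compose[OF open_dom(2) open_dom(1) _ Ck_on_SucD[OF F]])
    (use y_in in \<open>auto intro!: Ck_on_Pair Ck_on_fst Ck_on_snd Ck_on_ident y open_Times N\<close>)
  ultimately have "Ck_on m (N \<times> I) (%z. ?V z + snd w *R F (fst z,snd z,y z))"
   by (intro Ck_on_add Ck_on_scaleR Ck_on_const open_dom(2))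
  then show ?thesis
   by (rule Ck_on_cong[OF open_dom(2)]) (auto simp: fd_eq[where w = "fst w" and \<tau> = "snd w", symmetric])
 qed
 then show ?case using fd[THEN conjunct1] by auto
qed

section \<open>Local flows, uniqueness and the time-one map\<close>

lemma Ck_on_local_lipschitz:
 fixes X :: "'a::euclidean_space => 'b::real_normed_vector"
 assumes U: "open U" and X: "Ck_on (Suc 0) U X" and x: "x : U"
 obtains r L where "0 < r" "0 <= L" "cball x r <= U"
  "!!u v. u : cball x r ==> v : cball x r ==> norm (X u - X v) <= L * norm (u - v)"
proof -
 obtain r where r: "0 < r" "cball x r <= U" using U x open_contains_cball by blast
 let ?g = "%z. \<Sum>b\<in>Basis. norm (FD X z b)"
 have "continuous_on (cball x r) ?g"
  using X r(2) by (intro continuous_on_sum continuous_on_norm) (auto intro: continuous_on_subset)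
 from continuous_attains_sup[OF compact_cball _ this] r(1)
 obtain m where m: "!!z. z : cball x r ==> ?g z <= ?g m" by force
 have der: "(X has_derivative FD X z) (at z)" if "z : cball x r" for z
  using Ck_on_has_derivative[OF X] r(2) that by blast
 have "norm (X u - X v) <= ?g m * norm (u - v)" if "u : cball x r" "v : cball x r" for u v
 proof (rule differentiable_bound[OF convex_cball _ _ that])
  fix z assume z: "z : cball x r"
  show "(X has_derivative FD X z) (at z within cball x r)"
   using der[OF z] has_derivative_at_withinI by blast
  show "onorm (FD X z) <= ?g m"
   using onorm_componentwise[OF has_derivative_bounded_linear[OF der[OF z]]] m[OF z] by linarith
 qed
 note bound = this
 show ?thesis by (rule that[OF r(1) _ r(2) bound]) (simp add: sum_nonneg)
qed

text \<open>Composing the field with the projection onto a closed ball makes it globally Lipschitz.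
  Solutions that start in the ball of half the radius do not leave the large one within time
  \<delta>, so they solve the original equation.\<close>

lemma local_flow:
 fixes X :: "'a::euclidean_space => 'a"
 assumes U: "open U" and X: "smooth_on U X" and x: "x : U"
 shows "\<exists>r \<delta> \<psi>. 0 < r & 0 < \<delta> & smooth_on (ball x r \<times> {-\<delta><..<\<delta>}) \<psi> &
  (\<forall>p\<in>ball x r. \<psi> (p,0) = p & (\<forall>t\<in>{-\<delta><..<\<delta>}. \<psi> (p,t) : U &
    ((%t. \<psi> (p,t)) hvd X (\<psi> (p,t))) (at t)))"
proof -
 obtain r L where r: "0 < r" and L: "0 <= L" and sub: "cball x r <= U"
  and lip: "!!u v. u : cball x r ==> v : cball x r ==> norm (X u - X v) <= L * norm (u - v)"
  using Ck_on_local_lipschitz[OF U smooth_onD[OF X] x] by blast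
 have Xc: "continuous_on (cball x r) X"
  using smooth_on_continuous_on[OF X] sub continuous_on_subset by blast
 then have "bounded (X ` cball x r)"
  using compact_continuous_image compact_imp_bounded compact_cball by blast
 then obtain M where M: "0 < M" "!!z. z : cball x r ==> norm (X z) <= M"
  unfolding bounded_pos by blast
 let ?cp = "closest_point (cball x r)"
 have ne: "cball x r ~= {}" using r by auto
 have cp: "?cp z : cball x r" for z by (rule closest_point_in_set[OF closed_cball ne])
 have cp_lip: "dist (?cp u) (?cp v) <= dist u v" for u v
  by (rule closest_point_lipschitz[OF convex_cball closed_cball ne])
 \<comment> \<open>The first bound gives \<delta> L <= 1 / 2, the second keeps the displacement
   below r / 2 at speeds up to M.\<close>
 define \<delta> where "\<delta> = min (1 / (2 * (L + 1))) (r / (4 * M))"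
 have \<delta>: "0 < \<delta>" "\<delta> * L <= 1 / 2" "\<delta> * M < r / 2"
 proof -
  show "0 < \<delta>" using L M r by (simp add: \<delta>_def)
  have "\<delta> * L <= 1 / (2 * (L + 1)) * L" unfolding \<delta>_def using L by (intro mult_right_mono) auto
  also have "\<dots> <= 1 / 2" using L by (simp add: field_simps)
  finally show "\<delta> * L <= 1 / 2" .
  have "\<delta> * M <= r / (4 * M) * M" unfolding \<delta>_def using M by (intro mult_right_mono) auto
  also have "\<dots> < r / 2" using M r by simp
  finally show "\<delta> * M < r / 2" .
 qed
 let ?J = "{-\<delta>..\<delta>}"
 have "\<exists>y. y 0 = p & (\<forall>t\<in>?J. (y hvd X (?cp (y t))) (at t within ?J))" for p
 proof -
  obtain y where "y 0 = p" "!!t. t : ?J ==> (y hvd X (?cp (y t))) (at t within ?J)"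
  proof (rule picard_short_time[of \<delta> L "%t y. X (?cp y)" p])
   have cc: "continuous_on UNIV ?cp" by (rule continuous_on_closest_point[OF convex_cball closed_cball ne])
   have "continuous_on UNIV (%y. X (?cp y))"
    by (rule continuous_on_compose2[OF Xc cc]) (use cp in auto)
   from continuous_on_compose2[OF this, of "?J \<times> UNIV" snd]
   show "continuous_on (?J \<times> UNIV) (%(t,y). X (?cp y))"
    by (simp add: case_prod_unfold continuous_on_snd)
   show "norm (X (?cp u) - X (?cp v)) <= L * norm (u - v)" for u v
    using lip[OF cp cp, of u v] mult_left_mono[OF cp_lip[of u v] L] by (simp add: dist_norm)
  qed (use \<delta> L in auto)
  then show ?thesis by blast
 qed
 then obtain Y where Y0: "!!p. Y p 0 = p"
  and Y': "!!p t. t : ?J ==> (Y p hvd X (?cp (Y p t))) (at t within ?J)"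
  by metis
 define \<psi> where "\<psi> = (%(p,t). Y p t)"
 let ?N = "ball x (r / 2)"
 have in_ball: "Y p t : ball x r" if p: "p : ?N" and t: "t : ?J" for p t
 proof -
  have "norm (Y p t - Y p 0) <= M * \<bar>t - 0\<bar>"
   by (rule vector_derivative_bound[of ?J, OF _ Y' M(2)[OF cp]]) (use t in auto)
  also have "\<dots> <= M * \<delta>" using t M by (intro mult_left_mono) auto
  finally have "dist p (Y p t) < r / 2" using \<delta>(3) by (simp add: Y0 dist_norm norm_minus_commute mult.commute)
  then show ?thesis using p dist_triangle[of x "Y p t" p] by simp
 qed
 have sol: "((%t. \<psi> (p,t)) hvd X (\<psi> (p,t))) (at t)" if p: "p : ?N" and t: "t : {-\<delta><..<\<delta>}" for p t
 proof -
  have tJ: "t : ?J" "-\<delta> < t" "t < \<delta>" using t by auto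
  have "?cp (Y p t) = Y p t"
   using in_ball[OF p tJ(1)] by (intro closest_point_self) (auto simp: less_imp_le)
  then show ?thesis using Y'[OF tJ(1), of p] tJ(2,3) by (simp add: \<psi>_def at_within_Icc_at)
 qed
 have fam: "ode_family ?N \<delta> L (ball x r) (%(p,t,y). X y) \<psi>"
  unfolding ode_family_def
  using sol in_ball lip by (auto simp: \<psi>_def less_imp_le)
 have "Ck_on m (?N \<times> {-\<delta><..<\<delta>}) \<psi>" for m
 proof (rule ode_family_Ck[OF _ \<delta>(1,2) L _ fam])
  have "Ck_on m (?N \<times> {-\<delta><..<\<delta>} \<times> ball x r) (%z. X (snd (snd z)))"
   by (rule Ck_on_compose[OF _ U _ smooth_onD[OF X]])
    (use sub in \<open>auto intro!: Ck_on_snd Ck_on_ident open_Times\<close>)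
  then show "Ck_on m (?N \<times> {-\<delta><..<\<delta>} \<times> ball x r) (%(p,t,y). X y)" by (simp add: case_prod_unfold)
  show "Ck_on m ?N (%p. \<psi> (p,0))" by (simp add: \<psi>_def Y0 Ck_on_ident)
 qed auto
 moreover have "\<psi> (p,t) : U" if "p : ?N" "t : {-\<delta><..<\<delta>}" for p t
  using in_ball[OF that(1), of t] that(2) sub by (auto simp: \<psi>_def less_imp_le)
 ultimately show ?thesis
  using r \<delta>(1) sol Y0
  by (intro exI[of _ "r / 2"] exI[of _ \<delta>] exI[of _ \<psi>]) (auto simp: \<psi>_def intro: smooth_onI)
qed

text \<open>Derivatives are one-sided at the end points, so that solutions can be cut and
  joined.\<close>

definition ode_sol :: "('a::euclidean_space => 'a) => 'a set => real => real => (real => 'a) => bool" where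
 "ode_sol X U a b y \<longleftrightarrow> (\<forall>t\<in>{a..b}. y t : U & (y hvd X (y t)) (at t within {a..b}))"

lemma ode_sol_subinterval: "ode_sol X U a b y ==> a <= a' ==> b' <= b ==> ode_sol X U a' b' y"
 unfolding ode_sol_def
 by (meson atLeastAtMost_iff atLeastatMost_subset_iff has_vector_derivative_within_subset order_trans)

lemma ode_sol_continuous: "ode_sol X U a b y ==> continuous_on {a..b} y"
 unfolding ode_sol_def by (rule has_vector_derivative_imp_continuous_on) blast

lemma ode_sol_join:
 assumes y: "ode_sol X U a b y" and z: "ode_sol X U b c z" and eq: "y b = z b" and le: "a <= b" "b <= c"
 shows "ode_sol X U a c (%t. if t <= b then y t else z t)"
proof -
 let ?w = "%t. if t <= b then y t else z t"
 have un: "{a..c} = {a..b} \<union> {b..c}" using le by auto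
 have wz: "?w t = z t" if "t : {b..c}" for t using that eq by auto
 have wy: "(?w hvd X (?w t)) (at t within {a..b})" if "t : {a..b}" for t
 proof -
  have "(y hvd X (y t)) (at t within {a..b})" using y that by (simp add: ode_sol_def)
  from has_vector_derivative_transform[OF that _ this, of ?w] show ?thesis using that by simp
 qed
 have wz': "(?w hvd X (?w t)) (at t within {b..c})" if "t : {b..c}" for t
 proof -
  have "(z hvd X (z t)) (at t within {b..c})" using z that by (simp add: ode_sol_def)
  from has_vector_derivative_transform[OF that wz this] show ?thesis by (simp only: wz[OF that])
 qed
 \<comment> \<open>Off a closed interval the derivative within it is a vacuous notion. So at every t
   derivatives within both pieces are available and can be combined on the union.\<close>
 have trivial: "(f hvd D) (at t within S)" if "closed S" "t \<notin> S" for f :: "real => 'a" and D t S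
 proof -
  have "at t within S = bot"
   using that not_in_closure_trivial_limitI[of t S] closure_closed[of S] by simp
  then show ?thesis by (simp add: has_vector_derivative_def has_derivative_def bounded_linear_scaleR_left)
 qed
 show ?thesis
  unfolding ode_sol_def
 proof (intro ballI conjI)
  fix t assume t: "t : {a..c}"
  show "?w t : U" using y z t by (auto simp: ode_sol_def)
  have "(?w hvd X (?w t)) (at t within {a..b})"
   by (cases "t : {a..b}") (use wy trivial[OF closed_atLeastAtMost] in blast)+
  moreover have "(?w hvd X (?w t)) (at t within {b..c})"
   by (cases "t : {b..c}") (use wz' trivial[OF closed_atLeastAtMost] in blast)+
  ultimately show "(?w hvd X (?w t)) (at t within {a..c})"
   unfolding un has_vector_derivative_def has_derivative_within by (auto intro: Lim_Un)
 qed
qed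

text \<open>Bisection: agreement propagates over adjacent intervals, so only short intervals around
  a point s matter. If the solutions agree at s, Gronwall's bound applies there; otherwise they
  differ everywhere near s and the premise of P fails.\<close>

lemma ode_sol_unique:
 assumes U: "open U" and X: "smooth_on U X" and y: "ode_sol X U a b y" and z: "ode_sol X U a b z"
  and eq: "y a = z a" and t: "t : {a..b}"
 shows "y t = z t"
proof -
 define P where "P c d \<longleftrightarrow> (a <= c & d <= b & y c = z c \<longrightarrow> (\<forall>t\<in>{c..d}. y t = z t))" for c d
 have "P a b"
 proof (rule Bolzano)
  show "a <= b" using t by auto
 next
  fix p q r assume *: "P p q" "P q r" "p <= q" "q <= r"
  show "P p r"
   unfolding P_def
  proof (intro impI ballI)
   fix t assume h: "a <= p & r <= b & y p = z p" "t : {p..r}"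
   then have pq: "\<forall>t\<in>{p..q}. y t = z t" using * by (auto simp: P_def)
   then have "y q = z q" using * by auto
   then have "\<forall>t\<in>{q..r}. y t = z t" using * h by (auto simp: P_def)
   then show "y t = z t" using pq h(2) by (cases "t <= q") auto
  qed
 next
  fix s assume s: "a <= s" "s <= b"
  then have sI: "s : {a..b}" by auto
  have yU: "y s : U" using y sI by (simp add: ode_sol_def)
  obtain r L where r: "0 < r" and L: "0 <= L" and sub: "cball (y s) r <= U"
   and lip: "!!u v. u : cball (y s) r ==> v : cball (y s) r ==> norm (X u - X v) <= L * norm (u - v)"
   using Ck_on_local_lipschitz[OF U smooth_onD[OF X] yU] by blast
  have cy: "continuous_on {a..b} y" and cz: "continuous_on {a..b} z" using y z ode_sol_continuous by blast+
  obtain d1 where d1: "d1 > 0" "!!t. t : {a..b} ==> dist t s < d1 ==> dist (y t) (y s) < r / 2"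
   using cy sI r unfolding continuous_on_iff by (meson half_gt_zero)
  show "\<exists>d>0. \<forall>c e. c <= s & s <= e & e - c < d \<longrightarrow> P c e"
  proof (cases "y s = z s")
   case True
   obtain d2 where d2: "d2 > 0" "!!t. t : {a..b} ==> dist t s < d2 ==> dist (z t) (z s) < r / 2"
    using cz sI r unfolding continuous_on_iff by (meson half_gt_zero)
   define d where "d = min (min d1 d2) (1 / (2 * (L + 1)))"
   have d: "d > 0" "d <= d1" "d <= d2" "d <= 1 / (2 * (L + 1))" using d1 d2 L by (auto simp: d_def)
   have dL: "d * L <= 1 / 2"
   proof -
    have "d * L <= 1 / (2 * (L + 1)) * L" using d L by (intro mult_right_mono) auto
    also have "\<dots> <= 1 / 2" using L by (simp add: field_simps)
    finally show ?thesis .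
   qed
   show ?thesis
   proof (intro exI[of _ d] conjI d(1) allI impI)
    fix c e assume ce: "c <= s & s <= e & e - c < d"
    show "P c e"
     unfolding P_def
    proof (intro impI ballI)
     fix t assume h: "a <= c & e <= b & y c = z c" and t: "t : {c..e}"
     have near: "y t : cball (y s) r" "z t : cball (y s) r" if "t : {c..e}" for t
     proof -
      have "t : {a..b}" "dist t s < d1" "dist t s < d2" using that ce h d by (auto simp: dist_real_def)
      then have "dist (y t) (y s) < r / 2" "dist (z t) (z s) < r / 2" using d1(2) d2(2) by blast+
      then show "y t : cball (y s) r" "z t : cball (y s) r" using True r by (auto simp: dist_commute)
     qed
     have "norm (y t - z t) <= 2 * (norm (y c - z c) + d * 0)"
     proof (rule short_time_gronwall[of c e c d t L 0 "%t. y t - z t" "%t. X (y t) - X (z t)"])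
      show "((%t. y t - z t) hvd X (y t) - X (z t)) (at t within {c..e})" if "t : {c..e}" for t
       using ode_sol_subinterval[OF y, of c e] ode_sol_subinterval[OF z, of c e] h that
       by (intro has_vector_derivative_diff) (auto simp: ode_sol_def)
      show "norm (X (y t) - X (z t)) <= L * norm (y t - z t) + 0" if "t : {c..e}" for t
       using lip[OF near[OF that]] by simp
     qed (use t ce L dL in auto)
     then show "y t = z t" using h by simp
    qed
   qed
  next
   case False
   have "continuous_on {a..b} (%t. y t - z t)" using cy cz by (intro continuous_intros)
   moreover have "norm (y s - z s) > 0" using False by simp
   ultimately obtain d where d: "d > 0" "!!t. t : {a..b} ==> dist t s < d ==> dist (y t - z t) (y s - z s) < norm (y s - z s)"
    using sI unfolding continuous_on_iff by metis
   show ?thesis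
   proof (intro exI[of _ d] conjI d(1) allI impI)
    fix c e assume ce: "c <= s & s <= e & e - c < d"
    show "P c e"
     unfolding P_def
    proof (intro impI ballI)
     fix t assume h: "a <= c & e <= b & y c = z c" and t: "t : {c..e}"
     have "dist (y c - z c) (y s - z s) < norm (y s - z s)"
      using d(2)[of c] ce h s by (auto simp: dist_real_def)
     then have False using h by (simp add: dist_norm norm_minus_commute)
     then show "y t = z t" ..
    qed
   qed
  qed
 qed
 then show ?thesis using eq t by (auto simp: P_def)
qed

text \<open>Bisection again: the transport of initial values along a short piece of the solution is
  the local flow, and the transports along adjacent pieces are composed.\<close>

lemma flow_along_solution:
 fixes X :: "'a::euclidean_space => 'a"
 assumes U: "open U" and X: "smooth_on U X" and y: "ode_sol X U a b y" and ab: "a <= b"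
 shows "\<exists>N g. open N & y a : N & smooth_on N g & g (y a) = y b &
  (\<forall>p\<in>N. \<exists>z. ode_sol X U a b z & z a = p & z b = g p)"
proof -
 define P where "P c d \<longleftrightarrow> (a <= c & c <= d & d <= b \<longrightarrow> (\<exists>N g. open N & y c : N & smooth_on N g & g (y c) = y d &
  (\<forall>p\<in>N. \<exists>z. ode_sol X U c d z & z c = p & z d = g p)))" for c d
 have "P a b"
 proof (rule Bolzano)
  show "a <= b" by (rule ab)
 next
  fix c d e assume *: "P c d" "P d e" "c <= d" "d <= e"
  show "P c e"
   unfolding P_def
  proof (intro impI)
   assume h: "a <= c & c <= e & e <= b"
   obtain N1 g1 where 1: "open N1" "y c : N1" "smooth_on N1 g1" "g1 (y c) = y d"
    "!!p. p : N1 ==> \<exists>z. ode_sol X U c d z & z c = p & z d = g1 p"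
    using * h unfolding P_def by (meson order_trans)
   obtain N2 g2 where 2: "open N2" "y d : N2" "smooth_on N2 g2" "g2 (y d) = y e"
    "!!p. p : N2 ==> \<exists>z. ode_sol X U d e z & z d = p & z e = g2 p"
    using * h unfolding P_def by (meson order_trans)
   define N where "N = N1 \<inter> g1 -` N2"
   have N: "open N" unfolding N_def
    using smooth_on_continuous_on[OF 1(3)] 1(1) 2(1) by (simp add: Int_commute continuous_on_open_vimage)
   have "smooth_on N (%p. g2 (g1 p))"
    by (rule smooth_on_compose[OF N 2(1) _ 2(3) smooth_on_subset[OF 1(3)]]) (auto simp: N_def)
   moreover have "\<exists>z. ode_sol X U c e z & z c = p & z e = g2 (g1 p)" if p: "p : N" for p
   proof -
    obtain z1 where z1: "ode_sol X U c d z1" "z1 c = p" "z1 d = g1 p" using 1(5)[of p] p by (auto simp: N_def)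
    obtain z2 where z2: "ode_sol X U d e z2" "z2 d = g1 p" "z2 e = g2 (g1 p)" using 2(5)[of "g1 p"] p by (auto simp: N_def)
    have "ode_sol X U c e (%t. if t <= d then z1 t else z2 t)"
     using ode_sol_join[OF z1(1) z2(1) _ *(3,4)] z1 z2 by simp
    moreover have "(if e <= d then z1 e else z2 e) = g2 (g1 p)"
    proof (cases "e <= d")
     case True
     then have "e = d" using *(4) by simp
     then show ?thesis using z1 z2 by simp
    qed (use z2 in simp)
    ultimately show ?thesis
     by (intro exI[of _ "%t. if t <= d then z1 t else z2 t"]) (use z1 *(3) in auto)
   qed
   ultimately show "\<exists>N g. open N & y c : N & smooth_on N g & g (y c) = y e &
     (\<forall>p\<in>N. \<exists>z. ode_sol X U c e z & z c = p & z e = g p)"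
    using N 1 2 by (intro exI[of _ N] exI[of _ "%p. g2 (g1 p)"]) (auto simp: N_def)
  qed
 next
  fix s assume s: "a <= s" "s <= b"
  then have sI: "s : {a..b}" by auto
  have yU: "y s : U" using y sI by (simp add: ode_sol_def)
  obtain r \<delta> \<psi> where r: "0 < r" and \<delta>: "0 < \<delta>" and \<psi>: "smooth_on (ball (y s) r \<times> {-\<delta><..<\<delta>}) \<psi>"
   and \<psi>0: "!!p. p : ball (y s) r ==> \<psi> (p,0) = p"
   and \<psi>_sol: "!!p t. p : ball (y s) r ==> t : {-\<delta><..<\<delta>} ==> \<psi> (p,t) : U &
    ((%t. \<psi> (p,t)) hvd X (\<psi> (p,t))) (at t)"
   using local_flow[OF U X yU] by blast
  obtain d1 where d1: "d1 > 0" "!!t. t : {a..b} ==> dist t s < d1 ==> dist (y t) (y s) < r"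
   using ode_sol_continuous[OF y] sI r unfolding continuous_on_iff by meson
  show "\<exists>d>0. \<forall>c e. c <= s & s <= e & e - c < d \<longrightarrow> P c e"
  proof (intro exI[of _ "min d1 \<delta>"] conjI allI impI)
   fix c e assume ce: "c <= s & s <= e & e - c < min d1 \<delta>"
   show "P c e"
    unfolding P_def
   proof (intro impI)
    assume h: "a <= c & c <= e & e <= b"
    have yc: "y c : ball (y s) r" using d1(2)[of c] ce h by (auto simp: dist_real_def dist_commute)
    have sol: "ode_sol X U c e (%t. \<psi> (p,t - c))" if p: "p : ball (y s) r" for p
     unfolding ode_sol_def
    proof (intro ballI conjI)
     fix t assume t: "t : {c..e}"
     then have t': "t - c : {-\<delta><..<\<delta>}" using ce by auto
     show "\<psi> (p,t - c) : U" using \<psi>_sol[OF p t'] by blast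
     have "((%t. \<psi> (p,t)) \<circ> (%t. t - c) hvd 1 *R X (\<psi> (p,t - c))) (at t)"
      using \<psi>_sol[OF p t'] by (intro vector_diff_chain_at) (auto intro!: derivative_eq_intros)
     then show "((%t. \<psi> (p,t - c)) hvd X (\<psi> (p,t - c))) (at t within {c..e})"
      by (simp add: o_def has_vector_derivative_at_within)
    qed
    have "\<psi> (y c,e - c) = y e"
     using ode_sol_unique[OF U X sol[OF yc] ode_sol_subinterval[OF y, of c e], of e] h \<psi>0[OF yc] by auto
    moreover have "smooth_on (ball (y s) r) (%p. \<psi> (p,e - c))"
     by (rule smooth_on_compose[OF _ _ _ \<psi>]) (use ce h in \<open>auto intro!: smooth_intros open_Times\<close>)
    ultimately show "\<exists>N g. open N & y c : N & smooth_on N g & g (y c) = y e &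
     (\<forall>p\<in>N. \<exists>z. ode_sol X U c e z & z c = p & z e = g p)"
     using yc sol \<psi>0 by (intro exI[of _ "ball (y s) r"] exI[of _ "%p. \<psi> (p,e - c)"]) force
   qed
  qed (use d1 \<delta> in auto)
 qed
 then show ?thesis using ab by (auto simp: P_def)
qed

definition flow_dom :: "('a::euclidean_space => 'a) => 'a set => 'a set" where
 "flow_dom X U = {p. \<exists>z. ode_sol X U 0 1 z & z 0 = p}"

text \<open>Time one is enough, because in the application the elapsed time is encoded in a constant
  component of the state.\<close>

definition flow_one :: "('a::euclidean_space => 'a) => 'a set => 'a => 'a" where
 "flow_one X U p = (SOME z. ode_sol X U 0 1 z & z 0 = p) 1"

lemma flow_one_eq:
 assumes "open U" "smooth_on U X" "ode_sol X U 0 1 z"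
 shows "flow_one X U (z 0) = z 1"
proof -
 have "ode_sol X U 0 1 (SOME y. ode_sol X U 0 1 y & y 0 = z 0) & (SOME y. ode_sol X U 0 1 y & y 0 = z 0) 0 = z 0"
  by (rule someI[of "%y. ode_sol X U 0 1 y & y 0 = z 0" z]) (use assms in auto)
 then show ?thesis
  unfolding flow_one_def using ode_sol_unique[OF assms(1,2) _ assms(3)] by auto
qed

theorem flow_one_smooth:
 assumes U: "open U" and X: "smooth_on U X"
 shows "open (flow_dom X U)" "smooth_on (flow_dom X U) (flow_one X U)"
proof -
 have *: "\<exists>N. open N & p : N & N <= flow_dom X U & smooth_on N (flow_one X U)" if p: "p : flow_dom X U" for p
 proof -
  obtain y where y: "ode_sol X U 0 1 y" "y 0 = p" using p by (auto simp: flow_dom_def)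
  obtain N g where N: "open N" "p : N" "smooth_on N g" "!!p. p : N ==> \<exists>z. ode_sol X U 0 1 z & z 0 = p & z 1 = g p"
   using flow_along_solution[OF U X y(1)] unfolding y(2) by (metis zero_le_one)
  have "g p = flow_one X U p" if "p : N" for p
   using N(4)[OF that] flow_one_eq[OF U X] by auto
  then have "smooth_on N (flow_one X U)" by (rule smooth_on_cong[OF N(1,3)])
  moreover have "N <= flow_dom X U" using N(4) unfolding flow_dom_def by blast
  ultimately show ?thesis using N(1,2) by blast
 qed
 show op: "open (flow_dom X U)"
  by (subst open_subopen) (use * in blast)
 show "smooth_on (flow_dom X U) (flow_one X U)"
 proof (rule smooth_on_local[OF op])
  fix p assume "p : flow_dom X U"
  from *[OF this] show "\<exists>N. open N & p : N & smooth_on N (flow_one X U)" by blast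
 qed
qed

section \<open>Newton's equations in a chart\<close>

lemma bounded_bilinear_matrix_vector_mult: "bounded_bilinear ((*v) :: real^'n^'m => real^'n => real^'m)"
proof -
 have "bilinear ((*v) :: real^'n^'m => real^'n => real^'m)"
  unfolding bilinear_def
  by (auto intro!: linearI simp: matrix_vector_mult_add_rdistrib matrix_vector_right_distrib
    matrix_vector_mult_scaleR scaleR_matrix_vector_assoc[symmetric])
 then show ?thesis by (simp add: bilinear_conv_bounded_bilinear)
qed

lemma inner_matrix_transpose: "a \<bullet> (transpose J *v w) = (J *v a) \<bullet> (w :: real^'m)" for J :: "real^'n^'m"
 by (simp only: transpose_matrix_vector inner_commute[of a "w v* J"] dot_lmul_matrix inner_commute[of w])

lemma inner_matrix_symmetric: "transpose M = M ==> a \<bullet> (M *v b) = b \<bullet> (M *v a)" for M :: "real^'n^'n"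
 using inner_matrix_transpose[of a M b] by (simp add: inner_commute)

lemma is_chartD:
 assumes "is_chart c"
 shows "open (fst c)" "open (chart_img c)" "p : fst c ==> snd c p : chart_img c"
  "p : fst c ==> chart_inv c (snd c p) = p" "z : chart_img c ==> chart_inv c z : fst c"
  "z : chart_img c ==> snd c (chart_inv c z) = z"
  "continuous_on (fst c) (snd c)" "continuous_on (chart_img c) (chart_inv c)"
 using assms unfolding is_chart_def homeomorphism_def by auto

lemma chart_image_open:
 assumes c: "is_chart c" and P: "open P" "P <= fst c"
 shows "open (snd c ` P)"
proof -
 have "snd c ` P = chart_img c \<inter> chart_inv c -` P"
  using P(2) is_chartD[OF c] by (force simp: image_iff)
 then show ?thesis
  using continuous_open_preimage[OF is_chartD(8)[OF c] is_chartD(2)[OF c] P(1)] by simp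
qed

definition transition :: "('p,'n::finite) chart => ('p,'n) chart => real^'n => real^'n" where
 "transition c c' = snd c' \<circ> chart_inv c"

text \<open>Charts of the maximal atlas are by definition compatible with the given atlas, not with
  each other; near each point the transition map factors through a chart of the atlas.\<close>

lemma transition_smooth:
 fixes S :: "('p::topological_space,'n::finite) mech_system"
 assumes S: "smooth_manifold S" and c: "c : charts S" and c': "c' : charts S"
 shows "smooth_on (snd c ` (fst c \<inter> fst c')) (transition c c')"
proof (rule smooth_on_local)
 have ch: "is_chart c" "is_chart c'" using c c' by (auto simp: charts_def)
 show op: "open (snd c ` (fst c \<inter> fst c'))"
  by (intro chart_image_open[OF ch(1)] open_Int is_chartD(1) ch) auto
 fix z assume "z : snd c ` (fst c \<inter> fst c')"
 then obtain p where p: "p : fst c" "p : fst c'" "z = snd c p" by auto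
 obtain a where a: "a : sys_atlas S" "p : fst a" using S unfolding smooth_manifold_def by blast
 have cha: "is_chart a" using S a by (auto simp: smooth_manifold_def)
 let ?N = "snd c ` (fst c \<inter> fst a \<inter> fst c')" and ?M = "snd a ` (fst c' \<inter> fst a)"
 have N: "open ?N" by (intro chart_image_open[OF ch(1)] open_Int is_chartD(1) ch cha) auto
 have M: "open ?M" by (intro chart_image_open[OF cha] open_Int is_chartD(1) ch cha) auto
 have s1: "smooth_on ?N (snd a \<circ> chart_inv c)"
  using c a(1) by (auto simp: charts_def compatible_def intro: smooth_on_subset)
 have s2: "smooth_on ?M (snd c' \<circ> chart_inv a)"
  using c' a(1) by (auto simp: charts_def compatible_def)
 have "smooth_on ?N (%z. (snd c' \<circ> chart_inv a) ((snd a \<circ> chart_inv c) z))"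
  by (rule smooth_on_compose[OF N M _ s2 s1]) (use is_chartD[OF ch(1)] in auto)
 then have "smooth_on ?N (transition c c')"
  by (rule smooth_on_cong[OF N]) (use is_chartD[OF ch(1)] is_chartD[OF cha] in \<open>auto simp: transition_def\<close>)
 then show "\<exists>N. open N & z : N & smooth_on N (transition c c')"
  using N p a by (intro exI[of _ ?N]) auto
qed

definition metric_at :: "('p,'n::finite) mech_system => ('p,'n) chart => real^'n => real^'n^'n" where
 "metric_at S c = sys_metric S c \<circ> chart_inv c"

definition potential_at :: "('p,'n::finite) mech_system => ('p,'n) chart => real^'n => real" where
 "potential_at S c = sys_potential S \<circ> chart_inv c"

definition force :: "('p,'n::finite) mech_system => ('p,'n) chart => real^'n => real^'n" where
 "force S c z = - gradient (metric_at S c) (potential_at S c) z"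

definition geodesic_term :: "('p,'n::finite) mech_system => ('p,'n) chart => real^'n => real^'n => real^'n" where
 "geodesic_term S c z v = (\<chi> l. \<Sum>i\<in>UNIV. \<Sum>j\<in>UNIV. christoffel (metric_at S c) z l i j * v $ i * v $ j)"

lemma geodesic_term_scaleR: "geodesic_term S c z (r *R v) = r\<^sup>2 *R geodesic_term S c z v"
 by (simp add: geodesic_term_def vec_eq_iff sum_distrib_left power2_eq_square mult_ac)

locale mech_chart =
 fixes S :: "('p::{t2_space,second_countable_topology},'n::finite) mech_system" and c :: "('p,'n) chart"
 assumes mech: "mechanical_system S" and chart: "c : charts S"
begin

abbreviation "Z \<equiv> chart_img c"
abbreviation "K \<equiv> metric_at S c"
abbreviation "V \<equiv> potential_at S c"

lemma is_chart: "is_chart c" using chart by (simp add: charts_def)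

lemmas chartD = is_chartD[OF is_chart]

lemma riem: "riemannian_metric S" and manifold: "smooth_manifold S"
 using mech by (simp_all add: mechanical_system_def)

lemma K_smooth: "smooth_on Z K"
 using riem chart unfolding riemannian_metric_def metric_at_def by blast

lemma K_symmetric: "z : Z ==> transpose (K z) = K z"
 and K_positive: "z : Z ==> v ~= 0 ==> v \<bullet> (K z *v v) > 0"
 using riem chart chartD(5) unfolding riemannian_metric_def metric_at_def o_def by blast+

lemma V_smooth: "smooth_on Z V"
 using mech chart unfolding mechanical_system_def smooth_potential_def potential_at_def by blast

lemma K_det: "z : Z ==> det (K z) ~= 0"
 using K_positive by (intro det_nonzero_of_kernel) fastforce

abbreviation "DK \<equiv> %z. FD K z"
abbreviation "DV \<equiv> %z. FD V z"

lemma partial_K: "z : Z ==> partial i (%y. K y $ j $ m) z = DK z (axis i 1) $ j $ m"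
proof -
 assume z: "z : Z"
 have "((%y. K y $ j $ m) has_derivative (%u. DK z u $ j $ m)) (at z)"
  by (intro bounded_linear.has_derivative[OF bounded_linear_vec_nth] smooth_on_has_derivative[OF K_smooth z])
 then show ?thesis unfolding partial_def by (metis frechet_derivative_at)
qed

lemma axis_expansion: "linear f ==> f v = (\<Sum>i\<in>UNIV. v $ i *R f (axis i 1))" for f :: "real^'n => 'b::real_vector"
proof -
 assume f: "linear f"
 have "f (\<Sum>i\<in>UNIV. v $ i *R axis i 1) = (\<Sum>i\<in>UNIV. v $ i *R f (axis i 1))"
  by (simp only: linear_sum[OF f] linear_scale[OF f])
 moreover have "(\<Sum>i\<in>UNIV. v $ i *R axis i 1) = v"
  using basis_expansion[of v] by (simp add: scalar_mult_eq_scaleR)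
 ultimately show ?thesis by simp
qed

text \<open>Lowering the index cancels the inverse metric in the Christoffel symbols. Of the three
  derivative terms the first two coincide after contraction with v twice, which leaves the
  Euler--Lagrange form of the geodesic equation.\<close>

lemma lowered_geodesic_term:
 assumes z: "z : Z"
 shows "u \<bullet> (K z *v geodesic_term S c z v) = u \<bullet> (DK z v *v v) - v \<bullet> (DK z u *v v) / 2"
proof -
 let ?D = "%i j m. DK z (axis i 1) $ j $ m"
 define B where "B = (\<chi> m. \<Sum>i\<in>UNIV. \<Sum>j\<in>UNIV. (1 / 2) * (?D i j m + ?D j i m - ?D m i j) * v $ i * v $ j)"
 have lin: "linear (DK z)" by (rule smooth_on_linear_derivative[OF K_smooth z])
 have "geodesic_term S c z v = matrix_inv (K z) *v B"
 proof (simp only: vec_eq_iff, intro allI)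
  fix l
  have "geodesic_term S c z v $ l = (\<Sum>i\<in>UNIV. \<Sum>j\<in>UNIV. \<Sum>m\<in>UNIV.
    matrix_inv (K z) $ l $ m * ((1 / 2) * (?D i j m + ?D j i m - ?D m i j) * v $ i * v $ j))"
   by (simp add: geodesic_term_def christoffel_def partial_K[OF z] sum_distrib_left sum_distrib_right mult_ac)
  also have "\<dots> = (\<Sum>i\<in>UNIV. \<Sum>m\<in>UNIV. \<Sum>j\<in>UNIV.
    matrix_inv (K z) $ l $ m * ((1 / 2) * (?D i j m + ?D j i m - ?D m i j) * v $ i * v $ j))"
   by (intro sum.cong refl sum.swap)
  also have "\<dots> = (\<Sum>m\<in>UNIV. \<Sum>i\<in>UNIV. \<Sum>j\<in>UNIV.
    matrix_inv (K z) $ l $ m * ((1 / 2) * (?D i j m + ?D j i m - ?D m i j) * v $ i * v $ j))"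
   by (rule sum.swap)
  finally show "geodesic_term S c z v $ l = (matrix_inv (K z) *v B) $ l"
   by (simp add: B_def matrix_vector_mult_def sum_distrib_left)
 qed
 then have "K z *v geodesic_term S c z v = B"
  by (simp add: matrix_vector_mul_assoc matrix_inv_mult(1)[OF K_det[OF z]])
 moreover have "B $ m = (\<Sum>j\<in>UNIV. DK z v $ j $ m * v $ j) - v \<bullet> (DK z (axis m 1) *v v) / 2" for m
 proof -
  have 1: "DK z v $ j $ m = (\<Sum>i\<in>UNIV. v $ i * ?D i j m)" for j
   by (subst axis_expansion[OF lin]) simp
  have 2: "(\<Sum>i\<in>UNIV. \<Sum>j\<in>UNIV. ?D i j m * v $ i * v $ j) = (\<Sum>j\<in>UNIV. DK z v $ j $ m * v $ j)"
   unfolding 1 sum_distrib_right by (subst sum.swap) (simp add: mult_ac)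
  have 3: "(\<Sum>i\<in>UNIV. \<Sum>j\<in>UNIV. ?D j i m * v $ i * v $ j) = (\<Sum>j\<in>UNIV. DK z v $ j $ m * v $ j)"
   unfolding 1 sum_distrib_right by (simp add: mult_ac)
  have 4: "(\<Sum>i\<in>UNIV. \<Sum>j\<in>UNIV. ?D m i j * v $ i * v $ j) = v \<bullet> (DK z (axis m 1) *v v)"
   by (simp add: inner_vec_def matrix_vector_mult_def sum_distrib_left mult_ac)
  have "B $ m = (1 / 2) * ((\<Sum>i\<in>UNIV. \<Sum>j\<in>UNIV. ?D i j m * v $ i * v $ j) +
    (\<Sum>i\<in>UNIV. \<Sum>j\<in>UNIV. ?D j i m * v $ i * v $ j) - (\<Sum>i\<in>UNIV. \<Sum>j\<in>UNIV. ?D m i j * v $ i * v $ j))"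
  proof -
   have "B $ m = (\<Sum>i\<in>UNIV. \<Sum>j\<in>UNIV. (1 / 2) *
     ((?D i j m * v $ i * v $ j + ?D j i m * v $ i * v $ j) - ?D m i j * v $ i * v $ j))"
    unfolding B_def vec_lambda_beta
    by (intro sum.cong refl) (simp only: mult.assoc distrib_right left_diff_distrib)
   then show ?thesis by (simp only: sum_distrib_left[symmetric] sum.distrib sum_subtractf)
  qed
  also have "\<dots> = (\<Sum>j\<in>UNIV. DK z v $ j $ m * v $ j) - v \<bullet> (DK z (axis m 1) *v v) / 2"
  proof -
   have "(1 / 2) * (a + a - b) = a - b / 2" for a b :: real by simp
   then show ?thesis unfolding 2 3 4 .
  qed
  finally show ?thesis .
 qed
 moreover have "u \<bullet> (DK z v *v v) = (\<Sum>m\<in>UNIV. u $ m * (\<Sum>j\<in>UNIV. DK z v $ j $ m * v $ j))"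
 proof -
  have "transpose (DK z v) = DK z v"
  proof -
   have "((%y. transpose (K y)) has_derivative (%u. transpose (DK z u))) (at z)"
   proof (rule bounded_linear.has_derivative[OF _ smooth_on_has_derivative[OF K_smooth z]])
    show "bounded_linear (transpose :: real^'n^'n => real^'n^'n)"
     by (rule linear_conv_bounded_linear[THEN iffD1]) (auto intro!: linearI simp: transpose_def vec_eq_iff)
   qed
   moreover have "((%y. transpose (K y)) has_derivative DK z) (at z)"
    by (rule has_derivative_transform_within_open[OF smooth_on_has_derivative[OF K_smooth z] chartD(2) z])
     (simp add: K_symmetric)
   ultimately have "(%u. transpose (DK z u)) = DK z" by (rule has_derivative_unique)
   then show ?thesis by metis
  qed
  from arg_cong[OF this, of "%M. M $ j $ m" for j m]
  have "DK z v $ m $ j = DK z v $ j $ m" for m j by (simp add: transpose_def)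
  then show ?thesis by (simp add: inner_vec_def matrix_vector_mult_def)
 qed
 moreover have "v \<bullet> (DK z u *v v) = (\<Sum>m\<in>UNIV. u $ m * (v \<bullet> (DK z (axis m 1) *v v)))"
 proof -
  have "linear (%u. v \<bullet> (DK z u *v v))"
   using lin by (auto intro!: linearI simp: linear_add linear_scale matrix_vector_mult_add_rdistrib
     inner_add_right scaleR_matrix_vector_assoc[symmetric])
  from axis_expansion[OF this, of u] show ?thesis by simp
 qed
 ultimately show ?thesis
  by (simp add: inner_vec_def[of u B] right_diff_distrib sum_subtractf sum_divide_distrib)
qed

lemma lowered_force: "z : Z ==> u \<bullet> (K z *v force S c z) = - DV z u"
proof -
 assume z: "z : Z"
 have "K z *v force S c z = - (\<chi> m. partial m V z)"
  by (simp add: force_def gradient_def linear_neg[OF matrix_vector_mul_linear] matrix_vector_mul_assoc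
    matrix_inv_mult(1)[OF K_det[OF z]])
 moreover have "DV z u = (\<Sum>m\<in>UNIV. u $ m * partial m V z)"
  unfolding partial_def using axis_expansion[OF smooth_on_linear_derivative[OF V_smooth z], of u] by simp
 ultimately show ?thesis by (simp add: inner_vec_def sum_negf)
qed

lemma K_cancel:
 assumes "z : Z" "!!u. u \<bullet> (K z *v w) = 0"
 shows "w = 0"
 using K_positive[OF assms(1), of w] assms(2)[of w] by force

abbreviation "acc z v \<equiv> force S c z - geodesic_term S c z v"

lemma lowered_acceleration:
 assumes "z : Z"
 shows "u \<bullet> (K z *v acc z v) = - DV z u - u \<bullet> (DK z v *v v) + v \<bullet> (DK z u *v v) / 2"
 using lowered_geodesic_term[OF assms, of u v] lowered_force[OF assms, of u]
 by (simp add: matrix_vector_mult_diff_distrib inner_diff_right)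

end

section \<open>Newton's equations under a change of chart\<close>

lemma metric_pullback:
 fixes S :: "('p::{t2_space,second_countable_topology},'n::finite) mech_system"
 assumes S: "mechanical_system S" and c: "c : charts S" and c': "c' : charts S"
  and y: "y : snd c ` (fst c \<inter> fst c')"
 shows "a \<bullet> (metric_at S c y *v b) = FD (transition c c') y a \<bullet>
   (metric_at S c' (transition c c' y) *v FD (transition c c') y b)"
proof -
 interpret c: mech_chart S c by unfold_locales fact+
 interpret c': mech_chart S c' by unfold_locales fact+
 obtain p where p: "p : fst c" "p : fst c'" "y = snd c p" using y by auto
 have ch: "chart_inv c y = p" "chart_inv c' (transition c c' y) = p"
  using p c.chartD c'.chartD by (auto simp: transition_def)
 let ?J = "transition_jacobian c c' p"
 have J: "?J *v u = FD (transition c c') y u" for u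
  unfolding transition_jacobian_def
  using smooth_on_linear_derivative[OF transition_smooth[OF c.manifold c c'] y] p
  by (simp add: matrix_works transition_def)
 have "sys_metric S c p = transpose ?J ** sys_metric S c' p ** ?J"
  using c.riem c c' p unfolding riemannian_metric_def by blast
 then have "a \<bullet> (sys_metric S c p *v b) = (?J *v a) \<bullet> (sys_metric S c' p *v (?J *v b))"
  by (simp only: matrix_vector_mul_assoc[symmetric] inner_matrix_transpose)
 then show ?thesis by (simp add: metric_at_def ch J)
qed

lemma potential_pullback:
 fixes S :: "('p::{t2_space,second_countable_topology},'n::finite) mech_system"
 assumes "c : charts S" "c' : charts S" "y : snd c ` (fst c \<inter> fst c')"
 shows "potential_at S c y = potential_at S c' (transition c c' y)"
proof -
 have ch: "is_chart c" "is_chart c'" using assms by (auto simp: charts_def)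
 obtain p where p: "p : fst c" "p : fst c'" "y = snd c p" using assms(3) by auto
 then show ?thesis using is_chartD(4)[OF ch(1)] is_chartD(4)[OF ch(2)]
  by (simp add: potential_at_def transition_def)
qed

text \<open>Both sides are tested against the vectors \<open>d\<phi> u\<close>: in lowered form Newton's equation is the
 Euler--Lagrange equation, whose left-hand side is a covector, and the terms with second derivatives of
 the transition map \<open>\<phi>\<close> cancel.\<close>
lemma acceleration_transition:
 fixes S :: "('p::{t2_space,second_countable_topology},'n::finite) mech_system"
 assumes S: "mechanical_system S" and c: "c : charts S" and c': "c' : charts S"
  and z: "z : snd c ` (fst c \<inter> fst c')"
 defines "\<phi> \<equiv> transition c c'"
 shows "force S c' (\<phi> z) - geodesic_term S c' (\<phi> z) (FD \<phi> z v) =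
  FD \<phi> z (force S c z - geodesic_term S c z v) +
  FD (%y. FD \<phi> y v) z v"
proof -
 interpret c: mech_chart S c by unfold_locales fact+
 interpret c': mech_chart S c' by unfold_locales fact+
 let ?O = "snd c ` (fst c \<inter> fst c')"
 have O: "open ?O" by (intro chart_image_open[OF c.is_chart] open_Int c.chartD c'.chartD) auto
 have OZ: "y : c.Z" "\<phi> y : c'.Z" if "y : ?O" for y
  using that c.chartD c'.chartD by (auto simp: \<phi>_def transition_def)
 have \<phi>: "smooth_on ?O \<phi>" unfolding \<phi>_def by (rule transition_smooth[OF c.manifold c c'])
 let ?P = "FD \<phi> z"
 let ?H = "%a. FD (%y. FD \<phi> y a) z"
 let ?K' = "c'.K (\<phi> z)"
 let ?D' = "c'.DK (\<phi> z)"
 have P: "linear ?P" by (rule smooth_on_linear_derivative[OF \<phi> z])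
 have H: "?H a b = ?H b a" for a b
  by (rule frechet_derivative_commute[OF O smooth_onD[OF \<phi>] z])
 have dK: "a \<bullet> (c.DK z u *v b) = ?P a \<bullet> (?K' *v ?H b u) + ?P a \<bullet> (?D' (?P u) *v ?P b) + ?H a u \<bullet> (?K' *v ?P b)" for a b u
 proof -
  have K: "(c.K has_derivative c.DK z) (at z)" by (rule smooth_on_has_derivative[OF c.K_smooth OZ(1)[OF z]])
  have dH: "((%y. FD \<phi> y a) has_derivative ?H a) (at z)" for a
   by (rule smooth_on_has_derivative[OF smooth_on_frechet_derivative[OF \<phi>] z])
  have K': "((%y. c'.K (\<phi> y)) has_derivative (%u. ?D' (?P u))) (at z)"
   by (rule has_derivative_compose[OF smooth_on_has_derivative[OF \<phi> z] smooth_on_has_derivative[OF c'.K_smooth OZ(2)[OF z]]])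
  note mv = bounded_bilinear.FDERIV[OF bounded_bilinear_matrix_vector_mult]
  have 1: "((%y. a \<bullet> (c.K y *v b)) has_derivative (%u. a \<bullet> (c.DK z u *v b))) (at z)"
   using has_derivative_inner_right[OF mv[OF K has_derivative_const[of b]], of a] by simp
  have "((%y. FD \<phi> y a \<bullet> (c'.K (\<phi> y) *v FD \<phi> y b)) has_derivative
    (%u. ?P a \<bullet> (?K' *v ?H b u + ?D' (?P u) *v ?P b) + ?H a u \<bullet> (?K' *v ?P b))) (at z)"
   by (rule has_derivative_inner[OF dH mv[OF K' dH]])
  then have "((%y. a \<bullet> (c.K y *v b)) has_derivative
    (%u. ?P a \<bullet> (?K' *v ?H b u + ?D' (?P u) *v ?P b) + ?H a u \<bullet> (?K' *v ?P b))) (at z)"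
   by (rule has_derivative_transform_within_open[OF _ O z])
    (simp add: metric_pullback[OF S c c'] \<phi>_def)
  from has_derivative_unique[OF 1 this] show ?thesis
   by (simp add: fun_eq_iff inner_add_right)
 qed
 have dV: "c.DV z u = c'.DV (\<phi> z) (?P u)" for u
 proof -
  have "((%y. c'.V (\<phi> y)) has_derivative (%u. c'.DV (\<phi> z) (?P u))) (at z)"
   by (rule has_derivative_compose[OF smooth_on_has_derivative[OF \<phi> z] smooth_on_has_derivative[OF c'.V_smooth OZ(2)[OF z]]])
  then have "(c.V has_derivative (%u. c'.DV (\<phi> z) (?P u))) (at z)"
   by (rule has_derivative_transform_within_open[OF _ O z])
    (simp add: potential_pullback[OF c c'] \<phi>_def)
  from has_derivative_unique[OF smooth_on_has_derivative[OF c.V_smooth OZ(1)[OF z]] this] show ?thesis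
   by (simp add: fun_eq_iff)
 qed
 have sym: "a \<bullet> (?K' *v b) = b \<bullet> (?K' *v a)" for a b
  by (rule inner_matrix_symmetric[OF c'.K_symmetric[OF OZ(2)[OF z]]])
 let ?a' = "c'.acc (\<phi> z) (?P v)"
 have pull: "u \<bullet> (c.K z *v b) = ?P u \<bullet> (?K' *v ?P b)" for u b
  unfolding \<phi>_def by (rule metric_pullback[OF S c c' z])
 have test: "?P u \<bullet> (?K' *v (?P (c.acc z v) + ?H v v - ?a')) = 0" for u
 proof -
  have "?P u \<bullet> (?K' *v ?P (c.acc z v)) = - c.DV z u - u \<bullet> (c.DK z v *v v) + v \<bullet> (c.DK z u *v v) / 2"
   using c.lowered_acceleration[OF OZ(1)[OF z], of u v] pull by simp
  also have "\<dots> = - c'.DV (\<phi> z) (?P u) - ?P u \<bullet> (?D' (?P v) *v ?P v) + ?P v \<bullet> (?D' (?P u) *v ?P v) / 2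
    - ?P u \<bullet> (?K' *v ?H v v)"
   unfolding dV dK using H[of u v] sym[of "?P v" "?H v u"] by (simp add: field_simps)
  also have "\<dots> = ?P u \<bullet> (?K' *v ?a') - ?P u \<bullet> (?K' *v ?H v v)"
   using c'.lowered_acceleration[OF OZ(2)[OF z], of "?P u" "?P v"] by simp
  finally show ?thesis
   by (simp add: matrix_vector_mult_diff_distrib matrix_vector_right_distrib inner_diff_right inner_add_right)
 qed
 \<comment> \<open>The metric is the pullback of a positive definite one, so a vector annihilated by
   d\<phi> has length 0. Thus d\<phi> is invertible and the test vectors d\<phi> u exhaust the
   space.\<close>
 have det: "det (matrix ?P) ~= 0"
 proof (rule det_nonzero_of_kernel)
  fix b assume "matrix ?P *v b = 0"
  then have "?P b = 0" using P by (simp add: matrix_works)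
  then have "b \<bullet> (c.K z *v b) = 0" using pull by simp
  then show "b = 0" using c.K_positive[OF OZ(1)[OF z], of b] by force
 qed
 have surj: "?P (matrix_inv (matrix ?P) *v w) = w" for w
 proof -
  have "matrix ?P *v (matrix_inv (matrix ?P) *v w) = w"
   using det by (simp add: matrix_vector_mul_assoc matrix_inv_mult(1))
  moreover have "matrix ?P *v u = ?P u" for u using P by (simp add: matrix_works)
  ultimately show ?thesis by simp
 qed
 have "?P (c.acc z v) + ?H v v - ?a' = 0"
  by (rule c'.K_cancel[OF OZ(2)[OF z]]) (metis test surj)
 then show ?thesis by (simp add: \<phi>_def)
qed

section \<open>Newton solutions as solutions of a first-order system\<close>

context mech_chart
begin

lemma newton_in_chart:
 assumes "newton_solution S J \<gamma>" "t : J" "\<gamma> t : fst c"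
 shows "((%t. snd c (\<gamma> t)) hvd velocity c \<gamma> t) (at t)"
  "(velocity c \<gamma> hvd acc (snd c (\<gamma> t)) (velocity c \<gamma> t)) (at t)"
proof -
 have n: "(snd c \<circ> \<gamma>) differentiable (at t)" "velocity c \<gamma> differentiable (at t)"
  "covariant_acceleration S c \<gamma> t =
     - gradient (sys_metric S c \<circ> chart_inv c) (sys_potential S \<circ> chart_inv c) (snd c (\<gamma> t))"
  using assms chart unfolding newton_solution_def by blast+
 show "((%t. snd c (\<gamma> t)) hvd velocity c \<gamma> t) (at t)"
  using n(1) unfolding velocity_def by (simp add: vector_derivative_works o_def)
 have "vector_derivative (velocity c \<gamma>) (at t) = acc (snd c (\<gamma> t)) (velocity c \<gamma> t)"
  using n(3) unfolding covariant_acceleration_def force_def geodesic_term_def metric_at_def potential_at_def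
  by (simp add: eq_diff_eq)
 then show "(velocity c \<gamma> hvd acc (snd c (\<gamma> t)) (velocity c \<gamma> t)) (at t)"
  using n(2) by (simp add: vector_derivative_works)
qed

text \<open>Newton's equation is demanded in every chart of the maximal atlas, so a solution
  computed in one chart has to be transferred to all others by the transformation rule of the
  acceleration.\<close>

lemma newton_of_chart_solution:
 assumes J: "open J" "is_interval J"
  and zZ: "!!t. t : J ==> z t : Z"
  and z': "!!t. t : J ==> (z hvd v t) (at t)"
  and v': "!!t. t : J ==> (v hvd acc (z t) (v t)) (at t)"
 shows "newton_solution S J (%t. chart_inv c (z t))"
  "!!t. t : J ==> velocity c (%t. chart_inv c (z t)) t = v t"
proof -
 let ?\<gamma> = "%t. chart_inv c (z t)"
 have zc: "continuous_on J z"
  using z' by (meson continuous_at_imp_continuous_on has_vector_derivative_continuous)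
 have \<gamma>c: "continuous_on J ?\<gamma>"
  by (rule continuous_on_compose2[OF chartD(8) zc]) (use zZ in auto)
 have *: "(snd c' \<circ> ?\<gamma>) differentiable (at t) & velocity c' ?\<gamma> differentiable (at t) &
   velocity c' ?\<gamma> t = FD (transition c c') (z t) (v t) &
   vector_derivative (velocity c' ?\<gamma>) (at t) =
    force S c' (snd c' (?\<gamma> t)) - geodesic_term S c' (snd c' (?\<gamma> t)) (velocity c' ?\<gamma> t)"
  if t: "t : J" and c': "c' : charts S" and tc': "?\<gamma> t : fst c'" for t c'
 proof -
  interpret c': mech_chart S c' by unfold_locales (fact mech, fact c')
  let ?O = "snd c ` (fst c \<inter> fst c')"
  have O: "open ?O" by (intro chart_image_open[OF is_chart] open_Int chartD(1) c'.chartD(1)) auto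
  define \<phi> where "\<phi> = transition c c'"
  have \<phi>: "smooth_on ?O \<phi>" unfolding \<phi>_def by (rule transition_smooth[OF manifold chart c'])
  define T where "T = {s : J. ?\<gamma> s : fst c'}"
  have T: "open T"
  proof -
   have "T = J \<inter> ?\<gamma> -` fst c'" by (auto simp: T_def)
   then show ?thesis using continuous_open_preimage[OF \<gamma>c J(1) c'.chartD(1)] by simp
  qed
  have tT: "t : T" using t tc' by (simp add: T_def)
  have zO: "z s : ?O" if "s : T" for s
   using that zZ[of s] chartD(5,6)[of "z s"] by (force simp: T_def image_iff)
  have d1: "(snd c' \<circ> ?\<gamma> hvd FD \<phi> (z s) (v s)) (at s)" if "s : T" for s
  proof -
   have sJ: "s : J" using that by (simp add: T_def)
   have "(\<phi> \<circ> z hvd FD \<phi> (z s) (v s)) (at s)"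
    by (rule vector_derivative_diff_chain_within[OF z'[OF sJ]])
     (rule has_derivative_at_withinI[OF smooth_on_has_derivative[OF \<phi> zO[OF that]]])
   then show ?thesis by (simp add: \<phi>_def transition_def o_def)
  qed
  have vel: "velocity c' ?\<gamma> s = FD \<phi> (z s) (v s)" if "s : T" for s
   unfolding velocity_def by (rule vector_derivative_at[OF d1[OF that]])
  have lin: "linear (FD \<phi> (z s))" if "s : T" for s
   by (rule smooth_on_linear_derivative[OF \<phi> zO[OF that]])
  let ?H = "%a. FD (%y. FD \<phi> y a) (z t)"
  \<comment> \<open>The velocity in the new chart is d\<phi> applied to v with base point and vector
    both moving; in the basis expansion the product rule applies term by term.\<close>
  have 1: "((%s. \<Sum>b\<in>Basis. (v s \<bullet> b) *R FD \<phi> (z s) b) has_vector_derivative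
    (\<Sum>b\<in>Basis. (v t \<bullet> b) *R ?H b (v t) + (acc (z t) (v t) \<bullet> b) *R FD \<phi> (z t) b)) (at t)"
  proof (rule has_vector_derivative_sum)
   fix b :: "real^'n"
   have "((%y. FD \<phi> y b) \<circ> z hvd ?H b (v t)) (at t)"
    by (rule vector_derivative_diff_chain_within[OF z'[OF t]])
     (rule has_derivative_at_withinI[OF smooth_on_has_derivative[OF smooth_on_frechet_derivative[OF \<phi>] zO[OF tT]]])
   moreover have "((%s. v s \<bullet> b) has_real_derivative acc (z t) (v t) \<bullet> b) (at t)"
    using bounded_linear.has_vector_derivative[OF bounded_linear_inner_left v'[OF t], of b]
    by (simp add: has_real_derivative_iff_has_vector_derivative)
   ultimately show "((%s. (v s \<bullet> b) *R FD \<phi> (z s) b) has_vector_derivative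
    (v t \<bullet> b) *R ?H b (v t) + (acc (z t) (v t) \<bullet> b) *R FD \<phi> (z t) b) (at t)"
    by (intro has_vector_derivative_scaleR) (auto simp: o_def)
  qed
  have 2: "(\<Sum>b\<in>Basis. (v t \<bullet> b) *R ?H b (v t) + (acc (z t) (v t) \<bullet> b) *R FD \<phi> (z t) b)
    = ?H (v t) (v t) + FD \<phi> (z t) (acc (z t) (v t))"
  proof -
   have H: "?H b (v t) = ?H (v t) b" for b
    by (rule frechet_derivative_commute[OF O smooth_onD[OF \<phi>] zO[OF tT]])
   have linH: "linear (?H (v t))"
    by (rule smooth_on_linear_derivative[OF smooth_on_frechet_derivative[OF \<phi>] zO[OF tT]])
   have "(\<Sum>b\<in>Basis. (v t \<bullet> b) *R ?H b (v t)) = (\<Sum>b\<in>Basis. (v t \<bullet> b) *R ?H (v t) b)"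
    by (subst H) (rule refl)
   also have "\<dots> = ?H (v t) (v t)" by (rule linear_Basis_expansion[OF linH, symmetric])
   finally have "(\<Sum>b\<in>Basis. (v t \<bullet> b) *R ?H b (v t)) = ?H (v t) (v t)" .
   then show ?thesis
    unfolding sum.distrib linear_Basis_expansion[OF lin[OF tT], of "acc (z t) (v t)", symmetric] by (rule arg_cong)
  qed
  have 3: "(\<Sum>b\<in>Basis. (v s \<bullet> b) *R FD \<phi> (z s) b) = velocity c' ?\<gamma> s" if "s : T" for s
   using linear_Basis_expansion[OF lin[OF that], of "v s"] vel[OF that] by simp
  have "(velocity c' ?\<gamma> has_vector_derivative
    ?H (v t) (v t) + FD \<phi> (z t) (acc (z t) (v t))) (at t)"
   by (rule has_vector_derivative_transform_within_open[OF 1[unfolded 2] T tT 3])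
  moreover have "snd c' (?\<gamma> t) = \<phi> (z t)" by (simp add: \<phi>_def transition_def)
  ultimately show ?thesis
   using acceleration_transition[OF mech chart c' zO[OF tT], of "v t"] vel[OF tT] d1[OF tT]
   by (auto simp: \<phi>_def add.commute vector_derivative_at differentiable_def has_vector_derivative_def)
 qed
 show "newton_solution S J ?\<gamma>"
  unfolding newton_solution_def
 proof (intro conjI ballI impI J \<gamma>c)
  fix t c' assume t: "t : J" "c' : charts S" "?\<gamma> t : fst c'"
  note * = *[OF t]
  show "(snd c' \<circ> ?\<gamma>) differentiable (at t)" "velocity c' ?\<gamma> differentiable (at t)" using * by blast+
  show "covariant_acceleration S c' ?\<gamma> t = - gradient (sys_metric S c' \<circ> chart_inv c') (sys_potential S \<circ> chart_inv c') (snd c' (?\<gamma> t))"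
   using * unfolding covariant_acceleration_def force_def geodesic_term_def metric_at_def potential_at_def by simp
 qed
 show "velocity c ?\<gamma> t = v t" if t: "t : J" for t
 proof -
  have "(snd c \<circ> ?\<gamma> hvd v t) (at t)"
   by (rule has_vector_derivative_transform_within_open[OF z'[OF t] J(1) t]) (use zZ chartD(6) in auto)
  then show ?thesis unfolding velocity_def by (rule vector_derivative_at)
 qed
qed

lemma force_smooth: "smooth_on Z (force S c)"
proof -
 have "smooth_on Z (%z. matrix_inv (K z) *v (\<chi> m. DV z (axis m 1)))"
  by (intro smooth_on_matrix_vector_mult chartD(2) smooth_on_matrix_inv K_smooth K_det smooth_on_vec_lambda
    smooth_on_frechet_derivative V_smooth)
 from smooth_on_minus[OF chartD(2) this] show ?thesis
  by (rule smooth_on_cong[OF chartD(2)]) (simp add: force_def gradient_def partial_def)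
qed

lemma christoffel_smooth: "smooth_on Z (%z. christoffel K z l i j)"
proof -
 have D: "smooth_on Z (%z. DK z (axis i 1) $ j $ m)" for i j m
  by (intro smooth_on_vec_nth chartD(2) smooth_on_frechet_derivative K_smooth)
 have "smooth_on Z (%z. (1 / 2) * (\<Sum>m\<in>UNIV. matrix_inv (K z) $ l $ m *
   (DK z (axis i 1) $ j $ m + DK z (axis j 1) $ i $ m - DK z (axis m 1) $ i $ j)))"
  by (intro smooth_on_mult smooth_on_const smooth_on_sum smooth_on_add smooth_on_diff D chartD(2)
    smooth_on_matrix_inv K_smooth K_det)
 then show ?thesis
  by (rule smooth_on_cong[OF chartD(2)]) (simp add: christoffel_def partial_K)
qed

lemma geodesic_term_smooth: "smooth_on (Z \<times> UNIV) (%(z,v). geodesic_term S c z v)"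
proof -
 have op: "open (Z \<times> (UNIV :: (real^'n) set))" by (intro open_Times chartD(2) open_UNIV)
 have "smooth_on (Z \<times> (UNIV :: (real^'n) set)) (%p. christoffel K (fst p) l i j)" for l i j
  by (rule smooth_on_compose[OF op chartD(2) _ christoffel_smooth]) (auto intro!: smooth_intros op)
 then have "smooth_on (Z \<times> UNIV) (%p. geodesic_term S c (fst p) (snd p))"
  unfolding geodesic_term_def by (intro smooth_intros op)
 then show ?thesis by (simp add: case_prod_unfold)
qed

definition "newton_field = (%(z,v). (v,acc z v))"

lemma newton_field_smooth: "open (Z \<times> (UNIV :: (real^'n) set))" "smooth_on (Z \<times> UNIV) newton_field"
proof -
 show op: "open (Z \<times> (UNIV :: (real^'n) set))" by (intro open_Times chartD(2) open_UNIV)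
 have "smooth_on (Z \<times> (UNIV :: (real^'n) set)) (%p. force S c (fst p))"
  by (rule smooth_on_compose[OF op chartD(2) _ force_smooth]) (auto intro!: smooth_intros op)
 moreover have "smooth_on (Z \<times> UNIV) (%p. geodesic_term S c (fst p) (snd p))"
  using geodesic_term_smooth by (simp add: case_prod_unfold)
 ultimately have "smooth_on (Z \<times> UNIV) (%p. (snd p,acc (fst p) (snd p)))"
  by (intro smooth_on_Pair smooth_on_diff smooth_on_snd smooth_on_ident op)
 then show "smooth_on (Z \<times> UNIV) newton_field" by (simp add: newton_field_def case_prod_unfold)
qed

lemma newton_ode_sol:
 assumes "newton_solution S J \<gamma>" "{a..b} <= J" "\<gamma> ` {a..b} <= fst c"
 shows "ode_sol newton_field (Z \<times> UNIV) a b (%t. (snd c (\<gamma> t),velocity c \<gamma> t))"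
 unfolding ode_sol_def
proof (intro ballI conjI)
 fix t assume t: "t : {a..b}"
 have m: "t : J" "\<gamma> t : fst c" using assms t by auto
 show "(snd c (\<gamma> t),velocity c \<gamma> t) : Z \<times> UNIV" using chartD(3)[OF m(2)] by simp
 show "((%t. (snd c (\<gamma> t),velocity c \<gamma> t)) hvd newton_field (snd c (\<gamma> t),velocity c \<gamma> t)) (at t within {a..b})"
  unfolding newton_field_def prod.case
  by (rule has_vector_derivative_Pair[OF has_vector_derivative_at_within[OF newton_in_chart(1)[OF assms(1) m]]
     has_vector_derivative_at_within[OF newton_in_chart(2)[OF assms(1) m]]])
qed

text \<open>Only the first solution is known to stay in the chart. By bisection, agreement at s
  keeps the second one in the chart near s, where uniqueness for the first-order system applies;
  disagreement at s persists nearby by the Hausdorff property. This gives the definite description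
  in \<open>newton_exp\<close> its meaning.\<close>

lemma newton_chart_unique:
 assumes 1: "newton_solution S J1 \<gamma>1" and 2: "newton_solution S J2 \<gamma>2"
  and J: "{0..T} <= J1" "{0..T} <= J2" and init: "\<gamma>1 0 = \<gamma>2 0" "velocity c \<gamma>1 0 = velocity c \<gamma>2 0"
  and in_c: "\<gamma>1 ` {0..T} <= fst c" and t: "t : {0..T}"
 shows "\<gamma>2 t = \<gamma>1 t & velocity c \<gamma>2 t = velocity c \<gamma>1 t"
proof -
 let ?E = "%t. \<gamma>2 t = \<gamma>1 t & velocity c \<gamma>2 t = velocity c \<gamma>1 t"
 define P where "P a b \<longleftrightarrow> (0 <= a & b <= T & ?E a \<longrightarrow> (\<forall>r\<in>{a..b}. ?E r))" for a b
 have "P 0 T"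
 proof (rule Bolzano)
  show "0 <= T" using t by auto
 next
  fix p q r assume *: "P p q" "P q r" "p <= q" "q <= r"
  show "P p r"
   unfolding P_def
  proof (intro impI ballI)
   fix t assume h: "0 <= p & r <= T & ?E p" "t : {p..r}"
   then have pq: "\<forall>t\<in>{p..q}. ?E t" using * by (auto simp: P_def)
   then have "?E q" using * by auto
   then have "\<forall>t\<in>{q..r}. ?E t" using * h by (auto simp: P_def)
   then show "?E t" using pq h(2) by (cases "t <= q") auto
  qed
 next
  fix s assume s: "0 <= s" "s <= T"
  have sJ: "s : J1" "s : J2" using s J by auto
  have op: "open J1" "open J2" and cont: "continuous_on J1 \<gamma>1" "continuous_on J2 \<gamma>2"
   using 1 2 by (auto simp: newton_solution_def)
  show "\<exists>d>0. \<forall>a b. a <= s & s <= b & b - a < d \<longrightarrow> P a b"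
  proof (cases "\<gamma>2 s = \<gamma>1 s")
   case True
   have "s : J2 \<inter> \<gamma>2 -` fst c" using True in_c s sJ by auto
   then obtain d where d: "d > 0" "ball s d <= J2 \<inter> \<gamma>2 -` fst c"
    using continuous_open_preimage[OF cont(2) op(2) chartD(1)] openE by blast
   show ?thesis
   proof (intro exI[of _ d] conjI d(1) allI impI)
    fix a b assume ab: "a <= s & s <= b & b - a < d"
    show "P a b"
     unfolding P_def
    proof (intro impI ballI)
     fix r assume h: "0 <= a & b <= T & ?E a" and r: "r : {a..b}"
     have sub: "{a..b} <= {0..T}" using h by auto
     have "{a..b} <= ball s d" using ab by (auto simp: dist_real_def)
     then have in2: "\<gamma>2 ` {a..b} <= fst c" using d(2) by blast
     have s2: "ode_sol newton_field (Z \<times> UNIV) a b (%t. (snd c (\<gamma>2 t),velocity c \<gamma>2 t))"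
      by (rule newton_ode_sol[OF 2 _ in2]) (use sub J in auto)
     have s1: "ode_sol newton_field (Z \<times> UNIV) a b (%t. (snd c (\<gamma>1 t),velocity c \<gamma>1 t))"
      by (rule newton_ode_sol[OF 1]) (use sub J in_c in auto)
     have "(snd c (\<gamma>2 r),velocity c \<gamma>2 r) = (snd c (\<gamma>1 r),velocity c \<gamma>1 r)"
      by (rule ode_sol_unique[OF newton_field_smooth s2 s1 _ r]) (use h in auto)
     moreover have "\<gamma>2 r : fst c" "\<gamma>1 r : fst c" using in2 in_c sub r by auto
     ultimately show "?E r" using chartD(4) by (metis Pair_inject)
    qed
   qed
  next
   case False
   then obtain U V where UV: "open U" "open V" "\<gamma>2 s : U" "\<gamma>1 s : V" "U \<inter> V = {}"
    using hausdorff by metis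
   have "open ((J2 \<inter> \<gamma>2 -` U) \<inter> (J1 \<inter> \<gamma>1 -` V))"
    by (intro open_Int continuous_open_preimage cont op UV)
   moreover have "s : (J2 \<inter> \<gamma>2 -` U) \<inter> (J1 \<inter> \<gamma>1 -` V)" using UV sJ by auto
   ultimately obtain d where d: "d > 0" "ball s d <= (J2 \<inter> \<gamma>2 -` U) \<inter> (J1 \<inter> \<gamma>1 -` V)"
    using openE by blast
   show ?thesis
   proof (intro exI[of _ d] conjI d(1) allI impI)
    fix a b assume ab: "a <= s & s <= b & b - a < d"
    then have "a : ball s d" by (auto simp: dist_real_def)
    then have "\<gamma>2 a : U" "\<gamma>1 a : V" using d(2) by blast+
    then have "\<gamma>2 a ~= \<gamma>1 a" using UV(5) by auto
    then show "P a b" by (simp add: P_def)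
   qed
  qed
 qed
 then show ?thesis using t init by (auto simp: P_def)
qed

text \<open>The lowered form of the acceleration, tested with the velocity itself, makes the
  derivative of the energy vanish.\<close>

lemma energy_conserved:
 assumes sol: "ode_sol newton_field (Z \<times> UNIV) a b (%t. (z t,v t))" and t: "s : {a..b}" "t : {a..b}"
 shows "v s \<bullet> (K (z s) *v v s) / 2 + V (z s) = v t \<bullet> (K (z t) *v v t) / 2 + V (z t)"
proof -
 let ?I = "{a..b}"
 have "((%t. v t \<bullet> (K (z t) *v v t) * (1 / 2) + V (z t)) hvd 0) (at t within ?I)" if t: "t : ?I" for t
 proof -
  have zZ: "z t : Z" and d: "((%t. (z t,v t)) hvd (v t,acc (z t) (v t))) (at t within ?I)"
   using sol t unfolding ode_sol_def newton_field_def by auto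
  have z': "(z has_derivative (%h. h *R v t)) (at t within ?I)"
   and v': "(v has_derivative (%h. h *R acc (z t) (v t))) (at t within ?I)"
   using bounded_linear.has_vector_derivative[OF bounded_linear_fst d] bounded_linear.has_vector_derivative[OF bounded_linear_snd d]
   by (simp_all add: has_vector_derivative_def)
  have lin: "linear (DK (z t))" "linear (DV (z t))"
   using smooth_on_linear_derivative[OF K_smooth zZ] smooth_on_linear_derivative[OF V_smooth zZ] .
  have K': "((%t. K (z t)) has_derivative (%h. DK (z t) (h *R v t))) (at t within ?I)"
   by (rule has_derivative_compose[OF z' smooth_on_has_derivative[OF K_smooth zZ]])
  have V': "((%t. V (z t)) has_derivative (%h. DV (z t) (h *R v t))) (at t within ?I)"
   by (rule has_derivative_compose[OF z' smooth_on_has_derivative[OF V_smooth zZ]])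
  note mv = bounded_bilinear.FDERIV[OF bounded_bilinear_matrix_vector_mult K' v']
  have "((%t. v t \<bullet> (K (z t) *v v t) * (1 / 2) + V (z t)) has_derivative
   (%h. (v t \<bullet> (K (z t) *v (h *R acc (z t) (v t)) + DK (z t) (h *R v t) *v v t)
    + h *R acc (z t) (v t) \<bullet> (K (z t) *v v t)) * (1 / 2) + DV (z t) (h *R v t))) (at t within ?I)"
   by (intro has_derivative_add V' has_derivative_mult_left has_derivative_inner[OF v' mv])
  moreover have "(v t \<bullet> (K (z t) *v (h *R acc (z t) (v t)) + DK (z t) (h *R v t) *v v t)
    + h *R acc (z t) (v t) \<bullet> (K (z t) *v v t)) * (1 / 2) + DV (z t) (h *R v t) = 0" for h
  proof -
   have "(v t \<bullet> (K (z t) *v (h *R A) + DK (z t) (h *R v t) *v v t)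
    + h *R A \<bullet> (K (z t) *v v t)) * (1 / 2) + DV (z t) (h *R v t)
    = h * (v t \<bullet> (K (z t) *v A) + v t \<bullet> (DK (z t) (v t) *v v t) / 2 + DV (z t) (v t))" for A
    using inner_matrix_symmetric[OF K_symmetric[OF zZ], of A "v t"]
    by (simp add: linear_scale[OF lin(1)] linear_scale[OF lin(2)] matrix_vector_mult_scaleR
      scaleR_matrix_vector_assoc[symmetric] inner_add_right algebra_simps)
   then have "(v t \<bullet> (K (z t) *v (h *R acc (z t) (v t)) + DK (z t) (h *R v t) *v v t)
    + h *R acc (z t) (v t) \<bullet> (K (z t) *v v t)) * (1 / 2) + DV (z t) (h *R v t)
    = h * (v t \<bullet> (K (z t) *v acc (z t) (v t)) + v t \<bullet> (DK (z t) (v t) *v v t) / 2 + DV (z t) (v t))" .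
   also have "\<dots> = 0"
    unfolding lowered_acceleration[OF zZ] by simp
   finally show ?thesis .
  qed
  ultimately show ?thesis by (simp add: has_vector_derivative_def)
 qed
 from vector_derivative_bound[OF _ this _ t, of 0] show ?thesis by simp
qed

text \<open>Newton solutions live on open intervals, so a solution on a closed interval is continued
  a little at both ends by local solutions.\<close>

lemma ode_sol_extend:
 fixes X :: "'b::euclidean_space => 'b"
 assumes U: "open U" and X: "smooth_on U X" and y: "ode_sol X U a b y" and ab: "a <= b"
 obtains d z where "0 < d" "!!t. t : {a - d<..<b + d} ==> z t : U & (z hvd X (z t)) (at t)"
  "!!t. t : {a..b} ==> z t = y t"
proof -
 have loc: "\<exists>d>0. \<forall>s. \<exists>w. w s = p & (\<forall>t\<in>{s - d..s + d}. w t : U & (w hvd X (w t)) (at t within {s - d..s + d}))"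
  if p: "p : U" for p
 proof -
  obtain r \<delta> \<psi> where r: "0 < r" and \<delta>: "0 < \<delta>"
   and \<psi>0: "!!p'. p' : ball p r ==> \<psi> (p',0) = p'"
   and \<psi>_sol: "!!p' t. p' : ball p r ==> t : {-\<delta><..<\<delta>} ==> \<psi> (p',t) : U &
    ((%t. \<psi> (p',t)) hvd X (\<psi> (p',t))) (at t)"
   using local_flow[OF U X p] by blast
  have pb: "p : ball p r" using r by simp
  show ?thesis
  proof (intro exI[of _ "\<delta> / 2"] conjI allI)
   fix s
   show "\<exists>w. w s = p & (\<forall>t\<in>{s - \<delta> / 2..s + \<delta> / 2}. w t : U & (w hvd X (w t)) (at t within {s - \<delta> / 2..s + \<delta> / 2}))"
   proof (intro exI[of _ "%t. \<psi> (p,t - s)"] conjI ballI)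
    show "\<psi> (p,s - s) = p" using \<psi>0[OF pb] by simp
    fix t assume t: "t : {s - \<delta> / 2..s + \<delta> / 2}"
    have "t - s <= \<delta> / 2" "- (\<delta> / 2) <= t - s" "\<delta> / 2 < \<delta>" using t \<delta> by auto
    then have t': "t - s : {-\<delta><..<\<delta>}" by auto
    show "\<psi> (p,t - s) : U" using \<psi>_sol[OF pb t'] by blast
    have "((%t. \<psi> (p,t)) \<circ> (%t. t - s) hvd 1 *R X (\<psi> (p,t - s))) (at t)"
     using \<psi>_sol[OF pb t'] by (intro vector_diff_chain_at) (auto intro!: derivative_eq_intros)
    then show "((%t. \<psi> (p,t - s)) hvd X (\<psi> (p,t - s))) (at t within {s - \<delta> / 2..s + \<delta> / 2})"
     by (simp add: o_def has_vector_derivative_at_within)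
   qed
  qed (use \<delta> in simp)
 qed
 have yU: "y a : U" "y b : U" using y ab by (auto simp: ode_sol_def)
 obtain d1 where d1: "d1 > 0" "!!s. \<exists>w. w s = y a & (\<forall>t\<in>{s - d1..s + d1}. w t : U & (w hvd X (w t)) (at t within {s - d1..s + d1}))"
  using loc[OF yU(1)] by blast
 obtain d2 where d2: "d2 > 0" "!!s. \<exists>w. w s = y b & (\<forall>t\<in>{s - d2..s + d2}. w t : U & (w hvd X (w t)) (at t within {s - d2..s + d2}))"
  using loc[OF yU(2)] by blast
 obtain w1 where w1: "w1 a = y a" "ode_sol X U (a - d1) (a + d1) w1"
  using d1(2)[of a] unfolding ode_sol_def by blast
 obtain w2 where w2: "w2 b = y b" "ode_sol X U (b - d2) (b + d2) w2"
  using d2(2)[of b] unfolding ode_sol_def by blast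
 have w1': "ode_sol X U (a - d1) a w1" and w2': "ode_sol X U b (b + d2) w2"
  using ode_sol_subinterval[OF w1(2), of "a - d1" a] ode_sol_subinterval[OF w2(2), of b "b + d2"] d1 d2 by auto
 let ?z1 = "%t. if t <= a then w1 t else y t"
 let ?z = "%t. if t <= b then ?z1 t else w2 t"
 have j1: "ode_sol X U (a - d1) b ?z1"
  by (rule ode_sol_join[OF w1' y w1(1)]) (use d1 ab in auto)
 have z1b: "?z1 b = y b" using ab w1(1) by auto
 have j: "ode_sol X U (a - d1) (b + d2) ?z"
  by (rule ode_sol_join[OF j1 w2']) (use z1b w2(1) d1 d2 ab in auto)
 define d where "d = min d1 d2"
 have dd: "d <= d1" "d <= d2" "d > 0" using d1 d2 by (auto simp: d_def)
 show ?thesis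
 proof (rule that[of d ?z])
  show "d > 0" by (rule dd(3))
  fix t assume t: "t : {a - d<..<b + d}"
  then have t': "a - d1 < t" "t < b + d2" using dd by auto
  then have "?z t : U & (?z hvd X (?z t)) (at t within {a - d1..b + d2})"
   using j unfolding ode_sol_def by auto
  then show "?z t : U & (?z hvd X (?z t)) (at t)"
   by (simp only: at_within_Icc_at[OF t'])
 next
  fix t assume "t : {a..b}"
  then show "?z t = y t" using w1(1) by auto
 qed
qed

lemma newton_of_ode_sol:
 assumes sol: "ode_sol newton_field (Z \<times> UNIV) 0 T w" and T: "0 <= T"
 obtains J \<gamma> where "newton_solution S J \<gamma>" "{0..T} <= J"
  "!!t. t : {0..T} ==> \<gamma> t = chart_inv c (fst (w t)) & velocity c \<gamma> t = snd (w t)"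
proof -
 obtain d z where d: "0 < d"
  and z: "!!t. t : {0 - d<..<T + d} ==> z t : Z \<times> UNIV & (z hvd newton_field (z t)) (at t)"
  and zw: "!!t. t : {0..T} ==> z t = w t"
  using ode_sol_extend[OF newton_field_smooth sol T] by blast
 let ?J = "{0 - d<..<T + d}"
 have J: "open ?J" "is_interval ?J" by (auto simp: is_interval_1)
 have 1: "fst (z t) : Z" if "t : ?J" for t using z[OF that] by auto
 have 2: "((%t. fst (z t)) hvd snd (z t)) (at t)" if "t : ?J" for t
  using bounded_linear.has_vector_derivative[OF bounded_linear_fst conjunct2[OF z[OF that]]]
  by (simp add: newton_field_def case_prod_unfold)
 have 3: "((%t. snd (z t)) hvd acc (fst (z t)) (snd (z t))) (at t)" if "t : ?J" for t
  using bounded_linear.has_vector_derivative[OF bounded_linear_snd conjunct2[OF z[OF that]]]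
  by (simp add: newton_field_def case_prod_unfold)
 show ?thesis
 proof (rule that)
  show "newton_solution S ?J (%t. chart_inv c (fst (z t)))"
   by (rule newton_of_chart_solution(1)[OF J 1 2 3])
  show "{0..T} <= ?J" using d by auto
  then show "chart_inv c (fst (z t)) = chart_inv c (fst (w t)) & velocity c (%t. chart_inv c (fst (z t))) t = snd (w t)"
   if "t : {0..T}" for t
   using newton_of_chart_solution(2)[OF J 1 2 3, of t] that zw by auto
 qed
qed

end

lemma has_vector_derivative_rescale:
 fixes g :: "real => 'a::real_normed_vector"
 assumes g: "(g hvd g') (at (r * s) within {0..b})" and r: "0 <= r" "r * a <= b"
 shows "((%s. g (r * s)) hvd r *R g') (at s within {0..a})"
proof -
 have "(*) r ` {0..a} <= {0..b}" using r by (auto intro: order_trans[OF mult_left_mono])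
 then have "(g hvd g') (at (r * s) within (*) r ` {0..a})"
  using g has_vector_derivative_within_subset by blast
 moreover have "((*) r hvd r) (at s within {0..a})"
  by (auto intro!: derivative_eq_intros simp: has_vector_derivative_def)
 ultimately have "(g \<circ> (*) r hvd r *R g') (at s within {0..a})"
  by (intro vector_diff_chain_within)
 then show ?thesis by (simp add: o_def)
qed

section \<open>The rescaled equation near a boundary point\<close>

context mech_chart
begin

text \<open>With \<open>z = x + \<mu> Y\<close> and time measured in units of \<open>sqrt (\<mu> T)\<close>, Newton's equation becomes
 \<open>Y'' = T force - \<mu> geodesic_term\<close>. The parameters are carried along as constant components of the state,
 and \<open>\<mu> = 0\<close>, the limit of uniform gravity, is allowed.\<close>
definition scaled_field ::
 "(real^'n) \<times> (real^'n) \<times> real \<times> (real^'n) \<times> real => (real^'n) \<times> (real^'n) \<times> real \<times> (real^'n) \<times> real" where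
 "scaled_field = (%(Y,P,\<mu>,x,T).
   (P,T *R force S c (x + \<mu> *R Y) - \<mu> *R geodesic_term S c (x + \<mu> *R Y) P,0,0,0))"

definition scaled_dom :: "((real^'n) \<times> (real^'n) \<times> real \<times> (real^'n) \<times> real) set" where
 "scaled_dom = {(Y,P,\<mu>,x,T). x + \<mu> *R Y : Z}"

abbreviation "sol \<equiv> ode_sol scaled_field scaled_dom 0 1"
abbreviation "admissible \<equiv> flow_dom scaled_field scaled_dom"

definition pos :: "(real^'n) \<times> (real^'n) \<times> real \<times> (real^'n) \<times> real => real^'n" where
 "pos p = fst (flow_one scaled_field scaled_dom p)"

lemma scaled_smooth: "open scaled_dom" "smooth_on scaled_dom scaled_field"
proof -
 let ?q = "%p::(real^'n) \<times> (real^'n) \<times> real \<times> (real^'n) \<times> real.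
  fst (snd (snd (snd p))) + fst (snd (snd p)) *R fst p"
 have dom: "scaled_dom = ?q -` Z" by (auto simp: scaled_dom_def)
 have "continuous_on UNIV ?q" by (intro continuous_intros)
 then show op: "open scaled_dom" unfolding dom using chartD(2) open_vimage by blast
 have q: "smooth_on scaled_dom ?q" by (intro smooth_intros op)
 have F: "smooth_on scaled_dom (%p. force S c (?q p))"
  by (rule smooth_on_compose[OF op chartD(2) _ force_smooth q]) (auto simp: dom)
 have "smooth_on scaled_dom (%p. fst (snd p))" by (intro smooth_intros op)
 from smooth_on_compose[OF op open_Times[OF chartD(2) open_UNIV] _ geodesic_term_smooth smooth_on_Pair[OF op q this]]
 have "smooth_on scaled_dom (%p. (%(z,v). geodesic_term S c z v) (?q p,fst (snd p)))"
  by (simp add: dom)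
 then have G: "smooth_on scaled_dom (%p. geodesic_term S c (?q p) (fst (snd p)))" by simp
 have "smooth_on scaled_dom (%p. (fst (snd p),
   snd (snd (snd (snd p))) *R force S c (?q p) - fst (snd (snd p)) *R geodesic_term S c (?q p) (fst (snd p)),
   0::real,0::real^'n,0::real))"
  by (intro smooth_on_Pair smooth_on_fst smooth_on_snd smooth_on_ident smooth_on_const smooth_on_diff
    smooth_on_scaleR F G op)
 then show "smooth_on scaled_dom scaled_field" by (simp add: scaled_field_def case_prod_unfold)
qed

lemma pos_smooth: "open admissible" "smooth_on admissible pos"
 using flow_one_smooth[OF scaled_smooth] unfolding pos_def
 by (auto intro: smooth_on_fst)

lemma pos_eq: "sol w ==> pos (w 0) = fst (w 1)"
 using flow_one_eq[OF scaled_smooth] by (simp add: pos_def)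

lemma solD:
 assumes w: "sol w" and t: "t : {0..1}" and init: "w 0 = (Y0,P0,\<mu>,x,T)"
 shows "snd (snd (w t)) = (\<mu>,x,T)" "x + \<mu> *R fst (w t) : Z"
  "((%t. fst (w t)) hvd fst (snd (w t))) (at t within {0..1})"
  "((%t. fst (snd (w t))) hvd T *R force S c (x + \<mu> *R fst (w t))
   - \<mu> *R geodesic_term S c (x + \<mu> *R fst (w t)) (fst (snd (w t)))) (at t within {0..1})"
proof -
 have d: "(w hvd scaled_field (w t)) (at t within {0..1})" "w t : scaled_dom" if "t : {0..1}" for t
  using w that by (auto simp: ode_sol_def)
 have "((%t. snd (snd (w t))) hvd 0) (at t within {0..1})" if "t : {0..1}" for t
  using bounded_linear.has_vector_derivative[OF bounded_linear_compose[OF bounded_linear_snd bounded_linear_snd] d(1)[OF that]]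
  by (simp add: scaled_field_def case_prod_unfold zero_prod_def)
 from vector_derivative_bound[OF _ this _ t, of 0 0] show c: "snd (snd (w t)) = (\<mu>,x,T)"
  using init by simp
 then obtain Y P where wt: "w t = (Y,P,\<mu>,x,T)" by (metis prod.collapse)
 show "x + \<mu> *R fst (w t) : Z" using d(2)[OF t] by (simp add: wt scaled_dom_def)
 show "((%t. fst (w t)) hvd fst (snd (w t))) (at t within {0..1})"
  using bounded_linear.has_vector_derivative[OF bounded_linear_fst d(1)[OF t]]
  by (simp add: wt scaled_field_def)
 show "((%t. fst (snd (w t))) hvd T *R force S c (x + \<mu> *R fst (w t))
   - \<mu> *R geodesic_term S c (x + \<mu> *R fst (w t)) (fst (snd (w t)))) (at t within {0..1})"
  using bounded_linear.has_vector_derivative[OF bounded_linear_compose[OF bounded_linear_fst bounded_linear_snd] d(1)[OF t]]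
  by (simp add: wt scaled_field_def)
qed

lemma solI:
 assumes "!!t. t : {0..1} ==> x + \<mu> *R Y t : Z"
  and "!!t. t : {0..1} ==> (Y hvd P t) (at t within {0..1})"
  and "!!t. t : {0..1} ==> (P hvd T *R force S c (x + \<mu> *R Y t)
   - \<mu> *R geodesic_term S c (x + \<mu> *R Y t) (P t)) (at t within {0..1})"
 shows "sol (%t. (Y t,P t,\<mu>,x,T))"
 unfolding ode_sol_def
proof (intro ballI conjI)
 fix t :: real assume t: "t : {0..1}"
 show "(Y t,P t,\<mu>,x,T) : scaled_dom" using assms(1)[OF t] by (simp add: scaled_dom_def)
 show "((%t. (Y t,P t,\<mu>,x,T)) hvd scaled_field (Y t,P t,\<mu>,x,T)) (at t within {0..1})"
  unfolding scaled_field_def prod.case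
  by (rule has_vector_derivative_Pair[OF assms(2)[OF t] has_vector_derivative_Pair[OF assms(3)[OF t]
     has_vector_derivative_Pair[OF has_vector_derivative_const has_vector_derivative_Pair[OF
      has_vector_derivative_const has_vector_derivative_const]]]])
qed

text \<open>Slowing time down by \<sigma> multiplies the velocity by \<sigma> and T by \<sigma>^2,
  since the geodesic term is quadratic. The position at time \<sigma> is therefore again a time-one
  position, which turns trajectories into rays of initial data.\<close>

lemma sol_rescale:
 assumes w: "sol w" and init: "w 0 = (Y0,P0,\<mu>,x,T)" and \<sigma>: "\<sigma> : {0..1}"
 shows "sol (%t. (fst (w (\<sigma> * t)),\<sigma> *R fst (snd (w (\<sigma> * t))),\<mu>,x,\<sigma>\<^sup>2 * T))"
  "(Y0,\<sigma> *R P0,\<mu>,x,\<sigma>\<^sup>2 * T) : admissible"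
  "pos (Y0,\<sigma> *R P0,\<mu>,x,\<sigma>\<^sup>2 * T) = fst (w \<sigma>)"
proof -
 have m: "\<sigma> * t : {0..1}" if "t : {0..1}" for t
  using that \<sigma> by (auto simp: mult_le_one)
 let ?w = "%t. (fst (w (\<sigma> * t)),\<sigma> *R fst (snd (w (\<sigma> * t))),\<mu>,x,\<sigma>\<^sup>2 * T)"
 show 1: "sol ?w"
 proof (rule solI)
  fix t :: real assume t: "t : {0..1}"
  note D = solD[OF w m[OF t] init]
  show "x + \<mu> *R fst (w (\<sigma> * t)) : Z" by (rule D(2))
  show "((%t. fst (w (\<sigma> * t))) hvd \<sigma> *R fst (snd (w (\<sigma> * t)))) (at t within {0..1})"
   by (rule has_vector_derivative_rescale[OF D(3)]) (use \<sigma> in auto)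
  have "((%t. fst (snd (w (\<sigma> * t)))) hvd \<sigma> *R (T *R force S c (x + \<mu> *R fst (w (\<sigma> * t)))
    - \<mu> *R geodesic_term S c (x + \<mu> *R fst (w (\<sigma> * t))) (fst (snd (w (\<sigma> * t)))))) (at t within {0..1})"
   by (rule has_vector_derivative_rescale[OF D(4)]) (use \<sigma> in auto)
  from bounded_linear.has_vector_derivative[OF bounded_linear_scaleR_right[of \<sigma>] this]
  show "((%t. \<sigma> *R fst (snd (w (\<sigma> * t)))) hvd (\<sigma>\<^sup>2 * T) *R force S c (x + \<mu> *R fst (w (\<sigma> * t)))
    - \<mu> *R geodesic_term S c (x + \<mu> *R fst (w (\<sigma> * t))) (\<sigma> *R fst (snd (w (\<sigma> * t))))) (at t within {0..1})"
   by (simp add: geodesic_term_scaleR scaleR_diff_right power2_eq_square mult_ac)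
 qed
 have init': "?w 0 = (Y0,\<sigma> *R P0,\<mu>,x,\<sigma>\<^sup>2 * T)" by (simp add: init)
 show "(Y0,\<sigma> *R P0,\<mu>,x,\<sigma>\<^sup>2 * T) : admissible"
  unfolding flow_dom_def using 1 init' by blast
 show "pos (Y0,\<sigma> *R P0,\<mu>,x,\<sigma>\<^sup>2 * T) = fst (w \<sigma>)"
  using pos_eq[OF 1] unfolding init' by simp
qed

lemma admissibleE:
 assumes "(Y0,P0,\<mu>,x,T) : admissible"
 obtains w where "sol w" "w 0 = (Y0,P0,\<mu>,x,T)"
 using assms unfolding flow_dom_def by blast

lemma admissible_ray:
 assumes "(Y0,P0,\<mu>,x,T) : admissible" "\<sigma> : {0..1}"
 shows "(Y0,\<sigma> *R P0,\<mu>,x,\<sigma>\<^sup>2 * T) : admissible"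
 using admissibleE[OF assms(1)] sol_rescale(2)[OF _ _ assms(2)] by metis

lemma pos_in_chart:
 assumes "(Y0,P0,\<mu>,x,T) : admissible"
 shows "x + \<mu> *R pos (Y0,P0,\<mu>,x,T) : Z"
proof -
 obtain w where w: "sol w" "w 0 = (Y0,P0,\<mu>,x,T)" by (rule admissibleE[OF assms])
 show ?thesis using solD(2)[OF w(1) _ w(2), of 1] pos_eq[OF w(1)] w(2) by simp
qed

lemma pos_start:
 assumes "(Y0,P0,\<mu>,x,T) : admissible"
 shows "pos (Y0,0,\<mu>,x,0) = Y0"
proof -
 obtain w where w: "sol w" "w 0 = (Y0,P0,\<mu>,x,T)" by (rule admissibleE[OF assms])
 show ?thesis using sol_rescale(3)[OF w, of 0] w(2) by simp
qed

text \<open>In units \<mu> of length and t of time, the displacement from x and the velocity of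
  \<gamma> solve the scaled equation with T = t^2 / \<mu>.\<close>

lemma scaled_of_newton:
 assumes N: "newton_solution S J \<gamma>" "{0..t} <= J" "\<gamma> ` {0..t} <= fst c" and t: "0 < t" and \<mu>: "0 < \<mu>"
  and q: "x + \<mu> *R Y0 = snd c (\<gamma> 0)"
 shows "(Y0,(t / \<mu>) *R velocity c \<gamma> 0,\<mu>,x,t\<^sup>2 / \<mu>) : admissible"
  "\<tau> : {0..1} ==> snd c (\<gamma> (\<tau> * t)) = x + \<mu> *R pos (Y0,\<tau> *R (t / \<mu>) *R velocity c \<gamma> 0,\<mu>,x,\<tau>\<^sup>2 * (t\<^sup>2 / \<mu>))"
proof -
 let ?Y = "%s. (1 / \<mu>) *R (snd c (\<gamma> (t * s)) - x)" and ?P = "%s. (t / \<mu>) *R velocity c \<gamma> (t * s)"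
 let ?w = "%s. (?Y s,?P s,\<mu>,x,t\<^sup>2 / \<mu>)"
 have Y: "x + \<mu> *R ?Y s = snd c (\<gamma> (t * s))" for s using \<mu> by simp
 have w: "sol ?w"
 proof (rule solI)
  fix s :: real assume s: "s : {0..1}"
  then have ts: "t * s : {0..t}" using t by (auto simp: mult_left_le)
  then have m: "t * s : J" "\<gamma> (t * s) : fst c" using N by auto
  show "x + \<mu> *R ?Y s : Z" unfolding Y by (rule chartD(3)[OF m(2)])
  note d = newton_in_chart[OF N(1) m, THEN has_vector_derivative_at_within[where S = "{0..t}"]]
  have d1: "((%s. snd c (\<gamma> (t * s))) hvd t *R velocity c \<gamma> (t * s)) (at s within {0..1})"
   by (rule has_vector_derivative_rescale[OF d(1)]) (use t in auto)
  have d2: "((%s. velocity c \<gamma> (t * s)) hvd t *R acc (snd c (\<gamma> (t * s))) (velocity c \<gamma> (t * s))) (at s within {0..1})"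
   by (rule has_vector_derivative_rescale[OF d(2)]) (use t in auto)
  have "((%s. snd c (\<gamma> (t * s)) - x) hvd t *R velocity c \<gamma> (t * s)) (at s within {0..1})"
   using has_vector_derivative_diff[OF d1 has_vector_derivative_const[of x]] by simp
  from bounded_linear.has_vector_derivative[OF bounded_linear_scaleR_right[of "1 / \<mu>"] this]
  show "(?Y hvd ?P s) (at s within {0..1})" by simp
  from bounded_linear.has_vector_derivative[OF bounded_linear_scaleR_right[of "t / \<mu>"] d2]
  have "(?P hvd (t / \<mu>) *R t *R acc (snd c (\<gamma> (t * s))) (velocity c \<gamma> (t * s))) (at s within {0..1})" .
  moreover have "(t / \<mu>) *R t *R acc (snd c (\<gamma> (t * s))) (velocity c \<gamma> (t * s)) =
    (t\<^sup>2 / \<mu>) *R force S c (snd c (\<gamma> (t * s))) - \<mu> *R geodesic_term S c (snd c (\<gamma> (t * s))) (?P s)"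
  proof -
   have "\<mu> * (t / \<mu>)\<^sup>2 = t\<^sup>2 / \<mu>" using \<mu> by (simp add: power2_eq_square)
   then show ?thesis
    by (simp add: geodesic_term_scaleR scaleR_diff_right power2_eq_square)
  qed
  ultimately show "(?P hvd (t\<^sup>2 / \<mu>) *R force S c (x + \<mu> *R ?Y s)
    - \<mu> *R geodesic_term S c (x + \<mu> *R ?Y s) (?P s)) (at s within {0..1})"
   unfolding Y by simp
 qed
 have "(1 / \<mu>) *R (snd c (\<gamma> 0) - x) = Y0" using \<mu> by (simp add: q[symmetric])
 then have init: "?w 0 = (Y0,(t / \<mu>) *R velocity c \<gamma> 0,\<mu>,x,t\<^sup>2 / \<mu>)" by simp
 show "(Y0,(t / \<mu>) *R velocity c \<gamma> 0,\<mu>,x,t\<^sup>2 / \<mu>) : admissible"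
  unfolding flow_dom_def using w init by blast
 show "snd c (\<gamma> (\<tau> * t)) = x + \<mu> *R pos (Y0,\<tau> *R (t / \<mu>) *R velocity c \<gamma> 0,\<mu>,x,\<tau>\<^sup>2 * (t\<^sup>2 / \<mu>))"
  if "\<tau> : {0..1}"
  unfolding sol_rescale(3)[OF w init that] using \<mu> by (simp add: mult.commute)
qed

lemma newton_of_scaled:
 assumes adm: "(Y0,P0,\<mu>,x,t\<^sup>2 / \<mu>) : admissible" and t: "0 < t" and \<mu>: "0 < \<mu>"
 obtains J \<gamma> where "newton_solution S J \<gamma>" "{0..t} <= J" "\<gamma> 0 = chart_inv c (x + \<mu> *R Y0)"
  "velocity c \<gamma> 0 = (\<mu> / t) *R P0"
  "!!\<tau>. \<tau> : {0..1} ==> \<gamma> (\<tau> * t) = chart_inv c (x + \<mu> *R pos (Y0,\<tau> *R P0,\<mu>,x,\<tau>\<^sup>2 * (t\<^sup>2 / \<mu>)))"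
proof -
 obtain w where w: "sol w" and init: "w 0 = (Y0,P0,\<mu>,x,t\<^sup>2 / \<mu>)" by (rule admissibleE[OF adm])
 let ?y = "%s. (x + \<mu> *R fst (w (1 / t * s)),(\<mu> / t) *R fst (snd (w (1 / t * s))))"
 have sol': "ode_sol newton_field (Z \<times> UNIV) 0 t ?y"
  unfolding ode_sol_def
 proof (intro ballI conjI)
  fix s assume s: "s : {0..t}"
  have ts: "1 / t * s : {0..1}" using s t by auto
  note D = solD[OF w ts init]
  let ?Y = "fst (w (1 / t * s))" and ?P = "fst (snd (w (1 / t * s)))"
  show "?y s : Z \<times> UNIV" using D(2) by simp
  have d1: "((%s. fst (w (1 / t * s))) hvd (1 / t) *R ?P) (at s within {0..t})"
   by (rule has_vector_derivative_rescale[OF D(3)]) (use t in auto)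
  have d2: "((%s. fst (snd (w (1 / t * s)))) hvd (1 / t) *R ((t\<^sup>2 / \<mu>) *R force S c (x + \<mu> *R ?Y)
   - \<mu> *R geodesic_term S c (x + \<mu> *R ?Y) ?P)) (at s within {0..t})"
   by (rule has_vector_derivative_rescale[OF D(4)]) (use t in auto)
  have "((%s. x + \<mu> *R fst (w (1 / t * s))) hvd \<mu> *R (1 / t) *R ?P) (at s within {0..t})"
   using has_vector_derivative_add[OF has_vector_derivative_const[of x]
     bounded_linear.has_vector_derivative[OF bounded_linear_scaleR_right[of \<mu>] d1]] by simp
  moreover have "((%s. (\<mu> / t) *R fst (snd (w (1 / t * s)))) hvd acc (x + \<mu> *R ?Y) ((\<mu> / t) *R ?P)) (at s within {0..t})"
  proof -
   have "(\<mu> / t) *R (1 / t) *R ((t\<^sup>2 / \<mu>) *R force S c (x + \<mu> *R ?Y)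
     - \<mu> *R geodesic_term S c (x + \<mu> *R ?Y) ?P) = acc (x + \<mu> *R ?Y) ((\<mu> / t) *R ?P)"
    using t \<mu> by (simp add: geodesic_term_scaleR scaleR_diff_right power2_eq_square)
   then show ?thesis
    using bounded_linear.has_vector_derivative[OF bounded_linear_scaleR_right[of "\<mu> / t"] d2] by simp
  qed
  ultimately show "(?y hvd newton_field (?y s)) (at s within {0..t})"
   unfolding newton_field_def prod.case using has_vector_derivative_Pair by fastforce
 qed
 obtain J \<gamma> where \<gamma>: "newton_solution S J \<gamma>" "{0..t} <= J"
  "!!s. s : {0..t} ==> \<gamma> s = chart_inv c (fst (?y s)) & velocity c \<gamma> s = snd (?y s)"
  using newton_of_ode_sol[OF sol'] t by auto
 show ?thesis
 proof (rule that[OF \<gamma>(1,2)])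
  show "\<gamma> 0 = chart_inv c (x + \<mu> *R Y0)" "velocity c \<gamma> 0 = (\<mu> / t) *R P0"
   using \<gamma>(3)[of 0] t init by auto
  fix \<tau> :: real assume \<tau>: "\<tau> : {0..1}"
  then have "\<tau> * t : {0..t}" using t by (auto simp: mult_left_le_one_le)
  from \<gamma>(3)[OF this] show "\<gamma> (\<tau> * t) = chart_inv c (x + \<mu> *R pos (Y0,\<tau> *R P0,\<mu>,x,\<tau>\<^sup>2 * (t\<^sup>2 / \<mu>)))"
   unfolding sol_rescale(3)[OF w init \<tau>] using t by simp
 qed
qed

text \<open>The scaled solution provides one Newton solution that stays in the chart up to time t,
  and uniqueness compares every other candidate in the definite description with it.\<close>

lemma newton_exp_eq:
 assumes adm: "(Y0,(t / \<mu>) *R v,\<mu>,x,t\<^sup>2 / \<mu>) : admissible" and t: "0 < t" and \<mu>: "0 < \<mu>"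
  and q: "q : fst c" "x + \<mu> *R Y0 = snd c q"
 shows "newton_exp S c q (v,t) = chart_inv c (x + \<mu> *R pos (Y0,(t / \<mu>) *R v,\<mu>,x,t\<^sup>2 / \<mu>))"
proof -
 obtain J \<gamma> where \<gamma>: "newton_solution S J \<gamma>" "{0..t} <= J" "\<gamma> 0 = chart_inv c (x + \<mu> *R Y0)"
  "velocity c \<gamma> 0 = (\<mu> / t) *R (t / \<mu>) *R v"
  "!!\<tau>. \<tau> : {0..1} ==> \<gamma> (\<tau> * t) = chart_inv c (x + \<mu> *R pos (Y0,\<tau> *R (t / \<mu>) *R v,\<mu>,x,\<tau>\<^sup>2 * (t\<^sup>2 / \<mu>)))"
  using newton_of_scaled[OF adm t \<mu>] by metis
 have v: "velocity c \<gamma> 0 = v" using \<gamma>(4) t \<mu> by simp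
 have \<gamma>0: "\<gamma> 0 = q" using \<gamma>(3) q chartD(4) by simp
 have \<gamma>t: "\<gamma> t = chart_inv c (x + \<mu> *R pos (Y0,(t / \<mu>) *R v,\<mu>,x,t\<^sup>2 / \<mu>))"
  using \<gamma>(5)[of 1] by simp
 have in_c: "\<gamma> ` {0..t} <= fst c"
 proof
  fix p assume "p : \<gamma> ` {0..t}"
  then obtain s where s: "s : {0..t}" "p = \<gamma> s" by auto
  then have \<tau>: "s / t : {0..1}" "s / t * t = s" using t by auto
  have "x + \<mu> *R pos (Y0,(s / t) *R (t / \<mu>) *R v,\<mu>,x,(s / t)\<^sup>2 * (t\<^sup>2 / \<mu>)) : Z"
   by (rule pos_in_chart[OF admissible_ray[OF adm \<tau>(1)]])
  then show "p : fst c" using \<gamma>(5)[OF \<tau>(1)] \<tau>(2) s(2) chartD(5) by simp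
 qed
 show ?thesis
  unfolding newton_exp_def prod.case
 proof (rule the_equality)
  show "\<exists>J \<gamma>. newton_solution S J \<gamma> & 0 : J & t : J & \<gamma> 0 = q & velocity c \<gamma> 0 = v &
    \<gamma> t = chart_inv c (x + \<mu> *R pos (Y0,(t / \<mu>) *R v,\<mu>,x,t\<^sup>2 / \<mu>))"
   using \<gamma>(1,2) \<gamma>0 v \<gamma>t t by (intro exI[of _ J] exI[of _ \<gamma>]) auto
  fix p assume "\<exists>J \<gamma>. newton_solution S J \<gamma> & 0 : J & t : J & \<gamma> 0 = q & velocity c \<gamma> 0 = v & \<gamma> t = p"
  then obtain J' \<gamma>' where \<gamma>': "newton_solution S J' \<gamma>'" "0 : J'" "t : J'" "\<gamma>' 0 = q" "velocity c \<gamma>' 0 = v" "\<gamma>' t = p"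
   by blast
  have "{0..t} <= J'"
   using \<gamma>'(1,2,3) unfolding newton_solution_def is_interval_1 by (meson atLeastAtMost_iff subsetI)
  then have "\<gamma>' t = \<gamma> t"
   using newton_chart_unique[OF \<gamma>(1) \<gamma>'(1) \<gamma>(2) _ _ _ in_c, of t] \<gamma>' \<gamma>0 v t by simp
  then show "p = chart_inv c (x + \<mu> *R pos (Y0,(t / \<mu>) *R v,\<mu>,x,t\<^sup>2 / \<mu>))"
   using \<gamma>' \<gamma>t by simp
 qed
qed

end

section \<open>Brake orbits in Seifert coordinates\<close>

lemma matrix_vector_axis: "(M *v axis k 1) $ i = M $ i $ k" for M :: "real^'n^'m"
 by (simp add: matrix_vector_mult_basis column_def)

lemma inner_axis_mult: "axis k 1 \<bullet> (M *v axis k 1) = M $ k $ k" for M :: "real^'n^'n"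
 by (simp add: inner_axis' matrix_vector_axis)

lemma x_part_nth: "x_part k z $ i = (if i = k then 0 else z $ i)"
 by (simp add: x_part_def axis_def)

lemma x_part_add_axis: "x $ k = 0 ==> x_part k (x + y *R axis k 1) = x"
 by (simp add: vec_eq_iff x_part_nth axis_def)

lemma axis_decomposition: "x $ k = 0 ==> (x + y *R axis k 1 :: real^'n) $ k = y"
 by (simp add: axis_def)

locale seifert = mech_chart S c
 for S :: "('p::{t2_space,second_countable_topology},'n::finite) mech_system" and c +
 fixes q0 :: 'p and k :: 'n and W :: "(real^'n) set"
 assumes seif: "seifert_chart S q0 k c" and base: "cylinder_base c k W"
begin

abbreviation e :: "real^'n" where "e \<equiv> axis k 1"

definition f :: "real^'n => real" where "f z = hill_fun S (chart_inv c z)"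

lemma f_eq_V: "f z = 2 * (sys_energy S - V z)"
 by (simp add: f_def hill_fun_def potential_at_def)

lemma f_sign: "z : Z ==> 0 <= f z \<longleftrightarrow> 0 <= z $ k" "z : Z ==> f z = 0 \<longleftrightarrow> z $ k = 0"
proof -
 assume z: "z : Z"
 note c = chartD(5,6)[OF z]
 have "fst c \<inter> hill_region S = {p : fst c. snd c p $ k \<ge> 0}" "fst c \<inter> hill_boundary S = {p : fst c. snd c p $ k = 0}"
  using seif by (simp_all add: seifert_chart_def)
 from this[THEN eqset_imp_iff, of "chart_inv c z"] c
 show "0 <= f z \<longleftrightarrow> 0 <= z $ k" "f z = 0 \<longleftrightarrow> z $ k = 0"
  by (auto simp: hill_region_def hill_boundary_def f_def)
qed

lemma jm_components:
 assumes z: "z : Z" "0 <= z $ k"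
 shows "f z * K z $ k $ k = z $ k" "i ~= k ==> f z * K z $ i $ k = 0"
proof -
 have p: "chart_inv c z : fst c \<inter> hill_region S" "snd c (chart_inv c z) = z"
  using f_sign(1)[OF z(1)] z chartD(5,6)[OF z(1)] by (auto simp: hill_region_def f_def)
 obtain g :: "real^'n => real^'n^'n" where "\<forall>p\<in>fst c \<inter> hill_region S.
      jm_metric S c p $ k $ k = snd c p $ k &
      (\<forall>i. i ~= k \<longrightarrow> jm_metric S c p $ i $ k = 0 & jm_metric S c p $ k $ i = 0) &
      (\<forall>i j. i ~= k & j ~= k \<longrightarrow>
       jm_metric S c p $ i $ j = snd c p $ k * g (snd c p) $ i $ j)"
  using seif unfolding seifert_chart_def by blast
 from bspec[OF this p(1)] show "f z * K z $ k $ k = z $ k" "i ~= k ==> f z * K z $ i $ k = 0"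
  by (auto simp: p(2) jm_metric_def f_def metric_at_def)
qed

lemma Kkk_pos: "z : Z ==> 0 < K z $ k $ k"
 using K_positive[of z e] by (simp add: inner_axis_mult)

lemma f_eq: "z : Z ==> 0 <= z $ k ==> f z = z $ k / K z $ k $ k"
 using jm_components(1) Kkk_pos by (simp add: nonzero_eq_divide_eq order_less_imp_not_eq2)

lemma segment_in_chart:
 assumes "z : Z"
 obtains d where "0 < d" "!!t u. norm u <= 1 ==> \<bar>t\<bar> < d ==> z + t *R u : Z"
proof -
 obtain d where d: "0 < d" "ball z d <= Z" using openE[OF chartD(2) assms] by blast
 have "z + t *R u : Z" if "norm u <= 1" "\<bar>t\<bar> < d" for t u
 proof -
  have "norm (t *R u) <= \<bar>t\<bar>" using mult_left_mono[OF that(1), of "\<bar>t\<bar>"] by simp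
  then show ?thesis using d(2) that(2) by (auto simp: dist_norm)
 qed
 then show ?thesis using that d(1) by blast
qed

text \<open>For y > 0 the Jacobi--Maupertuis components can be divided by f. On y = 0 they vanish
  and carry no information, so there the value is obtained by continuity from above.\<close>

lemma K_offdiag:
 assumes z: "z : Z" "0 <= z $ k" and i: "i ~= k"
 shows "K z $ i $ k = 0"
proof (cases "z $ k = 0")
 case False
 then show ?thesis using jm_components(2)[OF z i] f_sign(2)[OF z(1)] by auto
next
 case True
 show ?thesis
 proof (rule ccontr)
  assume ne: "K z $ i $ k ~= 0"
  obtain d where d: "0 < d" "!!t u. norm u <= 1 ==> \<bar>t\<bar> < d ==> z + t *R u : Z"
   using segment_in_chart[OF z(1)] by blast
  have "continuous (at z) (%y. K y $ i $ k)"
   using smooth_on_continuous_on[OF smooth_on_vec_nth[OF chartD(2) smooth_on_vec_nth[OF chartD(2) K_smooth]]]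
    chartD(2) z(1) continuous_on_eq_continuous_at by blast
  then obtain d' where d': "0 < d'" "!!y. dist y z < d' ==> dist (K y $ i $ k) (K z $ i $ k) < \<bar>K z $ i $ k\<bar>"
   using continuous_at_distE[where e = "\<bar>K z $ i $ k\<bar>"] ne by auto
  define t where "t = min d d' / 2"
  have t: "0 < t" "t < d" "t < d'" using d(1) d'(1) by (auto simp: t_def)
  have y: "z + t *R e : Z" "(z + t *R e) $ k = t" using d(2)[of e t] t axis_decomposition[OF True] by auto
  have "K (z + t *R e) $ i $ k = 0"
   using jm_components(2)[OF y(1) _ i] f_sign(2)[OF y(1)] y(2) t(1) by auto
  then show False using d'(2)[of "z + t *R e"] t by (simp add: dist_norm)
 qed
qed

lemma K_axis: "z : Z ==> 0 <= z $ k ==> K z *v e = K z $ k $ k *R e"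
proof (simp only: vec_eq_iff, intro allI)
 fix i assume z: "z : Z" "0 <= z $ k"
 have "(K z $ k $ k *R e) $ i = (if i = k then K z $ k $ k else 0)" by (simp add: axis_def)
 then show "(K z *v e) $ i = (K z $ k $ k *R e) $ i"
  using K_offdiag[OF z, of i] by (simp add: matrix_vector_axis)
qed

lemma line_derivative:
 assumes z: "z : Z"
 shows "((%t. V (z + t *R u)) has_real_derivative DV z u) (at 0)"
proof -
 have "(V has_derivative DV z) (at (z + 0 *R u))" using smooth_on_has_derivative[OF V_smooth z] by simp
 then have "((%t. V (z + t *R u)) has_derivative (%t. DV z (t *R u))) (at 0)"
  by (rule has_derivative_compose[where f = "%t. z + t *R u", rotated]) (auto intro!: derivative_eq_intros)
 then show ?thesis
  using linear_scale[OF smooth_on_linear_derivative[OF V_smooth z]]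
  by (simp add: has_field_derivative_def mult_commute_abs)
qed

text \<open>V is constant on y = 0, so only the vertical derivative remains. It comes from f = y / h
  with h the vertical component of K, an identity that is available for y >= 0 only; therefore the
  derivatives are compared on a one-sided interval.\<close>

lemma DV_boundary:
 assumes z: "z : Z" "z $ k = 0"
 shows "DV z u = - u $ k / (2 * K z $ k $ k)"
proof -
 obtain d where d: "0 < d" "!!t u. norm u <= 1 ==> \<bar>t\<bar> < d ==> z + t *R u : Z"
  using segment_in_chart[OF z(1)] by blast
 have lin: "linear (DV z)" by (rule smooth_on_linear_derivative[OF V_smooth z(1)])
 have i: "DV z (axis i 1) = 0" if "i ~= k" for i
 proof -
  have c: "V (z + t *R axis i 1) = sys_energy S" if "t : {-d<..<d}" for t
  proof -
   have "z + t *R axis i 1 : Z" using d(2)[of "axis i 1" t] that by auto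
   moreover have "(z + t *R axis i 1) $ k = 0" using z(2) \<open>i ~= k\<close> by (simp add: axis_def)
   ultimately show ?thesis using f_sign(2) f_eq_V by fastforce
  qed
  have "((%t. sys_energy S) has_real_derivative DV z (axis i 1)) (at 0)"
   by (rule has_field_derivative_transform_within_open[OF line_derivative[OF z(1)], of "{-d<..<d}"])
    (use c d(1) in auto)
  then show ?thesis using DERIV_unique DERIV_const by blast
 qed
 have k: "DV z e = - 1 / (2 * K z $ k $ k)"
 proof -
  let ?g = "%t. K (z + t *R e) $ k $ k"
  have "((%y. K y $ k $ k) has_derivative (%u. DK z u $ k $ k)) (at (z + 0 *R e))"
   using bounded_linear.has_derivative[OF bounded_linear_vec_nth bounded_linear.has_derivative[OF
      bounded_linear_vec_nth smooth_on_has_derivative[OF K_smooth z(1)]]] by simp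
  then have "((%t. K (z + t *R e) $ k $ k) has_derivative (%t. DK z (t *R e) $ k $ k)) (at 0)"
   by (rule has_derivative_compose[where f = "%t. z + t *R e", rotated]) (auto intro!: derivative_eq_intros)
  then have g': "(?g has_real_derivative DK z e $ k $ k) (at 0)"
   using linear_scale[OF smooth_on_linear_derivative[OF K_smooth z(1)]]
   by (simp add: has_field_derivative_def mult_commute_abs)
  have "?g 0 ~= 0" using Kkk_pos[OF z(1)] by simp
  then have "((%t. sys_energy S - t * inverse (?g t) / 2) has_real_derivative - 1 / (2 * K z $ k $ k)) (at 0)"
   by (auto intro!: derivative_eq_intros g' simp: field_simps)
  then have 1: "((%t. sys_energy S - t * inverse (?g t) / 2) hvd - 1 / (2 * K z $ k $ k)) (at 0 within {0..d/2})"
   by (simp add: has_real_derivative_iff_has_vector_derivative has_vector_derivative_at_within)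
  have 2: "((%t. V (z + t *R e)) hvd DV z e) (at 0 within {0..d/2})"
   using line_derivative[OF z(1), of e] by (simp add: has_real_derivative_iff_has_vector_derivative has_vector_derivative_at_within)
  have "sys_energy S - t * inverse (?g t) / 2 = V (z + t *R e)" if t: "t : {0..d/2}" for t
  proof -
   have "t < d" using t d(1) by auto
   then have y: "z + t *R e : Z" "(z + t *R e) $ k = t" using d(2)[of e t] t axis_decomposition[OF z(2)] by auto
   show ?thesis using f_eq[OF y(1)] f_eq_V[of "z + t *R e"] y(2) t by (simp add: field_simps)
  qed
  then have eq: "V (z + t *R e) = sys_energy S - t * inverse (?g t) / 2" if "t : {0..d/2}" for t using that by simp
  have "(0::real) : {0..d/2}" using d(1) by simp
  from has_vector_derivative_transform[OF this eq 1]
  have "((%t. V (z + t *R e)) hvd - 1 / (2 * K z $ k $ k)) (at 0 within {0..d/2})" by simp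
  from vector_derivative_unique_within_closed_interval[OF _ _ 2[folded cbox_interval] this[folded cbox_interval]] d(1)
  show ?thesis by simp
 qed
 have "DV z u = (\<Sum>i\<in>UNIV. u $ i *R DV z (axis i 1))" by (rule axis_expansion[OF lin])
 also have "\<dots> = (\<Sum>i\<in>UNIV. if i = k then u $ k * DV z e else 0)"
  by (rule sum.cong) (auto simp: i)
 finally show ?thesis by (simp add: k)
qed

text \<open>The gradient of V and the axis e are both orthogonal to the boundary, so the force there
  is vertical. Its size is what turns the limit \<mu> = 0 into vertical free fall with a known
  constant.\<close>

lemma force_boundary:
 assumes z: "z : Z" "z $ k = 0"
 shows "force S c z = (1 / (2 * (K z $ k $ k)\<^sup>2)) *R e"
proof -
 let ?h = "K z $ k $ k"
 have h: "?h > 0" by (rule Kkk_pos[OF z(1)])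
 have "u \<bullet> (K z *v (force S c z - (1 / (2 * ?h\<^sup>2)) *R e)) = 0" for u
 proof -
  have "u \<bullet> (K z *v (force S c z - (1 / (2 * ?h\<^sup>2)) *R e)) = - DV z u - (1 / (2 * ?h\<^sup>2)) * (?h * u $ k)"
   using lowered_force[OF z(1), of u] K_axis[OF z(1)] z(2)
   by (simp add: matrix_vector_mult_diff_distrib matrix_vector_mult_scaleR inner_diff_right inner_axis)
  also have "\<dots> = 0"
   using h by (simp add: DV_boundary[OF z] power2_eq_square field_simps)
  finally show ?thesis .
 qed
 from K_cancel[OF z(1) this] show ?thesis by simp
qed

section \<open>Trajectories issuing from the cylinder, uniformly over its base\<close>

abbreviation "Wc \<equiv> closure W"

lemma Wc: "compact Wc" "Wc <= Z" "x : Wc ==> x $ k = 0" "W <= Wc" "0 : Wc"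
proof -
 have W: "W <= {x. x $ k = 0}" using base by (auto simp: cylinder_base_def dest: openin_imp_subset)
 have "closed {x::real^'n. x $ k = 0}" by (intro closed_Collect_eq continuous_intros)
 then have "Wc <= {x. x $ k = 0}" using W closure_minimal by blast
 then show "x : Wc ==> x $ k = 0" by blast
 show "compact Wc" "Wc <= Z" "W <= Wc" "0 : Wc"
  using base closure_subset[of W] by (auto simp: cylinder_base_def compact_closure)
qed

lemma tube_height: obtains y1 where "0 < y1" "!!x y. x : Wc ==> 0 <= y ==> y <= y1 ==> x + y *R e : Z"
proof -
 obtain d where d: "0 < d" "!!z z'. z : Wc ==> dist z' z < d ==> z' : Z & dist (V z') (V z) < 1"
  using compact_uniform_neighbourhood[OF chartD(2) smooth_on_continuous_on[OF V_smooth] Wc(1,2), of 1] by auto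
 show ?thesis
 proof (rule that[of "d / 2"])
  fix x y assume *: "x : Wc" "0 <= y" "y <= d / 2"
  have "y < d" using *(3) d(1) by simp
  then have "dist (x + y *R e) x < d" using *(2) by (simp add: dist_norm)
  then show "x + y *R e : Z" using d(2)[OF *(1)] by blast
 qed (use d in simp)
qed

text \<open>The Seifert chart provides the orbit only as a curve whose image is the vertical
  segment. Its initial velocity is 0 because the energy condition leaves no kinetic energy on the
  boundary.\<close>

lemma brake_orbit:
 assumes x: "x : Wc" and y1: "0 <= y1" "!!y. 0 <= y ==> y <= y1 ==> x + y *R e : Z"
 obtains J \<gamma> T where "newton_solution S J \<gamma>" "has_energy S J \<gamma>" "0 <= T" "{0..T} <= J" "\<gamma> 0 = chart_inv c x"
  "velocity c \<gamma> 0 = 0" "!!t. t : {0..T} ==> \<gamma> t : fst c & x_part k (snd c (\<gamma> t)) = x & snd c (\<gamma> t) $ k <= y1"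
  "!!y. 0 <= y ==> y <= y1 ==> \<exists>t\<in>{0..T}. \<gamma> t = chart_inv c (x + y *R e)"
proof -
 note xk = Wc(3)[OF x]
 let ?q = "chart_inv c (x + y1 *R e)"
 have z1: "x + y1 *R e : Z" by (rule y1(2)) (use y1 in auto)
 have q: "?q : fst c" "snd c ?q = x + y1 *R e" using chartD(5,6)[OF z1] by auto
 have qk: "snd c ?q $ k = y1" "x_part k (snd c ?q) = x"
  using q axis_decomposition[OF xk] x_part_add_axis[OF xk] by auto
 have "?q : fst c \<inter> hill_region S"
  using q(1) f_sign(1)[OF z1] axis_decomposition[OF xk] y1(1) by (simp add: hill_region_def f_def)
 moreover have "\<forall>s\<in>{0..snd c ?q $ k}. x_part k (snd c ?q) + s *R e : Z" using y1(2) by (simp add: qk)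
 ultimately obtain J \<gamma> T where \<gamma>: "newton_solution S J \<gamma>" "has_energy S J \<gamma>" "0 <= T" "{0..T} <= J"
  "\<gamma> 0 = brake_point c k ?q" "\<gamma> ` {0..T} = vertical_segment c k ?q"
  using seif unfolding seifert_chart_def by blast
 have \<gamma>0: "\<gamma> 0 = chart_inv c x" using \<gamma>(5) by (simp add: brake_point_def qk)
 have xZ: "x : Z" using x Wc(2) by blast
 show ?thesis
 proof (rule that[OF \<gamma>(1-4) \<gamma>0])
  have in_c: "\<gamma> 0 : fst c" using \<gamma>0 chartD(5)[OF xZ] by simp
  have 0: "0 : J" using \<gamma>(3,4) by auto
  have "f x = 0" using f_sign(2)[OF xZ] xk by simp
  moreover have "(1 / 2) * (velocity c \<gamma> 0 \<bullet> (sys_metric S c (\<gamma> 0) *v velocity c \<gamma> 0)) + sys_potential S (\<gamma> 0) = sys_energy S"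
   using \<gamma>(2) 0 chart in_c unfolding has_energy_def by blast
  ultimately have "velocity c \<gamma> 0 \<bullet> (K x *v velocity c \<gamma> 0) = 0"
   using f_eq_V[of x] by (simp add: \<gamma>0 metric_at_def potential_at_def)
  then show "velocity c \<gamma> 0 = 0" using K_positive[OF xZ, of "velocity c \<gamma> 0"] by force
  fix t assume "t : {0..T}"
  then have "\<gamma> t : vertical_segment c k ?q" using \<gamma>(6) by blast
  then show "\<gamma> t : fst c & x_part k (snd c (\<gamma> t)) = x & snd c (\<gamma> t) $ k <= y1" by (simp add: vertical_segment_def qk)
 next
  fix y assume y: "0 <= y" "y <= y1"
  have zy: "x + y *R e : Z" by (rule y1(2)[OF y])
  have "chart_inv c (x + y *R e) : vertical_segment c k ?q"
   using chartD(5,6)[OF zy] y axis_decomposition[OF xk] x_part_add_axis[OF xk] by (simp add: vertical_segment_def qk)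
  then show "\<exists>t\<in>{0..T}. \<gamma> t = chart_inv c (x + y *R e)" using \<gamma>(6) by force
 qed
qed

text \<open>For \<open>q = x + \<mu> s\<^sup>2 e\<close> the vector \<open>w\<close> stands for the initial velocity \<open>v\<close> and the time \<open>t\<close> with
 \<open>t v = \<mu> s w\<close>; the energy condition then fixes \<open>T = t\<^sup>2 / \<mu>\<close>. In contrast to \<open>(v, t)\<close>, this stays
 regular at \<open>t = 0\<close> and when \<open>q\<close> approaches the Hill boundary (\<open>s = 0\<close>).\<close>
definition base_pt :: "real \<times> (real^'n) \<times> real \<times> (real^'n) => real^'n" where
 "base_pt = (%(\<mu>,x,s,w). x + (\<mu> * s\<^sup>2) *R e)"

text \<open>With t v = \<mu> s w the energy condition K(v, v) = \<mu> s^2 / h at q, where h is the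
  vertical component of K, becomes t^2 / \<mu> = h K(w, w). The factor s has cancelled, so the
  formula also makes sense at s = 0.\<close>

definition time_sq :: "real \<times> (real^'n) \<times> real \<times> (real^'n) => real" where
 "time_sq = (%(\<mu>,x,s,w). K (base_pt (\<mu>,x,s,w)) $ k $ k * (w \<bullet> (K (base_pt (\<mu>,x,s,w)) *v w)))"

definition init :: "real \<times> (real^'n) \<times> real \<times> (real^'n) => (real^'n) \<times> (real^'n) \<times> real \<times> (real^'n) \<times> real" where
 "init = (%(\<mu>,x,s,w). (s\<^sup>2 *R e,s *R w,\<mu>,x,time_sq (\<mu>,x,s,w)))"

definition "Om = {p. base_pt p : Z & init p : admissible}"

definition G :: "real \<times> (real^'n) \<times> real \<times> (real^'n) => real^'n" where
 "G p = pos (init p)"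

lemma Om_smooth: "open Om" "smooth_on Om G" "smooth_on Om init"
proof -
 let ?B = "base_pt -` Z"
 have bp: "base_pt p = fst (snd p) + (fst p * (fst (snd (snd p)) * fst (snd (snd p)))) *R e" for p
  by (simp add: base_pt_def case_prod_unfold power2_eq_square)
 have "continuous_on UNIV base_pt" unfolding bp by (intro continuous_intros)
 then have B: "open ?B" using chartD(2) open_vimage by blast
 have sbp: "smooth_on ?B base_pt" unfolding bp by (intro smooth_intros B[unfolded bp])
 have KB: "smooth_on ?B (%p. K (base_pt p))"
  by (rule smooth_on_compose[OF B chartD(2) _ K_smooth sbp]) auto
 have ts: "time_sq p = K (base_pt p) $ k $ k * (snd (snd (snd p)) \<bullet> (K (base_pt p) *v snd (snd (snd p))))" for p
  by (cases p) (simp add: time_sq_def)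
 have w: "smooth_on ?B (%p. snd (snd (snd p)))" and s: "smooth_on ?B (%p. fst (snd (snd p)))"
  and m: "smooth_on ?B (%p. fst p)" and x: "smooth_on ?B (%p. fst (snd p))"
  by (intro smooth_on_fst smooth_on_snd smooth_on_ident B)+
 have sts: "smooth_on ?B time_sq"
  unfolding ts by (intro smooth_on_mult smooth_on_vec_nth smooth_on_inner smooth_on_matrix_vector_mult KB w B)
 have in_eq: "init p = ((fst (snd (snd p)) * fst (snd (snd p))) *R e,fst (snd (snd p)) *R snd (snd (snd p)),
   fst p,fst (snd p),time_sq p)" for p
  by (cases p) (simp add: init_def power2_eq_square)
 have si: "smooth_on ?B init"
  unfolding in_eq by (intro smooth_on_Pair smooth_on_scaleR smooth_on_mult smooth_on_const w s m x sts B)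
 have Om: "Om = ?B \<inter> init -` admissible" by (auto simp: Om_def)
 show op: "open Om" unfolding Om
  by (rule continuous_open_preimage[OF smooth_on_continuous_on[OF si] B pos_smooth(1)])
 show i: "smooth_on Om init" by (rule smooth_on_subset[OF si]) (auto simp: Om)
 show "smooth_on Om G" unfolding G_def
  by (rule smooth_on_compose[OF op pos_smooth(1) _ pos_smooth(2) i]) (auto simp: Om)
qed

text \<open>For \<mu> = 0 the force is evaluated at x throughout and the geodesic term drops out, so
  the trajectory is a parabola, which exists for all s and w.\<close>

lemma Om_zero:
 assumes x: "x : Z"
 shows "(0,x,s,w) : Om"
  "G (0,x,s,w) = s\<^sup>2 *R e + s *R w + ((K x $ k $ k * (w \<bullet> (K x *v w))) / 2) *R force S c x"
proof -
 let ?T = "K x $ k $ k * (w \<bullet> (K x *v w))"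
 let ?Y = "%t. s\<^sup>2 *R e + t *R s *R w + (t\<^sup>2 * (?T / 2)) *R force S c x"
 let ?P = "%t. s *R w + (t * ?T) *R force S c x"
 have sol: "sol (%t. (?Y t,?P t,0,x,?T))"
 proof (rule solI)
  fix t :: real
  show "x + 0 *R ?Y t : Z" using x by simp
  show "(?Y hvd ?P t) (at t within {0..1})"
   unfolding has_vector_derivative_def
   by (auto intro!: derivative_eq_intros simp: scaleR_add_right scaleR_add_left fun_eq_iff algebra_simps)
  show "(?P hvd ?T *R force S c (x + 0 *R ?Y t) - 0 *R geodesic_term S c (x + 0 *R ?Y t) (?P t)) (at t within {0..1})"
   unfolding has_vector_derivative_def
   by (auto intro!: derivative_eq_intros simp: fun_eq_iff algebra_simps)
 qed
 have i: "init (0,x,s,w) = (?Y 0,?P 0,0,x,?T)" by (simp add: init_def time_sq_def base_pt_def)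
 have "init (0,x,s,w) : admissible" unfolding flow_dom_def i using sol by blast
 then show "(0,x,s,w) : Om" using x by (simp add: Om_def base_pt_def)
 show "G (0,x,s,w) = s\<^sup>2 *R e + s *R w + (?T / 2) *R force S c x"
  using pos_eq[OF sol] unfolding G_def i by simp
qed

lemma init_ray: "init (\<mu>,x,s,\<sigma> *R w) = (s\<^sup>2 *R e,\<sigma> *R s *R w,\<mu>,x,\<sigma>\<^sup>2 * time_sq (\<mu>,x,s,w))"
 by (simp add: init_def time_sq_def base_pt_def matrix_vector_mult_scaleR power2_eq_square)

lemma Om_ray:
 assumes "(\<mu>,x,s,w) : Om" "\<sigma> : {0..1}"
 shows "(\<mu>,x,s,\<sigma> *R w) : Om"
proof -
 have "(s\<^sup>2 *R e,s *R w,\<mu>,x,time_sq (\<mu>,x,s,w)) : admissible"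
  using assms(1) by (simp add: Om_def init_def)
 from admissible_ray[OF this assms(2)] show ?thesis
  using assms(1) unfolding Om_def mem_Collect_eq init_ray by (simp add: base_pt_def)
qed

lemma G_start:
 assumes "(\<mu>,x,s,w) : Om"
 shows "(\<mu>,x,s,0) : Om" "G (\<mu>,x,s,0) = s\<^sup>2 *R e"
proof -
 have "init (\<mu>,x,s,w) : admissible" using assms by (simp add: Om_def)
 then show "G (\<mu>,x,s,0) = s\<^sup>2 *R e"
  using pos_start[of "s\<^sup>2 *R e" "s *R w" \<mu> x] by (simp add: G_def init_def time_sq_def)
 show "(\<mu>,x,s,0) : Om" using Om_ray[OF assms, of 0] by simp
qed

text \<open>The slice \<mu> = 0 over the chart belongs to the open set \<open>Om\<close>, so a
  compact part of it has a uniform neighbourhood. The range of s exceeds [-1, 1] to leave room for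
  derivatives at s = 0 and s = 1.\<close>

lemma Om_box:
 obtains \<mu>1 N where "0 < \<mu>1" "open N" "Wc <= N" "{-\<mu>1<..<\<mu>1} \<times> N \<times> {-2<..<2} \<times> ball 0 R <= Om"
proof -
 let ?C = "{0} \<times> Wc \<times> {-2..2::real} \<times> cball (0::real^'n) R"
 have C: "compact ?C" by (intro compact_Times Wc(1) compact_Icc compact_cball) auto
 have CO: "?C <= Om" using Om_zero(1) Wc(2) by auto
 obtain d where d: "0 < d" "!!z z'. z : ?C ==> dist z' z < d ==> z' : Om & dist (G z') (G z) < 1"
  using compact_uniform_neighbourhood[OF Om_smooth(1) smooth_on_continuous_on[OF Om_smooth(2)] C CO, of 1] by auto
 let ?N = "\<Union>x\<in>Wc. ball x (d / 2)"
 show ?thesis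
 proof (rule that[of "d / 2" ?N])
  show "Wc <= ?N" using d(1) by force
  show "{-(d / 2)<..<d / 2} \<times> ?N \<times> {-2<..<2} \<times> ball 0 R <= Om"
  proof
   fix p assume p: "p : {-(d / 2)<..<d / 2} \<times> ?N \<times> {-2<..<2::real} \<times> ball (0::real^'n) R"
   then obtain \<mu> x s w x0 where [simp]: "p = (\<mu>,x,s,w)" and b: "\<bar>\<mu>\<bar> < d / 2" "x0 : Wc" "dist x x0 < d / 2"
    "s : {-2..2}" "w : cball 0 R"
    by (force simp: dist_commute abs_less_iff less_imp_le)
   have "dist (\<mu>,x,s,w) (0,x0,s,w) = norm (\<mu>,x - x0,0::real,0::real^'n)" by (simp add: dist_norm zero_prod_def)
   also have "\<dots> <= norm \<mu> + norm (x - x0,0::real,0::real^'n)" by (rule norm_Pair_le)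
   also have "\<dots> <= \<bar>\<mu>\<bar> + dist x x0" by (simp add: norm_Pair dist_norm zero_prod_def)
   also have "\<dots> < d / 2 + d / 2" by (intro add_strict_mono b)
   finally have "dist p (0,x0,s,w) < d" by simp
   then show "p : Om" using d(2)[of "(0,x0,s,w)" p] b by auto
  qed
 qed (use d(1) in auto)
qed

end

section \<open>Brake orbits in the rescaled picture\<close>

context seifert
begin

lemma time_sq_pos: "base_pt (\<mu>,x,s,w) : Z ==> w ~= 0 ==> 0 < time_sq (\<mu>,x,s,w)"
 by (simp add: time_sq_def Kkk_pos K_positive)

lemma G_in_chart: "(\<mu>,x,s,w) : Om ==> x + \<mu> *R G (\<mu>,x,s,w) : Z"
 unfolding G_def Om_def init_def using pos_in_chart by auto

lemma Om_bounded:
 obtains \<mu>1 C where "0 < \<mu>1" "0 < C"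
  "!!\<mu> x s w. \<bar>\<mu>\<bar> <= \<mu>1 ==> x : Wc ==> \<bar>s\<bar> <= 1 ==> norm w <= R ==> (\<mu>,x,s,w) : Om & norm (G (\<mu>,x,s,w)) < C"
proof -
 obtain \<mu>1 N where *: "0 < \<mu>1" "open N" "Wc <= N" "{-\<mu>1<..<\<mu>1} \<times> N \<times> {-2<..<2} \<times> ball 0 (R + 1) <= Om"
  using Om_box[of "R + 1"] by blast
 let ?C = "{-(\<mu>1 / 2)..\<mu>1 / 2} \<times> Wc \<times> {-1..1::real} \<times> cball (0::real^'n) R"
 have sub: "?C <= Om"
 proof -
  have "?C <= {-\<mu>1<..<\<mu>1} \<times> N \<times> {-2<..<2} \<times> ball 0 (R + 1)"
   using * by (intro Sigma_mono) auto
  then show ?thesis using *(4) by blast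
 qed
 have "compact ?C" by (intro compact_Times Wc(1) compact_Icc compact_cball)
 then have "bounded (G ` ?C)"
  by (intro compact_imp_bounded compact_continuous_image continuous_on_subset[OF smooth_on_continuous_on[OF Om_smooth(2)] sub])
 then obtain C where C: "0 < C" "!!p. p : ?C ==> norm (G p) <= C" unfolding bounded_pos by blast
 show ?thesis
 proof (rule that[of "\<mu>1 / 2" "C + 1"])
  fix \<mu> s :: real and x w :: "real^'n" assume "\<bar>\<mu>\<bar> <= \<mu>1 / 2" "x : Wc" "\<bar>s\<bar> <= 1" "norm w <= R"
  then have p: "(\<mu>,x,s,w) : ?C" by (auto simp: abs_le_iff)
  then show "(\<mu>,x,s,w) : Om & norm (G (\<mu>,x,s,w)) < C + 1" using C(2)[OF p] sub by auto
 qed (use * C in auto)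
qed

text \<open>For s = 0 the initial velocity s w vanishes, so by uniqueness the trajectory is the
  brake orbit over x; w only determines how far it is followed.\<close>

lemma vertical_from_boundary:
 obtains \<mu>2 where "0 < \<mu>2"
  "!!\<mu> x w i. 0 < \<mu> ==> \<mu> <= \<mu>2 ==> x : Wc ==> norm w <= R ==> i ~= k ==>
   (\<mu>,x,0,w) : Om & G (\<mu>,x,0,w) $ i = 0"
proof -
 obtain \<mu>1 C where C: "0 < \<mu>1" "0 < C"
  "!!\<mu> x s w. \<bar>\<mu>\<bar> <= \<mu>1 ==> x : Wc ==> \<bar>s\<bar> <= 1 ==> norm w <= R ==> (\<mu>,x,s,w) : Om & norm (G (\<mu>,x,s,w)) < C"
  using Om_bounded[of R] by blast
 obtain y1 where y1: "0 < y1" "!!x y. x : Wc ==> 0 <= y ==> y <= y1 ==> x + y *R e : Z"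
  using tube_height by blast
 show ?thesis
 proof (rule that[of "min \<mu>1 (y1 / C)"])
  show "0 < min \<mu>1 (y1 / C)" using C y1 by simp
  fix \<mu> :: real and x w :: "real^'n" and i assume \<mu>: "0 < \<mu>" "\<mu> <= min \<mu>1 (y1 / C)" and x: "x : Wc" and w: "norm w <= R" and i: "i ~= k"
  have \<mu>C: "\<mu> * C <= y1" using \<mu> C by (simp add: pos_le_divide_eq)
  have b: "(\<mu>,x,0,\<tau> *R w) : Om & norm (G (\<mu>,x,0,\<tau> *R w)) < C" if "\<tau> : {0..1}" for \<tau>
  proof (rule C(3))
   have "norm (\<tau> *R w) <= norm w" using that by (simp add: mult_left_le_one_le)
   then show "norm (\<tau> *R w) <= R" using w by linarith
  qed (use \<mu> x in auto)
  have Om: "(\<mu>,x,0,w) : Om" using b[of 1] by simp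
  have xZ: "x : Z" and xk: "x $ k = 0" using x Wc by blast+
  show "(\<mu>,x,0,w) : Om & G (\<mu>,x,0,w) $ i = 0"
  proof (cases "w = 0")
   case True
   then show ?thesis using G_start(2)[OF Om] Om by simp
  next
   case False
   let ?T = "time_sq (\<mu>,x,0,w)"
   have T: "0 < ?T" by (rule time_sq_pos) (use False xZ in \<open>auto simp: base_pt_def\<close>)
   define t where "t = sqrt (\<mu> * ?T)"
   have t: "0 < t" "t\<^sup>2 / \<mu> = ?T" using T \<mu> by (auto simp: t_def)
   have adm: "(0,0,\<mu>,x,t\<^sup>2 / \<mu>) : admissible"
    using Om unfolding t(2) by (simp add: Om_def init_def)
   obtain J' \<gamma>' where \<gamma>': "newton_solution S J' \<gamma>'" "{0..t} <= J'" "\<gamma>' 0 = chart_inv c (x + \<mu> *R 0)"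
    "velocity c \<gamma>' 0 = (\<mu> / t) *R 0"
    "!!\<tau>. \<tau> : {0..1} ==> \<gamma>' (\<tau> * t) = chart_inv c (x + \<mu> *R pos (0,\<tau> *R 0,\<mu>,x,\<tau>\<^sup>2 * (t\<^sup>2 / \<mu>)))"
    using newton_of_scaled[OF adm t(1) \<mu>(1)] by metis
   have \<gamma>'G: "\<gamma>' (\<tau> * t) = chart_inv c (x + \<mu> *R G (\<mu>,x,0,\<tau> *R w))" if "\<tau> : {0..1}" for \<tau>
    using \<gamma>'(5)[OF that] unfolding G_def init_ray t(2) by simp
   obtain J \<gamma> Tb where brake: "newton_solution S J \<gamma>" "has_energy S J \<gamma>" "0 <= Tb" "{0..Tb} <= J" "\<gamma> 0 = chart_inv c x"
    "velocity c \<gamma> 0 = 0" "!!t. t : {0..Tb} ==> \<gamma> t : fst c & x_part k (snd c (\<gamma> t)) = x & snd c (\<gamma> t) $ k <= y1"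
    "!!y. 0 <= y ==> y <= y1 ==> \<exists>t\<in>{0..Tb}. \<gamma> t = chart_inv c (x + y *R e)"
    using brake_orbit[OF x less_imp_le[OF y1(1)] y1(2)[OF x]] by blast
   note \<gamma> = brake(1,3-8)
   have agree: "\<gamma>' r = \<gamma> r" if "r : {0..min t Tb}" for r
   proof -
    have "\<gamma> ` {0..min t Tb} <= fst c" "{0..min t Tb} <= J" "{0..min t Tb} <= J'"
     using \<gamma>(3,6) \<gamma>'(2) by auto
    from newton_chart_unique[OF \<gamma>(1) \<gamma>'(1) this(2,3) _ _ this(1) that] show ?thesis
     using \<gamma>(4,5) \<gamma>'(3,4) by simp
   qed
   have at: "snd c (\<gamma> r) = x + \<mu> *R G (\<mu>,x,0,(r / t) *R w)" if r: "r : {0..min t Tb}" for r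
   proof -
    have \<tau>: "r / t : {0..1}" "r / t * t = r" using r t(1) by auto
    have "\<gamma> r = chart_inv c (x + \<mu> *R G (\<mu>,x,0,(r / t) *R w))"
     using agree[OF r] \<gamma>'G[OF \<tau>(1)] \<tau>(2) by simp
    then show ?thesis using chartD(6)[OF G_in_chart] b[OF \<tau>(1)] by simp
   qed
   \<comment> \<open>The brake orbit is known up to height y1 only. If it reached this height before
     time t, so would the rescaled trajectory, whose distance from x is less than \<mu> C <=
     y1.\<close>
   have "t <= Tb"
   proof (rule ccontr)
    assume n: "\<not> t <= Tb"
    obtain r where r: "r : {0..Tb}" "\<gamma> r = chart_inv c (x + y1 *R e)" using \<gamma>(7)[of y1] y1(1) by auto
    have rt: "r : {0..min t Tb}" using r n by auto
    have "x + y1 *R e = x + \<mu> *R G (\<mu>,x,0,(r / t) *R w)"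
     using at[OF rt] r(2) chartD(6)[OF y1(2)[OF x]] y1(1) by simp
    then have "norm (y1 *R e) = norm (\<mu> *R G (\<mu>,x,0,(r / t) *R w))" by simp
    then have "y1 = \<mu> * norm (G (\<mu>,x,0,(r / t) *R w))" using y1(1) \<mu>(1) by simp
    also have "\<dots> < \<mu> * C"
     using b[of "r / t"] rt t(1) \<mu>(1) by (intro mult_strict_left_mono) auto
    finally show False using \<mu>C by simp
   qed
   then have tt: "t : {0..min t Tb}" "t : {0..Tb}" using t(1) by auto
   have "x_part k (x + \<mu> *R G (\<mu>,x,0,w)) $ i = x $ i"
    using at[OF tt(1)] \<gamma>(6)[OF tt(2)] t(1) by simp
   then show ?thesis using i \<mu>(1) Om by (simp add: x_part_nth)
  qed
 qed
qed

text \<open>The acceleration is even in the velocity, so reversing time and velocity together gives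
  a solution again.\<close>

lemma newton_field_reverse:
 assumes sol: "ode_sol newton_field (Z \<times> UNIV) a b (%t. (z t,v t))"
 shows "ode_sol newton_field (Z \<times> UNIV) 0 (b - a) (%t. (z (b - t),- v (b - t)))"
 unfolding ode_sol_def
proof (intro ballI conjI)
 let ?I = "{0..b - a}"
 fix t assume t: "t : ?I"
 then have Tt: "b - t : {a..b}" by auto
 have zZ: "z (b - t) : Z" and d: "((%t. (z t,v t)) hvd (v (b - t),acc (z (b - t)) (v (b - t)))) (at (b - t) within {a..b})"
  using sol Tt unfolding ode_sol_def newton_field_def by auto
 show "(z (b - t),- v (b - t)) : Z \<times> UNIV" using zZ by simp
 have im: "(%t. b - t) ` ?I = {a..b}" by simp
 have r: "((%t. b - t) hvd - 1) (at t within ?I)"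
  unfolding has_vector_derivative_def by (auto intro!: derivative_eq_intros)
 have "((%t. (z t,v t)) \<circ> (%t. b - t) hvd (- 1) *R (v (b - t),acc (z (b - t)) (v (b - t)))) (at t within ?I)"
  by (rule vector_diff_chain_within[OF r]) (use d im in simp)
 from bounded_linear.has_vector_derivative[OF bounded_linear_Pair[OF bounded_linear_fst
    bounded_linear_minus[OF bounded_linear_snd]] this]
 have "((%t. (z (b - t),- v (b - t))) hvd (- v (b - t),acc (z (b - t)) (v (b - t)))) (at t within ?I)"
  by (simp add: o_def)
 moreover have "geodesic_term S c (z (b - t)) (- v (b - t)) = geodesic_term S c (z (b - t)) (v (b - t))"
  using geodesic_term_scaleR[of S c "z (b - t)" "- 1" "v (b - t)"] by simp
 ultimately show "((%t. (z (b - t),- v (b - t))) hvd newton_field (z (b - t),- v (b - t))) (at t within ?I)"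
  unfolding newton_field_def by simp
qed

text \<open>The brake orbit from x up to q is run backwards: it leaves q with a vertical velocity
  and arrives at x, which gives a vertical parameter that ends on the boundary.\<close>

lemma brake_down:
 obtains \<mu>3 where "0 < \<mu>3"
  "!!\<mu> x s. 0 < \<mu> ==> \<mu> <= \<mu>3 ==> x : Wc ==> 0 < s ==> s <= 1 ==>
   \<exists>p. p ~= 0 & (\<mu>,x,s,p *R e) : Om & G (\<mu>,x,s,p *R e) = 0 &
    (\<forall>\<tau>\<in>{0..1}. G (\<mu>,x,s,\<tau> *R p *R e) $ k <= s\<^sup>2 & (\<forall>i. i ~= k \<longrightarrow> G (\<mu>,x,s,\<tau> *R p *R e) $ i = 0))"
proof -
 obtain y1 where y1: "0 < y1" "!!x y. x : Wc ==> 0 <= y ==> y <= y1 ==> x + y *R e : Z"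
  using tube_height by blast
 show ?thesis
 proof (rule that[OF y1(1)])
  fix \<mu> x s assume \<mu>: "0 < \<mu>" "\<mu> <= y1" and x: "x : Wc" and s: "0 < s" "s <= (1::real)"
  have xZ: "x : Z" and xk: "x $ k = 0" using x Wc by blast+
  let ?y = "\<mu> * s\<^sup>2"
  have y: "0 < ?y" "?y <= y1"
  proof -
   have "s\<^sup>2 <= 1" using s by (simp add: power_le_one)
   then have "\<mu> * s\<^sup>2 <= \<mu> * 1" using \<mu> by (intro mult_left_mono) auto
   then show "?y <= y1" using \<mu> by linarith
  qed (use \<mu> s in simp)
  let ?q = "x + ?y *R e"
  have qZ: "?q : Z" by (rule y1(2)[OF x]) (use y in auto)
  have qk: "?q $ k = ?y" by (rule axis_decomposition[OF xk])
  let ?h = "K ?q $ k $ k"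
  have h: "0 < ?h" by (rule Kkk_pos[OF qZ])
  have yZ: "x + y' *R e : Z" if "0 <= y'" "y' <= ?y" for y'
   by (rule y1(2)[OF x that(1)]) (use that y in linarith)
  obtain J \<gamma> Tb where \<gamma>: "newton_solution S J \<gamma>" "has_energy S J \<gamma>" "0 <= Tb" "{0..Tb} <= J" "\<gamma> 0 = chart_inv c x"
   "velocity c \<gamma> 0 = 0" "!!t. t : {0..Tb} ==> \<gamma> t : fst c & x_part k (snd c (\<gamma> t)) = x & snd c (\<gamma> t) $ k <= ?y"
   "!!y. 0 <= y ==> y <= ?y ==> \<exists>t\<in>{0..Tb}. \<gamma> t = chart_inv c (x + y *R e)"
   using brake_orbit[OF x less_imp_le[OF y(1)] yZ] by blast
  obtain t1 where t1: "t1 : {0..Tb}" "\<gamma> t1 = chart_inv c ?q" using \<gamma>(8)[of ?y] y by auto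
  have "t1 ~= 0"
  proof
   assume "t1 = 0"
   then have "chart_inv c ?q = chart_inv c x" using t1(2) \<gamma>(5) by simp
   then have "?q = x" using chartD(6)[OF qZ] chartD(6)[OF xZ] by metis
   then show False using y(1) by auto
  qed
  then have t1p: "0 < t1" using t1(1) by auto
  have sub: "{0..t1} <= {0..Tb}" using t1(1) by auto
  have in_c: "\<gamma> ` {0..t1} <= fst c" and J1: "{0..t1} <= J" using \<gamma>(4,7) sub by auto
  define a where "a = velocity c \<gamma> t1 $ k"
  have vel: "velocity c \<gamma> t1 = a *R e"
  proof (simp only: vec_eq_iff, intro allI)
   fix i
   show "velocity c \<gamma> t1 $ i = (a *R e) $ i"
   proof (cases "i = k")
    case False
    have "t1 : J" "\<gamma> t1 : fst c" using J1 in_c t1p by auto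
    from bounded_linear.has_vector_derivative[OF bounded_linear_vec_nth newton_in_chart(1)[OF \<gamma>(1) this], of i]
    have d1: "((%t. snd c (\<gamma> t) $ i) hvd velocity c \<gamma> t1 $ i) (at t1 within {0..t1})"
     by (rule has_vector_derivative_at_within)
    have const: "snd c (\<gamma> t) $ i = x $ i" if "t : {0..t1}" for t
    proof -
     have "x_part k (snd c (\<gamma> t)) $ i = x $ i" using \<gamma>(7)[of t] that sub by auto
     then show ?thesis using False by (simp add: x_part_nth)
    qed
    have t1m: "t1 : {0..t1}" using t1p by auto
    have d2: "((%t. snd c (\<gamma> t) $ i) hvd 0) (at t1 within {0..t1})"
     by (rule has_vector_derivative_transform[OF t1m const has_vector_derivative_const])
    show ?thesis
     using vector_derivative_unique_within_closed_interval[OF _ _ d1[folded cbox_interval] d2[folded cbox_interval]] t1p False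
     by (simp add: axis_def)
   qed (simp add: a_def axis_def)
  qed
  have energy: "a\<^sup>2 * ?h = \<mu> * s\<^sup>2 / ?h"
  proof -
   have "t1 : J" "\<gamma> t1 : fst c" using J1 in_c t1p by auto
   then have "(1 / 2) * (velocity c \<gamma> t1 \<bullet> (sys_metric S c (\<gamma> t1) *v velocity c \<gamma> t1)) + sys_potential S (\<gamma> t1) = sys_energy S"
    using \<gamma>(2) chart unfolding has_energy_def by blast
   then have "velocity c \<gamma> t1 \<bullet> (K ?q *v velocity c \<gamma> t1) = f ?q"
    using f_eq_V[of ?q] t1(2) by (simp add: metric_at_def potential_at_def)
   moreover have "velocity c \<gamma> t1 \<bullet> (K ?q *v velocity c \<gamma> t1) = a\<^sup>2 * ?h"
    unfolding vel by (simp add: matrix_vector_mult_scaleR inner_axis_mult power2_eq_square)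
   moreover have "f ?q = ?y / ?h" using f_eq[OF qZ] qk y(1) by simp
   ultimately show ?thesis by simp
  qed
  have fwd: "ode_sol newton_field (Z \<times> UNIV) 0 t1 (%t. (snd c (\<gamma> t),velocity c \<gamma> t))"
   by (rule newton_ode_sol[OF \<gamma>(1) J1 in_c])
  from newton_of_ode_sol[OF newton_field_reverse[OF fwd, unfolded diff_zero] less_imp_le[OF t1p]]
  obtain J' \<sigma> where \<sigma>: "newton_solution S J' \<sigma>" "{0..t1} <= J'"
   "!!t. t : {0..t1} ==> \<sigma> t = chart_inv c (snd c (\<gamma> (t1 - t))) & velocity c \<sigma> t = - velocity c \<gamma> (t1 - t)"
   by (metis fst_conv snd_conv)
  have \<sigma>\<gamma>: "\<sigma> t = \<gamma> (t1 - t)" if "t : {0..t1}" for t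
  proof -
   have "\<gamma> (t1 - t) : fst c" using in_c that by auto
   then show ?thesis using \<sigma>(3)[OF that] chartD(4) by simp
  qed
  have \<sigma>c: "\<sigma> ` {0..t1} <= fst c" using \<sigma>\<gamma> in_c by force
  have \<sigma>0: "velocity c \<sigma> 0 = - (a *R e)" "\<sigma> 0 = chart_inv c ?q"
   using \<sigma>(3)[of 0] \<sigma>\<gamma>[of 0] t1p vel t1(2) by auto
  \<comment> \<open>From t v = \<mu> s w with t = t1 and v = -a e, the initial velocity of the
    reversed orbit.\<close>
  define p where "p = - (t1 * a / (\<mu> * s))"
  have "a ~= 0" using energy h \<mu> s by auto
  then have p0: "p ~= 0" using t1p \<mu> s by (simp add: p_def)
  have start: "x + \<mu> *R (s\<^sup>2 *R e) = snd c (\<sigma> 0)" using \<sigma>0(2) chartD(6)[OF qZ] by simp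
  note sc = scaled_of_newton[OF \<sigma>(1,2) \<sigma>c t1p \<mu>(1) start]
  have P0: "(t1 / \<mu>) *R velocity c \<sigma> 0 = s *R p *R e"
   using s \<mu> by (simp add: \<sigma>0 p_def)
  have bp: "base_pt (\<mu>,x,s,p *R e) = ?q" by (simp add: base_pt_def)
  have T: "time_sq (\<mu>,x,s,p *R e) = t1\<^sup>2 / \<mu>"
  proof -
   have "time_sq (\<mu>,x,s,p *R e) = ?h * (p * (p * ?h))"
    unfolding time_sq_def prod.case bp by (simp add: matrix_vector_mult_scaleR inner_axis_mult)
   also have "\<dots> = (t1 / (\<mu> * s))\<^sup>2 * ?h * (a\<^sup>2 * ?h)" by (simp add: p_def power2_eq_square)
   also have "\<dots> = (t1 / (\<mu> * s))\<^sup>2 * (\<mu> * s\<^sup>2)" unfolding energy using h by simp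
   also have "\<dots> = t1\<^sup>2 / \<mu>" using \<mu> s by (simp add: power2_eq_square)
   finally show ?thesis .
  qed
  have in_eq: "init (\<mu>,x,s,\<tau> *R p *R e) = (s\<^sup>2 *R e,\<tau> *R (t1 / \<mu>) *R velocity c \<sigma> 0,\<mu>,x,\<tau>\<^sup>2 * (t1\<^sup>2 / \<mu>))" for \<tau>
   unfolding init_ray T P0 ..
  have adm: "init (\<mu>,x,s,p *R e) : admissible" using sc(1) in_eq[of 1] by simp
  have G: "snd c (\<gamma> (t1 - \<tau> * t1)) = x + \<mu> *R G (\<mu>,x,s,\<tau> *R p *R e)" if "\<tau> : {0..1}" for \<tau>
  proof -
   have "\<tau> * t1 : {0..t1}" using that t1p by (auto simp: mult_left_le_one_le)
   then show ?thesis using sc(2)[OF that] \<sigma>\<gamma> unfolding G_def in_eq by simp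
  qed
  show "\<exists>p. p ~= 0 & (\<mu>,x,s,p *R e) : Om & G (\<mu>,x,s,p *R e) = 0 &
    (\<forall>\<tau>\<in>{0..1}. G (\<mu>,x,s,\<tau> *R p *R e) $ k <= s\<^sup>2 & (\<forall>i. i ~= k \<longrightarrow> G (\<mu>,x,s,\<tau> *R p *R e) $ i = 0))"
  proof (intro exI[of _ p] conjI ballI allI impI p0)
   show "(\<mu>,x,s,p *R e) : Om" unfolding Om_def using adm bp qZ by simp
   have "x + \<mu> *R G (\<mu>,x,s,p *R e) = x" using G[of 1] \<gamma>(5) chartD(6)[OF xZ] by simp
   then show "G (\<mu>,x,s,p *R e) = 0" using \<mu> by simp
   fix \<tau> i assume \<tau>: "\<tau> : {0..1::real}"
   have t: "t1 - \<tau> * t1 : {0..Tb}"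
    using \<tau> t1p t1(1) by (auto simp: mult_left_le_one_le intro: order_trans[OF _ t1(1)[THEN atLeastAtMost_iff[THEN iffD1], THEN conjunct2]])
   have "snd c (\<gamma> (t1 - \<tau> * t1)) $ k <= ?y" using \<gamma>(7)[OF t] by blast
   then show "G (\<mu>,x,s,\<tau> *R p *R e) $ k <= s\<^sup>2" using xk \<mu> unfolding G[OF \<tau>] by simp
   assume i: "i ~= k"
   have "x_part k (x + \<mu> *R G (\<mu>,x,s,\<tau> *R p *R e)) $ i = x $ i" using \<gamma>(7)[OF t] G[OF \<tau>] by metis
   then show "G (\<mu>,x,s,\<tau> *R p *R e) $ i = 0" using i \<mu> by (simp add: x_part_nth)
  qed
 qed
qed

text \<open>The flow carries the initial variation \<open>(Y', P')(0)\<close> of the time-shifted brake orbit, which is a multiple of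
 \<open>(0, e)\<close>, to the vertical velocity \<open>Y'(1)\<close>.\<close>
lemma vertical_variation:
 assumes \<mu>: "0 < \<mu>" and x: "x : Wc" and w: "w ~= 0" and \<sigma>: "1 < \<sigma>" and i: "i ~= k"
  and Om: "(\<mu>,x,0,\<sigma> *R w) : Om"
  and vert: "!!\<tau>. \<tau> : {0..1} ==> G (\<mu>,x,0,\<tau> *R \<sigma> *R w) $ i = 0"
 shows "FD pos (init (\<mu>,x,0,w)) (0,e,0,0,0) $ i = 0"
proof -
 have xZ: "x : Z" and xk: "x $ k = 0" using x Wc by blast+
 let ?T = "time_sq (\<mu>,x,0,w)"
 have T: "0 < ?T" by (rule time_sq_pos) (use w xZ in \<open>auto simp: base_pt_def\<close>)
 have in\<sigma>: "init (\<mu>,x,0,\<sigma> *R w) = (0,0,\<mu>,x,\<sigma>\<^sup>2 * ?T)" unfolding init_ray by simp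
 have t\<sigma>: "time_sq (\<mu>,x,0,\<sigma> *R w) = \<sigma>\<^sup>2 * ?T" using in\<sigma> by (simp add: init_def)
 have in1: "init (\<mu>,x,0,w) = (0,0,\<mu>,x,?T)" by (simp add: init_def)
 have "(0,0,\<mu>,x,\<sigma>\<^sup>2 * ?T) : admissible" using Om in\<sigma> by (simp add: Om_def)
 then obtain u where u: "sol u" and u0: "u 0 = (0,0,\<mu>,x,\<sigma>\<^sup>2 * ?T)" by (rule admissibleE)
 have uY: "fst (u \<tau>) $ i = 0" if "\<tau> : {0..1}" for \<tau>
 proof -
  have "G (\<mu>,x,0,\<tau> *R \<sigma> *R w) = fst (u \<tau>)"
   unfolding G_def init_ray using sol_rescale(3)[OF u u0 that] by (simp add: t\<sigma>)
  then show ?thesis using vert[OF that] by simp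
 qed
 \<comment> \<open>The orbit is reparametrised to [0, \<sigma>] with \<sigma> > 1, so that it goes
   on after time 1 and can be shifted in time by up to \<sigma> - 1.\<close>
 define Y where "Y t = fst (u (1 / \<sigma> * t))" for t
 define P where "P t = (1 / \<sigma>) *R fst (snd (u (1 / \<sigma> * t)))" for t
 have D: "x + \<mu> *R Y t : Z" "(Y hvd P t) (at t within {0..\<sigma>})"
  "(P hvd ?T *R force S c (x + \<mu> *R Y t) - \<mu> *R geodesic_term S c (x + \<mu> *R Y t) (P t)) (at t within {0..\<sigma>})"
  if t: "t : {0..\<sigma>}" for t
 proof -
  have ts: "1 / \<sigma> * t : {0..1}" using t \<sigma> by auto
  note D = solD[OF u ts u0]
  show "x + \<mu> *R Y t : Z" using D(2) by (simp add: Y_def)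
  show "(Y hvd P t) (at t within {0..\<sigma>})"
   unfolding Y_def P_def by (rule has_vector_derivative_rescale[OF D(3)]) (use \<sigma> in auto)
  have d: "((%t. fst (snd (u (1 / \<sigma> * t)))) hvd (1 / \<sigma>) *R ((\<sigma>\<^sup>2 * ?T) *R force S c (x + \<mu> *R Y t)
   - \<mu> *R geodesic_term S c (x + \<mu> *R Y t) (fst (snd (u (1 / \<sigma> * t)))))) (at t within {0..\<sigma>})"
   unfolding Y_def by (rule has_vector_derivative_rescale[OF D(4)]) (use \<sigma> in auto)
  have "(1 / \<sigma>) *R (1 / \<sigma>) *R ((\<sigma>\<^sup>2 * ?T) *R force S c (x + \<mu> *R Y t)
   - \<mu> *R geodesic_term S c (x + \<mu> *R Y t) (fst (snd (u (1 / \<sigma> * t)))))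
   = ?T *R force S c (x + \<mu> *R Y t) - \<mu> *R geodesic_term S c (x + \<mu> *R Y t) (P t)"
   using \<sigma> by (simp add: P_def geodesic_term_scaleR scaleR_diff_right power2_eq_square)
  then show "(P hvd ?T *R force S c (x + \<mu> *R Y t) - \<mu> *R geodesic_term S c (x + \<mu> *R Y t) (P t)) (at t within {0..\<sigma>})"
   unfolding P_def[abs_def] using bounded_linear.has_vector_derivative[OF bounded_linear_scaleR_right[of "1 / \<sigma>"] d]
   by simp
 qed
 have YP0: "Y 0 = 0" "P 0 = 0" using u0 by (auto simp: Y_def P_def)
 have Yi: "Y t $ i = 0" if "t : {0..\<sigma>}" for t
  unfolding Y_def by (rule uY) (use that \<sigma> in auto)
 have shift: "pos (Y r,P r,\<mu>,x,?T) = Y (1 + r)" if r: "r : {0..\<sigma> - 1}" for r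
 proof -
  have sol: "sol (%t. (Y (r + t),P (r + t),\<mu>,x,?T))"
  proof (rule solI)
   fix t :: real assume t: "t : {0..1}"
   have rt: "r + t : {0..\<sigma>}" using r t by auto
   have im: "(+) r ` {0..1} <= {0..\<sigma>}" using r by auto
   have sh: "((+) r hvd 1) (at t within {0..1})"
    unfolding has_vector_derivative_def by (auto intro!: derivative_eq_intros)
   show "x + \<mu> *R Y (r + t) : Z" by (rule D(1)[OF rt])
   from vector_diff_chain_within[OF sh has_vector_derivative_within_subset[OF D(2)[OF rt] im]]
   show "((%t. Y (r + t)) hvd P (r + t)) (at t within {0..1})" by (simp add: o_def)
   from vector_diff_chain_within[OF sh has_vector_derivative_within_subset[OF D(3)[OF rt] im]]
   show "((%t. P (r + t)) hvd ?T *R force S c (x + \<mu> *R Y (r + t))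
    - \<mu> *R geodesic_term S c (x + \<mu> *R Y (r + t)) (P (r + t))) (at t within {0..1})" by (simp add: o_def)
  qed
  from pos_eq[OF sol] show ?thesis by (simp add: add.commute)
 qed
 let ?I = "{0..\<sigma> - 1}"
 have adm: "init (\<mu>,x,0,w) : admissible"
 proof -
  have "1 / \<sigma> : {0..1}" using \<sigma> by auto
  from Om_ray[OF Om this] show ?thesis using \<sigma> by (simp add: Om_def)
 qed
 have dpos: "(pos has_derivative FD pos (init (\<mu>,x,0,w))) (at (init (\<mu>,x,0,w)))"
  by (rule smooth_on_has_derivative[OF pos_smooth(2) adm])
 let ?Dp = "FD pos (init (\<mu>,x,0,w))"
 have "0 : {0..\<sigma>}" "?I <= {0..\<sigma>}" using \<sigma> by auto
 have dY: "(Y hvd 0) (at 0 within ?I)" 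
  using has_vector_derivative_within_subset[OF D(2)[OF \<open>0 : {0..\<sigma>}\<close>] \<open>?I <= {0..\<sigma>}\<close>] YP0 by simp
 have dP: "(P hvd ?T *R force S c x) (at 0 within ?I)"
  using has_vector_derivative_within_subset[OF D(3)[OF \<open>0 : {0..\<sigma>}\<close>] \<open>?I <= {0..\<sigma>}\<close>] YP0
   geodesic_term_scaleR[of S c x 0 0] by simp
 have "((%r. (Y r,P r,\<mu>,x,?T)) hvd (0,?T *R force S c x,0,0,0)) (at 0 within ?I)"
  by (rule has_vector_derivative_Pair[OF dY has_vector_derivative_Pair[OF dP
     has_vector_derivative_Pair[OF has_vector_derivative_const has_vector_derivative_Pair[OF
      has_vector_derivative_const has_vector_derivative_const]]]])
 moreover have "(pos has_derivative ?Dp) (at ((%r. (Y r,P r,\<mu>,x,?T)) 0) within (%r. (Y r,P r,\<mu>,x,?T)) ` ?I)"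
  using has_derivative_at_withinI[OF dpos] YP0 in1 by simp
 ultimately have "(pos \<circ> (%r. (Y r,P r,\<mu>,x,?T)) hvd ?Dp (0,?T *R force S c x,0,0,0)) (at 0 within ?I)"
  by (rule vector_derivative_diff_chain_within)
 from bounded_linear.has_vector_derivative[OF bounded_linear_vec_nth this, of i]
 have d1: "((%r. pos (Y r,P r,\<mu>,x,?T) $ i) hvd ?Dp (0,?T *R force S c x,0,0,0) $ i) (at 0 within ?I)"
  by (simp add: o_def)
 have z: "pos (Y r,P r,\<mu>,x,?T) $ i = 0" if "r : ?I" for r
  using shift[OF that] Yi[of "1 + r"] that by auto
 have 0: "0 : ?I" using \<sigma> by auto
 have d2: "((%r. pos (Y r,P r,\<mu>,x,?T) $ i) hvd 0) (at 0 within ?I)"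
  by (rule has_vector_derivative_transform[OF 0 z has_vector_derivative_const])
 have 1: "?Dp (0,?T *R force S c x,0,0,0) $ i = 0"
  using vector_derivative_unique_within_closed_interval[OF _ _ d1[folded cbox_interval] d2[folded cbox_interval]] \<sigma> by simp
 have 2: "(0,?T *R force S c x,0,0,0) = (?T / (2 * (K x $ k $ k)\<^sup>2)) *R (0::real^'n,e,0::real,0::real^'n,0::real)"
  using force_boundary[OF xZ xk] by simp
 have "(?T / (2 * (K x $ k $ k)\<^sup>2)) * ?Dp (0,e,0,0,0) $ i = 0"
  using 1 unfolding 2 linear_scale[OF has_derivative_linear[OF dpos]] by simp
 then show ?thesis using T Kkk_pos[OF xZ] by simp
qed

end

section \<open>The exponential map as a perturbation of the fold\<close>

text \<open>The set f > 0 is open and contains the compact slice \<mu> = 0, hence a uniform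
  neighbourhood of it. The margins of the perturbed fold are obtained in this way.\<close>

lemma compact_positive_neighbourhood:
 fixes f :: "real \<times> 'b::euclidean_space => real"
 assumes D: "open D" and f: "continuous_on D f" and Q: "compact Q" "{0} \<times> Q <= D"
  and pos: "!!q. q : Q ==> 0 < f (0,q)"
 obtains d where "0 < d" "!!\<mu> q. \<bar>\<mu>\<bar> < d ==> q : Q ==> (\<mu>,q) : D & 0 < f (\<mu>,q)"
proof -
 let ?D = "D \<inter> f -` {0<..}"
 have "open ?D" using continuous_open_preimage[OF f D] by simp
 \<comment> \<open>Only the inclusion in \<open>?D\<close> is wanted from the uniform neighbourhood,
   so the function in it is constant.\<close>
 moreover have "continuous_on ?D (%_. 0::real)" by simp
 moreover have "compact ({0::real} \<times> Q)" "{0} \<times> Q <= ?D" using Q pos by (auto intro: compact_Times)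
 ultimately obtain d where d: "0 < d" "!!z z'. z : {0} \<times> Q ==> dist z' z < d ==> z' : ?D & dist (0::real) 0 < (1::real)"
  by (rule compact_uniform_neighbourhood[where e = 1]) auto
 show ?thesis
 proof (rule that[OF d(1)])
  fix \<mu> q assume "\<bar>\<mu>\<bar> < d" "q : Q"
  then show "(\<mu>,q) : D & 0 < f (\<mu>,q)" using d(2)[of "(0,q)" "(\<mu>,q)"] by (auto simp: dist_Pair_Pair)
 qed
qed

lemma even_derivative_zero:
 fixes g :: "real => 'a::real_normed_vector"
 assumes g: "(g hvd D) (at 0)" and \<epsilon>: "0 < \<epsilon>" and even: "!!t. \<bar>t\<bar> < \<epsilon> ==> g (- t) = g t"
 shows "D = 0"
proof -
 have "(g \<circ> uminus hvd (- 1) *R D) (at 0)"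
  by (rule vector_diff_chain_at) (use g in \<open>auto intro!: derivative_eq_intros simp: has_vector_derivative_def\<close>)
 then have "(g \<circ> uminus hvd - D) (at 0)" by simp
 then have "(g hvd - D) (at 0)"
  by (rule has_vector_derivative_transform_within_open[where S = "{-\<epsilon><..<\<epsilon>}"])
   (use \<epsilon> even in \<open>auto simp: abs_less_iff\<close>)
 from vector_derivative_unique_at[OF g this] have "D + D = 0" by (metis add.right_inverse)
 then show ?thesis by (metis scaleR_2 scaleR_eq_0_iff zero_neq_numeral)
qed

lemma curve_derivative:
 fixes f :: "'a::euclidean_space => 'b::real_normed_vector"
 assumes f: "smooth_on D f" "p : D" and \<gamma>: "(\<gamma> hvd v) (at 0)" "\<gamma> 0 = p"
 shows "((%t. f (\<gamma> t)) hvd FD f p v) (at (0::real))"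
 using vector_derivative_diff_chain_within[OF \<gamma>(1), of f "FD f p"] \<gamma>(2)
  has_derivative_at_withinI[OF smooth_on_has_derivative[OF f]] by (simp add: o_def)

lemma line_has_vector_derivative: "((%t::real. p + t *R v) hvd v) (at t within S)"
 unfolding has_vector_derivative_def by (auto intro!: derivative_eq_intros)

lemma line_derivative_unique:
 fixes f :: "'a::euclidean_space => 'b::real_normed_vector"
 assumes f: "smooth_on D f" "p : D" and g: "((%t. f (p + t *R v)) hvd g') (at 0)"
 shows "FD f p v = g'"
 by (rule vector_derivative_unique_at[OF curve_derivative[OF f line_has_vector_derivative] g]) simp

text \<open>The first part is Taylor's formula with the remainder bounded below, the second the
  convexity of g t - m t^2.\<close>

lemma second_order_lower_bound:
 fixes g :: "real => real"
 assumes "!!t. t : {0..1} ==> (g has_real_derivative g1 t) (at t)"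
  "!!t. t : {0..1} ==> (g1 has_real_derivative g2 t) (at t)"
  "!!t. t : {0..1} ==> 2 * m <= g2 t"
 shows "g 0 + g1 0 + m <= g 1"
  "\<tau> : {0..1} ==> g \<tau> <= (1 - \<tau>) * g 0 + \<tau> * g 1 - m * (\<tau> * (1 - \<tau>))"
proof -
 define diff where "diff n = (if n = 0 then g else if n = Suc 0 then g1 else g2)" for n :: nat
 have "\<exists>t>0. t < 1 & g 1 = (\<Sum>n<2. diff n 0 / fact n * 1 ^ n) + diff 2 t / fact 2 * 1 ^ 2"
  by (rule Maclaurin) (use assms in \<open>auto simp: diff_def less_2_cases_iff\<close>)
 then obtain t where t: "0 < t" "t < 1" "g 1 = g 0 + g1 0 + g2 t / 2"
  by (auto simp: diff_def numeral_2_eq_2)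
 then show "g 0 + g1 0 + m <= g 1" using assms(3)[of t] by (simp add: field_simps)
 have "convex_on {0..1} (%t. g t - m * t\<^sup>2)"
 proof (rule f''_ge0_imp_convex)
  show "convex {0..1::real}" by simp
  show "((%t. g t - m * t\<^sup>2) has_real_derivative g1 t - m * (2 * t)) (at t)" if "t : {0..1}" for t
   using assms(1)[OF that] by (auto intro!: derivative_eq_intros)
  show "((%t. g1 t - m * (2 * t)) has_real_derivative g2 t - 2 * m) (at t)" if "t : {0..1}" for t
   using assms(2)[OF that] by (auto intro!: derivative_eq_intros)
  show "g2 t - 2 * m \<ge> 0" if "t : {0..1}" for t using assms(3)[OF that] by simp
 qed
 then show "\<tau> : {0..1} ==> g \<tau> <= (1 - \<tau>) * g 0 + \<tau> * g 1 - m * (\<tau> * (1 - \<tau>))"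
  using convex_onD[of "{0..1}" "%t. g t - m * t\<^sup>2" \<tau> 0 1] by (simp add: power2_eq_square algebra_simps)
qed

text \<open>The properties of the perturbed fold on which the geometry rests, stated without
  mechanics. \<phi> is the pair (\<xi>, \<eta>) with \<eta> as component k; a spans the kernel of
  d\<xi>, and d\<eta> has the coefficients l with respect to d\<xi> and \<kappa> with respect to
  dw_k. \<open>above\<close> is uniform convexity of \<eta> relative to this first-order expansion
  at w', and \<open>outside\<close> says that the sphere of radius R is mapped above the top of the
  cylinder.\<close>

locale fold_map =
 fixes k :: "'n::finite" and R cc s :: real and \<phi> a :: "real^'n => real^'n" and l :: "real^'n => 'n => real"
  and \<kappa> :: "real^'n => real"
 assumes R: "0 < R" and cc: "0 < cc" and s: "0 < s" "s <= 1"
  and smooth: "smooth_on (ball 0 (R + 1)) \<phi>" "\<exists>U. open U & cball 0 R <= U & smooth_on U \<kappa>"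
  and kernel: "norm w <= R ==> i ~= k ==> FD \<phi> w (a w) $ i = 0" "norm w <= R ==> a w $ k = 1"
   "norm w <= R ==> (!!i. i ~= k ==> FD \<phi> w v $ i = 0) ==> v = v $ k *R a w"
  and height: "norm w <= R ==> FD \<phi> w v $ k =
   (\<Sum>i\<in>- {k}. l w i * FD \<phi> w v $ i) + \<kappa> w * v $ k"
  and transverse: "norm w <= R ==> 0 < FD \<kappa> w (a w)"
  and above: "norm w <= R ==> norm w' <= R ==>
   \<phi> w' $ k + (\<Sum>i\<in>- {k}. l w' i * (\<phi> w $ i - \<phi> w' $ i)) + \<kappa> w' * (w - w') $ k + cc * (norm (w - w'))\<^sup>2 <= \<phi> w $ k"
  and ray_convex: "norm w <= R ==> \<tau> : {0..1} ==>
   \<phi> (\<tau> *R w) $ k <= (1 - \<tau>) * \<phi> 0 $ k + \<tau> * \<phi> w $ k - cc * (norm w)\<^sup>2 * (\<tau> * (1 - \<tau>))"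
  and crit_decreasing: "norm w <= R ==> \<kappa> w = 0 ==> FD \<kappa> w w < 0"
  and \<kappa>_pos: "norm w <= R ==> 0 <= w $ k ==> 0 < \<kappa> w"
  and outside: "norm w = R ==> 1 < \<phi> w $ k"
  and start: "\<phi> 0 = s\<^sup>2 *R axis k 1"

context seifert
begin

text \<open>A minimum over a compact sphere bundle. K is measured against its vertical component
  because the height of the unperturbed fold involves the quotient of the two.\<close>

lemma metric_lower_bound:
 obtains c0 where "0 < c0" "!!x w. x : Wc ==> c0 * (norm w)\<^sup>2 * K x $ k $ k <= w \<bullet> (K x *v w)"
proof -
 let ?C = "Wc \<times> sphere (0::real^'n) 1"
 let ?f = "%p. snd p \<bullet> (K (fst p) *v snd p) * inverse (K (fst p) $ k $ k)"
 have op: "open (Z \<times> (UNIV :: (real^'n) set))" by (intro open_Times chartD(2) open_UNIV)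
 have Kf: "smooth_on (Z \<times> (UNIV :: (real^'n) set)) (%p. K (fst p))"
  by (rule smooth_on_compose[OF op chartD(2) _ K_smooth smooth_on_fst[OF op smooth_on_ident[OF op]]]) auto
 have "smooth_on (Z \<times> UNIV) ?f"
  by (intro smooth_on_mult smooth_on_inner smooth_on_matrix_vector_mult smooth_on_inverse smooth_on_vec_nth Kf
    smooth_on_snd smooth_on_ident op) (auto dest!: Kkk_pos)
 then have cont: "continuous_on ?C ?f"
  using Wc(2) by (intro continuous_on_subset[OF smooth_on_continuous_on]) auto
 have "compact ?C" by (intro compact_Times Wc(1) compact_sphere)
 moreover have "(0,e) : ?C" using Wc(5) by simp
 then have "?C ~= {}" by blast
 ultimately obtain m where m: "m : ?C" "!!p. p : ?C ==> ?f m <= ?f p"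
  using continuous_attains_inf[OF _ _ cont] by blast
 have "fst m : Z" "snd m ~= 0" using m(1) Wc(2) by auto
 then have pos: "0 < ?f m" using K_positive Kkk_pos by simp
 show ?thesis
 proof (rule that[OF pos])
  fix x w assume x: "x : Wc"
  then have h: "0 < K x $ k $ k" using Kkk_pos Wc(2) by blast
  show "?f m * (norm w)\<^sup>2 * K x $ k $ k <= w \<bullet> (K x *v w)"
  proof (cases "w = 0")
   case False
   have "?f m <= ?f (x,w /\<^sub>R norm w)" using m(2)[of "(x,w /\<^sub>R norm w)"] x False by simp
   also have "\<dots> = (w \<bullet> (K x *v w)) / ((norm w)\<^sup>2 * K x $ k $ k)"
    by (simp add: matrix_vector_mult_scaleR divide_inverse power2_eq_square mult_ac)
   finally have "?f m <= (w \<bullet> (K x *v w)) / ((norm w)\<^sup>2 * K x $ k $ k)" .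
   moreover have "0 < (norm w)\<^sup>2 * K x $ k $ k" using False h by simp
   ultimately show ?thesis by (simp add: pos_le_divide_eq mult.assoc)
  qed simp
 qed
qed

text \<open>Hadamard's lemma for the division by \<open>s\<close>: the integral of the \<open>s\<close>-derivative over the segment from
 \<open>(\<mu>, x, 0, w)\<close> is obtained as the solution of a differential equation with parameters.\<close>
lemma G_divided:
 assumes N: "open N" and \<mu>1: "0 < \<mu>1" and box: "{-\<mu>1<..<\<mu>1} \<times> N \<times> {-2<..<2} \<times> ball 0 r <= Om"
 obtains \<Xi> where "smooth_on ({-\<mu>1<..<\<mu>1} \<times> N \<times> {-4/3<..<4/3::real} \<times> ball 0 r) \<Xi>"
  "!!\<mu> x s w. (\<mu>,x,s,w) : {-\<mu>1<..<\<mu>1} \<times> N \<times> {-4/3<..<4/3::real} \<times> ball 0 r ==> G (\<mu>,x,s,w) = G (\<mu>,x,0,w) + s *R \<Xi> (\<mu>,x,s,w)"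
  "!!\<mu> x w. (\<mu>,x,0,w) : {-\<mu>1<..<\<mu>1} \<times> N \<times> {-4/3<..<4/3::real} \<times> ball 0 r ==> \<Xi> (\<mu>,x,0,w) = FD G (\<mu>,x,0,w) (0,0,1,0)"
proof -
 let ?B = "{-\<mu>1<..<\<mu>1} \<times> N \<times> {-4/3<..<4/3::real} \<times> ball (0::real^'n) r"
 \<comment> \<open>The bounds 3/2 for t and 4/3 for s keep t s inside (-2, 2), while both ranges
   contain 1 in their interior.\<close>
 let ?J = "{-(3/2)..3/2::real}" and ?I = "{-(3/2)<..<3/2::real}"
 let ?q = "%p t. (fst p,fst (snd p),t * fst (snd (snd p)),snd (snd (snd p)))"
 let ?H = "%p t. FD G (?q p t) (0,0,1,0)"
 have B: "open ?B" by (intro open_Times N open_ball open_greaterThanLessThan)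
 have q_in: "?q p t : Om" if "p : ?B" "t : ?J" for p t
 proof -
  have "\<bar>t * fst (snd (snd p))\<bar> < 2"
  proof -
   have "\<bar>fst (snd (snd p))\<bar> < 4/3" "\<bar>t\<bar> <= 3/2" using that by (auto simp: abs_less_iff abs_le_iff)
   then have "\<bar>t\<bar> * \<bar>fst (snd (snd p))\<bar> <= 3/2 * \<bar>fst (snd (snd p))\<bar>" by (intro mult_right_mono) auto
   also have "\<dots> < 3/2 * (4/3)" using \<open>\<bar>fst (snd (snd p))\<bar> < 4/3\<close> by (intro mult_strict_left_mono) auto
   finally show ?thesis by (simp add: abs_mult)
  qed
  then have "?q p t : {-\<mu>1<..<\<mu>1} \<times> N \<times> {-2<..<2} \<times> ball 0 r" using that by (auto simp: abs_less_iff)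
  then show ?thesis using box by blast
 qed
 have Hs: "smooth_on (?B \<times> ?I) (%z. ?H (fst z) (snd z))"
 proof -
  have op: "open (?B \<times> ?I)" by (intro open_Times B open_greaterThanLessThan)
  show ?thesis
  proof (rule smooth_on_compose[OF op Om_smooth(1) _ smooth_on_frechet_derivative[OF Om_smooth(2)]])
   show "smooth_on (?B \<times> ?I) (%z. ?q (fst z) (snd z))" by (intro smooth_intros op)
   show "?q (fst z) (snd z) : Om" if "z : ?B \<times> ?I" for z using q_in[of "fst z" "snd z"] that by auto
  qed
 qed
 have "\<exists>y. y 0 = 0 & (\<forall>t\<in>?J. (y hvd ?H p t) (at t within ?J))" if p: "p : ?B" for p
 proof -
  have "continuous_on ?J (%t. ?H p t)"
  proof (rule continuous_on_compose2[OF smooth_on_continuous_on[OF smooth_on_frechet_derivative[OF Om_smooth(2)]]])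
   show "continuous_on ?J (%t. ?q p t)" by (intro continuous_intros)
  qed (use q_in[OF p] in auto)
  from continuous_on_compose2[OF this, of "?J \<times> UNIV" fst]
  have c: "continuous_on (?J \<times> (UNIV :: (real^'n) set)) (%(t,y). ?H p t)"
   by (auto simp: case_prod_unfold continuous_on_fst)
  obtain y where "y 0 = 0" "!!t. t : ?J ==> (y hvd ?H p t) (at t within ?J)"
   by (rule picard_short_time[of "3/2" 0 "%t y. ?H p t" 0, OF _ _ _ c]) auto
  then show ?thesis by blast
 qed
 then obtain y where y0: "!!p. p : ?B ==> y p 0 = 0"
  and y': "!!p t. p : ?B ==> t : ?J ==> (y p hvd ?H p t) (at t within ?J)"
  by metis
 let ?Y = "%(p,t). y p t"
 have fam: "ode_family ?B (3/2) 0 UNIV (%(p,t,u::real^'n). ?H p t) ?Y"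
  unfolding ode_family_def
 proof (intro ballI conjI)
  fix p t assume p: "p : ?B" and t: "t : ?I"
  then have t': "t : ?J" "-(3/2) < t" "t < 3/2" by auto
  show "((%t. ?Y (p,t)) hvd (%(p,t,u). ?H p t) (p,t,?Y (p,t))) (at t)"
   using y'[OF p t'(1)] by (simp add: at_within_Icc_at[OF t'(2,3)])
 qed auto
 have Ys: "Ck_on m (?B \<times> ?I) ?Y" for m
 proof (rule ode_family_Ck[OF B _ _ _ open_UNIV fam])
  have op: "open (?B \<times> ?I \<times> (UNIV :: (real^'n) set))" by (intro open_Times B open_greaterThanLessThan open_UNIV)
  have "Ck_on m (?B \<times> ?I \<times> (UNIV :: (real^'n) set)) (%z. (%z. ?H (fst z) (snd z)) (fst z,fst (snd z)))"
   by (rule Ck_on_compose[OF op _ _ smooth_onD[OF Hs]])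
    (auto intro!: open_Times B Ck_on_Pair Ck_on_fst Ck_on_snd Ck_on_ident N)
  then show "Ck_on m (?B \<times> ?I \<times> (UNIV :: (real^'n) set)) (%(p,t,u). ?H p t)" by (simp add: case_prod_unfold)
  have "Ck_on m ?B (%p. 0::real^'n)" by (rule Ck_on_const[OF B])
  then show "Ck_on m ?B (%p. ?Y (p,0))" by (rule Ck_on_cong[OF B]) (simp add: y0)
 qed auto
 show ?thesis
 proof (rule that[of "%p. y p 1"])
  show "smooth_on ?B (%p. y p 1)"
  proof (rule smooth_onI)
   fix m
   have "Ck_on m ?B (%p. ?Y (p,1))"
    by (rule Ck_on_compose[OF B _ _ Ys]) (auto intro!: open_Times B Ck_on_Pair Ck_on_ident Ck_on_const N)
   then show "Ck_on m ?B (%p. y p 1)" by simp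
  qed
  fix \<mu> x s w assume p: "(\<mu>,x,s,w) : ?B"
  have sub: "{0..1} <= ?J" by auto
  have "((%t. G (\<mu>,x,t * s,w) - s *R y (\<mu>,x,s,w) t) hvd 0) (at t within {0..1})"
   if t: "t : {0..1}" for t
  proof -
   have tJ: "t : ?J" using t sub by blast
   have "(\<mu>,x,t * s,w) : Om" using q_in[OF p tJ] by simp
   note dG = smooth_on_has_derivative[OF Om_smooth(2) this]
   have "((%t. (\<mu>,x,t * s,w)) hvd s *R (0,0,1,0)) (at t within {0..1})"
    unfolding has_vector_derivative_def by (auto intro!: derivative_eq_intros simp: zero_prod_def)
   from vector_derivative_diff_chain_within[OF this has_derivative_at_withinI[OF dG]]
   have "((%t. G (\<mu>,x,t * s,w)) hvd s *R ?H (\<mu>,x,s,w) t) (at t within {0..1})"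
    using linear_scale[OF has_derivative_linear[OF dG], of s "(0,0,1,0)"] by (simp add: o_def)
   moreover have "((%t. s *R y (\<mu>,x,s,w) t) hvd s *R ?H (\<mu>,x,s,w) t) (at t within {0..1})"
    by (rule bounded_linear.has_vector_derivative[OF bounded_linear_scaleR_right
       has_vector_derivative_within_subset[OF y'[OF p tJ] sub]])
   ultimately show ?thesis using has_vector_derivative_diff by fastforce
  qed
  from vector_derivative_bound[OF _ this, of 0 1 0] y0[OF p]
  show "G (\<mu>,x,s,w) = G (\<mu>,x,0,w) + s *R y (\<mu>,x,s,w) 1" by (simp add: algebra_simps)
 next
  fix \<mu> x w assume p: "(\<mu>,x,0,w) : ?B"
  let ?D = "FD G (\<mu>,x,0,w) (0,0,1,0)"
  have sub: "{0..1} <= ?J" by auto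
  have "((%t. y (\<mu>,x,0,w) t - t *R ?D) hvd 0) (at t within {0..1})" if t: "t : {0..1}" for t
  proof -
   have tJ: "t : ?J" using t sub by blast
   have "(y (\<mu>,x,0,w) hvd ?D) (at t within {0..1})"
    using has_vector_derivative_within_subset[OF y'[OF p tJ] sub] by simp
   moreover have "((%t. t *R ?D) hvd ?D) (at t within {0..1})"
    using line_has_vector_derivative[of 0 ?D] by simp
   ultimately show ?thesis using has_vector_derivative_diff by fastforce
  qed
  from vector_derivative_bound[OF _ this, of 0 1 0] y0[OF p] show "y (\<mu>,x,0,w) 1 = ?D" by simp
 qed
qed

end

lemma frechet_derivative_nth:
 assumes "smooth_on D f" "p : D"
 shows "FD (%p. f p $ i) p u = FD f p u $ i"
 using frechet_derivative_at[OF bounded_linear.has_derivative[OF bounded_linear_vec_nth smooth_on_has_derivative[OF assms]]]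
 by metis

lemma matrix_inv_mat_1: "matrix_inv (mat 1 :: real^'n^'n) = mat 1"
 using matrix_inv_mult(2)[of "mat 1 :: real^'n^'n"] by simp

section \<open>The perturbed fold: kernel, multipliers and critical function\<close>

locale seifert_box = seifert S c q0 k W
 for S :: "('p::{t2_space,second_countable_topology},'n::finite) mech_system" and c q0 k W +
 fixes \<mu>1 r :: real and N :: "(real^'n) set" and \<Xi> :: "real \<times> (real^'n) \<times> real \<times> (real^'n) => real^'n"
 assumes \<mu>1: "0 < \<mu>1" and N: "open N" "Wc <= N"
  and box: "{-\<mu>1<..<\<mu>1} \<times> N \<times> {-2<..<2} \<times> ball 0 r <= Om"
  and \<Xi>_smooth: "smooth_on ({-\<mu>1<..<\<mu>1} \<times> N \<times> {-4/3<..<4/3::real} \<times> ball 0 r) \<Xi>"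
  and \<Xi>_div: "(\<mu>,x,s,w) : {-\<mu>1<..<\<mu>1} \<times> N \<times> {-4/3<..<4/3::real} \<times> ball 0 r ==> G (\<mu>,x,s,w) = G (\<mu>,x,0,w) + s *R \<Xi> (\<mu>,x,s,w)"
  and \<Xi>_0: "(\<mu>,x,0,w) : {-\<mu>1<..<\<mu>1} \<times> N \<times> {-4/3<..<4/3::real} \<times> ball 0 r ==> \<Xi> (\<mu>,x,0,w) = FD G (\<mu>,x,0,w) (0,0,1,0)"
  and vertical: "0 < \<mu> ==> \<mu> < \<mu>1 ==> x : Wc ==> norm w <= r ==> i ~= k ==> (\<mu>,x,0,w) : Om & G (\<mu>,x,0,w) $ i = 0"
begin

definition "B = {-\<mu>1<..<\<mu>1} \<times> N \<times> {-4/3<..<4/3::real} \<times> ball (0::real^'n) r"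

lemma B_open: "open B" unfolding B_def by (intro open_Times N open_ball open_greaterThanLessThan)

lemma B_Om: "B <= Om"
proof -
 have "B <= {-\<mu>1<..<\<mu>1} \<times> N \<times> {-2<..<2} \<times> ball 0 r"
  unfolding B_def by (intro Sigma_mono) auto
 then show ?thesis using box by blast
qed

lemma slice_in_B: "\<bar>\<mu>\<bar> < \<mu>1 ==> x : Wc ==> \<bar>s\<bar> <= 1 ==> norm w < r ==> (\<mu>,x,s,w) : B"
 using N by (auto simp: B_def abs_less_iff abs_le_iff)

text \<open>The pair (\<xi>, \<eta>): horizontally the quotient \<open>\<Xi>\<close> of G by s,
  vertically G itself, which does not vanish with s.\<close>

definition \<Phi> :: "real \<times> (real^'n) \<times> real \<times> (real^'n) => real^'n" where
 "\<Phi> p = (\<chi> i. if i = k then G p $ k else \<Xi> p $ i)"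

lemma \<Phi>_smooth: "smooth_on B \<Phi>"
proof -
 have "smooth_on B (%p. if i = k then G p $ k else \<Xi> p $ i)" for i
  using smooth_on_vec_nth[OF B_open smooth_on_subset[OF Om_smooth(2) B_Om]]
   smooth_on_vec_nth[OF B_open \<Xi>_smooth[folded B_def]] by (cases "i = k") auto
 then show ?thesis unfolding \<Phi>_def by (rule smooth_on_vec_lambda[OF B_open])
qed

lemma G_\<Phi>:
 assumes "(\<mu>,x,s,w) : B" "0 < \<mu>" "x : Wc"
 shows "G (\<mu>,x,s,w) = (\<chi> i. if i = k then \<Phi> (\<mu>,x,s,w) $ i else s * \<Phi> (\<mu>,x,s,w) $ i)"
proof (simp only: vec_eq_iff, intro allI)
 fix i
 have "\<mu> < \<mu>1" "norm w <= r" using assms(1) by (auto simp: B_def)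
 then have "i ~= k ==> G (\<mu>,x,0,w) $ i = 0" using vertical assms by blast
 then show "G (\<mu>,x,s,w) $ i = (\<chi> i. if i = k then \<Phi> (\<mu>,x,s,w) $ i else s * \<Phi> (\<mu>,x,s,w) $ i) $ i"
  using \<Xi>_div[OF assms(1)[unfolded B_def]] by (simp add: \<Phi>_def)
qed

abbreviation "dw p v \<equiv> FD \<Phi> p (0,0,0,v)"

lemma dw_linear: "p : B ==> linear (dw p)"
 using linear_compose[OF _ smooth_on_linear_derivative[OF \<Phi>_smooth], of "%v. (0,0,0,v)"]
 by (auto simp: o_def linear_iff)

text \<open>The derivative of w |-> (\<xi>, w_k), with w_k in row k. It is the identity at \<mu> =
  0, so (\<xi>, w_k) remain coordinates for small \<mu>, and kernel and multipliers are given by the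
  inverse matrix.\<close>

definition Bm :: "real \<times> (real^'n) \<times> real \<times> (real^'n) => real^'n^'n" where
 "Bm p = (\<chi> i j. if i = k then (if j = k then 1 else 0) else dw p (axis j 1) $ i)"

lemma Bm_mult:
 assumes "p : B"
 shows "(Bm p *v v) $ i = (if i = k then v $ k else dw p v $ i)"
proof (cases "i = k")
 case True
 then have "(Bm p *v v) $ i = (\<Sum>j\<in>UNIV. if j = k then v $ k else 0)"
  unfolding matrix_vector_mult_def vec_lambda_beta by (intro sum.cong) (auto simp: Bm_def)
 then show ?thesis using True by simp
next
 case False
 have "dw p v = (\<Sum>j\<in>UNIV. v $ j *R dw p (axis j 1))" by (rule axis_expansion[OF dw_linear[OF assms]])
 then have "dw p v $ i = (\<Sum>j\<in>UNIV. v $ j * dw p (axis j 1) $ i)" by simp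
 then show ?thesis using False by (simp add: matrix_vector_mult_def Bm_def mult.commute)
qed

definition "D = {p : B. det (Bm p) ~= 0}"

lemma Bm_smooth: "smooth_on B Bm"
proof -
 have "smooth_on B (%p. if i = k then (if j = k then 1 else 0) else dw p (axis j 1) $ i)" for i j
  by (cases "i = k") (auto intro: smooth_on_const[OF B_open] smooth_on_vec_nth[OF B_open] smooth_on_frechet_derivative[OF \<Phi>_smooth])
 then show ?thesis unfolding Bm_def by (intro smooth_on_vec_lambda[OF B_open])
qed

lemma D_open: "open D" and D_B: "D <= B"
proof -
 have "Ck_on 0 B (%p. det (Bm p))"
  by (rule Ck_on_det[OF B_open]) (intro Ck_on_vec_nth B_open smooth_onD[OF Bm_smooth])
 then have "continuous_on B (%p. det (Bm p))" by simp
 from continuous_open_preimage[OF this B_open, of "- {0}"]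
 have "open (B \<inter> (%p. det (Bm p)) -` (- {0}))" by (simp add: open_Compl)
 moreover have "B \<inter> (%p. det (Bm p)) -` (- {0}) = D" by (auto simp: D_def)
 ultimately show "open D" by simp
qed (auto simp: D_def)

lemma \<Phi>_smooth_D: "smooth_on D \<Phi>" by (rule smooth_on_subset[OF \<Phi>_smooth D_B])

definition ker :: "real \<times> (real^'n) \<times> real \<times> (real^'n) => real^'n" where
 "ker p = matrix_inv (Bm p) *v e"

text \<open>The coefficients of d\<eta> in the coordinates (\<xi>, w_k). The one with index k is
  \<open>crit\<close>, the derivative of \<eta> along the kernel of d\<xi>.\<close>

definition cof :: "real \<times> (real^'n) \<times> real \<times> (real^'n) => 'n => real" where
 "cof p i = dw p (matrix_inv (Bm p) *v axis i 1) $ k"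

definition crit :: "real \<times> (real^'n) \<times> real \<times> (real^'n) => real" where
 "crit p = dw p (ker p) $ k"

lemma crit_cof: "crit p = cof p k" by (simp add: crit_def cof_def ker_def)

lemma inv_smooth: "smooth_on D (%p. matrix_inv (Bm p) *v v)"
 by (intro smooth_on_matrix_vector_mult smooth_on_matrix_inv smooth_on_subset[OF Bm_smooth D_B] smooth_on_const D_open)
  (simp add: D_def)

lemma cof_smooth: "smooth_on D (%p. cof p i)" and ker_smooth: "smooth_on D ker" and crit_smooth: "smooth_on D crit"
proof -
 show c: "smooth_on D (%p. cof p i)" for i
  unfolding cof_def
  by (intro smooth_on_vec_nth smooth_on_frechet_derivative_apply smooth_on_Pair smooth_on_const inv_smooth \<Phi>_smooth_D D_open)
 show "smooth_on D ker" unfolding ker_def by (rule inv_smooth)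
 show "smooth_on D crit" unfolding crit_cof by (rule c)
qed

lemma inv_Bm: "p : D ==> matrix_inv (Bm p) *v (Bm p *v v) = v" "p : D ==> Bm p *v (matrix_inv (Bm p) *v v) = v"
 by (simp_all add: matrix_vector_mul_assoc matrix_inv_mult D_def)

lemma ker_props:
 assumes p: "p : D"
 shows "i ~= k ==> dw p (ker p) $ i = 0" "ker p $ k = 1"
  "(!!i. i ~= k ==> dw p v $ i = 0) ==> v = v $ k *R ker p"
proof -
 have pB: "p : B" using p D_B by blast
 have "Bm p *v ker p = e" unfolding ker_def by (rule inv_Bm(2)[OF p])
 then have *: "(if i = k then ker p $ k else dw p (ker p) $ i) = e $ i" for i by (metis Bm_mult[OF pB])
 show "i ~= k ==> dw p (ker p) $ i = 0" using *[of i] by (simp add: axis_def)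
 show "ker p $ k = 1" using *[of k] by simp
 show "v = v $ k *R ker p" if "!!i. i ~= k ==> dw p v $ i = 0"
 proof -
  have "Bm p *v v = v $ k *R e"
   by (simp only: vec_eq_iff) (use that in \<open>auto simp: Bm_mult[OF pB] axis_def\<close>)
  then have "matrix_inv (Bm p) *v (Bm p *v v) = v $ k *R ker p" by (simp add: ker_def matrix_vector_mult_scaleR)
  then show ?thesis unfolding inv_Bm(1)[OF p] .
 qed
qed

lemma height_differential:
 assumes p: "p : D"
 shows "dw p v $ k = (\<Sum>i\<in>- {k}. cof p i * dw p v $ i) + crit p * v $ k"
proof -
 have pB: "p : B" using p D_B by blast
 have lin: "linear (%u. dw p (matrix_inv (Bm p) *v u))"
  using linear_compose[OF matrix_vector_mul_linear dw_linear[OF pB]] by (simp add: o_def)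
 have "dw p v = dw p (matrix_inv (Bm p) *v (Bm p *v v))" unfolding inv_Bm(1)[OF p] ..
 also have "\<dots> = (\<Sum>i\<in>UNIV. (Bm p *v v) $ i *R dw p (matrix_inv (Bm p) *v axis i 1))"
  by (rule axis_expansion[OF lin])
 finally have "dw p v $ k = (\<Sum>i\<in>UNIV. (Bm p *v v) $ i * cof p i)" by (simp add: cof_def)
 also have "\<dots> = (Bm p *v v) $ k * cof p k + (\<Sum>i\<in>- {k}. (Bm p *v v) $ i * cof p i)"
  by (simp add: sum.remove[of UNIV k] Compl_eq_Diff_UNIV)
 also have "(\<Sum>i\<in>- {k}. (Bm p *v v) $ i * cof p i) = (\<Sum>i\<in>- {k}. cof p i * dw p v $ i)"
  by (rule sum.cong) (auto simp: Bm_mult[OF pB])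
 finally show ?thesis by (simp add: Bm_mult[OF pB] crit_cof)
qed

text \<open>Explicit formulas are known only on slices with \<mu> and x fixed. Derivatives in the
  directions of s and w stay in such a slice, so they can be read off from the formula.\<close>

lemma slice_derivative:
 fixes f :: "real \<times> (real^'n) \<times> real \<times> (real^'n) => 'b::real_normed_vector"
 assumes f: "smooth_on A f" and A: "open A" and p: "(\<mu>,x,s,w) : A"
  and eq: "!!s' w'. (\<mu>,x,s',w') : A ==> f (\<mu>,x,s',w') = g s' w'"
  and g: "((%t. g (s + t * \<sigma>) (w + t *R v)) hvd g') (at 0)"
 shows "FD f (\<mu>,x,s,w) (0,0,\<sigma>,v) = g'"
proof (rule line_derivative_unique[OF f p])
 let ?T = "(%t. (\<mu>,x,s,w) + t *R (0,0,\<sigma>,v)) -` A"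
 have "continuous_on UNIV (%t::real. (\<mu>,x,s,w) + t *R (0,0,\<sigma>,v))" by (intro continuous_intros)
 then have T: "open ?T" using A open_vimage by blast
 show "((%t. f ((\<mu>,x,s,w) + t *R (0,0,\<sigma>,v))) hvd g') (at 0)"
  by (rule has_vector_derivative_transform_within_open[OF g T]) (use p eq in auto)
qed

text \<open>For s ~= 0 the horizontal part comes from dividing G, for s = 0 from the s-derivative of
  G that \<open>\<Xi>\<close> is there. The coefficient 1 / (4 h) is half of h times the boundary
  force 1 / (2 h^2).\<close>

lemma \<Phi>_slice:
 assumes x: "x : Wc" and p: "(0,x,s,w) : B"
 shows "\<Phi> (0,x,s,w) $ i = (if i = k then s\<^sup>2 + s * w $ k + (w \<bullet> (K x *v w)) / (4 * K x $ k $ k) else w $ i)"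
proof -
 have xZ: "x : Z" and xk: "x $ k = 0" using x Wc by blast+
 have h: "K x $ k $ k > 0" by (rule Kkk_pos[OF xZ])
 have G0: "G (0,x,s',w') = s'\<^sup>2 *R e + s' *R w' + ((w' \<bullet> (K x *v w')) / (4 * K x $ k $ k)) *R e" for s' w'
  using h by (simp add: Om_zero(2)[OF xZ] force_boundary[OF xZ xk] power2_eq_square)
 show ?thesis
 proof (cases "i = k")
  case True
  then show ?thesis by (simp add: \<Phi>_def G0 algebra_simps)
 next
  case False
  have ei: "e $ i = 0" using False by (simp add: axis_def)
  have "\<Xi> (0,x,s,w) $ i = w $ i"
  proof (cases "s = 0")
   case True
   have O: "(0,x,0,w) : Om" using p B_Om True by blast
   have "FD (%p. G p $ i) (0,x,0,w) (0,0,1,0) = w $ i"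
   proof (rule slice_derivative[OF smooth_on_vec_nth[OF Om_smooth(1,2)] Om_smooth(1) O])
    show "G (0,x,s',w') $ i = s' * w' $ i" for s' w' by (simp add: G0 ei)
    show "((%t. (0 + t * 1) * (w + t *R 0) $ i) hvd w $ i) (at 0)"
     unfolding has_vector_derivative_def by (auto intro!: derivative_eq_intros)
   qed
   then show ?thesis
    using \<Xi>_0[OF p[unfolded B_def True]] True frechet_derivative_nth[OF Om_smooth(2) O] by simp
  next
   case False
   have "s * \<Xi> (0,x,s,w) $ i = G (0,x,s,w) $ i - G (0,x,0,w) $ i"
    using \<Xi>_div[OF p[unfolded B_def]] by simp
   then show ?thesis using False by (simp add: G0 ei)
  qed
  then show ?thesis using False by (simp add: \<Phi>_def)
 qed
qed

lemma dw_slice: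
 assumes x: "x : Wc" and p: "(0,x,s,w) : B"
 shows "dw (0,x,s,w) v $ i = (if i = k then s * v $ k + (v \<bullet> (K x *v w)) / (2 * K x $ k $ k) else v $ i)"
proof -
 have sym: "transpose (K x) = K x" using K_symmetric x Wc(2) by blast
 let ?h = "K x $ k $ k"
 have "FD (%p. \<Phi> p $ i) (0,x,s,w) (0,0,0,v)
   = (if i = k then s * v $ k + (v \<bullet> (K x *v w)) / (2 * ?h) else v $ i)"
 proof (rule slice_derivative[OF smooth_on_vec_nth[OF B_open \<Phi>_smooth] B_open p \<Phi>_slice[OF x]])
  have q: "(w + t *R v) \<bullet> (K x *v (w + t *R v)) = w \<bullet> (K x *v w) + t * (2 * (v \<bullet> (K x *v w))) + t\<^sup>2 * (v \<bullet> (K x *v v))" for t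
   using inner_matrix_symmetric[OF sym, of w v]
   by (simp add: matrix_vector_right_distrib matrix_vector_mult_scaleR inner_add_left inner_add_right power2_eq_square algebra_simps)
  show "((%t. if i = k then (s + t * 0)\<^sup>2 + (s + t * 0) * (w + t *R v) $ k +
    ((w + t *R v) \<bullet> (K x *v (w + t *R v))) / (4 * ?h) else (w + t *R v) $ i) has_vector_derivative
    (if i = k then s * v $ k + (v \<bullet> (K x *v w)) / (2 * ?h) else v $ i)) (at 0)"
  proof (cases "i = k")
   case True
   have "((%t. s\<^sup>2 + s * (w $ k + t * v $ k) + (w \<bullet> (K x *v w) + t * (2 * (v \<bullet> (K x *v w))) + t\<^sup>2 * (v \<bullet> (K x *v v))) / (4 * ?h))
     has_real_derivative s * v $ k + (2 * (v \<bullet> (K x *v w))) / (4 * ?h)) (at 0)"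
    using Kkk_pos[of x] x Wc(2) by (auto intro!: derivative_eq_intros)
   then show ?thesis using True by (simp add: q has_real_derivative_iff_has_vector_derivative)
  next
   case False
   have "((%t. w $ i + t * v $ i) has_real_derivative v $ i) (at 0)" by (auto intro!: derivative_eq_intros)
   then show ?thesis using False by (simp add: has_real_derivative_iff_has_vector_derivative)
  qed
 qed
 then show ?thesis by (simp add: frechet_derivative_nth[OF \<Phi>_smooth p])
qed

lemma slice_D:
 assumes x: "x : Wc" and p: "(0,x,s,w) : B"
 shows "(0,x,s,w) : D" "ker (0,x,s,w) = e" "crit (0,x,s,w) = s + w $ k / 2"
  "i ~= k ==> cof (0,x,s,w) i = s * axis i 1 $ k + (axis i 1 \<bullet> (K x *v w)) / (2 * K x $ k $ k)"
proof -
 have xZ: "x : Z" and xk: "x $ k = 0" using x Wc by blast+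
 have "Bm (0,x,s,w) = mat 1"
  by (simp add: Bm_def vec_eq_iff mat_def dw_slice[OF x p] axis_def)
 then have B1: "det (Bm (0,x,s,w)) ~= 0" "matrix_inv (Bm (0,x,s,w)) *v v = v" for v
  by (simp_all add: matrix_inv_mat_1)
 show "(0,x,s,w) : D" using p B1(1) by (simp add: D_def)
 show k: "ker (0,x,s,w) = e" by (simp add: ker_def B1)
 have "e \<bullet> (K x *v w) = K x $ k $ k * w $ k"
  using inner_matrix_symmetric[OF K_symmetric[OF xZ], of e w] K_axis[OF xZ] xk by (simp add: inner_axis)
 then show "crit (0,x,s,w) = s + w $ k / 2"
  using Kkk_pos[OF xZ] by (simp add: crit_def k dw_slice[OF x p])
 show "i ~= k ==> cof (0,x,s,w) i = s * axis i 1 $ k + (axis i 1 \<bullet> (K x *v w)) / (2 * K x $ k $ k)"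
  by (simp add: cof_def B1 dw_slice[OF x p])
qed

lemma crit_slice_derivative:
 assumes x: "x : Wc" and p: "(0,x,s,w) : B"
 shows "FD crit (0,x,s,w) (0,0,\<sigma>,v) = \<sigma> + v $ k / 2"
proof (rule slice_derivative[OF crit_smooth D_open slice_D(1)[OF x p]])
 show "crit (0,x,s',w') = s' + w' $ k / 2" if "(0,x,s',w') : D" for s' w'
  using slice_D(3)[OF x] that D_B by blast
 have "((%t. (s + t * \<sigma>) + (w $ k + t * v $ k) / 2) has_real_derivative \<sigma> + v $ k / 2) (at 0)"
  by (auto intro!: derivative_eq_intros)
 then show "((%t. (s + t * \<sigma>) + (w + t *R v) $ k / 2) hvd \<sigma> + v $ k / 2) (at 0)"
  by (simp add: has_real_derivative_iff_has_vector_derivative)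
qed

text \<open>Where \<open>crit\<close> vanishes this is minus its derivative along the ray.
  Subtracting that derivative removes the part linear in w: at \<mu> = 0 only s remains of s + w_k /
  2.\<close>

definition resid :: "real \<times> (real^'n) \<times> real \<times> (real^'n) => real" where
 "resid p = crit p - FD crit p (0,0,0,snd (snd (snd p)))"

lemma resid_smooth: "smooth_on D resid"
 unfolding resid_def
 by (intro smooth_on_diff crit_smooth smooth_on_frechet_derivative_apply smooth_on_Pair smooth_on_const smooth_on_snd smooth_on_ident D_open)

lemma resid_slice:
 assumes x: "x : Wc" and p: "(0,x,s,w) : B"
 shows "FD resid (0,x,s,w) (0,0,\<sigma>,v) = \<sigma>"
proof (rule slice_derivative[OF resid_smooth D_open slice_D(1)[OF x p]])
 show "resid (0,x,s',w') = s'" if "(0,x,s',w') : D" for s' w'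
 proof -
  have "(0,x,s',w') : B" using that D_B by blast
  then show ?thesis using slice_D(3)[OF x] crit_slice_derivative[OF x] by (simp add: resid_def)
 qed
 have "((%t. s + t * \<sigma>) has_real_derivative \<sigma>) (at 0)" by (auto intro!: derivative_eq_intros)
 then show "((%t. s + t * \<sigma>) hvd \<sigma>) (at 0)"
  by (simp add: has_real_derivative_iff_has_vector_derivative)
qed

text \<open>The second derivative in w, twice in direction v, written as a polynomial in v so that
  joint continuity in p and v is visible.\<close>

definition hess :: "real \<times> (real^'n) \<times> real \<times> (real^'n) => real^'n => real^'n" where
 "hess p v = (\<Sum>i\<in>UNIV. \<Sum>j\<in>UNIV. (v $ i * v $ j) *R
   FD (%p. dw p (axis i 1)) p (0,0,0,axis j 1))"

lemma hess_eq:
 assumes p: "p : B"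
 shows "hess p v = FD (%p. dw p v) p (0,0,0,v)"
proof -
 let ?D = "%i. FD (%p. dw p (axis i 1)) p"
 have sm: "smooth_on B (%p. dw p u)" for u by (rule smooth_on_frechet_derivative[OF \<Phi>_smooth])
 have "((%p. \<Sum>i\<in>UNIV. v $ i *R dw p (axis i 1)) has_derivative (%u. \<Sum>i\<in>UNIV. v $ i *R ?D i u)) (at p)"
  by (intro has_derivative_sum has_derivative_scaleR_right smooth_on_has_derivative[OF sm p])
 then have "((%p. dw p v) has_derivative (%u. \<Sum>i\<in>UNIV. v $ i *R ?D i u)) (at p)"
  by (rule has_derivative_transform_within_open[OF _ B_open p]) (rule axis_expansion[OF dw_linear, symmetric])
 then have 1: "FD (%p. dw p v) p u = (\<Sum>i\<in>UNIV. v $ i *R ?D i u)" for u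
  by (rule fun_cong[OF frechet_derivative_at, symmetric])
 have "linear (%u. ?D i (0,0,0,u))" for i
  using linear_compose[OF _ smooth_on_linear_derivative[OF sm p], of "%v. (0,0,0,v)"]
  by (auto simp: o_def linear_iff)
 from axis_expansion[OF this, of _ v] have 2: "?D i (0,0,0,v) = (\<Sum>j\<in>UNIV. v $ j *R ?D i (0,0,0,axis j 1))" for i .
 have "FD (%p. dw p v) p (0,0,0,v) = (\<Sum>i\<in>UNIV. v $ i *R ?D i (0,0,0,v))" by (rule 1)
 also have "\<dots> = hess p v"
  unfolding hess_def
 proof (rule sum.cong[OF refl])
  fix i
  show "v $ i *R ?D i (0,0,0,v) = (\<Sum>j\<in>UNIV. (v $ i * v $ j) *R ?D i (0,0,0,axis j 1))"
   by (simp only: 2[of i] scaleR_sum_right scaleR_scaleR)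
 qed
 finally show ?thesis by (rule sym)
qed

lemma hess_slice:
 assumes x: "x : Wc" and p: "(0,x,s,w) : B"
 shows "hess (0,x,s,w) v $ i = (if i = k then (v \<bullet> (K x *v v)) / (2 * K x $ k $ k) else 0)"
proof -
 let ?h = "K x $ k $ k"
 have sm: "smooth_on B (%p. dw p v)" by (rule smooth_on_frechet_derivative[OF \<Phi>_smooth])
 have "FD (%p. dw p v $ i) (0,x,s,w) (0,0,0,v) = (if i = k then (v \<bullet> (K x *v v)) / (2 * ?h) else 0)"
 proof (rule slice_derivative[OF smooth_on_vec_nth[OF B_open sm] B_open p dw_slice[OF x]])
  have q: "v \<bullet> (K x *v (w + t *R v)) = v \<bullet> (K x *v w) + t * (v \<bullet> (K x *v v))" for t
   by (simp add: matrix_vector_right_distrib matrix_vector_mult_scaleR inner_add_right)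
  have "((%t. s * v $ k + (v \<bullet> (K x *v w) + t * (v \<bullet> (K x *v v))) / (2 * ?h)) has_real_derivative (v \<bullet> (K x *v v)) / (2 * ?h)) (at 0)"
   using Kkk_pos[of x] x Wc(2) by (auto intro!: derivative_eq_intros)
  then show "((%t. if i = k then (s + t * 0) * v $ k + (v \<bullet> (K x *v (w + t *R v))) / (2 * ?h) else v $ i) has_vector_derivative
    (if i = k then (v \<bullet> (K x *v v)) / (2 * ?h) else 0)) (at 0)"
   by (simp add: q has_real_derivative_iff_has_vector_derivative)
 qed
 then show ?thesis by (simp add: hess_eq[OF p] frechet_derivative_nth[OF sm p])
qed

text \<open>Along w + t e the map \<Phi> at s = 0 is even in t. Its vertical part depends on w
  through \<open>time_sq\<close> only, for which e is orthogonal to w; its horizontal part is a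
  variation of the brake orbit, to which the component of w along e contributes nothing. Hence the
  derivative along e vanishes, so e spans the kernel and is annihilated by d\<eta>. This exact zero
  controls the fold as s tends to 0.\<close>

lemma crit_zero:
 assumes \<mu>: "0 < \<mu>" "\<mu> < \<mu>1" and x: "x : Wc" and w: "norm w < r" "w $ k = 0" and D: "(\<mu>,x,0,w) : D"
 shows "crit (\<mu>,x,0,w) = 0"
proof -
 have xZ: "x : Z" and xk: "x $ k = 0" using x Wc by blast+
 define \<epsilon> where "\<epsilon> = (r - norm w) / 2"
 have \<epsilon>: "0 < \<epsilon>" "norm w + \<epsilon> < r" using w by (auto simp: \<epsilon>_def field_simps)
 have inB: "(\<mu>,x,0,w + t *R e) : B" if "\<bar>t\<bar> < \<epsilon>" for t
 proof (rule slice_in_B)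
  have "norm (w + t *R e) <= norm w + \<bar>t\<bar>" using norm_triangle_ineq[of w "t *R e"] by simp
  then show "norm (w + t *R e) < r" using that \<epsilon> by linarith
 qed (use \<mu> x in auto)
 have bp: "base_pt (\<mu>,x,0,w') = x" for w' by (simp add: base_pt_def)
 have ts: "time_sq (\<mu>,x,0,w + t *R e) = K x $ k $ k * (w \<bullet> (K x *v w) + t\<^sup>2 * K x $ k $ k)" for t
 proof -
  have "w \<bullet> (K x *v e) = 0" using K_axis[OF xZ] xk w(2) by (simp add: inner_axis)
  moreover have "e \<bullet> (K x *v w) = 0" using inner_matrix_symmetric[OF K_symmetric[OF xZ], of e w] calculation by simp
  ultimately show ?thesis
   unfolding time_sq_def prod.case bp
   by (simp add: matrix_vector_right_distrib matrix_vector_mult_scaleR inner_add_left inner_add_right inner_axis_mult power2_eq_square)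
 qed
 have i_even: "init (\<mu>,x,0,w + (- t) *R e) = init (\<mu>,x,0,w + t *R e)" for t
  using ts[of t] ts[of "- t"] by (simp add: init_def)
 have \<Xi>: "\<Xi> (\<mu>,x,0,w') = FD pos (init (\<mu>,x,0,w')) (0,w',0,0,0)" if p: "(\<mu>,x,0,w') : B" for w'
 proof -
  have O: "(\<mu>,x,0,w') : Om" using p B_Om by blast
  have adm: "init (\<mu>,x,0,w') : admissible" using O by (simp add: Om_def)
  let ?d = "FD init (\<mu>,x,0,w') (0,0,1,0)"
  have di: "((%t. init (\<mu>,x,t,w')) hvd ?d) (at 0)"
   using curve_derivative[OF Om_smooth(3) O line_has_vector_derivative[of "(\<mu>,x,0,w')" "(0,0,1,0)" 0 UNIV]] by simp
  \<comment> \<open>The height s^2 and the time are even in s, so only the velocity s w' contributes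
    to first order.\<close>
  have d: "?d = (0,w',0,0,0)"
  proof -
   have c1: "((%t. t\<^sup>2 *R e) hvd fst ?d) (at 0)"
    using bounded_linear.has_vector_derivative[OF bounded_linear_fst di] by (simp add: init_def)
   have c2: "((%t. t *R w') hvd fst (snd ?d)) (at 0)"
    using bounded_linear.has_vector_derivative[OF bounded_linear_compose[OF bounded_linear_fst bounded_linear_snd] di] by (simp add: init_def)
   have c3: "((%t. snd (snd (init (\<mu>,x,t,w')))) hvd snd (snd ?d)) (at 0)"
    by (rule bounded_linear.has_vector_derivative[OF bounded_linear_compose[OF bounded_linear_snd bounded_linear_snd] di])
   have "fst ?d = 0" by (rule even_derivative_zero[OF c1 zero_less_one]) simp
   moreover have "fst (snd ?d) = w'"
    by (rule vector_derivative_unique_at[OF c2]) (use line_has_vector_derivative[of 0 w' 0 UNIV] in simp)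
   moreover have "snd (snd ?d) = 0"
    by (rule even_derivative_zero[OF c3 zero_less_one]) (simp add: init_def time_sq_def base_pt_def)
   ultimately show ?thesis by (metis prod.collapse zero_prod_def)
  qed
  have "(G has_derivative (%u. FD pos (init (\<mu>,x,0,w')) (FD init (\<mu>,x,0,w') u))) (at (\<mu>,x,0,w'))"
   unfolding G_def[abs_def]
   by (rule has_derivative_compose[OF smooth_on_has_derivative[OF Om_smooth(3) O] smooth_on_has_derivative[OF pos_smooth(2) adm]])
  then have "FD G (\<mu>,x,0,w') (0,0,1,0) = FD pos (init (\<mu>,x,0,w')) (0,w',0,0,0)"
   using d by (metis frechet_derivative_at)
  then show ?thesis using \<Xi>_0[OF p[unfolded B_def]] by simp
 qed
 have \<Xi>_even: "\<Xi> (\<mu>,x,0,w + (- t) *R e) $ i = \<Xi> (\<mu>,x,0,w + t *R e) $ i" if t: "\<bar>t\<bar> < \<epsilon>" and i: "i ~= k" for t i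
 proof (cases "w + t *R e = 0")
  case True
  have "(w + t *R e) $ k = 0" unfolding True by simp
  then have "t = 0" using w(2) by simp
  then show ?thesis by simp
 next
  case False
  have b: "(\<mu>,x,0,w + (- t) *R e) : B" "(\<mu>,x,0,w + t *R e) : B" using inB[of t] inB[of "- t"] t by auto
  let ?w = "w + t *R e"
  have wr: "norm ?w < r" using b(2) by (simp add: B_def)
  \<comment> \<open>The trajectory is followed beyond time one, up to the radius r at which
    verticality is still known, to leave room for the time shift.\<close>
  define \<sigma> where "\<sigma> = r / norm ?w"
  have \<sigma>: "1 < \<sigma>" "norm (\<sigma> *R ?w) <= r"
   using wr False less_imp_le[OF le_less_trans[OF norm_ge_zero wr]] by (auto simp: \<sigma>_def)
  have "FD pos (init (\<mu>,x,0,?w)) (0,e,0,0,0) $ i = 0"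
  proof (rule vertical_variation[OF \<mu>(1) x False \<sigma>(1) i])
   show "(\<mu>,x,0,\<sigma> *R ?w) : Om" using vertical[OF \<mu> x \<sigma>(2) i] by blast
   fix \<tau> :: real assume \<tau>: "\<tau> : {0..1}"
   have "norm (\<tau> *R \<sigma> *R ?w) <= norm (\<sigma> *R ?w)"
    using \<tau> by (metis abs_of_nonneg atLeastAtMost_iff mult_left_le_one_le norm_ge_zero norm_scaleR)
   then have "norm (\<tau> *R \<sigma> *R ?w) <= r" using \<sigma>(2) by linarith
   then show "G (\<mu>,x,0,\<tau> *R \<sigma> *R ?w) $ i = 0" using vertical[OF \<mu> x _ i] by blast
  qed
  then have e0: "FD pos (init (\<mu>,x,0,?w)) (0,e,0,0,0) $ i = 0" .
  have "init (\<mu>,x,0,?w) : admissible" using b(2) B_Om by (auto simp: Om_def)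
  then have lin: "linear (FD pos (init (\<mu>,x,0,?w)))"
   by (rule smooth_on_linear_derivative[OF pos_smooth(2)])
  have "(0::real^'n,w + (- t) *R e,0::real,0::real^'n,0::real) = (0,?w,0,0,0) + (- 2 * t) *R (0,e,0,0,0)"
   by (simp add: algebra_simps scaleR_2[symmetric])
  then have "FD pos (init (\<mu>,x,0,?w)) (0,w + (- t) *R e,0,0,0) $ i
    = FD pos (init (\<mu>,x,0,?w)) (0,?w,0,0,0) $ i"
   using e0 by (simp only: linear_add[OF lin] linear_scale[OF lin] vector_add_component vector_scaleR_component) simp
  then show ?thesis by (simp only: \<Xi>[OF b(1)] \<Xi>[OF b(2)] i_even)
 qed
 have p: "(\<mu>,x,0,w) : B" using D D_B by blast
 have dwi: "dw (\<mu>,x,0,w) e $ i = 0" for i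
 proof -
  have "((%t. \<Phi> ((\<mu>,x,0,w) + t *R (0,0,0,e))) hvd dw (\<mu>,x,0,w) e) (at 0)"
   by (rule curve_derivative[OF \<Phi>_smooth p line_has_vector_derivative]) simp
  from bounded_linear.has_vector_derivative[OF bounded_linear_vec_nth this, of i]
  have d: "((%t. \<Phi> (\<mu>,x,0,w + t *R e) $ i) hvd dw (\<mu>,x,0,w) e $ i) (at 0)" by simp
  show ?thesis
  proof (rule even_derivative_zero[OF d \<epsilon>(1)])
   fix t assume t: "\<bar>t\<bar> < \<epsilon>"
   show "\<Phi> (\<mu>,x,0,w + (- t) *R e) $ i = \<Phi> (\<mu>,x,0,w + t *R e) $ i"
    using \<Xi>_even[OF t, of i] i_even[of t] by (simp add: \<Phi>_def G_def)
  qed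
 qed
 then have "e = e $ k *R ker (\<mu>,x,0,w)" by (intro ker_props(3)[OF D])
 then have "ker (\<mu>,x,0,w) = e" by simp
 then show ?thesis using dwi by (simp add: crit_def)
qed

end

lemma smooth_on_line_derivative:
 assumes f: "smooth_on D f" "p + t *R v : D"
 shows "((%t. f (p + t *R v)) hvd FD f (p + t *R v) v) (at t)"
 using vector_derivative_diff_chain_within[OF line_has_vector_derivative, of f _ p t v UNIV]
  has_derivative_at_withinI[OF smooth_on_has_derivative[OF f]] by (simp add: o_def)

lemma smooth_on_line_derivative_nth:
 assumes f: "smooth_on D f" "p + t *R v : D"
 shows "((%t. f (p + t *R v) $ i) has_real_derivative FD f (p + t *R v) v $ i) (at t)"
 using bounded_linear.has_vector_derivative[OF bounded_linear_vec_nth smooth_on_line_derivative[OF f]]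
 by (simp add: has_real_derivative_iff_has_vector_derivative)

lemma slice_frechet_derivative:
 fixes f :: "real \<times> 'a::euclidean_space \<times> real \<times> 'b::euclidean_space => 'c::real_normed_vector"
 assumes "smooth_on D f" "(\<mu>,x,s,w) : D"
 shows "FD (%w. f (\<mu>,x,s,w)) w v = FD f (\<mu>,x,s,w) (0,0,0,v)"
proof -
 have "((%w. f (\<mu>,x,s,w)) has_derivative (%v. FD f (\<mu>,x,s,w) (0,0,0,v))) (at w)"
  by (rule has_derivative_compose[where f = "%w. (\<mu>,x,s,w)", OF _ smooth_on_has_derivative[OF assms]])
   (auto intro!: derivative_eq_intros simp: zero_prod_def)
 from fun_cong[OF frechet_derivative_at[OF this], of v] show ?thesis by (rule sym)
qed

lemma slice_smooth_on:
 fixes f :: "real \<times> 'a::euclidean_space \<times> real \<times> 'b::euclidean_space => 'c::real_normed_vector"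
 assumes "smooth_on D f" "open D" "open U" "!!w. w : U ==> (\<mu>,x,s,w) : D"
 shows "smooth_on U (%w. f (\<mu>,x,s,w))"
 by (rule smooth_on_compose[OF assms(3,2) _ assms(1)]) (auto intro!: smooth_intros assms(3,4))

lemma norm_convex_combination_le:
 assumes "norm (u :: 'a::real_normed_vector) <= R" "norm v <= R" "\<tau> : {0..1}"
 shows "norm (u + \<tau> *R (v - u)) <= R"
proof -
 have "u + \<tau> *R (v - u) = (1 - \<tau>) *R u + \<tau> *R v" by (simp add: algebra_simps)
 then show ?thesis
  using convexD_alt[OF convex_cball[of 0 R], of u v \<tau>] assms by simp
qed

lemma norm_x_part_le: "norm (x_part k w) <= norm w"
 by (rule norm_le_componentwise_cart) (simp add: x_part_nth)

section \<open>Estimates that hold uniformly for small \<mu>\<close>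

context seifert_box
begin

lemma compact_tube:
 assumes "compact T"
 shows "compact (Wc \<times> {0..1::real} \<times> T)"
 by (intro compact_Times Wc(1) compact_Icc assms)

lemma compact_param:
 fixes g :: "real \<times> (real^'n) \<times> real \<times> (real^'n) => real"
 assumes g: "continuous_on D g" and R: "R < r"
  and pos: "!!x s w. x : Wc ==> s : {0..1} ==> norm w <= R ==> 0 < g (0,x,s,w)"
 obtains d where "0 < d"
  "!!\<mu> x s w. \<bar>\<mu>\<bar> < d ==> x : Wc ==> s : {0..1} ==> norm w <= R ==> (\<mu>,x,s,w) : D & 0 < g (\<mu>,x,s,w)"
proof -
 let ?Q = "Wc \<times> {0..1::real} \<times> cball (0::real^'n) R"
 have Q: "{0} \<times> ?Q <= D"
 proof clarify
  fix x s w assume "x : Wc" "s : {0..1::real}" "w : cball (0::real^'n) R"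
  then show "(0,x,s,w) : D" using R \<mu>1 by (intro slice_D(1) slice_in_B) auto
 qed
 obtain d where d: "0 < d" "!!\<mu> q. \<bar>\<mu>\<bar> < d ==> q : ?Q ==> (\<mu>,q) : D & 0 < g (\<mu>,q)"
  by (rule compact_positive_neighbourhood[OF D_open g compact_tube[OF compact_cball] Q]) (use pos in auto)
 show ?thesis
 proof (rule that[OF d(1)])
  fix \<mu> s :: real and x w :: "real^'n" assume "\<bar>\<mu>\<bar> < d" "x : Wc" "s : {0..1}" "norm w <= R"
  then show "(\<mu>,x,s,w) : D & 0 < g (\<mu>,x,s,w)" using d(2)[of \<mu> "(x,s,w)"] by simp
 qed
qed

lemma hess_continuous: "continuous_on (B \<times> UNIV) (%z. hess (fst z) (snd z) $ i)"
proof -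
 have "continuous_on (B \<times> UNIV) (%z::(real \<times> (real^'n) \<times> real \<times> (real^'n)) \<times> (real^'n).
   FD (%p. dw p (axis i 1)) (fst z) (0,0,0,axis j 1))" for i j
  by (rule continuous_on_compose2[OF smooth_on_continuous_on[OF smooth_on_frechet_derivative[OF smooth_on_frechet_derivative[OF \<Phi>_smooth]]]
    continuous_on_fst[OF continuous_on_id]]) auto
 then show ?thesis unfolding hess_def by (intro continuous_intros)
qed

text \<open>At \<mu> = 0 the map \<xi> is linear, so its Hessian vanishes whatever the multipliers
  are, and that of \<eta> is K(v, v) / (2 h) >= c0 / 2. The multipliers are taken at an independent
  point w', because the expansion at w' is compared with second derivatives along the whole segment
  to another point.\<close>

lemma hess_positive:
 assumes R: "R < r" and c0: "0 < c0" "!!x w. x : Wc ==> c0 * (norm w)\<^sup>2 * K x $ k $ k <= w \<bullet> (K x *v w)"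
 obtains d where "0 < d"
  "!!\<mu> x s w w' v. \<bar>\<mu>\<bar> < d ==> x : Wc ==> s : {0..1} ==> norm w <= R ==> norm w' <= R ==> norm v = 1 ==>
   c0 / 4 < hess (\<mu>,x,s,w) v $ k - (\<Sum>i\<in>- {k}. cof (\<mu>,x,s,w') i * hess (\<mu>,x,s,w) v $ i) &
   c0 / 4 < hess (\<mu>,x,s,w) v $ k"
proof -
 let ?pA = "%(\<mu>::real,x::real^'n,s::real,w::real^'n,w'::real^'n,v::real^'n). (\<mu>,x,s,w)"
 let ?pB = "%(\<mu>::real,x::real^'n,s::real,w::real^'n,w'::real^'n,v::real^'n). (\<mu>,x,s,w')"
 let ?v = "%(\<mu>::real,x::real^'n,s::real,w::real^'n,w'::real^'n,v::real^'n). v"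
 let ?D = "?pA -` D \<inter> ?pB -` D"
 let ?Q = "Wc \<times> {0..1::real} \<times> cball (0::real^'n) R \<times> cball (0::real^'n) R \<times> sphere (0::real^'n) 1"
 let ?g = "%z. min (hess (?pA z) (?v z) $ k - (\<Sum>i\<in>- {k}. cof (?pB z) i * hess (?pA z) (?v z) $ i)) (hess (?pA z) (?v z) $ k) - c0 / 4"
 have c: "continuous_on UNIV ?pA" "continuous_on UNIV ?pB" "continuous_on UNIV ?v"
  by (simp_all add: case_prod_unfold) (intro continuous_intros)+
 have op: "open ?D" using c(1,2) D_open by (intro open_Int open_vimage)
 have h: "continuous_on ?D (%z. hess (?pA z) (?v z) $ i)" for i
 proof -
  have "continuous_on ?D (%z. hess (fst (?pA z,?v z)) (snd (?pA z,?v z)) $ i)"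
   by (rule continuous_on_compose2[OF hess_continuous])
    (use D_B in \<open>auto intro!: continuous_on_Pair continuous_on_subset[OF c(1)] continuous_on_subset[OF c(3)]\<close>)
  then show ?thesis by simp
 qed
 have l: "continuous_on ?D (%z. cof (?pB z) i)" for i
  by (rule continuous_on_compose2[OF smooth_on_continuous_on[OF cof_smooth] continuous_on_subset[OF c(2)]]) auto
 have g: "continuous_on ?D ?g" by (intro continuous_intros h l)
 have Q: "compact ?Q" by (intro compact_tube compact_Times compact_cball compact_sphere)
 have inB: "(0,x,s,w) : B" if "x : Wc" "s : {0..1}" "norm w <= R" for x s w
  using that R \<mu>1 by (intro slice_in_B) auto
 have QD: "{0} \<times> ?Q <= ?D" using slice_D(1)[OF _ inB] by auto
 have base_pos: "c0 / 4 < (v \<bullet> (K x *v v)) / (2 * K x $ k $ k)" if "x : Wc" "norm v = 1" for x v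
 proof -
  have h: "0 < K x $ k $ k" using Kkk_pos Wc(2) that by blast
  have "c0 * K x $ k $ k <= v \<bullet> (K x *v v)" using c0(2)[OF that(1), of v] that(2) by simp
  moreover have "0 < c0 * K x $ k $ k" using h c0 by simp
  ultimately show ?thesis using h by (simp add: field_simps)
 qed
 have gpos: "0 < ?g (0,q)" if "q : ?Q" for q
 proof -
  obtain x s w w' v where q': "q = (x,s,w,w',v)" by (cases q) auto
  then have q: "q = (x,s,w,w',v)" "x : Wc" "s : {0..1}" "norm w <= R" "norm w' <= R" "norm v = 1"
   using that by auto
  note hs = hess_slice[OF q(2) inB[OF q(2-4)]]
  have "(\<Sum>i\<in>- {k}. cof (0,x,s,w') i * hess (0,x,s,w) v $ i) = 0"
   by (intro sum.neutral ballI) (simp add: hs)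
  then show ?thesis using base_pos[OF q(2,6)] by (simp add: q(1) hs)
 qed
 obtain d2 where d2: "0 < d2" "!!\<mu> q. \<bar>\<mu>\<bar> < d2 ==> q : ?Q ==> (\<mu>,q) : ?D & 0 < ?g (\<mu>,q)"
 proof (rule compact_positive_neighbourhood[OF op g Q QD gpos], assumption, goal_cases)
  case (1 d)
  show ?case by (rule 1(1)[OF 1(2,3)])
 qed
 show ?thesis
 proof (rule that[OF d2(1)])
  fix \<mu> s :: real and x w w' v :: "real^'n" assume *: "\<bar>\<mu>\<bar> < d2" "x : Wc" "s : {0..1::real}" "norm w <= R" "norm w' <= R" "norm (v :: real^'n) = 1"
  then have "(x,s,w,w',v) : ?Q" by simp
  then show "c0 / 4 < hess (\<mu>,x,s,w) v $ k - (\<Sum>i\<in>- {k}. cof (\<mu>,x,s,w') i * hess (\<mu>,x,s,w) v $ i) &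
   c0 / 4 < hess (\<mu>,x,s,w) v $ k"
   using d2(2)[of \<mu> "(x,s,w,w',v)"] *(1) by simp
 qed
qed

lemma height_outside:
 assumes R: "R < r" and out: "!!x s w. x : Wc ==> s : {0..1} ==> norm w = R ==>
   1 < s\<^sup>2 + s * w $ k + (w \<bullet> (K x *v w)) / (4 * K x $ k $ k)"
 obtains d where "0 < d" "!!\<mu> x s w. \<bar>\<mu>\<bar> < d ==> x : Wc ==> s : {0..1} ==> norm w = R ==> 1 < \<Phi> (\<mu>,x,s,w) $ k"
proof -
 let ?Q = "Wc \<times> {0..1::real} \<times> sphere (0::real^'n) R"
 let ?f = "%p. \<Phi> p $ k - 1"
 have f: "continuous_on B ?f" by (intro continuous_intros smooth_on_continuous_on[OF \<Phi>_smooth])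
 have inB: "(0,x,s,w) : B" if "x : Wc" "s : {0..1}" "norm w = R" for x s w
  using that R \<mu>1 by (intro slice_in_B) auto
 then have QB: "{0} \<times> ?Q <= B" by auto
 have pos: "0 < ?f (0,q)" if "q : ?Q" for q
 proof -
  obtain x s w where q': "q = (x,s,w)" by (cases q) auto
  then have q: "q = (x,s,w)" "x : Wc" "s : {0..1}" "norm w = R" using that by auto
  then show ?thesis using out[OF q(2-4)] \<Phi>_slice[OF q(2) inB[OF q(2-4)], of k] by simp
 qed
 obtain d where d: "0 < d" "!!\<mu> q. \<bar>\<mu>\<bar> < d ==> q : ?Q ==> (\<mu>,q) : B & 0 < ?f (\<mu>,q)"
 proof (rule compact_positive_neighbourhood[OF B_open f compact_tube[OF compact_sphere] QB pos], assumption, goal_cases)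
  case (1 d)
  show ?case by (rule 1(1)[OF 1(2,3)])
 qed
 show ?thesis
 proof (rule that[OF d(1)])
  fix \<mu> s :: real and x w :: "real^'n" assume "\<bar>\<mu>\<bar> < d" "x : Wc" "s : {0..1}" "norm w = R"
  then show "1 < \<Phi> (\<mu>,x,s,w) $ k" using d(2)[of \<mu> "(x,s,w)"] by simp
 qed
qed

abbreviation "dcrit p u \<equiv> FD crit p u"
abbreviation "dresid p u \<equiv> FD resid p u"

text \<open>In order of appearance the derivatives at \<mu> = 0 are 1/2, 1 (bounded on both sides),
  1/2, 1 and 0. The margins are chosen to close the numerical estimate in
  \<open>crit_along_ray\<close>.\<close>

definition "crit_ok p \<longleftrightarrow> p : D & 0 < dcrit p (0,0,0,ker p) & 3/4 < dcrit p (0,0,1,0) & dcrit p (0,0,1,0) < 5/4 &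
 3/8 < dcrit p (0,0,0,e) & 3/4 < dresid p (0,0,1,0) & \<bar>dresid p (0,0,0,e)\<bar> < 1/16"

lemma crit_bounds:
 assumes R: "R < r"
 obtains d where "0 < d"
  "!!\<mu> x s w. \<bar>\<mu>\<bar> < d ==> x : Wc ==> s : {0..1} ==> norm w <= R ==> crit_ok (\<mu>,x,s,w)"
proof -
 have inB: "(0,x,s,w) : B" if "x : Wc" "s : {0..1}" "norm w <= R" for x s w
  using that R \<mu>1 by (intro slice_in_B) auto
 note sl = crit_slice_derivative[OF _ inB] resid_slice[OF _ inB] slice_D(2)[OF _ inB]
 have dc: "continuous_on D (%p. dcrit p u)" for u
  by (intro smooth_on_continuous_on smooth_on_frechet_derivative crit_smooth)
 have dck: "continuous_on D (%p. dcrit p (0,0,0,ker p))"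
  by (intro smooth_on_continuous_on smooth_on_frechet_derivative_apply D_open crit_smooth smooth_on_Pair smooth_on_const ker_smooth)
 have dr: "continuous_on D (%p. dresid p u)" for u
  by (intro smooth_on_continuous_on smooth_on_frechet_derivative resid_smooth)
 let ?g = "%p. min (dcrit p (0,0,0,ker p)) (min (dcrit p (0,0,1,0) - 3/4) (min (5/4 - dcrit p (0,0,1,0))
  (min (dcrit p (0,0,0,e) - 3/8) (min (dresid p (0,0,1,0) - 3/4) (1/16 - \<bar>dresid p (0,0,0,e)\<bar>)))))"
 have pos: "0 < ?g (0,x,s,w)" if "x : Wc" "s : {0..1}" "norm w <= R" for x s w
  by (simp add: sl[OF that(1) that])
 have cont: "continuous_on D ?g"
  by (intro continuous_on_min continuous_on_diff continuous_on_rabs continuous_on_const dck dc dr)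
 show ?thesis
 proof (rule compact_param[OF cont R pos], assumption+, goal_cases)
  case (1 d)
  have ok: "crit_ok p" if "p : D & 0 < ?g p" for p using that unfolding crit_ok_def by (elim conjE) auto
  show ?case by (rule that[OF 1(1)], rule ok, rule 1(2))
 qed
qed

text \<open>Made for two uses with \<alpha> = 1: taking for \<beta> the multipliers at w' gives
  convexity relative to the first-order expansion, while \<beta> = 0 and w' = 0 give convexity of
  the height along rays.\<close>

lemma second_order_along_segment:
 assumes Rr: "R < r" and inD: "!!w. norm w <= R ==> (\<mu>,x,s,w) : D"
  and w: "norm w <= R" "norm w' <= R"
  and pos: "!!u v. norm u <= R ==> norm v = 1 ==>
   2 * m <= \<alpha> * (hess (\<mu>,x,s,u) v $ k) - (\<Sum>i\<in>- {k}. \<beta> i * hess (\<mu>,x,s,u) v $ i)"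
 defines "g \<equiv> %t. \<alpha> * (\<Phi> (\<mu>,x,s,w' + t *R (w - w')) $ k) - (\<Sum>i\<in>- {k}. \<beta> i * \<Phi> (\<mu>,x,s,w' + t *R (w - w')) $ i)"
 shows "g 0 + (\<alpha> * (dw (\<mu>,x,s,w') (w - w') $ k) - (\<Sum>i\<in>- {k}. \<beta> i * dw (\<mu>,x,s,w') (w - w') $ i)) + m * (norm (w - w'))\<^sup>2 <= g 1"
  "\<tau> : {0..1} ==> g \<tau> <= (1 - \<tau>) * g 0 + \<tau> * g 1 - m * (norm (w - w'))\<^sup>2 * (\<tau> * (1 - \<tau>))"
proof -
 let ?\<Delta> = "w - w'"
 let ?p = "%t. (\<mu>,x,s,w' + t *R ?\<Delta>)"
 let ?g1 = "%t. \<alpha> * (dw (?p t) ?\<Delta> $ k) - (\<Sum>i\<in>- {k}. \<beta> i * dw (?p t) ?\<Delta> $ i)"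
 let ?g2 = "%t. \<alpha> * (hess (?p t) ?\<Delta> $ k) - (\<Sum>i\<in>- {k}. \<beta> i * hess (?p t) ?\<Delta> $ i)"
 have pl: "?p t = (\<mu>,x,s,w') + t *R (0,0,0,?\<Delta>)" for t by simp
 have nrm: "norm (w' + t *R ?\<Delta>) <= R" if "t : {0..1}" for t by (rule norm_convex_combination_le[OF w(2,1) that])
 have pB: "?p t : B" if "t : {0..1}" for t using inD[OF nrm[OF that]] D_B by blast
 have sm: "smooth_on B (%p. dw p v)" for v by (rule smooth_on_frechet_derivative[OF \<Phi>_smooth])
 have d1: "((%t. \<Phi> (?p t) $ i) has_real_derivative dw (?p t) ?\<Delta> $ i) (at t)" if "t : {0..1}" for t i
  using smooth_on_line_derivative_nth[OF \<Phi>_smooth pB[OF that, unfolded pl]] unfolding pl .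
 have d2: "((%t. dw (?p t) ?\<Delta> $ i) has_real_derivative hess (?p t) ?\<Delta> $ i) (at t)" if "t : {0..1}" for t i
  using smooth_on_line_derivative_nth[OF sm pB[OF that, unfolded pl], of ?\<Delta> i] hess_eq[OF pB[OF that], of ?\<Delta>] by (simp only: pl)
 have D1: "(g has_real_derivative ?g1 t) (at t)" if "t : {0..1}" for t
  unfolding g_def by (intro DERIV_diff DERIV_sum DERIV_cmult d1[OF that])
 have D2: "(?g1 has_real_derivative ?g2 t) (at t)" if "t : {0..1}" for t
  by (intro DERIV_diff DERIV_sum DERIV_cmult d2[OF that])
 have D3: "2 * (m * (norm ?\<Delta>)\<^sup>2) <= ?g2 t" if t: "t : {0..1}" for t
 proof (cases "?\<Delta> = 0")
  case False
  let ?n = "norm ?\<Delta>" and ?u = "w' + t *R ?\<Delta>" and ?v = "?\<Delta> /\<^sub>R norm ?\<Delta>"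
  have "hess p (c *R v) $ i = c\<^sup>2 * hess p v $ i" for p c v i
   by (simp add: hess_def sum_distrib_left power2_eq_square mult_ac)
  from this[of _ ?n ?v] have h: "hess (?p t) ?\<Delta> $ i = ?n\<^sup>2 * hess (?p t) ?v $ i" for i
   using False by simp
  have "2 * m <= \<alpha> * (hess (?p t) ?v $ k) - (\<Sum>i\<in>- {k}. \<beta> i * hess (?p t) ?v $ i)"
   using pos[OF nrm[OF t], of ?v] False by simp
  then have "?n\<^sup>2 * (2 * m) <= ?n\<^sup>2 * (\<alpha> * (hess (?p t) ?v $ k) - (\<Sum>i\<in>- {k}. \<beta> i * hess (?p t) ?v $ i))"
   by (intro mult_left_mono) auto
  also have "\<dots> = ?g2 t" by (simp only: h right_diff_distrib sum_distrib_left mult.left_commute)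
  finally show ?thesis by (simp add: mult_ac)
 qed (simp add: hess_def)
 show "g 0 + (\<alpha> * (dw (\<mu>,x,s,w') ?\<Delta> $ k) - (\<Sum>i\<in>- {k}. \<beta> i * dw (\<mu>,x,s,w') ?\<Delta> $ i)) + m * (norm ?\<Delta>)\<^sup>2 <= g 1"
  using second_order_lower_bound(1)[OF D1 D2 D3] by simp
 show "\<tau> : {0..1} ==> g \<tau> <= (1 - \<tau>) * g 0 + \<tau> * g 1 - m * (norm ?\<Delta>)\<^sup>2 * (\<tau> * (1 - \<tau>))"
  by (rule second_order_lower_bound(2)[OF D1 D2 D3])
qed

text \<open>At \<mu> = 0 both conclusions have a margin of order s only, so positivity on a compact
  set cannot give them. Instead \<open>crit\<close> and \<open>resid\<close> are compared with their
  exact zeros at s = 0, w_k = 0 by the mean value theorem, where derivatives with fixed margins are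
  multiplied by s and w_k.\<close>

lemma crit_along_ray:
 assumes Rr: "R < r" and \<mu>: "0 < \<mu>" "\<mu> < \<mu>1" and x: "x : Wc" and s: "0 < s" "s <= 1" and w: "norm w <= R"
  and bd: "!!s w. s : {0..1} ==> norm w <= R ==> crit_ok (\<mu>,x,s,w)"
 shows "0 <= w $ k ==> 0 < crit (\<mu>,x,s,w)"
  "crit (\<mu>,x,s,w) = 0 ==> dcrit (\<mu>,x,s,w) (0,0,0,w) < 0"
proof -
 \<comment> \<open>The segment from s = 0 and the horizontal part of w to (s, w), along which only s
   and w_k change.\<close>
 let ?p = "%\<tau>. (\<mu>,x,0,x_part k w) + \<tau> *R (0,0,s,w $ k *R e)"
 have p1: "?p 1 = (\<mu>,x,s,w)" by (simp add: x_part_def)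
 have wx: "norm (x_part k w) <= R" using norm_x_part_le[of k w] w by linarith
 have in_range: "\<tau> * s : {0..1}" "norm (x_part k w + (\<tau> * w $ k) *R e) <= R" if "\<tau> : {0..1}" for \<tau>
 proof -
  show "\<tau> * s : {0..1}" using that s by (auto intro: mult_le_one)
  have "x_part k w + (\<tau> * w $ k) *R e = x_part k w + \<tau> *R (w - x_part k w)" by (simp add: x_part_def)
  then show "norm (x_part k w + (\<tau> * w $ k) *R e) <= R" using norm_convex_combination_le[OF wx w that] by simp
 qed
 have pD: "?p \<tau> : D" if "\<tau> : {0..1}" for \<tau> using bd[OF in_range[OF that]] by (simp add: crit_ok_def)
 have mvt: "\<exists>\<tau>\<in>{0..1}. f (\<mu>,x,s,w) - f (\<mu>,x,0,x_part k w)
   = s * FD f (?p \<tau>) (0,0,1,0) + w $ k * FD f (?p \<tau>) (0,0,0,e)"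
  if f: "smooth_on D f" for f :: "real \<times> (real^'n) \<times> real \<times> (real^'n) => real"
 proof -
  have "\<exists>\<tau>>0. \<tau> < 1 & f (?p 1) - f (?p 0) = (1 - 0) * FD f (?p \<tau>) (0,0,s,w $ k *R e)"
  proof (rule MVT2)
   fix \<tau> :: real assume "0 <= \<tau>" "\<tau> <= 1"
   then have "?p \<tau> : D" using pD by simp
   from smooth_on_line_derivative[OF f this]
   show "((%\<tau>. f (?p \<tau>)) has_real_derivative FD f (?p \<tau>) (0,0,s,w $ k *R e)) (at \<tau>)"
    by (simp add: has_real_derivative_iff_has_vector_derivative)
  qed simp
  then obtain \<tau> where "0 < \<tau>" "\<tau> < 1" "f (?p 1) - f (?p 0) = (1 - 0) * FD f (?p \<tau>) (0,0,s,w $ k *R e)"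
   by blast
  then have \<tau>: "\<tau> : {0..1}" "f (?p 1) - f (?p 0) = FD f (?p \<tau>) (0,0,s,w $ k *R e)"
   by simp_all
  have lin: "linear (FD f (?p \<tau>))" by (rule smooth_on_linear_derivative[OF f pD[OF \<tau>(1)]])
  have eq: "(0::real,0::real^'n,s,w $ k *R e) = s *R (0,0,1,0) + w $ k *R (0,0,0,e)" by simp
  have "FD f (?p \<tau>) (0,0,s,w $ k *R e)
    = FD f (?p \<tau>) (s *R (0,0,1,0) + w $ k *R (0,0,0,e))" by (rule arg_cong[OF eq])
  also have "\<dots> = s * FD f (?p \<tau>) (0,0,1,0) + w $ k * FD f (?p \<tau>) (0,0,0,e)"
   by (simp only: linear_add[OF lin] linear_scale[OF lin] real_scaleR_def)
  finally have "f (?p 1) - f (?p 0) = s * FD f (?p \<tau>) (0,0,1,0) + w $ k * FD f (?p \<tau>) (0,0,0,e)"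
   using \<tau>(2) by (rule trans[rotated])
  then show ?thesis using \<tau>(1) p1 by (intro bexI[of _ \<tau>]) simp_all
 qed
 have xk: "x_part k w $ k = 0" by (simp add: x_part_nth)
 have p0D: "(\<mu>,x,0,x_part k w) : D" using bd[of 0 "x_part k w"] wx by (simp add: crit_ok_def)
 have c0: "crit (\<mu>,x,0,x_part k w) = 0"
  using crit_zero[OF \<mu> x _ xk p0D] wx Rr by linarith
 have dc0: "dcrit (\<mu>,x,0,x_part k w) (0,0,0,x_part k w) = 0"
 proof (rule slice_derivative[OF crit_smooth D_open p0D refl])
  have T: "open ((%t::real. (\<mu>,x,0::real,x_part k w + t *R x_part k w)) -` D)" (is "open ?T")
   by (rule open_vimage[OF D_open]) (intro continuous_intros)
  show "((%t. crit (\<mu>,x,0 + t * 0,x_part k w + t *R x_part k w)) hvd 0) (at 0)"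
  proof (rule has_vector_derivative_transform_within_open[OF has_vector_derivative_const[of 0] T])
   show "0 : ?T" using p0D by simp
   fix t assume "t : ?T"
   then have tD: "(\<mu>,x,0,x_part k w + t *R x_part k w) : D" by simp
   then have "norm (x_part k w + t *R x_part k w) < r" using D_B by (auto simp: B_def)
   from crit_zero[OF \<mu> x this _ tD] xk
   show "0 = crit (\<mu>,x,0 + t * 0,x_part k w + t *R x_part k w)" by simp
  qed
 qed
 have r0: "resid (\<mu>,x,0,x_part k w) = 0" by (simp add: resid_def c0 dc0)
 obtain \<tau> where \<tau>: "\<tau> : {0..1}" and cr: "crit (\<mu>,x,s,w) = s * dcrit (?p \<tau>) (0,0,1,0) + w $ k * dcrit (?p \<tau>) (0,0,0,e)"
  using mvt[OF crit_smooth] c0 by auto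
 have b: "3/4 < dcrit (?p \<tau>) (0,0,1,0)" "dcrit (?p \<tau>) (0,0,1,0) < 5/4" "3/8 < dcrit (?p \<tau>) (0,0,0,e)"
  using bd[OF in_range[OF \<tau>]] by (auto simp: crit_ok_def)
 show "0 < crit (\<mu>,x,s,w)" if "0 <= w $ k"
  unfolding cr using b s that by (intro add_pos_nonneg mult_pos_pos mult_nonneg_nonneg) linarith+
 assume z: "crit (\<mu>,x,s,w) = 0"
 \<comment> \<open>At a zero of \<open>crit\<close> the contributions of s and w_k cancel, so w_k is
   of order s; the constant is (5/4) / (3/8) = 10/3.\<close>
 have wk: "\<bar>w $ k\<bar> <= 10/3 * s"
 proof -
  have "\<bar>w $ k\<bar> * (3/8) <= \<bar>w $ k\<bar> * dcrit (?p \<tau>) (0,0,0,e)" using b by (intro mult_left_mono) auto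
  also have "\<dots> = \<bar>w $ k * dcrit (?p \<tau>) (0,0,0,e)\<bar>" using b by (simp add: abs_mult)
  also have "w $ k * dcrit (?p \<tau>) (0,0,0,e) = - (s * dcrit (?p \<tau>) (0,0,1,0))" using cr z by linarith
  also have "\<bar>- (s * dcrit (?p \<tau>) (0,0,1,0))\<bar> = s * dcrit (?p \<tau>) (0,0,1,0)" using b s by (simp add: abs_mult)
  also have "\<dots> <= s * (5/4)" using b s by (intro mult_left_mono) auto
  finally show ?thesis by (simp add: field_simps)
 qed
 obtain \<tau>' where \<tau>': "\<tau>' : {0..1}" and rs: "resid (\<mu>,x,s,w) = s * dresid (?p \<tau>') (0,0,1,0) + w $ k * dresid (?p \<tau>') (0,0,0,e)"
  using mvt[OF resid_smooth] r0 by auto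
 have b': "3/4 < dresid (?p \<tau>') (0,0,1,0)" "\<bar>dresid (?p \<tau>') (0,0,0,e)\<bar> < 1/16"
  using bd[OF in_range[OF \<tau>']] by (auto simp: crit_ok_def)
 define A1 A2 where "A1 = s * dresid (?p \<tau>') (0,0,1,0)" and "A2 = w $ k * dresid (?p \<tau>') (0,0,0,e)"
 \<comment> \<open>The product of 10/3 and 1/16 is 5/24, smaller than 3/4, so the term with s
   dominates.\<close>
 have "\<bar>A2\<bar> <= (10/3 * s) * (1/16)"
  unfolding A2_def abs_mult using wk b' s by (intro mult_mono) auto
 then have "24 * \<bar>A2\<bar> <= 5 * s" by (simp add: field_simps)
 moreover have "s * (3/4) <= A1" unfolding A1_def using b' s by (intro mult_left_mono) auto
 then have "3 * s <= 4 * A1" by (simp add: field_simps)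
 moreover have "resid (\<mu>,x,s,w) = A1 + A2" unfolding A1_def A2_def by (rule rs)
 ultimately have "0 < resid (\<mu>,x,s,w)" using s by (simp add: abs_if split: if_splits)
 then show "dcrit (\<mu>,x,s,w) (0,0,0,w) < 0" using z by (simp add: resid_def)
qed

text \<open>The constant c0 / 8 is half of the Hessian bound c0 / 4, the half being that of the
  second-order Taylor term.\<close>

lemma fold_map_of_box:
 assumes R: "0 < R" "r = R + 1"
  and c0: "0 < c0" "!!x w. x : Wc ==> c0 * (norm w)\<^sup>2 * K x $ k $ k <= w \<bullet> (K x *v w)"
  and out: "!!x s w. x : Wc ==> s : {0..1} ==> norm w = R ==>
   1 < s\<^sup>2 + s * w $ k + (w \<bullet> (K x *v w)) / (4 * K x $ k $ k)"
 obtains \<mu>0 where "0 < \<mu>0" "\<mu>0 < \<mu>1" "!!\<mu> x s. 0 < \<mu> ==> \<mu> <= \<mu>0 ==> x : Wc ==> 0 < s ==> s <= 1 ==>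
   fold_map k R (c0 / 8) s (%w. \<Phi> (\<mu>,x,s,w)) (%w. ker (\<mu>,x,s,w)) (%w. cof (\<mu>,x,s,w)) (%w. crit (\<mu>,x,s,w))"
proof -
 have Rr: "R < r" using R by simp
 obtain d1 where d1: "0 < d1"
  "!!\<mu> x s w. \<bar>\<mu>\<bar> < d1 ==> x : Wc ==> s : {0..1} ==> norm w <= R ==> crit_ok (\<mu>,x,s,w)"
  by (rule crit_bounds[OF Rr]) blast
 obtain d2 where d2: "0 < d2"
  "!!\<mu> x s w w' v. \<bar>\<mu>\<bar> < d2 ==> x : Wc ==> s : {0..1} ==> norm w <= R ==> norm w' <= R ==> norm v = 1 ==>
   c0 / 4 < hess (\<mu>,x,s,w) v $ k - (\<Sum>i\<in>- {k}. cof (\<mu>,x,s,w') i * hess (\<mu>,x,s,w) v $ i) &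
   c0 / 4 < hess (\<mu>,x,s,w) v $ k"
 proof (rule hess_positive[OF Rr c0], assumption, goal_cases)
  case (1 d)
  show ?case by (rule 1(1)[OF 1(2,3)])
 qed
 obtain d3 where d3: "0 < d3" "!!\<mu> x s w. \<bar>\<mu>\<bar> < d3 ==> x : Wc ==> s : {0..1} ==> norm w = R ==> 1 < \<Phi> (\<mu>,x,s,w) $ k"
  by (rule height_outside[OF Rr out]) blast+
 let ?\<mu>0 = "min (min d1 d2) (min d3 \<mu>1) / 2"
 show ?thesis
 proof (rule that[of ?\<mu>0])
  show "0 < ?\<mu>0" "?\<mu>0 < \<mu>1" using d1(1) d2(1) d3(1) \<mu>1 by (auto simp: min_def)
  fix \<mu> x s assume \<mu>: "0 < \<mu>" "\<mu> <= ?\<mu>0" and x: "x : Wc" and s: "0 < s" "s <= (1::real)"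
  have m: "\<bar>\<mu>\<bar> < d1" "\<bar>\<mu>\<bar> < d2" "\<bar>\<mu>\<bar> < d3" "\<mu> < \<mu>1"
   using \<mu> d1(1) d2(1) d3(1) \<mu>1 by (auto simp: min_def split: if_splits)
  have s01: "s : {0..1}" using s by simp
  note bd = d1(2)[OF m(1) x]
  have inD: "(\<mu>,x,s,w) : D" if "norm w <= R" for w using bd[OF s01 that] unfolding crit_ok_def by blast
  have inB: "(\<mu>,x,s,w) : B" if "norm w < r" for w using m \<mu> x s that by (intro slice_in_B) auto
  have d\<Phi>: "FD (%w. \<Phi> (\<mu>,x,s,w)) w v = dw (\<mu>,x,s,w) v" if "norm w <= R" for w v
   by (rule slice_frechet_derivative[OF \<Phi>_smooth inB]) (use that Rr in simp)
  have d\<kappa>: "FD (%w. crit (\<mu>,x,s,w)) w v = dcrit (\<mu>,x,s,w) (0,0,0,v)" if "norm w <= R" for w v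
   by (rule slice_frechet_derivative[OF crit_smooth inD[OF that]])
  note ray = crit_along_ray[OF Rr \<mu>(1) m(4) x s]
  show "fold_map k R (c0 / 8) s (%w. \<Phi> (\<mu>,x,s,w)) (%w. ker (\<mu>,x,s,w)) (%w. cof (\<mu>,x,s,w)) (%w. crit (\<mu>,x,s,w))"
  proof
   show "0 < R" "0 < c0 / 8" "0 < s" "s <= 1" using R c0 s by auto
   show "smooth_on (ball 0 (R + 1)) (%w. \<Phi> (\<mu>,x,s,w))"
    by (rule slice_smooth_on[OF \<Phi>_smooth B_open open_ball]) (use inB R in simp)
   have "open ((%w. (\<mu>,x,s,w)) -` D)" by (rule open_vimage[OF D_open]) (intro continuous_intros)
   moreover have "cball 0 R <= (%w. (\<mu>,x,s,w)) -` D" using inD by auto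
   moreover have "smooth_on ((%w. (\<mu>,x,s,w)) -` D) (%w. crit (\<mu>,x,s,w))"
    by (rule slice_smooth_on[OF crit_smooth D_open calculation(1)]) simp
   ultimately show "\<exists>U. open U & cball 0 R <= U & smooth_on U (%w. crit (\<mu>,x,s,w))" by blast
   show "FD (%w. \<Phi> (\<mu>,x,s,w)) w (ker (\<mu>,x,s,w)) $ i = 0" if "norm w <= R" "i ~= k" for w i
    using ker_props(1)[OF inD] that by (simp add: d\<Phi>)
   show "ker (\<mu>,x,s,w) $ k = 1" if "norm w <= R" for w using ker_props(2)[OF inD] that by simp
   show "v = v $ k *R ker (\<mu>,x,s,w)"
    if "norm w <= R" "!!i. i ~= k ==> FD (%w. \<Phi> (\<mu>,x,s,w)) w v $ i = 0" for w v
    using ker_props(3)[OF inD[OF that(1)]] that(2) by (simp add: d\<Phi>[OF that(1)])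
   show "FD (%w. \<Phi> (\<mu>,x,s,w)) w v $ k =
    (\<Sum>i\<in>- {k}. cof (\<mu>,x,s,w) i * FD (%w. \<Phi> (\<mu>,x,s,w)) w v $ i) + crit (\<mu>,x,s,w) * v $ k"
    if "norm w <= R" for w v
    unfolding d\<Phi>[OF that] by (rule height_differential[OF inD[OF that]])
   show "0 < FD (%w. crit (\<mu>,x,s,w)) w (ker (\<mu>,x,s,w))" if "norm w <= R" for w
    unfolding d\<kappa>[OF that] using bd[OF s01 that] unfolding crit_ok_def by blast
   show "\<Phi> (\<mu>,x,s,w') $ k + (\<Sum>i\<in>- {k}. cof (\<mu>,x,s,w') i * (\<Phi> (\<mu>,x,s,w) $ i - \<Phi> (\<mu>,x,s,w') $ i)) +
     crit (\<mu>,x,s,w') * (w - w') $ k + c0 / 8 * (norm (w - w'))\<^sup>2 <= \<Phi> (\<mu>,x,s,w) $ k"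
    if w: "norm w <= R" and w': "norm w' <= R" for w w'
   proof -
    have "2 * (c0 / 8) <= 1 * (hess (\<mu>,x,s,u) v $ k) - (\<Sum>i\<in>- {k}. cof (\<mu>,x,s,w') i * hess (\<mu>,x,s,u) v $ i)"
     if "norm u <= R" "norm v = 1" for u v using d2(2)[OF m(2) x s01 that(1) w' that(2)] by simp
    from second_order_along_segment(1)[where \<alpha> = 1, OF Rr inD w w' this] height_differential[OF inD[OF w'], of "w - w'"]
    show ?thesis by (simp add: right_diff_distrib sum_subtractf)
   qed
   show "\<Phi> (\<mu>,x,s,\<tau> *R w) $ k <= (1 - \<tau>) * \<Phi> (\<mu>,x,s,0) $ k + \<tau> * \<Phi> (\<mu>,x,s,w) $ k - c0 / 8 * (norm w)\<^sup>2 * (\<tau> * (1 - \<tau>))"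
    if w: "norm w <= R" and \<tau>: "\<tau> : {0..1}" for w \<tau>
   proof -
    have "2 * (c0 / 8) <= 1 * (hess (\<mu>,x,s,u) v $ k) - (\<Sum>i\<in>- {k}. 0 * hess (\<mu>,x,s,u) v $ i)"
     if "norm u <= R" "norm v = 1" for u v using d2(2)[OF m(2) x s01 that(1) that(1) that(2)] by simp
    from second_order_along_segment(2)[where \<alpha> = 1 and \<beta> = "%_. 0" and w' = 0, OF Rr inD w _ this \<tau>] R
    show ?thesis by simp
   qed
   show "0 < crit (\<mu>,x,s,w)" if "norm w <= R" "0 <= w $ k" for w
    by (rule ray(1)[OF that(1) _ that(2)]) (use bd in blast)
   show "FD (%w. crit (\<mu>,x,s,w)) w w < 0" if "norm w <= R" "crit (\<mu>,x,s,w) = 0" for w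
    unfolding d\<kappa>[OF that(1)] by (rule ray(2)[OF that(1) _ that(2)]) (use bd in blast)
   show "1 < \<Phi> (\<mu>,x,s,w) $ k" if "norm w = R" for w by (rule d3(2)[OF m(3) x s01 that])
   show "\<Phi> (\<mu>,x,s,0) = s\<^sup>2 *R e"
   proof -
    have p: "(\<mu>,x,s,0) : B" using inB R by simp
    have "G (\<mu>,x,s,0) = s\<^sup>2 *R e" using G_start(2) p B_Om by blast
    then have *: "(if i = k then \<Phi> (\<mu>,x,s,0) $ i else s * \<Phi> (\<mu>,x,s,0) $ i) = (s\<^sup>2 *R e) $ i" for i
     using arg_cong[OF G_\<Phi>[OF p \<mu>(1) x], of "%g. g $ i"] by simp
    show ?thesis
    proof (simp only: vec_eq_iff, intro allI)
     fix i show "\<Phi> (\<mu>,x,s,0) $ i = (s\<^sup>2 *R e) $ i"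
      using *[of i] s(1) by (cases "i = k") (simp_all add: axis_def)
    qed
   qed
  qed
 qed
qed

end

context seifert
begin

lemma fold_map_exists:
 obtains \<mu>0 R cc \<Phi> a l \<kappa> where "0 < \<mu>0"
  "!!\<mu> x s. 0 < \<mu> ==> \<mu> <= \<mu>0 ==> x : Wc ==> 0 < s ==> s <= 1 ==> fold_map k R cc s (\<Phi> \<mu> x s) (a \<mu> x s) (l \<mu> x s) (\<kappa> \<mu> x s)"
  "!!\<mu> x s w. 0 < \<mu> ==> \<mu> <= \<mu>0 ==> x : Wc ==> 0 < s ==> s <= 1 ==> norm w < R + 1 ==>
   (\<mu>,x,s,w) : Om & G (\<mu>,x,s,w) = (\<chi> i. if i = k then \<Phi> \<mu> x s w $ i else s * \<Phi> \<mu> x s w $ i)"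
proof -
 obtain c0 where c0: "0 < c0" "!!x w. x : Wc ==> c0 * (norm w)\<^sup>2 * K x $ k $ k <= w \<bullet> (K x *v w)"
  by (rule metric_lower_bound) blast
 \<comment> \<open>With c0 R / 4 >= 2 the quadratic term is at least 2 R on the sphere of radius R
   and beats s w_k >= -R; with R >= 8 the height there exceeds 1.\<close>
 define R where "R = 8 / c0 + 8"
 have R: "0 < R" "8 <= R" "2 <= c0 * R / 4" using c0 by (auto simp: R_def field_simps)
 have out: "1 < s\<^sup>2 + s * w $ k + (w \<bullet> (K x *v w)) / (4 * K x $ k $ k)"
  if x: "x : Wc" and s: "s : {0..1}" and w: "norm w = R" for x s w
 proof -
  have h: "0 < K x $ k $ k" using Kkk_pos Wc(2) x by blast
  have "\<bar>s * w $ k\<bar> <= 1 * R"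
   unfolding abs_mult using s component_le_norm_cart[of w k] w by (intro mult_mono) auto
  then have 1: "- R <= s * w $ k" by linarith
  have "c0 * R\<^sup>2 / 4 <= (w \<bullet> (K x *v w)) / (4 * K x $ k $ k)"
   using c0(2)[OF x, of w] w h by (simp add: field_simps)
  moreover have "R * 2 <= R * (c0 * R / 4)" using R by (intro mult_left_mono) auto
  ultimately have "R * 2 <= (w \<bullet> (K x *v w)) / (4 * K x $ k $ k)" by (simp add: power2_eq_square field_simps)
  then show ?thesis using 1 R(2) zero_le_power2[of s] by linarith
 qed
 obtain \<mu>1 N where box: "0 < \<mu>1" "open N" "Wc <= N" "{-\<mu>1<..<\<mu>1} \<times> N \<times> {-2<..<2} \<times> ball 0 (R + 1) <= Om"
  by (rule Om_box)
 obtain \<mu>2 where v: "0 < \<mu>2" "!!\<mu> x w i. 0 < \<mu> ==> \<mu> <= \<mu>2 ==> x : Wc ==> norm w <= R + 1 ==> i ~= k ==>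
   (\<mu>,x,0,w) : Om & G (\<mu>,x,0,w) $ i = 0"
  using vertical_from_boundary[of "R + 1"] by blast
 let ?\<mu> = "min \<mu>1 \<mu>2"
 have "{-?\<mu><..<?\<mu>} \<times> N \<times> {-2<..<2} \<times> ball 0 (R + 1) <= {-\<mu>1<..<\<mu>1} \<times> N \<times> {-2<..<2} \<times> ball 0 (R + 1)"
  by (intro Sigma_mono) auto
 then have sub: "{-?\<mu><..<?\<mu>} \<times> N \<times> {-2<..<2} \<times> ball 0 (R + 1) <= Om" using box(4) by blast
 have \<mu>p: "0 < ?\<mu>" using box v by simp
 obtain \<Xi> where \<Xi>: "smooth_on ({-?\<mu><..<?\<mu>} \<times> N \<times> {-4/3<..<4/3::real} \<times> ball 0 (R + 1)) \<Xi>"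
  "!!\<mu> x s w. (\<mu>,x,s,w) : {-?\<mu><..<?\<mu>} \<times> N \<times> {-4/3<..<4/3::real} \<times> ball 0 (R + 1) ==> G (\<mu>,x,s,w) = G (\<mu>,x,0,w) + s *R \<Xi> (\<mu>,x,s,w)"
  "!!\<mu> x w. (\<mu>,x,0,w) : {-?\<mu><..<?\<mu>} \<times> N \<times> {-4/3<..<4/3::real} \<times> ball 0 (R + 1) ==> \<Xi> (\<mu>,x,0,w) = FD G (\<mu>,x,0,w) (0,0,1,0)"
  by (rule G_divided[OF box(2) \<mu>p sub]) blast
 interpret b: seifert_box S c q0 k W ?\<mu> "R + 1" N \<Xi>
 proof unfold_locales
  fix \<mu> x i and w :: "real^'n" assume "0 < \<mu>" "\<mu> < ?\<mu>" "x : Wc" "norm w <= R + 1" "i ~= k"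
  then show "(\<mu>,x,0,w) : Om & G (\<mu>,x,0,w) $ i = 0" by (intro v(2)) auto
 qed (fact box sub \<mu>p \<Xi>)+
 obtain \<mu>0 where \<mu>0: "0 < \<mu>0" "\<mu>0 < ?\<mu>" "!!\<mu> x s. 0 < \<mu> ==> \<mu> <= \<mu>0 ==> x : Wc ==> 0 < s ==> s <= 1 ==>
   fold_map k R (c0 / 8) s (%w. b.\<Phi> (\<mu>,x,s,w)) (%w. b.ker (\<mu>,x,s,w)) (%w. b.cof (\<mu>,x,s,w)) (%w. b.crit (\<mu>,x,s,w))"
  by (rule b.fold_map_of_box[OF R(1) refl c0 out]) blast+
 show ?thesis
 proof (rule that[OF \<mu>0(1), of R "c0 / 8" "%\<mu> x s w. b.\<Phi> (\<mu>,x,s,w)" "%\<mu> x s w. b.ker (\<mu>,x,s,w)"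
    "%\<mu> x s w. b.cof (\<mu>,x,s,w)" "%\<mu> x s w. b.crit (\<mu>,x,s,w)"])
  fix \<mu> x s assume *: "0 < \<mu>" "\<mu> <= \<mu>0" "x : Wc" "0 < s" "s <= (1::real)"
  show "fold_map k R (c0 / 8) s (%w. b.\<Phi> (\<mu>,x,s,w)) (%w. b.ker (\<mu>,x,s,w)) (%w. b.cof (\<mu>,x,s,w)) (%w. b.crit (\<mu>,x,s,w))"
   by (rule \<mu>0(3)[OF *])
  fix w :: "real^'n" assume w: "norm w < R + 1"
  have p: "(\<mu>,x,s,w) : b.B" using * \<mu>0(2) w by (intro b.slice_in_B) auto
  then show "(\<mu>,x,s,w) : Om & G (\<mu>,x,s,w) = (\<chi> i. if i = k then b.\<Phi> (\<mu>,x,s,w) $ i else s * b.\<Phi> (\<mu>,x,s,w) $ i)"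
   using b.B_Om b.G_\<Phi>[OF p *(1,3)] by blast
 qed
qed

end

section \<open>Geometry of the fold\<close>

lemma tangent_spaceI:
 assumes "0 < \<delta>" "!!t. \<bar>t\<bar> < \<delta> ==> \<alpha> t : X" "\<alpha> (0::real) = z" "(\<alpha> hvd w) (at 0)"
 shows "w : tangent_space X z"
 using assms unfolding tangent_space_def by blast

lemma tangent_spaceE:
 assumes "w : tangent_space X z"
 obtains \<alpha> \<delta> where "0 < \<delta>" "!!t. \<bar>t\<bar> < \<delta> ==> \<alpha> t : X" "\<alpha> (0::real) = z" "(\<alpha> hvd w) (at 0)"
 using assms unfolding tangent_space_def by blast

lemma tangent_space_open:
 assumes "open X" "z : X"
 shows "tangent_space X z = UNIV"
proof (intro set_eqI iffI UNIV_I)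
 fix v
 have "open ((%t::real. z + t *R v) -` X)" by (rule open_vimage[OF assms(1)]) (intro continuous_intros)
 then obtain \<delta> where \<delta>: "0 < \<delta>" "!!t. dist t 0 < \<delta> ==> t : (%t. z + t *R v) -` X"
  using assms(2) by (metis (mono_tags, lifting) add.right_neutral open_dist scaleR_zero_left vimageI)
 show "v : tangent_space X z"
  by (rule tangent_spaceI[OF \<delta>(1) _ _ line_has_vector_derivative[of z v]]) (use \<delta>(2) in auto)
qed

lemma has_vector_derivative_compose_at:
 assumes "(\<alpha> hvd w) (at t)" "(f has_derivative f') (at (\<alpha> t))"
 shows "(f \<circ> \<alpha> hvd f' w) (at t)"
 by (rule vector_derivative_diff_chain_within[OF assms(1) has_derivative_at_withinI[OF assms(2)]])

lemma tangent_space_image_subset: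
 assumes f: "(f has_derivative f') (at z)"
 shows "f' ` tangent_space X z <= tangent_space (f ` X) (f z)"
proof
 fix u assume "u : f' ` tangent_space X z"
 then obtain w where u: "u = f' w" and w: "w : tangent_space X z" by blast
 obtain \<alpha> \<delta> where \<alpha>: "0 < \<delta>" "!!t. \<bar>t\<bar> < \<delta> ==> \<alpha> t : X" "\<alpha> (0::real) = z" "(\<alpha> hvd w) (at 0)"
 proof (rule tangent_spaceE[OF w], goal_cases)
  case (1 \<alpha> \<delta>)
  show ?case by (rule 1(1)[OF 1(2-5)])
 qed
 have d: "(f \<circ> \<alpha> hvd f' w) (at 0)"
  by (rule has_vector_derivative_compose_at[OF \<alpha>(4)]) (simp add: f \<alpha>(3))
 show "u : tangent_space (f ` X) (f z)"
  unfolding u by (rule tangent_spaceI[OF \<alpha>(1) _ _ d]) (simp_all add: \<alpha>(2,3))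
qed

text \<open>Curves in the image are pulled back to X by the differentiable left inverse g, and
  applying f to the result returns the given curve.\<close>

lemma tangent_space_image:
 assumes f: "(f has_derivative f') (at z)" and g: "(g has_derivative g') (at (f z))" and inv: "!!x. x : X ==> g (f x) = x"
  and z: "z : X"
 shows "tangent_space (f ` X) (f z) = f' ` tangent_space X z"
proof
 show "f' ` tangent_space X z <= tangent_space (f ` X) (f z)" by (rule tangent_space_image_subset[OF f])
 show "tangent_space (f ` X) (f z) <= f' ` tangent_space X z"
 proof
  fix u assume u: "u : tangent_space (f ` X) (f z)"
  obtain \<alpha> \<delta> where \<alpha>: "0 < \<delta>" "!!t. \<bar>t\<bar> < \<delta> ==> \<alpha> t : f ` X" "\<alpha> (0::real) = f z" "(\<alpha> hvd u) (at 0)"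
 proof (rule tangent_spaceE[OF u], goal_cases)
  case (1 \<alpha> \<delta>)
  show ?case by (rule 1(1)[OF 1(2-5)])
 qed
  have d: "(g \<circ> \<alpha> hvd g' u) (at 0)"
   by (rule has_vector_derivative_compose_at[OF \<alpha>(4)]) (simp add: g \<alpha>(3))
  have gz: "(g \<circ> \<alpha>) 0 = z" using \<alpha>(3) inv[OF z] by simp
  have "g' u : tangent_space X z"
  proof (rule tangent_spaceI[OF \<alpha>(1) _ gz d])
   fix t assume "\<bar>t\<bar> < \<delta>"
   then obtain y where "y : X" "\<alpha> t = f y" using \<alpha>(2) by blast
   then show "(g \<circ> \<alpha>) t : X" using inv by simp
  qed
  moreover have "f' (g' u) = u"
  proof (rule vector_derivative_unique_at)
   have "(f \<circ> (g \<circ> \<alpha>) hvd f' (g' u)) (at 0)"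
    by (rule has_vector_derivative_compose_at[OF d]) (unfold gz, rule f)
   then show "(\<alpha> hvd f' (g' u)) (at 0)"
   proof (rule has_vector_derivative_transform_within_open)
    show "open {-\<delta><..<\<delta>}" "0 : {-\<delta><..<\<delta>}" using \<alpha>(1) by auto
    fix t assume "t : {-\<delta><..<\<delta>}"
    then have "\<bar>t\<bar> < \<delta>" by (auto simp: abs_less_iff)
    then obtain y where "y : X" "\<alpha> t = f y" using \<alpha>(2) by blast
    then show "(f \<circ> (g \<circ> \<alpha>)) t = \<alpha> t" using inv by simp
   qed
   show "(\<alpha> hvd u) (at 0)" by (rule \<alpha>(4))
  qed
  ultimately show "u : f' ` tangent_space X z" by force
 qed
qed

section \<open>The fold of the perturbed map\<close>

context fold_map
begin

abbreviation "d\<phi> w \<equiv> FD \<phi> w"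
abbreviation "d\<kappa> w \<equiv> FD \<kappa> w"

lemma \<phi>_derivative: "norm w < R + 1 ==> (\<phi> has_derivative d\<phi> w) (at w)"
 by (rule smooth_on_has_derivative[OF smooth(1)]) simp

lemma \<kappa>_derivative: "norm w <= R ==> (\<kappa> has_derivative d\<kappa> w) (at w)"
 using smooth(2) by (metis mem_cball_0 smooth_on_has_derivative subsetD)

lemma linear_d\<phi>: "norm w < R + 1 ==> linear (d\<phi> w)"
 and linear_d\<kappa>: "norm w <= R ==> linear (d\<kappa> w)"
 using \<phi>_derivative \<kappa>_derivative has_derivative_linear by blast+

lemma \<kappa>_continuous: "continuous_on (cball 0 R) \<kappa>"
 using \<kappa>_derivative by (meson continuous_at_imp_continuous_on has_derivative_continuous mem_cball_0)

text \<open>At a zero of \<kappa> and with equal horizontal parts all first-order terms of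
  \<open>above\<close> disappear. So the image of a fold point is strictly lowest on its vertical
  line.\<close>

lemma above_fold:
 assumes "norm w <= R" "norm w' <= R" "\<kappa> w' = 0" "!!i. i ~= k ==> \<phi> w $ i = \<phi> w' $ i"
 shows "\<phi> w' $ k + cc * (norm (w - w'))\<^sup>2 <= \<phi> w $ k"
 using above[OF assms(1,2)] assms(3,4) by simp

lemma fold_point_unique:
 assumes "norm w <= R" "norm w' <= R" "\<kappa> w' = 0" "!!i. i ~= k ==> \<phi> w $ i = \<phi> w' $ i" "\<phi> w $ k <= \<phi> w' $ k"
 shows "w = w'"
proof -
 have "cc * (norm (w - w'))\<^sup>2 <= 0" using above_fold[OF assms(1-4)] assms(5) by linarith
 then show ?thesis using cc by (simp add: mult_le_0_iff)
qed

lemma fold_graph: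
 assumes "norm w <= R" "norm w' <= R" "\<kappa> w = 0" "\<kappa> w' = 0" "!!i. i ~= k ==> \<phi> w $ i = \<phi> w' $ i"
 shows "w = w'"
proof (cases "\<phi> w $ k <= \<phi> w' $ k")
 case True
 show ?thesis by (rule fold_point_unique[OF assms(1,2,4) _ True]) (rule assms(5))
next
 case False
 then show ?thesis using fold_point_unique[OF assms(2,1,3)] assms(5) by force
qed

text \<open>Coordinates that straighten the fold: \<kappa> takes the place of \<eta> beside \<xi>.
  They are regular because d\<kappa> does not vanish on the kernel of d\<xi>.\<close>

definition "\<Theta> w = (\<chi> i. if i = k then \<kappa> w else \<phi> w $ i)"
definition "d\<Theta> w v = (\<chi> i. if i = k then d\<kappa> w v else d\<phi> w v $ i)"

lemma \<Theta>_derivative: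
 assumes "norm w <= R"
 shows "(\<Theta> has_derivative d\<Theta> w) (at w)"
proof -
 have "((%w. \<Theta> w $ i) has_derivative (%v. d\<Theta> w v $ i)) (at w)" for i
  using \<kappa>_derivative[OF assms] bounded_linear.has_derivative[OF bounded_linear_vec_nth \<phi>_derivative] assms
  by (cases "i = k") (simp_all add: \<Theta>_def d\<Theta>_def)
 then have "((%w. \<Theta> w \<bullet> b) has_derivative (%v. d\<Theta> w v \<bullet> b)) (at w)" if "b : Basis" for b
  using that by (auto simp: Basis_vec_def inner_axis)
 then show ?thesis by (subst has_derivative_componentwise_within) simp
qed

lemma d\<Theta>_injective:
 assumes w: "norm w <= R" and v: "d\<Theta> w v = 0"
 shows "v = 0"
proof -
 have c: "(if i = k then d\<kappa> w v else d\<phi> w v $ i) = 0" for i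
  using arg_cong[OF v, of "%u. u $ i"] by (simp add: d\<Theta>_def)
 have va: "v = v $ k *R a w"
  by (rule kernel(3)[OF w]) (use c in \<open>metis\<close>)
 then have "d\<kappa> w v = v $ k * d\<kappa> w (a w)"
  using linear_scale[OF linear_d\<kappa>[OF w], of "v $ k" "a w"] by simp
 then have "v $ k = 0" using c[of k] transverse[OF w] by simp
 then show ?thesis using va by simp
qed

lemma linear_d\<Theta>: "norm w <= R ==> linear (d\<Theta> w)"
 using \<Theta>_derivative has_derivative_linear by blast

lemma d\<Theta>_surjective:
 assumes w: "norm w <= R"
 obtains b where "d\<Theta> w b = u"
proof -
 have "inj (d\<Theta> w)"
  using d\<Theta>_injective[OF w] linear_injective_0[OF linear_d\<Theta>[OF w]] by blast
 then show ?thesis using linear_injective_imp_surjective[OF linear_d\<Theta>[OF w]] that by (metis surjD)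
qed

lemma tangent_decomposition:
 assumes w: "norm w <= R"
 obtains \<alpha> b where "v = \<alpha> *R a w + b" "d\<kappa> w b = 0"
proof (rule that)
 let ?\<alpha> = "d\<kappa> w v / d\<kappa> w (a w)"
 show "v = ?\<alpha> *R a w + (v - ?\<alpha> *R a w)" by simp
 show "d\<kappa> w (v - ?\<alpha> *R a w) = 0"
  using transverse[OF w]
  by (simp only: linear_diff[OF linear_d\<kappa>[OF w]] linear_scale[OF linear_d\<kappa>[OF w]]) simp
qed

lemma d\<phi>_kernel_vector:
 assumes w: "norm w <= R"
 shows "d\<phi> w (a w) = \<kappa> w *R axis k 1"
proof (simp only: vec_eq_iff, intro allI)
 fix i show "d\<phi> w (a w) $ i = (\<kappa> w *R axis k 1) $ i"
  using height[OF w, of "a w"] kernel(1,2)[OF w] by (cases "i = k") (simp_all add: axis_def)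
qed

text \<open>A vector annihilated by d\<phi> lies in the kernel of d\<xi>, hence is a multiple of a,
  and d\<phi> maps a to \<kappa> times the vertical axis.\<close>

lemma fold_iff_singular:
 assumes w: "norm w <= R"
 shows "range (d\<phi> w) ~= UNIV \<longleftrightarrow> \<kappa> w = 0"
proof
 have lin: "linear (d\<phi> w)" using linear_d\<phi> w by simp
 assume "range (d\<phi> w) ~= UNIV"
 then have "\<not> inj (d\<phi> w)" using linear_injective_imp_surjective[OF lin] by blast
 then obtain v where v: "d\<phi> w v = 0" "v ~= 0" using linear_injective_0[OF lin] by blast
 have "v = v $ k *R a w" by (rule kernel(3)[OF w]) (simp add: v(1))
 then have "v $ k ~= 0" using v(2) by (metis scaleR_zero_left)
 then show "\<kappa> w = 0" using height[OF w, of v] v(1) by simp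
next
 have lin: "linear (d\<phi> w)" using linear_d\<phi> w by simp
 assume "\<kappa> w = 0"
 then have "d\<phi> w (a w) = 0" using d\<phi>_kernel_vector[OF w] by simp
 moreover have "a w ~= 0" using kernel(2)[OF w] by auto
 ultimately have "\<not> inj (d\<phi> w)" using linear_injective_0[OF lin] by blast
 then show "range (d\<phi> w) ~= UNIV" using linear_surjective_imp_injective[OF lin] by blast
qed

lemma \<kappa>_start: "0 < \<kappa> 0"
 using \<kappa>_pos[of 0] R by simp

lemma fold_first_on_ray:
 assumes w: "norm w <= R" "\<kappa> w = 0" and \<tau>: "0 <= \<tau>" "\<tau> < 1"
 shows "0 < \<kappa> (\<tau> *R w)"
proof (rule ccontr)
 assume neg: "\<not> 0 < \<kappa> (\<tau> *R w)"
 let ?g = "%t. \<kappa> (t *R w)"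
 have nrm: "norm (t *R w) <= R" if "t : {0..1}" for t
  using that w(1) mult_left_le_one_le[of "norm w" t] by simp
 have cont: "continuous_on {0..1} ?g"
  by (rule continuous_on_compose2[OF \<kappa>_continuous]) (use nrm in \<open>auto intro!: continuous_intros\<close>)
 have deriv: "(?g has_real_derivative d\<kappa> (t *R w) w) (at t)" if "t : {0..1}" for t
 proof -
  have "((%t. t *R w) hvd w) (at t)" using line_has_vector_derivative[of 0 w t UNIV] by simp
  from vector_derivative_diff_chain_within[OF this has_derivative_at_withinI[OF \<kappa>_derivative[OF nrm[OF that]]]]
  show ?thesis by (simp add: o_def has_real_derivative_iff_has_vector_derivative)
 qed
 have dneg: "d\<kappa> (t *R w) w < 0" if t: "t : {0<..1}" "?g t = 0" for t
 proof -
  have t': "t : {0..1}" using t(1) by simp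
  have "d\<kappa> (t *R w) (t *R w) < 0" by (rule crit_decreasing[OF nrm[OF t'] t(2)])
  then show ?thesis
   using linear_scale[OF linear_d\<kappa>[OF nrm[OF t']], of t w] t(1) by (simp add: mult_less_0_iff)
 qed
 \<comment> \<open>The last zero before \<open>1\<close> has a negative derivative, as has the zero \<open>1\<close>, so that there is a zero between.\<close>
 have "\<kappa> 0 > 0" by (rule \<kappa>_start)
 have \<tau>01: "\<tau> : {0..1}" using \<tau> by simp
 obtain t0 where t0: "0 < t0" "t0 < 1" "?g t0 = 0"
 proof -
  have "\<exists>t\<ge>0. t <= \<tau> & ?g t = 0"
   by (rule IVT2') (use neg \<kappa>_start \<tau> cont in \<open>auto intro: continuous_on_subset\<close>)
  then obtain t where "0 <= t" "t <= \<tau>" "?g t = 0" by blast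
  then show ?thesis using that[of t] \<tau> \<kappa>_start by (cases "t = 0") auto
 qed
 let ?Z = "{t : {t0..1}. ?g t = 0} - {1}"
 have gap: "\<exists>\<delta>>0. \<forall>h. 0 < h & h < \<delta> \<longrightarrow> 0 < ?g (1 - h)"
 proof -
  have "\<exists>\<delta>>0. \<forall>h>0. h < \<delta> \<longrightarrow> ?g 1 < ?g (1 - h)"
   by (rule DERIV_neg_dec_left[OF deriv]) (use dneg[of 1] w(2) in auto)
  then show ?thesis using w(2) by auto
 qed
 then obtain \<delta> where \<delta>: "0 < \<delta>" "!!h. 0 < h ==> h < \<delta> ==> 0 < ?g (1 - h)" by blast
 have closed: "closed {t : {t0..1}. ?g t = 0}"
  by (rule continuous_closed_preimage_constant[OF continuous_on_subset[OF cont]]) (use t0 in auto)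
 have "?Z = {t : {t0..1}. ?g t = 0} \<inter> {..1 - \<delta>}"
 proof (intro set_eqI iffI)
  fix t assume t: "t : ?Z"
  then have "\<not> 1 - t < \<delta>" using \<delta>(2)[of "1 - t"] by force
  then show "t : {t : {t0..1}. ?g t = 0} \<inter> {..1 - \<delta>}" using t by auto
 qed (use \<delta> in auto)
 then have "closed ?Z" using closed by (simp add: closed_Int)
 then have "compact ?Z" by (simp add: compact_eq_bounded_closed bounded_subset[OF bounded_closed_interval[of t0 1]] subset_iff)
 moreover have "t0 : ?Z" using t0 by simp
 ultimately obtain t1 where t1: "t1 : ?Z" "!!t. t : ?Z ==> t <= t1"
  using compact_attains_sup[of ?Z] by blast
 have t1': "0 < t1" "t1 < 1" "t0 <= t1" "?g t1 = 0" using t1(1) t0(1) by auto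
 have "\<exists>\<delta>>0. \<forall>h>0. h < \<delta> \<longrightarrow> ?g (t1 + h) < ?g t1"
  by (rule DERIV_neg_dec_right[OF deriv]) (use dneg[of t1] t1' in auto)
 then obtain \<delta>' where \<delta>': "0 < \<delta>'" "!!h. 0 < h ==> h < \<delta>' ==> ?g (t1 + h) < 0" using t1'(4) by auto
 define h where "h = min (min \<delta> \<delta>') (1 - t1) / 4"
 have h: "0 < h" "h < \<delta>" "h < \<delta>'" "t1 + h < 1 - h" using \<delta>(1) \<delta>'(1) t1'(2) by (auto simp: h_def min_def field_simps)
 have "\<exists>t\<ge>t1 + h. t <= 1 - h & ?g t = 0"
  by (rule IVT') (use \<delta>(2)[OF h(1,2)] \<delta>'(2)[OF h(1,3)] h t1' in \<open>auto intro!: continuous_on_subset[OF cont]\<close>)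
 then obtain t2 where t2: "t1 + h <= t2" "t2 <= 1 - h" "?g t2 = 0" by blast
 then have "t2 : ?Z" using h(1) t1'(3) by auto
 then show False using t1(2) t2(1) h(1) by force
qed

lemma norm_ray: "norm w <= R ==> \<tau> : {0..1} ==> norm (\<tau> *R w) <= R"
 using mult_left_le_one_le[of "norm w" \<tau>] by simp

lemma start_height: "\<phi> 0 $ k = s\<^sup>2" "i ~= k ==> \<phi> 0 $ i = 0" "s\<^sup>2 <= 1"
 using s by (simp_all add: start axis_def power_le_one)

text \<open>Both ends of the ray have height at most 1, the starting point because s <= 1, and
  uniform convexity pushes the interior down by a definite amount.\<close>

lemma ray_height:
 assumes w: "norm w <= R" "\<phi> w $ k <= 1" and \<tau>: "\<tau> : {0..1}"
 shows "\<phi> (\<tau> *R w) $ k + cc * (norm w)\<^sup>2 * (\<tau> * (1 - \<tau>)) <= 1"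
proof -
 have "(1 - \<tau>) * \<phi> 0 $ k + \<tau> * \<phi> w $ k <= (1 - \<tau>) * 1 + \<tau> * 1"
  using \<tau> w(2) start_height by (intro add_mono mult_left_mono) auto
 then show ?thesis using ray_convex[OF w(1) \<tau>] by simp
qed

lemma ray_height_le:
 assumes "norm w <= R" "\<phi> w $ k <= 1" "\<tau> : {0..1}"
 shows "\<phi> (\<tau> *R w) $ k <= 1"
proof -
 have "0 <= cc * (norm w)\<^sup>2 * (\<tau> * (1 - \<tau>))" using cc assms(3) by (intro mult_nonneg_nonneg) auto
 then show ?thesis using ray_height[OF assms] by linarith
qed

text \<open>With m = cc |w|^2 the heights on the ray are at most 1 - m \<tau> (1 - \<tau>), so
  height 1 is reached with positive slope; the proof compares with the slope m / 2. This
  transversality makes the caustic meet the top of the cylinder regularly.\<close>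

lemma ray_leaves_box:
 assumes w: "norm w <= R" "\<phi> w $ k = 1" and w0: "w ~= 0"
 shows "0 < d\<phi> w w $ k"
proof (rule ccontr)
 assume neg: "\<not> 0 < d\<phi> w w $ k"
 let ?m = "cc * (norm w)\<^sup>2"
 let ?g = "%t. \<phi> (t *R w) $ k - ?m / 2 * t"
 have m: "0 < ?m" using cc w0 by simp
 have "((%t. t *R w) hvd w) (at 1)" using line_has_vector_derivative[of 0 w 1 UNIV] by simp
 from vector_derivative_diff_chain_within[OF this, of \<phi> "d\<phi> w"]
 have "((%t. \<phi> (t *R w)) hvd d\<phi> w w) (at 1)"
  using has_derivative_at_withinI[OF \<phi>_derivative[of w]] w(1) by (simp add: o_def)
 from bounded_linear.has_vector_derivative[OF bounded_linear_vec_nth this, of k]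
 have "((%t. \<phi> (t *R w) $ k) has_real_derivative d\<phi> w w $ k) (at 1)"
  by (simp add: has_real_derivative_iff_has_vector_derivative)
 then have g: "(?g has_real_derivative d\<phi> w w $ k - ?m / 2) (at 1)"
  by (auto intro!: derivative_eq_intros)
 have "d\<phi> w w $ k - ?m / 2 < 0" using neg m by auto
 then have "\<exists>\<delta>>0. \<forall>h>0. h < \<delta> \<longrightarrow> ?g 1 < ?g (1 - h)" by (rule DERIV_neg_dec_left[OF g])
 then obtain \<delta> where \<delta>: "0 < \<delta>" "!!h. 0 < h ==> h < \<delta> ==> ?g 1 < ?g (1 - h)" by blast
 define h where "h = min \<delta> 1 / 2"
 have h: "0 < h" "h < \<delta>" "h <= 1/2" using \<delta>(1) by (auto simp: h_def min_def)
 have "?m * (1/2 * h) <= ?m * ((1 - h) * h)" using h m by (intro mult_left_mono mult_right_mono) auto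
 moreover have "\<phi> ((1 - h) *R w) $ k + ?m * ((1 - h) * (1 - (1 - h))) <= 1"
  by (rule ray_height) (use w h in auto)
 ultimately have "\<phi> ((1 - h) *R w) $ k + ?m * (1/2 * h) <= 1" by simp
 moreover have "\<phi> ((1 - h) *R w) $ k - ?m / 2 * (1 - h) > 1 - ?m / 2"
  using \<delta>(2)[OF h(1,2)] w(2) by simp
 moreover have "M / 2 * (1 - h) = M / 2 - M * (1/2 * h)" for M :: real by (simp add: field_simps)
 from this[of ?m] have "?m / 2 * (1 - h) = ?m / 2 - ?m * (1/2 * h)" .
 ultimately show False by linarith
qed

lemma fold_local_inverse:
 assumes Q: "open Q" "w : Q" "Q <= ball 0 R"
 obtains V g where "open V" "\<Theta> w : V" "smooth_on V g" "g (\<Theta> w) = w" "!!\<theta>. \<theta> : V ==> g \<theta> : Q & \<Theta> (g \<theta>) = \<theta>"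
proof -
 obtain U where U: "open U" "cball 0 R <= U" "smooth_on U \<kappa>" using smooth(2) by blast
 have sub: "Q <= U" "Q <= ball 0 (R + 1)" using Q(3) U(2) by force+
 have w: "norm w <= R" using Q by force
 have sm: "smooth_on Q \<Theta>"
 proof -
  have "smooth_on Q (%w. if i = k then \<kappa> w else \<phi> w $ i)" for i
   using smooth_on_subset[OF U(3) sub(1)] smooth_on_vec_nth[OF Q(1) smooth_on_subset[OF smooth(1) sub(2)]]
   by (cases "i = k") auto
  then show ?thesis unfolding \<Theta>_def by (rule smooth_on_vec_lambda[OF Q(1)])
 qed
 have "v = 0" if "FD \<Theta> w v = 0" for v
  using d\<Theta>_injective[OF w] that frechet_derivative_at[OF \<Theta>_derivative[OF w]] by metis
 from smooth_inverse_function[OF Q(1) sm Q(2) this]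
 obtain V W' g where *: "open V" "open W'" "w : W'" "W' <= Q" "\<Theta> w : V" "homeomorphism W' V \<Theta> g" "smooth_on V g"
  by blast
 show ?thesis
 proof (rule that[OF *(1,5,7)])
  show "g (\<Theta> w) = w" using *(3,6) by (simp add: homeomorphism_def)
  show "g \<theta> : Q & \<Theta> (g \<theta>) = \<theta>" if "\<theta> : V" for \<theta>
   using *(4,6) that by (auto simp: homeomorphism_def)
 qed
qed

text \<open>In the coordinates \<Theta> the fold is a piece of a hyperplane: a vector annihilated by
  d\<kappa> is the velocity of the preimage of a straight line in it.\<close>

lemma tangent_space_fold:
 assumes Q: "open Q" "w : Q" "Q <= ball 0 R" and w: "\<kappa> w = 0"
 shows "tangent_space {w : Q. \<kappa> w = 0} w = {b. d\<kappa> w b = 0}"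
proof (intro set_eqI iffI; simp only: mem_Collect_eq)
 have wR: "norm w <= R" using Q by force
 fix b
 show "d\<kappa> w b = 0" if b: "b : tangent_space {w : Q. \<kappa> w = 0} w"
 proof -
  obtain \<alpha> \<delta> where \<alpha>: "0 < \<delta>" "!!t. \<bar>t\<bar> < \<delta> ==> \<alpha> t : {w : Q. \<kappa> w = 0}" "\<alpha> (0::real) = w" "(\<alpha> hvd b) (at 0)"
 proof (rule tangent_spaceE[OF b], goal_cases)
  case (1 \<alpha> \<delta>)
  show ?case by (rule 1(1)[OF 1(2-5)])
 qed
  have "(\<kappa> \<circ> \<alpha> hvd d\<kappa> w b) (at 0)"
   by (rule has_vector_derivative_compose_at[OF \<alpha>(4)]) (simp add: \<kappa>_derivative[OF wR] \<alpha>(3))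
  then have "((%_. 0) hvd d\<kappa> w b) (at 0)"
   by (rule has_vector_derivative_transform_within_open[where S = "{-\<delta><..<\<delta>}"])
    (use \<alpha> in \<open>auto simp: abs_less_iff\<close>)
  from vector_derivative_unique_at[OF this has_vector_derivative_const] show ?thesis .
 qed
 show "b : tangent_space {w : Q. \<kappa> w = 0} w" if b: "d\<kappa> w b = 0"
 proof -
  obtain V g where V: "open V" "\<Theta> w : V" "smooth_on V g" "g (\<Theta> w) = w" "!!\<theta>. \<theta> : V ==> g \<theta> : Q & \<Theta> (g \<theta>) = \<theta>"
   using fold_local_inverse[OF Q] by blast
  let ?l = "%t::real. \<Theta> w + t *R d\<Theta> w b"
  have "open (?l -` V)" by (rule open_vimage[OF V(1)]) (intro continuous_intros)
  moreover have "0 : ?l -` V" using V(2) by simp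
  ultimately obtain \<delta> where "0 < \<delta>" "ball 0 \<delta> <= ?l -` V" using openE by blast
  then have \<delta>: "0 < \<delta>" "!!t. \<bar>t\<bar> < \<delta> ==> ?l t : V" by (auto simp: subset_iff dist_real_def)
  let ?b = "FD g (\<Theta> w) (d\<Theta> w b)"
  have dg: "((%t. g (?l t)) hvd ?b) (at 0)"
   by (rule curve_derivative[OF V(3,2) line_has_vector_derivative]) simp
  have g0: "g (?l 0) = w" using V(4) by simp
  have "((%t. \<Theta> (g (?l t))) hvd d\<Theta> w ?b) (at 0)"
   using vector_derivative_diff_chain_within[OF dg, of \<Theta> "d\<Theta> w"] g0
    has_derivative_at_withinI[OF \<Theta>_derivative[OF wR]] by (simp add: o_def)
  then have "(?l hvd d\<Theta> w ?b) (at 0)"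
   by (rule has_vector_derivative_transform_within_open[where S = "{-\<delta><..<\<delta>}"])
    (use \<delta> V(5) in \<open>auto simp: abs_less_iff\<close>)
  from vector_derivative_unique_at[OF this line_has_vector_derivative] have "d\<Theta> w ?b = d\<Theta> w b" .
  then have "d\<Theta> w (?b - b) = 0" by (simp add: linear_diff[OF linear_d\<Theta>[OF wR]])
  then have "?b = b" using d\<Theta>_injective[OF wR] by force
  show ?thesis
  proof (rule tangent_spaceI[OF \<delta>(1) _ g0 dg[unfolded \<open>?b = b\<close>]])
   fix t assume "\<bar>t\<bar> < \<delta>"
   then have *: "g (?l t) : Q" "\<Theta> (g (?l t)) = ?l t" using V(5) \<delta>(2) by blast+
   have "\<Theta> (g (?l t)) $ k = 0" unfolding *(2) using w b by (simp add: \<Theta>_def d\<Theta>_def)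
   then show "g (?l t) : {w : Q. \<kappa> w = 0}" using *(1) by (simp add: \<Theta>_def)
  qed
 qed
qed

text \<open>At an interior zero of the nonnegative height the whole derivative of \<eta> vanishes,
  hence so do \<kappa> and the multipliers l, and \<open>above\<close> becomes quadratic growth. It
  places the brake point on the fold and excludes every other boundary point.\<close>

lemma height_minimum:
 assumes nonneg: "!!w. norm w < R + 1 ==> 0 <= \<phi> w $ k" and w: "norm w < R" "\<phi> w $ k = 0"
 shows "\<kappa> w = 0" "norm w' <= R ==> cc * (norm (w' - w))\<^sup>2 <= \<phi> w' $ k"
proof -
 have wR: "norm w <= R" using w by simp
 have crit: "d\<phi> w v $ k = 0" for v
 proof -
  have d: "((%w. \<phi> w $ k) has_derivative (%v. d\<phi> w v $ k)) (at w)"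
   by (rule bounded_linear.has_derivative[OF bounded_linear_vec_nth \<phi>_derivative]) (use w in simp)
  have "(%v. d\<phi> w v $ k) = (%h. 0)"
   by (rule differential_zero_maxmin[OF _ open_ball d, of 0 "R + 1"]) (use w nonneg in auto)
  then show ?thesis by metis
 qed
 show \<kappa>: "\<kappa> w = 0" using crit[of "a w"] d\<phi>_kernel_vector[OF wR] by simp
 have l: "l w i = 0" if i: "i ~= k" for i
 proof -
  obtain b where b: "d\<Theta> w b = axis i 1" using d\<Theta>_surjective[OF wR] by blast
  have dj: "d\<phi> w b $ j = (if j = i then 1 else 0)" if "j ~= k" for j
   using arg_cong[OF b, of "%u. u $ j"] that by (simp add: d\<Theta>_def axis_def)
  have "(\<Sum>j\<in>- {k}. l w j * d\<phi> w b $ j) = (\<Sum>j\<in>- {k}. if j = i then l w j else 0)"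
   by (rule sum.cong) (auto simp: dj)
  also have "\<dots> = l w i" using i by simp
  finally show ?thesis using height[OF wR, of b] crit \<kappa> by simp
 qed
 show "cc * (norm (w' - w))\<^sup>2 <= \<phi> w' $ k" if "norm w' <= R"
  using above[OF that wR] \<kappa> l w(2) by simp
qed

end

text \<open>g is known through m only along the image of \<psi>, which determines its derivative on
  the vectors tangent to that image.\<close>

lemma frechet_derivative_along:
 fixes g :: "'b::real_normed_vector => 'c::real_normed_vector" and \<psi> :: "'a::real_normed_vector => 'b"
 assumes g: "(g has_derivative FD g (\<psi> w)) (at (\<psi> w))" and \<psi>: "(\<psi> has_derivative \<psi>') (at w)"
  and m: "(m has_derivative m') (at w)" and U: "open U" "w : U" "!!w. w : U ==> g (\<psi> w) = m w"
 shows "FD g (\<psi> w) (\<psi>' b) = m' b"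
proof -
 have "((%w. g (\<psi> w)) has_derivative (%b. FD g (\<psi> w) (\<psi>' b))) (at w)"
  by (rule has_derivative_compose[OF \<psi> g])
 then have "(m has_derivative (%b. FD g (\<psi> w) (\<psi>' b))) (at w)"
  by (rule has_derivative_transform_within_open[OF _ U])
 from has_derivative_unique[OF this m] show ?thesis by metis
qed

section \<open>The exponential map at a point near the boundary\<close>

text \<open>\<mu> is the height of the cylinder A, s fixes the position of q in it, and p times the
  vertical axis is the parameter of the brake orbit from q down to the boundary.\<close>

locale fold_point = seifert S c q0 k W + fold_map k R cc s \<phi> a l \<kappa>
 for S :: "('p::{t2_space,second_countable_topology},'n::finite) mech_system" and c q0 k W R cc s \<phi> a l \<kappa> +
 fixes \<mu> p :: real and x :: "real^'n" and q :: 'p and A :: "'p set"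
 assumes \<mu>: "0 < \<mu>" and x: "x : W" and q: "q : fst c" "snd c q = x + (\<mu> * s\<^sup>2) *R axis k 1"
  and A: "cylinder_set c k W \<mu> A"
  and G_\<phi>: "norm w < R + 1 ==> (\<mu>,x,s,w) : Om & G (\<mu>,x,s,w) = (\<chi> i. if i = k then \<phi> w $ i else s * \<phi> w $ i)"
  and brake: "p ~= 0" "(\<mu>,x,s,p *R axis k 1) : Om" "G (\<mu>,x,s,p *R axis k 1) = 0"
   "\<tau> : {0..1} ==> G (\<mu>,x,s,\<tau> *R p *R axis k 1) $ k <= s\<^sup>2"
   "\<tau> : {0..1} ==> i ~= k ==> G (\<mu>,x,s,\<tau> *R p *R axis k 1) $ i = 0"
begin

lemma x_closure: "x : Wc" and xk: "x $ k = 0"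
 using x Wc(3,4) by blast+

definition "F w = x + \<mu> *R (\<chi> i. if i = k then \<phi> w $ i else s * \<phi> w $ i)"
definition "dF w v = \<mu> *R (\<chi> i. if i = k then d\<phi> w v $ i else s * d\<phi> w v $ i)"

lemma F_nth: "F w $ i = (if i = k then \<mu> * \<phi> w $ k else x $ i + \<mu> * (s * \<phi> w $ i))"
 using xk by (simp add: F_def)

lemma dF_nth: "dF w v $ i = (if i = k then \<mu> * d\<phi> w v $ k else \<mu> * (s * d\<phi> w v $ i))"
 by (simp add: dF_def)

lemma F_eq_iff: "F w = F w' \<longleftrightarrow> \<phi> w = \<phi> w'"
proof -
 have "F w $ i = F w' $ i \<longleftrightarrow> \<phi> w $ i = \<phi> w' $ i" for i using \<mu> s(1) by (simp add: F_nth)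
 then show ?thesis by (simp only: vec_eq_iff)
qed

lemma dF_eq_0_iff: "dF w v = 0 \<longleftrightarrow> d\<phi> w v = 0"
proof -
 have "dF w v $ i = 0 \<longleftrightarrow> d\<phi> w v $ i = 0" for i using \<mu> s(1) by (simp add: dF_nth)
 then show ?thesis by (simp only: vec_eq_iff zero_index)
qed

lemma F_G: "norm w < R + 1 ==> F w = x + \<mu> *R G (\<mu>,x,s,w)"
 using G_\<phi> by (simp add: F_def)

lemma F_in_chart:
 assumes "norm w < R + 1"
 shows "F w : Z" "snd c (chart_inv c (F w)) = F w" "chart_inv c (F w) : fst c"
proof -
 show Z: "F w : Z" unfolding F_G[OF assms] by (rule G_in_chart) (use G_\<phi>[OF assms] in blast)
 show "snd c (chart_inv c (F w)) = F w" "chart_inv c (F w) : fst c" using chartD(5,6)[OF Z] by auto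
qed

lemma F_0: "F 0 = snd c q"
proof (simp only: vec_eq_iff, intro allI)
 fix i show "F 0 $ i = snd c q $ i" using xk by (cases "i = k") (simp_all add: F_nth q start axis_def)
qed

lemma F_derivative:
 assumes "norm w < R + 1"
 shows "(F has_derivative dF w) (at w)"
proof -
 have "((%w. F w $ i) has_derivative (%v. dF w v $ i)) (at w)" for i
 proof (cases "i = k")
  case True
  have "((%w. \<mu> * \<phi> w $ k) has_derivative (%v. \<mu> * d\<phi> w v $ k)) (at w)"
   by (intro has_derivative_mult_right bounded_linear.has_derivative[OF bounded_linear_vec_nth \<phi>_derivative[OF assms]])
  then show ?thesis using True by (simp add: F_nth dF_nth)
 next
  case False
  have "((%w. x $ i + \<mu> * (s * \<phi> w $ i)) has_derivative (%v. 0 + \<mu> * (s * d\<phi> w v $ i))) (at w)"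
   by (intro has_derivative_add has_derivative_const has_derivative_mult_right
     bounded_linear.has_derivative[OF bounded_linear_vec_nth \<phi>_derivative[OF assms]])
  then show ?thesis using False by (simp add: F_nth dF_nth)
 qed
 then have "((%w. F w \<bullet> b) has_derivative (%v. dF w v \<bullet> b)) (at w)" if "b : Basis" for b
  using that by (auto simp: Basis_vec_def inner_axis)
 then show ?thesis by (subst has_derivative_componentwise_within) simp
qed

lemma F_continuous: "continuous_on (ball 0 (R + 1)) F"
 using F_derivative by (meson continuous_at_imp_continuous_on has_derivative_continuous mem_ball_0)

lemma in_cylinder_iff: "P : A \<longleftrightarrow> P : fst c & x_part k (snd c P) : W & 0 <= snd c P $ k & snd c P $ k <= \<mu>"
proof -
 have Ac: "A <= fst c" and im: "snd c ` A = {x + y *R e | x y. x : W & 0 <= y & y <= \<mu>}"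
  using A by (auto simp: cylinder_set_def)
 have *: "z : snd c ` A \<longleftrightarrow> x_part k z : W & 0 <= z $ k & z $ k <= \<mu>" for z
 proof
  assume "z : snd c ` A"
  then obtain u y where z: "z = u + y *R e" "u : W" "0 <= y" "y <= \<mu>" unfolding im by blast
  then have "u $ k = 0" using Wc(3,4) by blast
  then show "x_part k z : W & 0 <= z $ k & z $ k <= \<mu>"
   using z axis_decomposition[of u k y] x_part_add_axis[of u k y] by simp
 next
  assume "x_part k z : W & 0 <= z $ k & z $ k <= \<mu>"
  moreover have "z = x_part k z + z $ k *R e" by (simp add: x_part_def)
  ultimately show "z : snd c ` A" unfolding im by blast
 qed
 have "P : A \<longleftrightarrow> P : fst c & snd c P : snd c ` A"
 proof
  assume "P : fst c & snd c P : snd c ` A"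
  then obtain P' where "P : fst c" "P' : A" "snd c P = snd c P'" by blast
  then show "P : A" using Ac chartD(4) by (metis subsetD)
 qed (use Ac in blast)
 then show ?thesis using * by blast
qed

subsection \<open>Rescaled initial data\<close>

definition "qz = x + (\<mu> * s\<^sup>2) *R axis k 1"
definition "h = K qz $ k $ k"
definition "time w = sqrt (\<mu> * time_sq (\<mu>,x,s,w))"
text \<open>\<Psi> parametrises the manifold of pairs (v, t) by the punctured vector space. Its
  inverse \<open>param\<close> is smooth on all pairs, which makes tangent spaces of that manifold
  computable.\<close>

definition "\<Psi> w = ((\<mu> * s / time w) *R w,time w)"
definition "param z = (snd z / (\<mu> * s)) *R fst z" for z :: "(real^'n) \<times> real"

abbreviation "X \<equiv> exp_manifold S c q"

lemma qz: "qz : Z" "snd c q = qz" "chart_inv c qz = q" "qz $ k = \<mu> * s\<^sup>2" "0 < h"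
proof -
 show qz: "snd c q = qz" using q(2) by (simp add: qz_def)
 show Z: "qz : Z" and "chart_inv c qz = q" unfolding qz[symmetric] using q(1) chartD(3,4) by auto
 show "qz $ k = \<mu> * s\<^sup>2" unfolding qz_def by (rule axis_decomposition[OF xk])
 show "0 < h" unfolding h_def by (rule Kkk_pos[OF Z])
qed

lemma time_sq_eq: "time_sq (\<mu>,x,s,w) = h * (w \<bullet> (K qz *v w))"
 by (simp add: time_sq_def base_pt_def h_def qz_def)

lemma energy_sphere_iff: "v : energy_sphere S c q \<longleftrightarrow> v \<bullet> (K qz *v v) = \<mu> * s\<^sup>2 / h"
proof -
 have "hill_fun S q = \<mu> * s\<^sup>2 / h"
  using f_eq[OF qz(1)] qz(3,4) \<mu> s by (simp add: f_def h_def)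
 moreover have "K qz = sys_metric S c q" using qz(3) by (simp add: metric_at_def)
 ultimately show ?thesis by (simp add: energy_sphere_def)
qed

lemma time_pos: "w ~= 0 ==> 0 < time w"
 using K_positive[OF qz(1)] qz(5) \<mu> by (simp add: time_def time_sq_eq)

lemma time_square: "(time w)\<^sup>2 = \<mu> * time_sq (\<mu>,x,s,w)"
proof -
 have "0 <= w \<bullet> (K qz *v w)" using K_positive[OF qz(1), of w] by (cases "w = 0") auto
 then show ?thesis using qz(5) \<mu> by (simp add: time_def time_sq_eq)
qed

lemma \<Psi>_in: 
 assumes w: "w ~= 0"
 shows "\<Psi> w : X" "param (\<Psi> w) = w"
proof -
 have t: "0 < time w" by (rule time_pos[OF w])
 let ?r = "\<mu> * s / time w"
 have "(?r *R w) \<bullet> (K qz *v (?r *R w)) = (\<mu> * s)\<^sup>2 * (w \<bullet> (K qz *v w)) / (time w)\<^sup>2"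
  by (simp add: matrix_vector_mult_scaleR power2_eq_square)
 also have "\<dots> = \<mu> * s\<^sup>2 / h"
  unfolding time_square time_sq_eq using K_positive[OF qz(1) w] \<mu> qz(5) by (simp add: power2_eq_square)
 finally show "\<Psi> w : X" using t by (simp add: exp_manifold_def \<Psi>_def energy_sphere_iff)
 show "param (\<Psi> w) = w" using t \<mu> s by (simp add: param_def \<Psi>_def)
qed

lemma param_in:
 assumes z: "z : X"
 shows "0 < snd z" "param z ~= 0" "time_sq (\<mu>,x,s,param z) = (snd z)\<^sup>2 / \<mu>" "time (param z) = snd z" "\<Psi> (param z) = z"
  "s *R param z = (snd z / \<mu>) *R fst z"
proof -
 obtain v t where [simp]: "z = (v,t)" by fastforce
 have t: "0 < t" and v: "v \<bullet> (K qz *v v) = \<mu> * s\<^sup>2 / h" using z by (auto simp: exp_manifold_def energy_sphere_iff)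
 have "0 < \<mu> * s\<^sup>2 / h" using \<mu> s qz(5) by simp
 then have v0: "v ~= 0" using v by auto
 show "0 < snd z" using t by simp
 show "param z ~= 0" using t v0 \<mu> s by (simp add: param_def)
 have "time_sq (\<mu>,x,s,param z) = h * ((t / (\<mu> * s))\<^sup>2 * (v \<bullet> (K qz *v v)))"
  by (simp add: time_sq_eq param_def matrix_vector_mult_scaleR power2_eq_square)
 also have "\<dots> = t\<^sup>2 / \<mu>" unfolding v using \<mu> s qz(5) by (simp add: power2_eq_square)
 finally show T: "time_sq (\<mu>,x,s,param z) = (snd z)\<^sup>2 / \<mu>" by simp
 then show T': "time (param z) = snd z" using t \<mu> by (simp add: time_def)
 show "\<Psi> (param z) = z" unfolding \<Psi>_def T' using t \<mu> s by (simp add: param_def)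
 show "s *R param z = (snd z / \<mu>) *R fst z" using s by (simp add: param_def)
qed

lemma X_eq: "X = \<Psi> ` (- {0})"
proof (intro set_eqI iffI)
 show "z : \<Psi> ` (- {0})" if "z : X" for z
  using param_in(2,5)[OF that] by (metis ComplI image_eqI singletonD)
 show "z : X" if "z : \<Psi> ` (- {0})" for z using that \<Psi>_in(1) by blast
qed

lemma \<Psi>_differentiable:
 assumes w: "w ~= 0"
 shows "(\<Psi> has_derivative FD \<Psi> w) (at w)"
proof -
 have sm: "smooth_on UNIV (%w. \<mu> * (h * (w \<bullet> (K qz *v w))))" by (intro smooth_intros open_UNIV)
 have t: "0 < time w" by (rule time_pos[OF w])
 let ?D = "FD (%w. \<mu> * (h * (w \<bullet> (K qz *v w)))) w"
 have "((%w. sqrt (\<mu> * (h * (w \<bullet> (K qz *v w))))) has_derivative (%v. ?D v * (inverse (sqrt (\<mu> * (h * (w \<bullet> (K qz *v w))))) / 2))) (at w)"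
  by (rule has_derivative_real_sqrt[OF _ smooth_on_has_derivative[OF sm UNIV_I]]) (use K_positive[OF qz(1) w] \<mu> qz(5) in simp)
 then have dt: "time differentiable (at w)"
  unfolding differentiable_def time_def[abs_def] time_sq_eq by blast
 then obtain T' where T': "(time has_derivative T') (at w)" unfolding differentiable_def by blast
 have "(%w. \<mu> * s / time w) differentiable (at w)"
  using dt t by (intro differentiable_divide) auto
 then obtain r' where r': "((%w. \<mu> * s / time w) has_derivative r') (at w)" unfolding differentiable_def by blast
 have "(\<Psi> has_derivative (%v. ((\<mu> * s / time w) *R v + r' v *R w,T' v))) (at w)"
  unfolding \<Psi>_def[abs_def] by (rule has_derivative_Pair[OF has_derivative_scaleR[OF r' has_derivative_ident] T'])
 then show ?thesis using frechet_derivative_works differentiableI by blast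
qed

subsection \<open>Trajectories through \<open>q\<close>\<close>

lemma init_param:
 assumes "z : X"
 shows "init (\<mu>,x,s,\<tau> *R param z) = (s\<^sup>2 *R e,\<tau> *R (snd z / \<mu>) *R fst z,\<mu>,x,\<tau>\<^sup>2 * ((snd z)\<^sup>2 / \<mu>))"
 unfolding init_ray param_in(3,6)[OF assms] ..

lemma init_param_1: "z : X ==> init (\<mu>,x,s,param z) = (s\<^sup>2 *R e,(snd z / \<mu>) *R fst z,\<mu>,x,(snd z)\<^sup>2 / \<mu>)"
 using init_param[of z 1] by simp

lemma start_eq: "x + \<mu> *R (s\<^sup>2 *R e) = snd c q"
 by (simp add: q)

lemma base_pt_eq: "base_pt (\<mu>,x,s,w) = qz"
 by (simp add: base_pt_def qz_def)

lemma ray_solution: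
 assumes z: "(v,t) : X" and N: "newton_solution S J \<gamma>" "{0..t} <= J" "\<gamma> ` {0..t} <= fst c" "\<gamma> 0 = q" "velocity c \<gamma> 0 = v"
 shows "(\<mu>,x,s,param (v,t)) : Om"
  "\<tau> : {0..1} ==> snd c (\<gamma> (\<tau> * t)) = x + \<mu> *R G (\<mu>,x,s,\<tau> *R param (v,t))"
proof -
 have t: "0 < t" using param_in(1)[OF z] by simp
 have st: "x + \<mu> *R (s\<^sup>2 *R e) = snd c (\<gamma> 0)" using start_eq N(4) by simp
 note sc = scaled_of_newton[OF N(1-3) t \<mu> st]
 show "(\<mu>,x,s,param (v,t)) : Om"
  using sc(1) init_param_1[OF z] qz(1) N(5) by (simp add: Om_def base_pt_eq)
 show "\<tau> : {0..1} ==> snd c (\<gamma> (\<tau> * t)) = x + \<mu> *R G (\<mu>,x,s,\<tau> *R param (v,t))"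
  using sc(2) init_param[OF z] N(5) by (simp add: G_def)
qed

lemma admissible_param:
 assumes z: "z : X" and w: "norm (param z) < R + 1"
 shows "(s\<^sup>2 *R e,(snd z / \<mu>) *R fst z,\<mu>,x,(snd z)\<^sup>2 / \<mu>) : admissible"
 using G_\<phi>[OF w] init_param_1[OF z] by (simp add: Om_def)

lemma norm_scaled_less:
 assumes "norm w < R'" "\<tau> : {0..1}"
 shows "norm (\<tau> *R (w :: real^'n)) < R'"
 using assms mult_left_le_one_le[of "norm w" \<tau>] by simp

lemma solution_exists:
 assumes z: "(v,t) : X" and w: "norm (param (v,t)) < R + 1"
 obtains J \<gamma> where "newton_solution S J \<gamma>" "{0..t} <= J" "\<gamma> 0 = q" "velocity c \<gamma> 0 = v"
  "!!\<tau>. \<tau> : {0..1} ==> \<gamma> (\<tau> * t) = chart_inv c (F (\<tau> *R param (v,t)))"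
proof -
 have t: "0 < t" using param_in(1)[OF z] by simp
 have adm: "(s\<^sup>2 *R e,(t / \<mu>) *R v,\<mu>,x,t\<^sup>2 / \<mu>) : admissible" using admissible_param[OF z w] by simp
 obtain J \<gamma> where \<gamma>: "newton_solution S J \<gamma>" "{0..t} <= J" "\<gamma> 0 = chart_inv c (x + \<mu> *R (s\<^sup>2 *R e))"
  "velocity c \<gamma> 0 = (\<mu> / t) *R (t / \<mu>) *R v"
  "!!\<tau>. \<tau> : {0..1} ==> \<gamma> (\<tau> * t) = chart_inv c (x + \<mu> *R pos (s\<^sup>2 *R e,\<tau> *R (t / \<mu>) *R v,\<mu>,x,\<tau>\<^sup>2 * (t\<^sup>2 / \<mu>)))"
  using newton_of_scaled[OF adm t \<mu>] by metis
 show ?thesis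
 proof (rule that[OF \<gamma>(1,2)])
  show "\<gamma> 0 = q" using \<gamma>(3) start_eq chartD(4)[OF q(1)] by simp
  show "velocity c \<gamma> 0 = v" using \<gamma>(4) t \<mu> by simp
  fix \<tau> :: real assume \<tau>: "\<tau> : {0..1}"
  show "\<gamma> (\<tau> * t) = chart_inv c (F (\<tau> *R param (v,t)))"
   using \<gamma>(5)[OF \<tau>] F_G[OF norm_scaled_less[OF w \<tau>]] init_param[OF z] by (simp add: G_def)
 qed
qed

lemma newton_exp_param:
 assumes z: "z : X" and w: "norm (param z) < R + 1"
 shows "newton_exp S c q z = chart_inv c (F (param z))" "snd c (newton_exp S c q z) = F (param z)"
proof -
 obtain v t where zz: "z = (v,t)" by fastforce
 have t: "0 < t" using param_in(1)[OF z] zz by simp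
 have adm: "(s\<^sup>2 *R e,(t / \<mu>) *R v,\<mu>,x,t\<^sup>2 / \<mu>) : admissible" using admissible_param[OF z w] zz by simp
 show 1: "newton_exp S c q z = chart_inv c (F (param z))"
  using newton_exp_eq[OF adm t \<mu> q(1) start_eq] F_G[OF w] init_param_1[OF z] by (simp add: G_def zz)
 show "snd c (newton_exp S c q z) = F (param z)" unfolding 1 by (rule F_in_chart(2)[OF w])
qed

lemma energy_at:
 assumes v: "velocity c \<gamma> 0 : energy_sphere S c q"
  and N: "newton_solution S J \<gamma>" "{0..t} <= J" "\<gamma> ` {0..t} <= fst c" "\<gamma> 0 = q" and t: "0 <= t"
 shows "velocity c \<gamma> t \<bullet> (K (snd c (\<gamma> t)) *v velocity c \<gamma> t) = f (snd c (\<gamma> t))"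
proof -
 have "velocity c \<gamma> 0 \<bullet> (K (snd c (\<gamma> 0)) *v velocity c \<gamma> 0) = f (snd c (\<gamma> 0))"
  using v qz(2,3) N(4) by (simp add: energy_sphere_def f_def metric_at_def)
 with energy_conserved[OF newton_ode_sol[OF N(1-3)], of 0 t] t show ?thesis
  by (simp add: f_eq_V field_simps)
qed

lemma interval_scaled:
 assumes t: "0 < t" and r: "r : {0..t}"
 shows "r / t : {0..1}" "(r / t) * t = (r::real)"
 using assms by auto

text \<open>The formula for the trajectory as a ray is available on [0, t] only, so the derivative
  at its end is identified from the left.\<close>

lemma end_velocity:
 assumes N: "newton_solution S J \<gamma>" "{0..t} <= J" "\<gamma> ` {0..t} <= fst c" and t: "0 < t"
  and w: "norm w < R + 1" "!!\<tau>. \<tau> : {0..1} ==> snd c (\<gamma> (\<tau> * t)) = F (\<tau> *R w)"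
 shows "velocity c \<gamma> t = (1 / t) *R dF w w"
proof -
 have "t : J" "\<gamma> t : fst c" using N(2,3) t by auto
 from has_vector_derivative_at_within[OF newton_in_chart(1)[OF N(1) this]]
 have 1: "((%r. snd c (\<gamma> r)) hvd velocity c \<gamma> t) (at t within {0..t})" .
 have "((%r. (r / t) *R w) hvd (1 / t) *R w) (at t)"
  unfolding has_vector_derivative_def using t by (auto intro!: derivative_eq_intros)
 moreover have "(F has_derivative dF w) (at ((t / t) *R w))" using F_derivative[OF w(1)] t by simp
 ultimately have "(F \<circ> (%r. (r / t) *R w) hvd dF w ((1 / t) *R w)) (at t)"
  by (rule has_vector_derivative_compose_at)
 then have "((%r. F ((r / t) *R w)) hvd (1 / t) *R dF w w) (at t)"
  using linear_scale[OF has_derivative_linear[OF F_derivative[OF w(1)]]] by (simp add: o_def)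
 then have "((%r. F ((r / t) *R w)) hvd (1 / t) *R dF w w) (at t within {0..t})"
  by (rule has_vector_derivative_at_within)
 then have 2: "((%r. snd c (\<gamma> r)) hvd (1 / t) *R dF w w) (at t within {0..t})"
 proof (rule has_vector_derivative_transform[rotated 2])
  show "t : {0..t}" using t by simp
  show "snd c (\<gamma> r) = F ((r / t) *R w)" if "r : {0..t}" for r
   using w(2)[OF interval_scaled(1)[OF t that]] interval_scaled(2)[OF t that] by simp
 qed
 show ?thesis
  using vector_derivative_unique_within_closed_interval[OF _ _ 1[folded cbox_interval] 2[folded cbox_interval]] t by simp
qed

text \<open>Kinetic energy is nonnegative, so by conservation of energy the trajectory ends in the
  Hill region, where y >= 0.\<close>

lemma height_nonneg:
 assumes w: "norm w < R + 1"
 shows "0 <= \<phi> w $ k"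
proof (cases "w = 0")
 case False
 obtain v t where vt: "\<Psi> w = (v,t)" by fastforce
 have z: "(v,t) : X" "param (v,t) = w" using \<Psi>_in[OF False] vt by auto
 have t: "0 < t" using param_in(1)[OF z(1)] by simp
 have w': "norm (param (v,t)) < R + 1" using w z(2) by simp
 obtain J \<gamma> where \<gamma>: "newton_solution S J \<gamma>" "{0..t} <= J" "\<gamma> 0 = q" "velocity c \<gamma> 0 = v"
  "!!\<tau>. \<tau> : {0..1} ==> \<gamma> (\<tau> * t) = chart_inv c (F (\<tau> *R param (v,t)))"
  using solution_exists[OF z(1) w'] by metis
 have in_c: "\<gamma> ` {0..t} <= fst c"
 proof clarify
  fix r assume r: "r : {0..t}"
  from \<gamma>(5)[OF interval_scaled(1)[OF t r]] show "\<gamma> r : fst c"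
   using F_in_chart(3)[OF norm_scaled_less[OF w interval_scaled(1)[OF t r]]] interval_scaled(2)[OF t r] z(2) by simp
 qed
 have gt: "snd c (\<gamma> t) = F w" using \<gamma>(5)[of 1] z(2) F_in_chart(2)[OF w] by simp
 have "velocity c \<gamma> 0 : energy_sphere S c q" using z(1) \<gamma>(4) by (simp add: exp_manifold_def)
 from energy_at[OF this \<gamma>(1,2) in_c \<gamma>(3)] t gt
 have "f (F w) = velocity c \<gamma> t \<bullet> (K (F w) *v velocity c \<gamma> t)" by simp
 then have "0 <= f (F w)" using K_positive[OF F_in_chart(1)[OF w], of "velocity c \<gamma> t"] by (cases "velocity c \<gamma> t = 0") auto
 then show ?thesis using f_sign(1)[OF F_in_chart(1)[OF w]] \<mu> by (simp add: F_nth zero_le_mult_iff)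
qed (simp add: start)

text \<open>The bound on the height is kept out of this set, so that it is open and the fold
  continues beyond the top of the cylinder.\<close>

definition "Q = {w. norm w < R & (\<forall>\<tau>\<in>{0..1}. x_part k (F (\<tau> *R w)) : W)}"

lemma x_part_F: "x_part k (F w) = (\<chi> i. if i = k then 0 else x $ i + \<mu> * (s * \<phi> w $ i))"
 by (simp add: vec_eq_iff x_part_nth F_nth)

lemma Q_ball: "Q <= ball 0 R" and Q_norm: "w : Q ==> norm w <= R" "w : Q ==> norm w < R + 1"
 by (auto simp: Q_def)

text \<open>A condition for all \<tau> in a compact interval is open, because its complement is the
  projection of a closed set along that interval.\<close>

lemma Q_open: "open Q"
proof -
 obtain T where T: "open T" "W = {x. x $ k = 0} \<inter> T"
  using base unfolding cylinder_base_def openin_open by blast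
 have W_iff: "x_part k z : W \<longleftrightarrow> x_part k z : T" for z by (simp add: T(2) x_part_nth)
 let ?D = "{(\<tau>,w). norm (\<tau> *R w) < R + 1 & x_part k (F (\<tau> *R w)) : T}"
 let ?B = "(%(\<tau>::real,w). \<tau> *R w) -` ball (0::real^'n) (R + 1)"
 have m: "continuous_on UNIV (%(\<tau>::real,w::real^'n). \<tau> *R w)"
  by (simp add: case_prod_unfold) (intro continuous_intros)
 have B: "open ?B" by (rule open_vimage[OF open_ball m])
 have "continuous_on ?B (%z. F ((%(\<tau>::real,w). \<tau> *R w) z))"
  by (rule continuous_on_compose2[OF F_continuous continuous_on_subset[OF m]]) auto
 then have "continuous_on ?B (%z. x_part k (F ((%(\<tau>::real,w). \<tau> *R w) z)))"
  unfolding x_part_def by (intro continuous_intros)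
 from continuous_open_preimage[OF this B T(1)]
 have "open (?B \<inter> (%z. x_part k (F ((%(\<tau>::real,w). \<tau> *R w) z))) -` T)" .
 moreover have "?B \<inter> (%z. x_part k (F ((%(\<tau>::real,w). \<tau> *R w) z))) -` T = ?D" by auto
 ultimately have "open ?D" by simp
 then have "closed (- ?D)" by (rule closed_Compl)
 from closed_compact_projection[OF compact_Icc this, of 0 1]
 have "open (- {w. \<exists>\<tau>. \<tau> : {0..1} & (\<tau>,w) : - ?D})" by (simp only: open_Compl)
 then have "open (ball 0 R \<inter> - {w. \<exists>\<tau>. \<tau> : {0..1} & (\<tau>,w) : - ?D})" by (intro open_Int open_ball)
 moreover have "ball 0 R \<inter> - {w. \<exists>\<tau>. \<tau> : {0..1} & (\<tau>,w) : - ?D} = Q"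
 proof (intro set_eqI iffI)
  fix w assume "w : Q"
  then have w: "norm w < R" "!!\<tau>. \<tau> : {0..1} ==> x_part k (F (\<tau> *R w)) : T" using W_iff by (auto simp: Q_def)
  have "norm (\<tau> *R w) < R + 1" if "\<tau> : {0..1}" for \<tau> by (rule norm_scaled_less[OF _ that]) (use w(1) in simp)
  then show "w : ball 0 R \<inter> - {w. \<exists>\<tau>. \<tau> : {0..1} & (\<tau>,w) : - ?D}" using w by auto
 next
  fix w assume "w : ball 0 R \<inter> - {w. \<exists>\<tau>. \<tau> : {0..1} & (\<tau>,w) : - ?D}"
  then show "w : Q" using W_iff by (auto simp: Q_def)
 qed
 ultimately show ?thesis by simp
qed

lemma in_cylinder_F:
 assumes w: "norm w < R + 1" "x_part k (F w) : W" "\<phi> w $ k <= 1"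
 shows "chart_inv c (F w) : A"
 unfolding in_cylinder_iff F_in_chart(2)[OF w(1)]
 using F_in_chart(3)[OF w(1)] w(2,3) height_nonneg[OF w(1)] \<mu> by (simp add: F_nth)

text \<open>A ray that reaches the sphere of radius R has left the cylinder through its top there.
  So the parameter of an arc in A lies in the ball where the fold is controlled.\<close>

lemma forward_arc:
 assumes N: "newton_solution S J \<gamma>" "{0..t} <= J" "\<gamma> ` {0..t} <= A" "\<gamma> 0 = q"
  and t: "0 < t" and v: "velocity c \<gamma> 0 : energy_sphere S c q"
 defines "w \<equiv> param (velocity c \<gamma> 0,t)"
 shows "w : Q" "\<phi> w $ k <= 1" "\<tau> : {0..1} ==> snd c (\<gamma> (\<tau> * t)) = F (\<tau> *R w)" "velocity c \<gamma> t = (1 / t) *R dF w w"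
proof -
 let ?z = "(velocity c \<gamma> 0,t)"
 have z: "?z : X" using v t by (simp add: exp_manifold_def)
 have in_c: "\<gamma> ` {0..t} <= fst c" using N(3) in_cylinder_iff by blast
 have inA: "\<gamma> (\<tau> * t) : A" if "\<tau> : {0..1}" for \<tau>
  using N(3) that t by (auto simp: mult_left_le_one_le)
 note ray = ray_solution[OF z N(1,2) in_c N(4) refl, folded w_def]
 have w0: "w ~= 0" using param_in(2)[OF z] by (simp add: w_def)
 have wR: "norm w < R"
 proof (rule ccontr)
  assume "\<not> norm w < R"
  then have \<tau>: "R / norm w : {0..1}" using R w0 by auto
  have n: "norm ((R / norm w) *R w) = R" using R w0 by simp
  then have n': "norm ((R / norm w) *R w) < R + 1" by simp
  have "\<mu> * 1 < \<mu> * \<phi> ((R / norm w) *R w) $ k" using outside[OF n] \<mu> by (intro mult_strict_left_mono)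
  moreover have "F ((R / norm w) *R w) $ k <= \<mu>"
   using inA[OF \<tau>] ray(2)[OF \<tau>] F_G[OF n'] by (simp add: in_cylinder_iff)
  ultimately show False by (simp add: F_nth)
 qed
 have less: "norm (\<tau> *R w) < R + 1" if "\<tau> : {0..1}" for \<tau>
  by (rule norm_scaled_less[OF _ that]) (use wR in simp)
 have ray': "snd c (\<gamma> (\<tau> * t)) = F (\<tau> *R w)" if "\<tau> : {0..1}" for \<tau>
  using ray(2)[OF that] F_G[OF less[OF that]] by simp
 show "\<tau> : {0..1} ==> snd c (\<gamma> (\<tau> * t)) = F (\<tau> *R w)" by (rule ray')
 have "x_part k (F (\<tau> *R w)) : W" if "\<tau> : {0..1}" for \<tau>
  using inA[OF that] ray'[OF that] by (simp add: in_cylinder_iff)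
 then show "w : Q" using wR by (simp add: Q_def)
 have "F w $ k <= \<mu>" using inA[of 1] ray'[of 1] by (simp add: in_cylinder_iff)
 then show "\<phi> w $ k <= 1" using \<mu> by (simp add: F_nth)
 show "velocity c \<gamma> t = (1 / t) *R dF w w"
  by (rule end_velocity[OF N(1,2) in_c t _ ray']) (use wR in simp)
qed

lemma interval_subset:
 assumes "newton_solution S J \<gamma>" "t1 : J" "t2 : J"
 shows "{t1..t2} <= J"
proof -
 have "is_interval J" using assms(1) unfolding newton_solution_def by blast
 then have "r : J" if "t1 <= r" "r <= t2" for r
  using that by (rule mem_is_interval_1_I[OF _ assms(2,3)])
 then show ?thesis by (simp add: subset_iff)
qed

text \<open>For the converse only the end of the ray is known to lie below the top; convexity of the
  height puts the rest of the ray there too.\<close>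

lemma exp_domain_iff: "z : exp_domain S c A q \<longleftrightarrow> z : X & param z : Q & \<phi> (param z) $ k <= 1"
proof -
 obtain v t where zz: "z = (v,t)" by fastforce
 show ?thesis
 proof
  assume "z : exp_domain S c A q"
  then obtain J \<gamma> where z: "z : X" and \<gamma>: "newton_solution S J \<gamma>" "0 : J" "t : J" "\<gamma> 0 = q" "velocity c \<gamma> 0 = v" "\<gamma> ` {0..t} <= A"
   unfolding exp_domain_def zz by blast
  have t: "0 < t" and v: "velocity c \<gamma> 0 : energy_sphere S c q" using z zz \<gamma>(5) by (auto simp: exp_manifold_def)
  from forward_arc(1,2)[OF \<gamma>(1) interval_subset[OF \<gamma>(1-3)] \<gamma>(6,4) t v] z
  show "z : X & param z : Q & \<phi> (param z) $ k <= 1" by (simp add: zz \<gamma>(5))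
 next
  assume *: "z : X & param z : Q & \<phi> (param z) $ k <= 1"
  then have z: "(v,t) : X" and w: "param (v,t) : Q" "\<phi> (param (v,t)) $ k <= 1" by (auto simp: zz)
  have t: "0 < t" using param_in(1)[OF z] by simp
  obtain J \<gamma> where \<gamma>: "newton_solution S J \<gamma>" "{0..t} <= J" "\<gamma> 0 = q" "velocity c \<gamma> 0 = v"
   "!!\<tau>. \<tau> : {0..1} ==> \<gamma> (\<tau> * t) = chart_inv c (F (\<tau> *R param (v,t)))"
   using solution_exists[OF z Q_norm(2)[OF w(1)]] by metis
  have "\<gamma> ` {0..t} <= A"
  proof clarify
   fix r assume r: "r : {0..t}"
   note \<tau> = interval_scaled[OF t r]
   have "chart_inv c (F ((r / t) *R param (v,t))) : A"
   proof (rule in_cylinder_F)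
    show "norm ((r / t) *R param (v,t)) < R + 1" by (rule norm_scaled_less[OF Q_norm(2)[OF w(1)] \<tau>(1)])
    show "x_part k (F ((r / t) *R param (v,t))) : W" using w(1) \<tau>(1) by (simp add: Q_def)
    show "\<phi> ((r / t) *R param (v,t)) $ k <= 1" by (rule ray_height_le[OF Q_norm(1)[OF w(1)] w(2) \<tau>(1)])
   qed
   then show "\<gamma> r : A" using \<gamma>(5)[OF \<tau>(1)] \<tau>(2) by simp
  qed
  moreover have "0 : J" "t : J" using \<gamma>(2) t by auto
  ultimately show "z : exp_domain S c A q" using \<gamma>(1,3,4) z unfolding exp_domain_def zz by blast
 qed
qed

text \<open>The expression in \<open>pos\<close> uses v and t independently, so it extends the
  exponential map smoothly off the energy sphere, as derivatives in the ambient space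
  require.\<close>

lemma exp_smooth:
 obtains N where "open N" "!!z. z : X ==> norm (param z) < R + 1 ==> z : N" "smooth_on N (snd c \<circ> newton_exp S c q)"
proof -
 let ?i = "%z. (s\<^sup>2 *R e,(snd z * inverse \<mu>) *R fst z,\<mu>,x,snd z * snd z * inverse \<mu>)"
 let ?N = "{z. 0 < snd z} \<inter> ?i -` admissible"
 have sm: "smooth_on N ?i" if "open N" for N :: "((real^'n) \<times> real) set" by (intro smooth_intros that)
 have "open {z::(real^'n) \<times> real. 0 < snd z}" by (rule open_Collect_less) (intro continuous_intros)+
 moreover have "open (?i -` admissible)"
  by (rule open_vimage[OF pos_smooth(1) smooth_on_continuous_on[OF sm[OF open_UNIV]]])
 ultimately have N: "open ?N" by blast
 show ?thesis
 proof (rule that[OF N])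
  show "z : ?N" if "z : X" "norm (param z) < R + 1" for z
   using admissible_param[OF that] param_in(1)[OF that(1)] by (simp add: divide_inverse power2_eq_square)
  have "smooth_on ?N (%z. pos (?i z))"
   by (rule smooth_on_compose[OF N pos_smooth(1) _ pos_smooth(2) sm[OF N]]) simp
  then have "smooth_on ?N (%z. x + \<mu> *R pos (?i z))" by (intro smooth_intros N)
  then show "smooth_on ?N (snd c \<circ> newton_exp S c q)"
  proof (rule smooth_on_cong[OF N])
   fix z assume z: "z : ?N"
   obtain v t where zz: "z = (v,t)" by fastforce
   have t: "0 < t" and adm: "(s\<^sup>2 *R e,(t / \<mu>) *R v,\<mu>,x,t\<^sup>2 / \<mu>) : admissible"
    using z by (auto simp: zz divide_inverse power2_eq_square)
   show "x + \<mu> *R pos (?i z) = (snd c \<circ> newton_exp S c q) z"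
    using newton_exp_eq[OF adm t \<mu> q(1) start_eq] chartD(6)[OF pos_in_chart[OF adm]]
    by (simp add: zz divide_inverse power2_eq_square)
  qed
 qed
qed

end

section \<open>The fold at q and the brake orbit through q\<close>

context fold_point
begin

text \<open>The fold over Q; \<Sigma> and \<Sigma>E are its images in the chart and in the manifold
  of pairs (v, t). Both contain points above the top of the cylinder and serve as the witnesses in
  \<open>hypersurface_upto\<close>.\<close>

definition "KQ = {w : Q. \<kappa> w = 0}"
definition "\<Sigma> = F ` KQ"
definition "\<Sigma>E = \<Psi> ` KQ"
definition wb :: "real^'n" where "wb = p *R axis k 1"

abbreviation "E \<equiv> snd c \<circ> newton_exp S c q"
abbreviation "d\<Psi> w \<equiv> FD \<Psi> w"

lemma KQ_D:
 assumes "w : KQ"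
 shows "w : Q" "\<kappa> w = 0" "norm w <= R" "norm w < R + 1" "w ~= 0"
 using assms Q_norm \<kappa>_start by (auto simp: KQ_def)

lemma linear_dF: "norm w < R + 1 ==> linear (dF w)"
 using F_derivative has_derivative_linear by blast

lemma brake_ray:
 assumes "\<tau> : {0..1}" "norm (\<tau> *R wb) < R + 1"
 shows "\<phi> (\<tau> *R wb) $ k <= 1" "x_part k (F (\<tau> *R wb)) = x"
proof -
 have G: "G (\<mu>,x,s,\<tau> *R wb) $ i = (if i = k then \<phi> (\<tau> *R wb) $ i else s * \<phi> (\<tau> *R wb) $ i)" for i
  using G_\<phi>[OF assms(2)] by simp
 show "\<phi> (\<tau> *R wb) $ k <= 1"
  using brake(4)[OF assms(1)] G[of k] start_height(3) by (simp add: wb_def)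
 have "s * \<phi> (\<tau> *R wb) $ i = 0" if "i ~= k" for i
  using brake(5)[OF assms(1) that] G[of i] that by (simp add: wb_def)
 then have "x_part k (F (\<tau> *R wb)) $ i = x $ i" for i using xk by (simp add: x_part_F)
 then show "x_part k (F (\<tau> *R wb)) = x" by (simp add: vec_eq_iff)
qed

text \<open>The descending brake orbit never rises above q, hence not above the top of the cylinder,
  whereas the sphere of radius R is mapped above it.\<close>

lemma brake_norm: "norm wb < R"
proof (rule ccontr)
 assume neg: "\<not> norm wb < R"
 have wb0: "wb ~= 0" using brake(1) by (simp add: wb_def)
 have \<tau>: "R / norm wb : {0..1}" using neg R wb0 by auto
 have n: "norm ((R / norm wb) *R wb) = R" using R wb0 by simp
 then show False using outside[OF n] brake_ray(1)[OF \<tau>] by simp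
qed

lemma brake_height: "\<phi> wb $ k = 0"
proof -
 have "G (\<mu>,x,s,wb) $ k = \<phi> wb $ k" using G_\<phi>[of wb] brake_norm by simp
 then show ?thesis using brake(3) by (simp add: wb_def)
qed

lemma brake_fold: "wb : KQ"
proof -
 have "x_part k (F (\<tau> *R wb)) : W" if "\<tau> : {0..1}" for \<tau>
  using brake_ray(2)[OF that norm_scaled_less[OF _ that]] brake_norm x by simp
 then have "wb : Q" using brake_norm by (simp add: Q_def)
 then show ?thesis using height_minimum(1)[OF height_nonneg brake_norm brake_height] by (simp add: KQ_def)
qed

lemma brake_negative: "p < 0"
proof (rule ccontr)
 assume "\<not> p < 0"
 then have "0 < \<kappa> wb" using \<kappa>_pos[of wb] KQ_D(3)[OF brake_fold] by (simp add: wb_def)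
 then show False using KQ_D(2)[OF brake_fold] by simp
qed

lemma F_brake: "F wb = x"
proof -
 have "x_part k (F wb) = x" using brake_ray(2)[of 1] brake_norm by simp
 moreover have "F wb $ k = 0" by (simp add: F_nth brake_height)
 ultimately show ?thesis by (simp add: x_part_def)
qed

lemma height_zero_iff:
 assumes w: "norm w <= R"
 shows "\<phi> w $ k = 0 \<longleftrightarrow> w = wb"
proof
 assume "\<phi> w $ k = 0"
 then have "cc * (norm (w - wb))\<^sup>2 <= 0"
  using height_minimum(2)[OF height_nonneg brake_norm brake_height w] by simp
 then show "w = wb" using cc by (simp add: mult_le_0_iff)
qed (simp add: brake_height)

lemma brake_point_eq: "brake_point c k q = chart_inv c x"
 by (simp add: brake_point_def q x_part_add_axis[OF xk])

lemma fold_tangent: "w : KQ ==> tangent_space KQ w = {b. d\<kappa> w b = 0}"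
 unfolding KQ_def by (rule tangent_space_fold[OF Q_open _ Q_ball]) auto

lemma fold_singular: "w : KQ ==> d\<phi> w (a w) = 0"
 using d\<phi>_kernel_vector[OF KQ_D(3)] KQ_D(2) by simp

text \<open>On the fold d\<phi> annihilates a, so the component of w along a can be removed without
  changing the image. The velocity of the trajectory is thus the image of a vector tangent to the
  fold, which is the reason for the tangency of arcs and locus.\<close>

lemma ray_tangent:
 assumes w: "w : KQ"
 obtains b where "d\<kappa> w b = 0" "d\<phi> w b = d\<phi> w w" "dF w b = dF w w"
proof -
 obtain \<alpha> b where b: "w = \<alpha> *R a w + b" "d\<kappa> w b = 0" using tangent_decomposition[OF KQ_D(3)[OF w]] by blast
 have "b = w - \<alpha> *R a w" using b(1) by (simp add: algebra_simps)
 then have 1: "d\<phi> w b = d\<phi> w w"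
  by (simp only: linear_diff[OF linear_d\<phi>[OF KQ_D(4)[OF w]]] linear_scale[OF linear_d\<phi>[OF KQ_D(4)[OF w]]] fold_singular[OF w]) simp
 show ?thesis by (rule that[OF b(2) 1]) (simp only: dF_def 1)
qed

subsection \<open>The singularities of the exponential map\<close>

lemma param_smooth: "open U ==> smooth_on U param"
proof -
 assume U: "open U"
 have "smooth_on U (%z. (snd z * inverse (\<mu> * s)) *R fst z)" by (intro smooth_intros U)
 then show ?thesis by (rule smooth_on_cong[OF U]) (simp add: param_def divide_inverse)
qed

lemma param_derivative: "(param has_derivative FD param z) (at z)"
 by (rule smooth_on_has_derivative[OF param_smooth[OF open_UNIV] UNIV_I])

lemma tangent_space_\<Psi>:
 assumes "Y <= - {0}" "w : Y"
 shows "tangent_space (\<Psi> ` Y) (\<Psi> w) = d\<Psi> w ` tangent_space Y w"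
 by (rule tangent_space_image[OF \<Psi>_differentiable param_derivative]) (use assms \<Psi>_in(2) in blast)+

lemma tangent_space_X: "w ~= 0 ==> tangent_space X (\<Psi> w) = range (d\<Psi> w)"
 unfolding X_eq by (subst tangent_space_\<Psi>) (simp_all add: tangent_space_open[OF open_Compl[OF closed_singleton]])

lemma tangent_space_\<Sigma>E: "w : KQ ==> tangent_space \<Sigma>E (\<Psi> w) = d\<Psi> w ` {b. d\<kappa> w b = 0}"
 unfolding \<Sigma>E_def by (subst tangent_space_\<Psi>) (use KQ_D(5) in \<open>auto simp: fold_tangent\<close>)

lemma E_derivative:
 assumes "w ~= 0" "norm w < R + 1"
 shows "(E has_derivative FD E (\<Psi> w)) (at (\<Psi> w))"
  "FD E (\<Psi> w) (d\<Psi> w b) = dF w b"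
proof -
 obtain N where N: "open N" "!!z. z : X ==> norm (param z) < R + 1 ==> z : N" "smooth_on N E"
  using exp_smooth by metis
 have "\<Psi> w : N" by (rule N(2)) (use \<Psi>_in[OF assms(1)] assms(2) in auto)
 then show d: "(E has_derivative FD E (\<Psi> w)) (at (\<Psi> w))" by (rule smooth_on_has_derivative[OF N(3)])
 show "FD E (\<Psi> w) (d\<Psi> w b) = dF w b"
 proof (rule frechet_derivative_along[OF d \<Psi>_differentiable[OF assms(1)] F_derivative[OF assms(2)]])
  show "open (ball 0 (R + 1) - {0 :: real^'n})" by (intro open_Diff open_ball) simp
  show "w : ball 0 (R + 1) - {0}" using assms by simp
  show "E (\<Psi> w) = F w" if "w : ball 0 (R + 1) - {0}" for w
   using newton_exp_param(2)[of "\<Psi> w"] \<Psi>_in[of w] that by simp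
 qed
qed

lemma E_image:
 assumes "w ~= 0" "norm w < R + 1"
 shows "FD E (\<Psi> w) ` tangent_space X (\<Psi> w) = range (dF w)"
 unfolding tangent_space_X[OF assms(1)] image_image E_derivative(2)[OF assms] ..

lemma singular_iff:
 assumes w: "norm w <= R"
 shows "range (dF w) ~= UNIV \<longleftrightarrow> \<kappa> w = 0"
proof -
 have l: "linear (dF w)" "linear (d\<phi> w)" using linear_dF linear_d\<phi> w by simp_all
 have "inj (dF w) \<longleftrightarrow> inj (d\<phi> w)"
  unfolding linear_injective_0[OF l(1)] linear_injective_0[OF l(2)] dF_eq_0_iff ..
 then have "range (dF w) = UNIV \<longleftrightarrow> range (d\<phi> w) = UNIV"
  using linear_injective_imp_surjective linear_surjective_imp_injective l by blast
 then show ?thesis using fold_iff_singular[OF w] by simp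
qed

lemma exp_crit_eq: "exp_crit S c A q = {z : \<Sigma>E. \<phi> (param z) $ k <= 1}"
proof -
 have "z : exp_crit S c A q \<longleftrightarrow> z : \<Sigma>E & \<phi> (param z) $ k <= 1" for z
 proof (cases "z : X & param z : Q")
  case True
  then have w: "param z ~= 0" "norm (param z) <= R" "norm (param z) < R + 1" "\<Psi> (param z) = z"
   using param_in Q_norm by auto
  have "z : exp_crit S c A q \<longleftrightarrow> \<kappa> (param z) = 0 & \<phi> (param z) $ k <= 1"
   using True E_image[OF w(1,3)] singular_iff[OF w(2)] w(4)
   by (auto simp: exp_crit_def crit_set_def exp_domain_iff)
  moreover have "z : \<Sigma>E \<longleftrightarrow> \<kappa> (param z) = 0"
  proof
   assume "z : \<Sigma>E"
   then obtain w' where "w' : KQ" "z = \<Psi> w'" by (auto simp: \<Sigma>E_def)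
   then show "\<kappa> (param z) = 0" using KQ_D(2,5) \<Psi>_in(2) by simp
  next
   assume "\<kappa> (param z) = 0"
   then have "param z : KQ" using True by (simp add: KQ_def)
   then show "z : \<Sigma>E" unfolding \<Sigma>E_def using w(4) by (metis image_eqI)
  qed
  ultimately show ?thesis by blast
 next
  case False
  have "z \<notin> \<Sigma>E"
  proof
   assume "z : \<Sigma>E"
   then obtain w' where "w' : KQ" "z = \<Psi> w'" by (auto simp: \<Sigma>E_def)
   then show False using False KQ_D(1,5) \<Psi>_in by metis
  qed
  moreover have "z \<notin> exp_crit S c A q" using False by (auto simp: exp_crit_def crit_set_def exp_domain_iff)
  ultimately show ?thesis by blast
 qed
 then show ?thesis by blast
qed

text \<open>\<kappa> composed with \<open>param\<close> is a defining function; its derivative along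
  the image of the kernel vector a is positive by transversality.\<close>

lemma \<Sigma>E_hypersurface: "smooth_hypersurface X \<Sigma>E"
 unfolding smooth_hypersurface_def
proof (intro conjI ballI)
 show "\<Sigma>E <= X" using KQ_D(5) \<Psi>_in(1) by (auto simp: \<Sigma>E_def)
 fix z assume z: "z : \<Sigma>E"
 let ?N = "param -` Q" and ?h = "%z. \<kappa> (param z)"
 have N: "open ?N"
  by (rule open_vimage[OF Q_open smooth_on_continuous_on[OF param_smooth[OF open_UNIV]]])
 obtain U where U: "open U" "cball 0 R <= U" "smooth_on U \<kappa>" using smooth(2) by blast
 have QU: "Q <= U" using Q_ball U(2) ball_subset_cball by blast
 have h: "smooth_on ?N ?h" by (rule smooth_on_compose[OF N U(1) _ U(3) param_smooth[OF N]]) (use QU in auto)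
 have KQ_param: "param z : KQ" "\<Psi> (param z) = z" if "z : \<Sigma>E" for z
  using that KQ_D(5) \<Psi>_in(2) by (auto simp: \<Sigma>E_def)
 have eq: "\<Sigma>E \<inter> ?N = {y : X \<inter> ?N. ?h y = 0}"
 proof (intro set_eqI iffI)
  fix y assume y: "y : \<Sigma>E \<inter> ?N"
  then have "param y : KQ" "\<Psi> (param y) = y" using KQ_param by auto
  then show "y : {y : X \<inter> ?N. ?h y = 0}" using KQ_D(2,5) \<Psi>_in(1)[of "param y"] y by auto
 next
  fix y assume "y : {y : X \<inter> ?N. ?h y = 0}"
  then have y: "y : X" "param y : Q" "\<kappa> (param y) = 0" by auto
  then have "param y : KQ" by (simp add: KQ_def)
  then show "y : \<Sigma>E \<inter> ?N" using param_in(5)[OF y(1)] y(2) unfolding \<Sigma>E_def by (metis IntI image_eqI vimageI)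
 qed
 have der: "\<exists>u\<in>tangent_space X y. FD ?h y u ~= 0" if y: "y : \<Sigma>E \<inter> ?N" for y
 proof -
  let ?w = "param y"
  have w: "?w : KQ" "\<Psi> ?w = y" using KQ_param y by auto
  note wD = KQ_D[OF w(1)]
  have "FD ?h (\<Psi> ?w) (d\<Psi> ?w (a ?w)) = d\<kappa> ?w (a ?w)"
  proof (rule frechet_derivative_along[OF _ \<Psi>_differentiable[OF wD(5)] \<kappa>_derivative[OF wD(3)]])
   show "(?h has_derivative FD ?h (\<Psi> ?w)) (at (\<Psi> ?w))"
    unfolding w(2) by (rule smooth_on_has_derivative[OF h]) (use y in simp)
   show "open (- {0 :: real^'n})" by (simp add: open_Compl)
  qed (use wD(5) \<Psi>_in(2) in auto)
  moreover have "d\<Psi> ?w (a ?w) : tangent_space X y" using tangent_space_X[OF wD(5)] w(2) by auto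
  ultimately show ?thesis using transverse[OF wD(3)] w(2) by (metis less_irrefl)
 qed
 show "\<exists>N (h :: _ => real). open N & z : N & smooth_on N h & \<Sigma>E \<inter> N = {y : X \<inter> N. h y = 0} &
   (\<forall>y\<in>\<Sigma>E \<inter> N. \<exists>w\<in>tangent_space X y. FD h y w ~= 0)"
  using N h eq der KQ_param(1)[OF z] KQ_D(1) by (intro exI[of _ ?N] exI[of _ ?h]) auto
qed

text \<open>With \<kappa> = 0 the height relation expresses d\<eta> through d\<xi>, so the image
  lies in the hyperplane with normal \<nu>, where the division by s undoes the factor s in the
  horizontal part of F. It is the whole hyperplane because d\<Theta> is onto.\<close>

lemma dF_image_dim:
 assumes w: "w : KQ"
 shows "dim (range (dF w)) = DIM(real^'n) - 1"
proof -
 note wD = KQ_D[OF w]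
 define \<nu> where "\<nu> = (\<chi> i. if i = k then 1 else - (l w i / s))"
 have \<nu>: "\<nu> ~= 0"
 proof
  assume "\<nu> = 0"
  then have "\<nu> $ k = 0" by simp
  then show False by (simp add: \<nu>_def)
 qed
 have \<nu>u: "\<nu> \<bullet> u = u $ k - (\<Sum>i\<in>- {k}. l w i / s * u $ i)" for u
 proof -
  have "\<nu> \<bullet> u = (\<Sum>i\<in>UNIV. \<nu> $ i * u $ i)" by (simp add: inner_vec_def)
  also have "\<dots> = \<nu> $ k * u $ k + (\<Sum>i\<in>- {k}. \<nu> $ i * u $ i)" by (simp add: sum.remove[of UNIV k] Compl_eq_Diff_UNIV)
  also have "(\<Sum>i\<in>- {k}. \<nu> $ i * u $ i) = (\<Sum>i\<in>- {k}. - (l w i / s * u $ i))"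
   by (rule sum.cong) (auto simp: \<nu>_def)
  finally show ?thesis by (simp add: \<nu>_def sum_negf)
 qed
 have height': "dF w v $ k = (\<Sum>i\<in>- {k}. l w i / s * dF w v $ i)" for v
 proof -
  have "dF w v $ k = (\<Sum>i\<in>- {k}. \<mu> * (l w i * d\<phi> w v $ i))"
   using height[OF wD(3), of v] wD(2) by (simp add: dF_nth sum_distrib_left)
  also have "\<dots> = (\<Sum>i\<in>- {k}. l w i / s * dF w v $ i)"
   by (rule sum.cong) (use s in \<open>auto simp: dF_nth\<close>)
  finally show ?thesis .
 qed
 have "range (dF w) = {u. \<nu> \<bullet> u = 0}"
 proof (intro set_eqI iffI)
  fix u assume "u : range (dF w)"
  then show "u : {u. \<nu> \<bullet> u = 0}" using height' by (auto simp: \<nu>u)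
 next
  fix u assume "u : {u. \<nu> \<bullet> u = 0}"
  then have uk: "u $ k = (\<Sum>i\<in>- {k}. l w i / s * u $ i)" by (simp add: \<nu>u)
  obtain b where b: "d\<Theta> w b = (\<chi> i. if i = k then 0 else u $ i / (\<mu> * s))"
   using d\<Theta>_surjective[OF wD(3)] by blast
  have i: "dF w b $ i = u $ i" if "i ~= k" for i
   using arg_cong[OF b, of "%z. z $ i"] that \<mu> s by (simp add: d\<Theta>_def dF_nth)
  then have "dF w b $ k = u $ k" unfolding height' uk by (intro sum.cong) auto
  then have "dF w b = u" using i by (metis vec_eq_iff)
  then show "u : range (dF w)" by blast
 qed
 then show ?thesis using dim_hyperplane[OF \<nu>] by simp
qed

text \<open>The trajectory crosses the top upwards, and its velocity is the image of a vector
  tangent to the fold; so the caustic is transverse to the top.\<close>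

lemma height_gradient_on_fold:
 assumes w: "w : KQ" "\<phi> w $ k = 1"
 obtains b where "d\<kappa> w b = 0" "0 < dF w b $ k"
proof -
 obtain b where b: "d\<kappa> w b = 0" "d\<phi> w b = d\<phi> w w" using ray_tangent[OF w(1)] by blast
 have "0 < d\<phi> w w $ k" by (rule ray_leaves_box) (use KQ_D[OF w(1)] w(2) in auto)
 then show ?thesis using that[OF b(1)] b(2) \<mu> by (simp add: dF_nth)
qed

lemma exp_hypersurface:
 "hypersurface_upto X (%z. snd c (newton_exp S c q z) $ k - \<mu>) (exp_crit S c A q) \<Sigma>E"
 unfolding hypersurface_upto_def
proof (intro conjI ballI impI \<Sigma>E_hypersurface)
 let ?u = "%z. snd c (newton_exp S c q z) $ k - \<mu>"
 have u: "?u (\<Psi> w) = \<mu> * (\<phi> w $ k - 1)" if "w ~= 0" "norm w < R + 1" for w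
  using newton_exp_param(2)[of "\<Psi> w"] \<Psi>_in[OF that(1)] that(2) by (simp add: F_nth right_diff_distrib)
 have u': "?u z = \<mu> * (\<phi> (param z) $ k - 1)" if z: "z : \<Sigma>E" for z
 proof -
  obtain w where w: "w : KQ" "z = \<Psi> w" using z unfolding \<Sigma>E_def by blast
  show ?thesis unfolding w(2) \<Psi>_in(2)[OF KQ_D(5)[OF w(1)]] by (rule u[OF KQ_D(5,4)[OF w(1)]])
 qed
 have "exp_crit S c A q = {z : \<Sigma>E. \<phi> (param z) $ k <= 1}" by (rule exp_crit_eq)
 also have "\<dots> = {z : \<Sigma>E. ?u z <= 0}"
 proof (rule Collect_cong, rule conj_cong[OF refl])
  fix z assume "z : \<Sigma>E"
  from u'[OF this] show "\<phi> (param z) $ k <= 1 \<longleftrightarrow> ?u z <= 0" using \<mu> by (simp only: mult_le_0_iff) simp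
 qed
 finally show "exp_crit S c A q = {z : \<Sigma>E. ?u z <= 0}" .
 fix z assume z: "z : \<Sigma>E" "?u z = 0"
 obtain w where w: "w : KQ" "z = \<Psi> w" using z(1) unfolding \<Sigma>E_def by blast
 note wD = KQ_D[OF w(1)]
 have "\<phi> w $ k = 1" using u[OF wD(5,4)] z(2) w(2) \<mu> by simp
 then obtain b where b: "d\<kappa> w b = 0" "0 < dF w b $ k" using height_gradient_on_fold[OF w(1)] by blast
 have "((%z. E z $ k - \<mu>) has_derivative (%v. FD E (\<Psi> w) v $ k - 0)) (at (\<Psi> w))"
  by (intro has_derivative_diff has_derivative_const bounded_linear.has_derivative[OF bounded_linear_vec_nth E_derivative(1)[OF wD(5,4)]])
 then have d: "(?u has_derivative (%v. FD E (\<Psi> w) v $ k)) (at (\<Psi> w))" by simp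
 then show "?u differentiable (at z)" unfolding w(2) differentiable_def by blast
 have "FD ?u z (d\<Psi> w b) = dF w b $ k"
  using fun_cong[OF frechet_derivative_at[OF d], of "d\<Psi> w b"] E_derivative(2)[OF wD(5,4)] w(2) by simp
 moreover have "d\<Psi> w b : tangent_space \<Sigma>E z" using tangent_space_\<Sigma>E[OF w(1)] b(1) w(2) by auto
 ultimately show "\<exists>v\<in>tangent_space \<Sigma>E z. FD ?u z v ~= 0" using b(2) by (metis less_irrefl)
qed

text \<open>Every vector splits into a multiple of a, which spans the kernel on the fold, and a
  vector tangent to the fold; the derivative of \<Psi> carries the splitting to the manifold of
  pairs (v, t).\<close>

lemma fold_singularity: "represents_fold X (exp_domain S c A q) (%z. snd c (newton_exp S c q z) $ k - \<mu>) E"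
 unfolding represents_fold_def exp_crit_def[symmetric]
proof (rule conjI)
 obtain N where N: "open N" "!!z. z : X ==> norm (param z) < R + 1 ==> z : N" "smooth_on N E"
  using exp_smooth by metis
 then have "exp_domain S c A q <= N" using exp_domain_iff Q_norm(2) by blast
 then show "\<exists>N. open N & exp_domain S c A q <= N & smooth_on N E" using N by blast
 show "\<exists>\<Sigma>. hypersurface_upto X (%z. snd c (newton_exp S c q z) $ k - \<mu>) (exp_crit S c A q) \<Sigma> &
    (\<forall>z\<in>exp_crit S c A q. dim (FD E z ` tangent_space X z) = DIM((real,'n) vec) - 1 &
      {a + b | a b. a : tangent_space X z & FD E z a = 0 & b : tangent_space \<Sigma> z} = tangent_space X z)"
 proof (intro exI[of _ \<Sigma>E] conjI exp_hypersurface ballI)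
  fix z assume z: "z : exp_crit S c A q"
  then obtain w where w: "w : KQ" "z = \<Psi> w" unfolding exp_crit_eq \<Sigma>E_def by blast
  note wD = KQ_D[OF w(1)]
  show "dim (FD E z ` tangent_space X z) = DIM((real,'n) vec) - 1"
   unfolding w(2) E_image[OF wD(5,4)] by (rule dF_image_dim[OF w(1)])
  have lin: "linear (d\<Psi> w)" by (rule has_derivative_linear[OF \<Psi>_differentiable[OF wD(5)]])
  show "{u + b | u b. u : tangent_space X z & FD E z u = 0 & b : tangent_space \<Sigma>E z} = tangent_space X z"
   (is "?L = _")
  proof
   show "?L <= tangent_space X z"
   proof
    fix y assume "y : ?L"
    then obtain u b where y: "y = u + b" and "u : tangent_space X z" "b : tangent_space \<Sigma>E z" by blast
    then obtain u' b' where "u = d\<Psi> w u'" "b = d\<Psi> w b'"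
     unfolding w(2) tangent_space_X[OF wD(5)] tangent_space_\<Sigma>E[OF w(1)] by blast
    then have "u + b = d\<Psi> w (u' + b')" by (simp add: linear_add[OF lin])
    then show "y : tangent_space X z" unfolding y w(2) tangent_space_X[OF wD(5)] by blast
   qed
   show "tangent_space X z <= ?L"
   proof
    fix y assume "y : tangent_space X z"
    then obtain v where v: "y = d\<Psi> w v" unfolding w(2) tangent_space_X[OF wD(5)] by blast
    obtain \<alpha> b where b: "v = \<alpha> *R a w + b" "d\<kappa> w b = 0" using tangent_decomposition[OF wD(3)] by blast
    have "dF w (a w) = 0" using dF_eq_0_iff fold_singular[OF w(1)] by simp
    then have "FD E z (d\<Psi> w (\<alpha> *R a w)) = 0"
     unfolding w(2) E_derivative(2)[OF wD(5,4)] by (simp add: linear_scale[OF linear_dF[OF wD(4)]])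
    moreover have "d\<Psi> w (\<alpha> *R a w) : tangent_space X z" unfolding w(2) tangent_space_X[OF wD(5)] by blast
    moreover have "d\<Psi> w b : tangent_space \<Sigma>E z" unfolding w(2) tangent_space_\<Sigma>E[OF w(1)] using b(2) by blast
    moreover have "y = d\<Psi> w (\<alpha> *R a w) + d\<Psi> w b" unfolding v b(1) by (rule linear_add[OF lin])
    ultimately show "y : ?L" by blast
   qed
  qed
 qed
qed

subsection \<open>The conjugate locus\<close>

abbreviation "C \<equiv> conjugate_locus S c A q"

text \<open>\<kappa> is positive on a ray before its zero, so a critical time is always the first
  one on its trajectory.\<close>

lemma conjugate_locus_eq_crit: "C = newton_exp S c q ` exp_crit S c A q"
proof
 show "C <= newton_exp S c q ` exp_crit S c A q" unfolding conjugate_locus_def by blast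
 show "newton_exp S c q ` exp_crit S c A q <= C"
 proof
  fix P assume "P : newton_exp S c q ` exp_crit S c A q"
  then obtain v t where P: "P = newton_exp S c q (v,t)" and vt: "(v,t) : exp_crit S c A q" by auto
  have z: "(v,t) : X" using vt by (auto simp: exp_crit_def crit_set_def exp_domain_iff)
  have t: "0 < t" using param_in(1)[OF z] by simp
  have \<Sigma>: "param z : KQ" if "z : exp_crit S c A q" for z
   using that KQ_D(5) \<Psi>_in(2) by (auto simp: exp_crit_eq \<Sigma>E_def)
  have "(v,t') \<notin> exp_crit S c A q" if t': "0 < t'" "t' < t" for t'
  proof
   assume c: "(v,t') : exp_crit S c A q"
   have "param (v,t') = (t' / t) *R param (v,t)" using t by (simp add: param_def)
   moreover have "0 < \<kappa> ((t' / t) *R param (v,t))"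
    by (rule fold_first_on_ray) (use KQ_D[OF \<Sigma>[OF vt]] t t' in auto)
   ultimately show False using KQ_D(2)[OF \<Sigma>[OF c]] by simp
  qed
  then show "P : C" using P vt unfolding conjugate_locus_def by blast
 qed
qed

lemma conjugate_locus_eq: "C = (%w. chart_inv c (F w)) ` {w : KQ. \<phi> w $ k <= 1}"
proof -
 have e: "newton_exp S c q (\<Psi> w) = chart_inv c (F w)" "param (\<Psi> w) = w" if "w : KQ" for w
  using newton_exp_param(1)[of "\<Psi> w"] \<Psi>_in KQ_D[OF that] by auto
 have "exp_crit S c A q = \<Psi> ` {w : KQ. \<phi> w $ k <= 1}"
  unfolding exp_crit_eq \<Sigma>E_def using e(2) by auto
 then have "C = (%w. newton_exp S c q (\<Psi> w)) ` {w : KQ. \<phi> w $ k <= 1}"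
  unfolding conjugate_locus_eq_crit by (simp only: image_image)
 also have "\<dots> = (%w. chart_inv c (F w)) ` {w : KQ. \<phi> w $ k <= 1}" by (rule image_cong) (use e(1) in auto)
 finally show ?thesis .
qed

lemma conjugate_locus_chart: "snd c ` C = {z : \<Sigma>. z $ k - \<mu> <= 0}"
proof -
 have "snd c ` C = F ` {w : KQ. \<phi> w $ k <= 1}"
  unfolding conjugate_locus_eq image_image by (rule image_cong) (use F_in_chart(2) KQ_D(4) in auto)
 also have "\<dots> = {z : \<Sigma>. z $ k - \<mu> <= 0}" unfolding \<Sigma>_def using \<mu> by (auto simp: F_nth)
 finally show ?thesis .
qed

text \<open>By strict minimality a parameter with the same image as a fold point is that fold point;
  so a trajectory meets the locus only at its own conjugate point.\<close>

lemma in_conjugate_locus: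
 assumes w: "w : Q" and C: "chart_inv c (F w) : C"
 shows "w : KQ"
proof -
 obtain w' where w': "w' : KQ" "chart_inv c (F w) = chart_inv c (F w')" using C unfolding conjugate_locus_eq by blast
 have "F w = F w'" using F_in_chart(2)[OF Q_norm(2)[OF w]] F_in_chart(2)[OF KQ_D(4)[OF w'(1)]] w'(2) by metis
 then have "\<phi> w = \<phi> w'" by (simp add: F_eq_iff)
 then have "w = w'" by (intro fold_point_unique[OF Q_norm(1)[OF w] KQ_D(3,2)[OF w'(1)]]) auto
 then show ?thesis using w' by simp
qed

text \<open>\<Sigma> is locally the graph of the height over the horizontal coordinates. No other
  sheet comes near z, because a fold point is determined by its horizontal part among all fold
  points.\<close>

lemma \<Sigma>_hypersurface: "smooth_hypersurface Z \<Sigma>"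
 unfolding smooth_hypersurface_def
proof (intro conjI ballI)
 show "\<Sigma> <= Z" using F_in_chart(1) KQ_D(4) by (auto simp: \<Sigma>_def)
 fix z assume "z : \<Sigma>"
 then obtain w where w: "w : KQ" "z = F w" by (auto simp: \<Sigma>_def)
 note wD = KQ_D[OF w(1)]
 obtain V g where V: "open V" "\<Theta> w : V" "smooth_on V g" "g (\<Theta> w) = w" "!!\<theta>. \<theta> : V ==> g \<theta> : Q & \<Theta> (g \<theta>) = \<theta>"
  using fold_local_inverse[OF Q_open wD(1) Q_ball] by blast
 \<comment> \<open>Recovers \<xi> from the horizontal position and prescribes \<kappa> = 0; the
   local inverse of \<Theta> then yields the fold point over y.\<close>
 let ?\<theta> = "%y :: real^'n. \<chi> i. if i = k then 0 else (y $ i - x $ i) * inverse (\<mu> * s)"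
 let ?N = "?\<theta> -` V" and ?h = "%y. y $ k - \<mu> * \<phi> (g (?\<theta> y)) $ k"
 have \<theta>s: "smooth_on U ?\<theta>" if U: "open U" for U
 proof (rule smooth_on_vec_lambda[OF U])
  fix i show "smooth_on U (%y. if i = k then 0 else (y $ i - x $ i) * inverse (\<mu> * s))"
   by (cases "i = k") (auto intro!: smooth_intros U)
 qed
 have N: "open ?N" by (rule open_vimage[OF V(1) smooth_on_continuous_on[OF \<theta>s[OF open_UNIV]]])
 have \<theta>F: "?\<theta> (F w') = \<Theta> w'" if "w' : KQ" for w'
 proof (simp only: vec_eq_iff, intro allI)
  fix i show "?\<theta> (F w') $ i = \<Theta> w' $ i" using KQ_D(2)[OF that] \<mu> s(1) by (simp add: \<Theta>_def F_nth field_simps)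
 qed
 have g: "g (?\<theta> y) : KQ" "i ~= k ==> \<phi> (g (?\<theta> y)) $ i = (y $ i - x $ i) * inverse (\<mu> * s)" if "y : ?N" for y i
 proof -
  have *: "g (?\<theta> y) : Q" "\<Theta> (g (?\<theta> y)) = ?\<theta> y" using V(5)[of "?\<theta> y"] that by auto
  show "g (?\<theta> y) : KQ" using *(1) arg_cong[OF *(2), of "%z. z $ k"] by (simp add: KQ_def \<Theta>_def)
  show "i ~= k ==> \<phi> (g (?\<theta> y)) $ i = (y $ i - x $ i) * inverse (\<mu> * s)"
   using arg_cong[OF *(2), of "%z. z $ i"] by (simp add: \<Theta>_def)
 qed
 have sm: "smooth_on ?N ?h"
 proof -
  have gs: "smooth_on ?N (%y. g (?\<theta> y))" by (rule smooth_on_compose[OF N V(1) _ V(3) \<theta>s[OF N]]) simp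
  have "smooth_on ?N (%y. \<phi> (g (?\<theta> y)))"
   by (rule smooth_on_compose[OF N open_ball _ smooth(1) gs]) (use g(1) KQ_D(4) in auto)
  then show ?thesis by (intro smooth_intros N)
 qed
 have F_g: "y = F (g (?\<theta> y)) \<longleftrightarrow> ?h y = 0" if y: "y : ?N" for y
 proof -
  have 1: "F (g (?\<theta> y)) $ i = y $ i" if "i ~= k" for i using g(2)[OF y that] that \<mu> s(1) by (simp add: F_nth field_simps)
  show ?thesis
  proof
   assume e: "y = F (g (?\<theta> y))"
   have "y $ k = F (g (?\<theta> y)) $ k" by (rule arg_cong[OF e])
   then show "?h y = 0" by (simp add: F_nth)
  next
   assume 0: "?h y = 0"
   show "y = F (g (?\<theta> y))"
   proof (simp only: vec_eq_iff, intro allI)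
    fix i show "y $ i = F (g (?\<theta> y)) $ i" using 1[of i] 0 by (cases "i = k") (simp_all add: F_nth)
   qed
  qed
 qed
 have eq: "\<Sigma> \<inter> ?N = {y : Z \<inter> ?N. ?h y = 0}"
 proof (intro set_eqI iffI)
  fix y assume y: "y : \<Sigma> \<inter> ?N"
  then obtain w' where w': "w' : KQ" "y = F w'" by (auto simp: \<Sigma>_def)
  have yN: "y : ?N" using y by simp
  have "\<phi> (g (?\<theta> y)) $ i = \<phi> w' $ i" if "i ~= k" for i
   using g(2)[OF yN that] that \<mu> s(1) by (simp add: w'(2) F_nth field_simps)
  then have "g (?\<theta> y) = w'"
   by (rule fold_graph[OF KQ_D(3)[OF g(1)[OF yN]] KQ_D(3)[OF w'(1)] KQ_D(2)[OF g(1)[OF yN]] KQ_D(2)[OF w'(1)]])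
  then have "?h y = 0" using F_g[OF yN] w'(2) by simp
  moreover have "y : Z" using w' F_in_chart(1) KQ_D(4) by simp
  ultimately show "y : {y : Z \<inter> ?N. ?h y = 0}" using yN by simp
 next
  fix y assume "y : {y : Z \<inter> ?N. ?h y = 0}"
  then have y: "y : ?N" "?h y = 0" by auto
  then have "y = F (g (?\<theta> y))" using F_g by blast
  then show "y : \<Sigma> \<inter> ?N" using g(1)[OF y(1)] y(1) unfolding \<Sigma>_def by blast
 qed
 have der: "\<exists>u\<in>tangent_space Z y. FD ?h y u ~= 0" if y: "y : \<Sigma> \<inter> ?N" for y
 proof (intro bexI)
  have yN: "y : ?N" using y by simp
  have "?\<theta> (y + t *R e) = ?\<theta> y" for t by (simp add: vec_eq_iff axis_def)
  then have h: "?h (y + t *R e) = ?h y + t *R 1" for t by simp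
  have "FD ?h y e = 1"
   by (rule line_derivative_unique[OF sm yN]) (simp only: h line_has_vector_derivative)
  then show "FD ?h y e ~= 0" by simp
  have "y : Z" using y F_in_chart(1) KQ_D(4) by (auto simp: \<Sigma>_def)
  then show "e : tangent_space Z y" by (simp add: tangent_space_open[OF chartD(2)])
 qed
 show "\<exists>N (h :: _ => real). open N & z : N & smooth_on N h & \<Sigma> \<inter> N = {y : Z \<inter> N. h y = 0} &
   (\<forall>y\<in>\<Sigma> \<inter> N. \<exists>w\<in>tangent_space Z y. FD h y w ~= 0)"
 proof (intro exI conjI ballI)
  show "z : ?N" using V(2) \<theta>F[OF w(1)] w(2) by simp
 qed (use N sm eq der in auto)
qed

lemma tangent_space_\<Sigma>:
 assumes w: "w : KQ" and b: "d\<kappa> w b = 0"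
 shows "dF w b : tangent_space \<Sigma> (F w)"
 unfolding \<Sigma>_def using tangent_space_image_subset[OF F_derivative[OF KQ_D(4)[OF w]], of KQ] fold_tangent[OF w] b by blast

lemma conjugate_hypersurface: "hypersurface_upto Z (%z. z $ k - \<mu>) (snd c ` C) \<Sigma>"
 unfolding hypersurface_upto_def
proof (intro conjI ballI impI \<Sigma>_hypersurface conjugate_locus_chart)
 fix z assume z: "z : \<Sigma>" "z $ k - \<mu> = 0"
 then obtain w where w: "w : KQ" "z = F w" by (auto simp: \<Sigma>_def)
 have d: "((%z :: real^'n. z $ k - \<mu>) has_derivative (%v. v $ k)) (at z)"
  using has_derivative_diff[OF bounded_linear_imp_has_derivative[OF bounded_linear_vec_nth] has_derivative_const] by simp
 then show "(%z :: real^'n. z $ k - \<mu>) differentiable (at z)" unfolding differentiable_def by blast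
 have "\<phi> w $ k = 1" using z(2) w(2) \<mu> by (simp add: F_nth)
 then obtain b where b: "d\<kappa> w b = 0" "0 < dF w b $ k" using height_gradient_on_fold[OF w(1)] by blast
 have "FD (%z :: real^'n. z $ k - \<mu>) z (dF w b) = dF w b $ k"
  using fun_cong[OF frechet_derivative_at[OF d], of "dF w b"] by simp
 then show "\<exists>v\<in>tangent_space \<Sigma> z. FD (%z :: real^'n. z $ k - \<mu>) z v ~= 0"
  using tangent_space_\<Sigma>[OF w(1) b(1)] b(2) w(2) by (metis less_irrefl)
qed

end

section \<open>Tangency to the Hill boundary\<close>

context fold_point
begin

abbreviation "qs \<equiv> brake_point c k q"

lemma brake_point_chart: "x : Z" "snd c qs = x" "qs : fst c" "qs : hill_boundary S"
proof -
 show xZ: "x : Z" using x_closure Wc(2) by blast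
 show "snd c qs = x" "qs : fst c" unfolding brake_point_eq using chartD(5,6)[OF xZ] by auto
 show "qs : hill_boundary S" using f_sign(2)[OF xZ] xk by (simp add: brake_point_eq hill_boundary_def f_def)
qed

lemma boundary_iff:
 assumes "P : fst c"
 shows "P : hill_boundary S \<longleftrightarrow> snd c P $ k = 0"
proof -
 have "f (snd c P) = hill_fun S P" using chartD(4)[OF assms] by (simp add: f_def)
 then show ?thesis using f_sign(2)[OF chartD(3)[OF assms]] by (simp add: hill_boundary_def)
qed

lemma conjugate_locus_boundary: "C \<inter> hill_boundary S = {qs}"
proof (intro set_eqI iffI)
 fix P assume P: "P : C \<inter> hill_boundary S"
 then obtain w where w: "w : KQ" "P = chart_inv c (F w)" unfolding conjugate_locus_eq by blast
 note Fw = F_in_chart[OF KQ_D(4)[OF w(1)]]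
 have "F w $ k = 0" using boundary_iff[of P] P Fw w(2) by simp
 then have "\<phi> w $ k = 0" using \<mu> by (simp add: F_nth)
 then have "w = wb" using height_zero_iff[OF KQ_D(3)[OF w(1)]] by blast
 then show "P : {qs}" using w(2) by (simp add: F_brake brake_point_eq)
next
 fix P assume "P : {qs}"
 then have "P = chart_inv c (F wb)" by (simp add: F_brake brake_point_eq)
 moreover have "wb : {w : KQ. \<phi> w $ k <= 1}" using brake_fold brake_height by simp
 ultimately have "P : C" unfolding conjugate_locus_eq by blast
 then show "P : C \<inter> hill_boundary S" using \<open>P : {qs}\<close> brake_point_chart(4) by simp
qed

lemma tangent_space_boundary:
 "tangent_space (snd c ` (fst c \<inter> hill_boundary S)) (snd c qs) = {b. b $ k = 0}"
proof -
 have im: "snd c ` (fst c \<inter> hill_boundary S) = {z : Z. z $ k = 0}"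
 proof (intro set_eqI iffI)
  fix z assume "z : {z : Z. z $ k = 0}"
  then have z: "z : Z" "z $ k = 0" by auto
  have "chart_inv c z : fst c \<inter> hill_boundary S" using boundary_iff[OF chartD(5)[OF z(1)]] chartD(5,6)[OF z(1)] z(2) by simp
  then show "z : snd c ` (fst c \<inter> hill_boundary S)" using chartD(6)[OF z(1)] by (metis image_eqI)
 qed (use boundary_iff chartD(3) in auto)
 show ?thesis
  unfolding im brake_point_chart(2)
 proof (intro set_eqI iffI)
  fix b assume b: "b : tangent_space {z : Z. z $ k = 0} x"
  obtain \<alpha> \<delta> where \<alpha>: "0 < \<delta>" "!!t. \<bar>t\<bar> < \<delta> ==> \<alpha> t : {z : Z. z $ k = 0}" "\<alpha> (0::real) = x" "(\<alpha> hvd b) (at 0)"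
  proof (rule tangent_spaceE[OF b], goal_cases)
   case (1 \<alpha> \<delta>)
   show ?case by (rule 1(1)[OF 1(2-5)])
  qed
  have "((%t. \<alpha> t $ k) hvd b $ k) (at 0)"
   by (rule bounded_linear.has_vector_derivative[OF bounded_linear_vec_nth \<alpha>(4)])
  then have "((%t. 0) hvd b $ k) (at 0)"
   by (rule has_vector_derivative_transform_within_open[where S = "{-\<delta><..<\<delta>}"]) (use \<alpha> in \<open>auto simp: abs_less_iff\<close>)
  from vector_derivative_unique_at[OF this has_vector_derivative_const] show "b : {b. b $ k = 0}" by simp
 next
  fix b :: "real^'n" assume b: "b : {b. b $ k = 0}"
  have "b : tangent_space Z x" using tangent_space_open[OF chartD(2) brake_point_chart(1)] by simp
  have "open ((%t::real. x + t *R b) -` Z)" by (rule open_vimage[OF chartD(2)]) (intro continuous_intros)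
  moreover have "0 : (%t::real. x + t *R b) -` Z" using brake_point_chart(1) by simp
  ultimately obtain \<delta> where "0 < \<delta>" "ball 0 \<delta> <= (%t::real. x + t *R b) -` Z" using openE by blast
  then have \<delta>: "0 < \<delta>" "!!t. \<bar>t\<bar> < \<delta> ==> x + t *R b : Z" by (auto simp: subset_iff dist_real_def)
  show "b : tangent_space {z : Z. z $ k = 0} x"
   by (rule tangent_spaceI[OF \<delta>(1) _ _ line_has_vector_derivative[of x b]]) (use \<delta>(2) xk b in auto)
 qed
qed

text \<open>\<Sigma> lies in y >= 0 and contains x, so y is minimal at x along every curve in
  \<Sigma>. Conversely, since d\<Theta> is onto, every horizontal direction is the image of a vector
  tangent to the fold.\<close>

lemma \<Sigma>_tangent_boundary:
 "tangent_space \<Sigma> (snd c qs) = tangent_space (snd c ` (fst c \<inter> hill_boundary S)) (snd c qs)"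
 unfolding tangent_space_boundary unfolding brake_point_chart(2)
proof (intro set_eqI iffI)
 have sub: "b $ k = 0" if b: "b : tangent_space \<Sigma> x" for b
 proof -
  obtain \<alpha> \<delta> where \<alpha>: "0 < \<delta>" "!!t. \<bar>t\<bar> < \<delta> ==> \<alpha> t : \<Sigma>" "\<alpha> (0::real) = x" "(\<alpha> hvd b) (at 0)"
  proof (rule tangent_spaceE[OF b], goal_cases)
   case (1 \<alpha> \<delta>)
   show ?case by (rule 1(1)[OF 1(2-5)])
  qed
  have "((%t. \<alpha> t $ k) has_real_derivative b $ k) (at 0)"
   using bounded_linear.has_vector_derivative[OF bounded_linear_vec_nth \<alpha>(4), of k]
   by (simp add: has_real_derivative_iff_has_vector_derivative)
  then show ?thesis
  proof (rule DERIV_local_min[OF _ \<alpha>(1)])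
   show "\<forall>t. \<bar>0 - t\<bar> < \<delta> \<longrightarrow> \<alpha> 0 $ k <= \<alpha> t $ k"
   proof (intro allI impI)
    fix t :: real assume "\<bar>0 - t\<bar> < \<delta>"
    then have "\<alpha> t : \<Sigma>" using \<alpha>(2) by simp
    then obtain w where "w : KQ" "\<alpha> t = F w" by (auto simp: \<Sigma>_def)
    then show "\<alpha> 0 $ k <= \<alpha> t $ k" using height_nonneg[OF KQ_D(4)] \<mu> \<alpha>(3) xk by (simp add: F_nth)
   qed
  qed
 qed
 fix b
 show "b : {b. b $ k = 0}" if "b : tangent_space \<Sigma> x" using sub[OF that] by simp
 show "b : tangent_space \<Sigma> x" if b: "b : {b. b $ k = 0}"
 proof -
  note wD = KQ_D[OF brake_fold]
  obtain v where v: "d\<Theta> wb v = (\<chi> i. if i = k then 0 else b $ i / (\<mu> * s))"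
   using d\<Theta>_surjective[OF wD(3)] by blast
  have "d\<kappa> wb v = 0" using arg_cong[OF v, of "%z. z $ k"] by (simp add: d\<Theta>_def)
  then have t: "dF wb v : tangent_space \<Sigma> x" using tangent_space_\<Sigma>[OF brake_fold] F_brake by simp
  have "dF wb v = b"
  proof (simp only: vec_eq_iff, intro allI)
   fix i show "dF wb v $ i = b $ i"
   proof (cases "i = k")
    case True
    then show ?thesis using sub[OF t] b by simp
   next
    case False
    then show ?thesis using arg_cong[OF v, of "%z. z $ i"] \<mu> s by (simp add: d\<Theta>_def dF_nth)
   qed
  qed
  then show ?thesis using t by simp
 qed
qed

subsection \<open>Geodesic arcs through \<open>q\<close>\<close>

lemma velocity_on_sphere:
 assumes "has_energy S J \<gamma>" "t : J" "\<gamma> t : fst c"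
 shows "velocity c \<gamma> t \<bullet> (K (snd c (\<gamma> t)) *v velocity c \<gamma> t) = f (snd c (\<gamma> t))"
proof -
 have "(1 / 2) * (velocity c \<gamma> t \<bullet> (sys_metric S c (\<gamma> t) *v velocity c \<gamma> t)) + sys_potential S (\<gamma> t) = sys_energy S"
  using assms chart unfolding has_energy_def by blast
 then show ?thesis using chartD(4)[OF assms(3)] by (simp add: f_eq_V metric_at_def potential_at_def)
qed

lemma arc_scaled:
 assumes "t1 <= 0" "0 <= t2" "t : {t1..t2}" "\<tau> : {0..1}"
 shows "\<tau> * t : {t1..t2::real}"
proof (cases "0 <= t")
 case True
 then show ?thesis using assms mult_left_le_one_le[of t \<tau>] by (auto intro: order_trans)
next
 case False
 then have "\<tau> * t <= 0" "t <= \<tau> * t"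
  using assms(4) mult_left_le_one_le[of "- t" \<tau>] mult_nonneg_nonpos[of \<tau> t] by auto
 then show ?thesis using assms by (auto intro: order_trans)
qed

text \<open>Points at negative times are reached by the reversed trajectory, which leaves q with the
  opposite velocity and the same energy. Thus both halves of the arc are rays, and division by the
  negative t accounts for the reversed velocity.\<close>

lemma arc_point:
 assumes arc: "geodesic_arc S A \<gamma> t1 t2" and t: "t1 <= 0" "0 <= t2" "t : {t1..t2}" "t ~= 0" and \<gamma>0: "\<gamma> 0 = q"
 obtains w where "w : Q" "\<phi> w $ k <= 1" "!!\<tau>. \<tau> : {0..1} ==> \<gamma> (\<tau> * t) = chart_inv c (F (\<tau> *R w))"
  "velocity c \<gamma> t = (1 / t) *R dF w w" "velocity c \<gamma> t \<bullet> (K (F w) *v velocity c \<gamma> t) = f (F w)"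
proof -
 obtain J where N: "newton_solution S J \<gamma>" and en: "has_energy S J \<gamma>" and J: "{t1..t2} <= J" and inA: "\<gamma> ` {t1..t2} <= A"
  using arc unfolding geodesic_arc_def by blast
 have in_c: "\<gamma> r : fst c" if "r : {t1..t2}" for r using inA that in_cylinder_iff by blast
 have 0: "0 : {t1..t2}" using t by simp
 have v0: "velocity c \<gamma> 0 \<bullet> (K qz *v velocity c \<gamma> 0) = \<mu> * s\<^sup>2 / h"
  using velocity_on_sphere[OF en _ in_c[OF 0]] J 0 \<gamma>0 qz(1,2,4) f_eq[OF qz(1)] \<mu> by (auto simp: h_def)
 have et: "velocity c \<gamma> t \<bullet> (K (snd c (\<gamma> t)) *v velocity c \<gamma> t) = f (snd c (\<gamma> t))"
  using velocity_on_sphere[OF en _ in_c[OF t(3)]] J t(3) by blast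
 note result = that
 have fin: thesis if w: "w : Q" "\<phi> w $ k <= 1" "!!\<tau>. \<tau> : {0..1} ==> snd c (\<gamma> (\<tau> * t)) = F (\<tau> *R w)"
  "velocity c \<gamma> t = (1 / t) *R dF w w" for w
 proof (rule result[OF w(1,2) _ w(4)])
  show "\<gamma> (\<tau> * t) = chart_inv c (F (\<tau> *R w))" if \<tau>: "\<tau> : {0..1}" for \<tau>
  proof -
   have "\<tau> * t : {t1..t2}" by (rule arc_scaled[OF t(1-3) \<tau>])
   from chartD(4)[OF in_c[OF this]] w(3)[OF \<tau>] show ?thesis by simp
  qed
  show "velocity c \<gamma> t \<bullet> (K (F w) *v velocity c \<gamma> t) = f (F w)" using et w(3)[of 1] by simp
 qed
 show thesis
 proof (cases "0 < t")
  case True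
  have sub: "{0..t} <= {t1..t2}" using t by auto
  have A': "{0..t} <= J" "\<gamma> ` {0..t} <= A" using sub J inA by auto
  have "velocity c \<gamma> 0 : energy_sphere S c q" using v0 energy_sphere_iff by blast
  note fa = forward_arc[OF N A' \<gamma>0 True this]
  show thesis by (rule fin[OF fa(1,2)]) (rule fa(3), assumption, rule fa(4))
 next
  case False
  then have tn: "t < 0" using t(4) by simp
  have sub: "{t..0} <= {t1..t2}" using t by auto
  have A': "{t..0} <= J" "\<gamma> ` {t..0} <= fst c" using sub J in_c by auto
  from newton_of_ode_sol[OF newton_field_reverse[OF newton_ode_sol[OF N A']]] tn
  obtain J' \<sigma> where \<sigma>: "newton_solution S J' \<sigma>" "{0..0 - t} <= J'"
   "!!r. r : {0..0 - t} ==> \<sigma> r = chart_inv c (snd c (\<gamma> (0 - r))) & velocity c \<sigma> r = - velocity c \<gamma> (0 - r)"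
   by (metis fst_conv snd_conv diff_ge_0_iff_ge less_imp_le)
  have \<sigma>r: "\<sigma> r = \<gamma> (- r)" "velocity c \<sigma> r = - velocity c \<gamma> (- r)" if "r : {0..- t}" for r
  proof -
   have "- r : {t..0}" using that by auto
   then have "\<gamma> (- r) : fst c" using A'(2) by blast
   then show "\<sigma> r = \<gamma> (- r)" "velocity c \<sigma> r = - velocity c \<gamma> (- r)" using \<sigma>(3)[of r] that chartD(4) by simp_all
  qed
  have s0: "0 : {0..- t}" "- t : {0..- t}" using tn by auto
  have B: "{0..- t} <= J'" "\<sigma> 0 = q" using \<sigma>(2) \<sigma>r(1)[OF s0(1)] \<gamma>0 by auto
  have C': "\<sigma> ` {0..- t} <= A"
  proof clarify
   fix r assume r: "r : {0..- t}"
   then have "- r : {t1..t2}" using sub by auto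
   then show "\<sigma> r : A" using \<sigma>r(1)[OF r] inA by auto
  qed
  have "velocity c \<sigma> 0 : energy_sphere S c q"
   unfolding energy_sphere_iff \<sigma>r(2)[OF s0(1)] using v0 matrix_vector_mult_scaleR[of "K qz" "- 1" "velocity c \<gamma> 0"] by simp
  note fa = forward_arc[OF \<sigma>(1) B(1) C' B(2) _ this]
  have tp: "0 < - t" using tn by simp
  show thesis
  proof (rule fin[OF fa(1)[OF tp] fa(2)[OF tp]])
   fix \<tau> :: real assume \<tau>: "\<tau> : {0..1}"
   have "\<tau> * (- t) : {0..- t}" using \<tau> tp mult_left_le_one_le[of "- t" \<tau>] by (auto intro: mult_nonneg_nonpos)
   from \<sigma>r(1)[OF this] fa(3)[OF tp \<tau>] show "snd c (\<gamma> (\<tau> * t)) = F (\<tau> *R param (velocity c \<sigma> 0,- t))" by simp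
  next
   have "velocity c \<gamma> t = - velocity c \<sigma> (- t)" using \<sigma>r(2)[OF s0(2)] by simp
   also have "\<dots> = (1 / t) *R dF (param (velocity c \<sigma> 0,- t)) (param (velocity c \<sigma> 0,- t))"
    unfolding fa(4)[OF tp] by simp
   finally show "velocity c \<gamma> t = (1 / t) *R dF (param (velocity c \<sigma> 0,- t)) (param (velocity c \<sigma> 0,- t))" .
  qed
 qed
qed

lemma q_regular: "q = chart_inv c (F 0)" "0 : Q" "q : A" "q \<notin> C"
proof -
 show 1: "q = chart_inv c (F 0)" using chartD(4)[OF q(1)] F_0 by simp
 have "x_part k (F 0) = x" by (simp add: F_0 q x_part_add_axis[OF xk])
 then show 2: "0 : Q" using R x by (simp add: Q_def)
 show "q : A"
  using in_cylinder_F[of 0] R x start_height \<open>x_part k (F 0) = x\<close> by (simp flip: 1)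
 show "q \<notin> C"
 proof
  assume "q : C"
  then have "0 : KQ" using in_conjugate_locus[OF 2] 1 by simp
  then show False using KQ_D(5) by blast
 qed
qed

text \<open>The brake trajectory has constant horizontal part and runs continuously from q to height
  0, so it covers the segment by the intermediate value theorem.\<close>

lemma vertical_segment_brake:
 assumes "!!\<tau>. \<tau> : {0..1} ==> \<gamma> (\<tau> * t) = chart_inv c (F (\<tau> *R wb))"
 shows "vertical_segment c k q <= (%\<tau>. \<gamma> (\<tau> * t)) ` {0..1}"
proof
 fix P assume P: "P : vertical_segment c k q"
 have less: "norm (\<tau> *R wb) < R + 1" if "\<tau> : {0..1}" for \<tau>
  by (rule norm_scaled_less[OF _ that]) (use brake_norm in simp)
 have cont: "continuous_on {0..1} (%\<tau>. F (\<tau> *R wb) $ k)"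
  by (intro continuous_intros continuous_on_compose2[OF F_continuous]) (use less in auto)
 have "snd c P $ k <= F (0 *R wb) $ k" "F (1 *R wb) $ k <= snd c P $ k"
  using P F_brake F_0 xk by (simp_all add: vertical_segment_def)
 then have "\<exists>\<tau>\<ge>0. \<tau> <= 1 & F (\<tau> *R wb) $ k = snd c P $ k" by (intro IVT2' cont) auto
 then obtain \<tau> where \<tau>: "\<tau> : {0..1}" "F (\<tau> *R wb) $ k = snd c P $ k" by auto
 have "x_part k (F (\<tau> *R wb)) = x_part k (snd c P)"
  using brake_ray(2)[OF \<tau>(1) less[OF \<tau>(1)]] P by (simp add: vertical_segment_def q x_part_add_axis[OF xk])
 then have "F (\<tau> *R wb) = snd c P" using \<tau>(2) by (simp add: x_part_def)
 then have "P = \<gamma> (\<tau> * t)" using assms[OF \<tau>(1)] chartD(4) P by (simp add: vertical_segment_def)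
 then show "P : (%\<tau>. \<gamma> (\<tau> * t)) ` {0..1}" using \<tau>(1) by blast
qed

text \<open>Zero velocity means contact with the Hill boundary, which happens only for the parameter
  of the brake orbit; then the arc would cover the vertical segment. The tangency itself is that of
  \<open>ray_tangent\<close>.\<close>

lemma arcs_touch_tangentially:
 assumes arc: "geodesic_arc S A \<gamma> t1 t2" and t: "t1 <= 0" "0 <= t2" "t : {t1..t2}" and \<gamma>0: "\<gamma> 0 = q"
  and nv: "\<not> vertical_segment c k q <= \<gamma> ` {t1..t2}" and C: "\<gamma> t : C"
 shows "velocity c \<gamma> t ~= 0" "velocity c \<gamma> t : tangent_space \<Sigma> (snd c (\<gamma> t))"
proof -
 have t0: "t ~= 0" using C q_regular(4) \<gamma>0 by auto
 obtain w where w: "w : Q" "!!\<tau>. \<tau> : {0..1} ==> \<gamma> (\<tau> * t) = chart_inv c (F (\<tau> *R w))"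
  "velocity c \<gamma> t = (1 / t) *R dF w w" "velocity c \<gamma> t \<bullet> (K (F w) *v velocity c \<gamma> t) = f (F w)"
  using arc_point[OF arc t t0 \<gamma>0] by metis
 have gt: "\<gamma> t = chart_inv c (F w)" using w(2)[of 1] by simp
 then have K: "w : KQ" using in_conjugate_locus[OF w(1)] C by simp
 note wD = KQ_D[OF K]
 have sg: "snd c (\<gamma> t) = F w" unfolding gt by (rule F_in_chart(2)[OF wD(4)])
 show "velocity c \<gamma> t ~= 0"
 proof
  assume "velocity c \<gamma> t = 0"
  then have "f (F w) = 0" using w(4) by simp
  then have "F w $ k = 0" using f_sign(2)[OF F_in_chart(1)[OF wD(4)]] by simp
  then have "\<phi> w $ k = 0" using \<mu> by (simp add: F_nth)
  then have "w = wb" using height_zero_iff[OF wD(3)] by blast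
  then have "vertical_segment c k q <= (%\<tau>. \<gamma> (\<tau> * t)) ` {0..1}" using w(2) by (intro vertical_segment_brake) simp
  also have "\<dots> <= \<gamma> ` {t1..t2}" using arc_scaled[OF t] by blast
  finally show False using nv by simp
 qed
 obtain b where b: "d\<kappa> w b = 0" "dF w b = dF w w" using ray_tangent[OF K] by blast
 have "d\<kappa> w ((1 / t) *R b) = 0" using b(1) by (simp add: linear_scale[OF linear_d\<kappa>[OF wD(3)]])
 from tangent_space_\<Sigma>[OF K this] show "velocity c \<gamma> t : tangent_space \<Sigma> (snd c (\<gamma> t))"
  unfolding sg w(3) linear_scale[OF linear_dF[OF wD(4)]] b(2) .
qed

lemma reachable_in_closure:
 assumes w: "w : Q" "\<phi> w $ k <= 1"
 shows "chart_inv c (F w) : closure (connected_component_set (A - C) q)"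
proof (cases "w = 0")
 case True
 have "q : connected_component_set (A - C) q" using q_regular by (simp add: connected_component_refl)
 then show ?thesis using True q_regular(1) closure_subset by (metis subsetD)
next
 case False
 let ?m = "cc * (norm w)\<^sup>2"
 have m: "0 < ?m" using False cc by simp
 note wR = Q_norm[OF w(1)]
 have less: "norm (\<tau> *R w) < R + 1" if "\<tau> : {0..1}" for \<tau> by (rule norm_scaled_less[OF wR(2) that])
 \<comment> \<open>The trajectory is pushed up into the region above the fold, which it only reaches at its end.\<close>
 define Y where "Y \<tau> = F (\<tau> *R w) + (\<mu> * ?m * (\<tau> * (1 - \<tau>))) *R axis k 1" for \<tau>
 let ?P = "%\<tau>. chart_inv c (Y \<tau>)"
 have Yk: "Y \<tau> $ k = \<mu> * (\<phi> (\<tau> *R w) $ k + ?m * (\<tau> * (1 - \<tau>)))" for \<tau>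
  by (simp add: Y_def F_nth algebra_simps)
 have Yi: "i ~= k ==> Y \<tau> $ i = F (\<tau> *R w) $ i" for i \<tau> by (simp add: Y_def axis_def)
 have Yx: "x_part k (Y \<tau>) = x_part k (F (\<tau> *R w))" for \<tau>
  by (simp add: vec_eq_iff x_part_nth Yi)
 have Yheight: "0 <= Y \<tau> $ k" "Y \<tau> $ k <= \<mu>" if \<tau>: "\<tau> : {0..1}" for \<tau>
 proof -
  have "0 <= ?m * (\<tau> * (1 - \<tau>))" by (rule mult_nonneg_nonneg[OF less_imp_le[OF m]]) (use \<tau> in simp)
  then show "0 <= Y \<tau> $ k" unfolding Yk using height_nonneg[OF less[OF \<tau>]] \<mu> by simp
  have "\<mu> * (\<phi> (\<tau> *R w) $ k + ?m * (\<tau> * (1 - \<tau>))) <= \<mu> * 1"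
   using ray_height[OF wR(1) w(2) \<tau>] \<mu> by (intro mult_left_mono) auto
  then show "Y \<tau> $ k <= \<mu>" unfolding Yk by simp
 qed
 have YW: "x_part k (Y \<tau>) : W" if "\<tau> : {0..1}" for \<tau> using w(1) that by (simp add: Yx Q_def)
 have YA: "Y \<tau> : Z & ?P \<tau> : A" if \<tau>: "\<tau> : {0..1}" for \<tau>
 proof -
  have "Y \<tau> = x_part k (Y \<tau>) + Y \<tau> $ k *R e" by (simp add: x_part_def)
  then have "Y \<tau> : {x + y *R e | x y. x : W & 0 <= y & y <= \<mu>}" using YW[OF \<tau>] Yheight[OF \<tau>] by blast
  then have "Y \<tau> : snd c ` A" using A by (simp add: cylinder_set_def)
  then obtain P where P: "P : A" "Y \<tau> = snd c P" by blast
  then have "P : fst c" using in_cylinder_iff by blast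
  then show ?thesis using P chartD(3,4) by simp
 qed
 have YC: "?P \<tau> \<notin> C" if \<tau>: "\<tau> : {0..<1}" for \<tau>
 proof (cases "\<tau> = 0")
  case True
  then show ?thesis using q_regular(1,4) by (simp add: Y_def)
 next
  case False
  show ?thesis
  proof
   assume "?P \<tau> : C"
   then obtain w' where w': "w' : KQ" "?P \<tau> = chart_inv c (F w')" unfolding conjugate_locus_eq by blast
   note wD = KQ_D[OF w'(1)]
   have \<tau>': "\<tau> : {0..1}" using \<tau> by simp
   have "Y \<tau> = F w'" using chartD(6) YA[OF \<tau>'] w'(2) F_in_chart(2)[OF wD(4)] by metis
   then have e: "Y \<tau> $ i = F w' $ i" for i by simp
   \<comment> \<open>The raised point is vertically above the ray point, so the fold point has the
     same horizontal part as the ray point. Being lowest on that vertical line, it cannot be the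
     higher one of the two.\<close>
   have "\<phi> (\<tau> *R w) $ i = \<phi> w' $ i" if "i ~= k" for i
    using e[of i] Yi[OF that] that \<mu> s by (simp add: F_nth)
   then have "\<phi> w' $ k + cc * (norm (\<tau> *R w - w'))\<^sup>2 <= \<phi> (\<tau> *R w) $ k"
    by (rule above_fold[OF norm_ray[OF wR(1) \<tau>'] wD(3,2)])
   moreover have "0 <= cc * (norm (\<tau> *R w - w'))\<^sup>2" using cc by simp
   moreover have "\<phi> w' $ k = \<phi> (\<tau> *R w) $ k + ?m * (\<tau> * (1 - \<tau>))"
    using e[of k] \<mu> unfolding Yk by (simp add: F_nth)
   moreover have "0 < ?m * (\<tau> * (1 - \<tau>))" using m \<tau> False by simp
   ultimately show False by linarith
  qed
 qed
 have contY: "continuous_on {0..1} Y"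
  unfolding Y_def by (intro continuous_intros continuous_on_compose2[OF F_continuous]) (use less in auto)
 have contP: "continuous_on {0..1} ?P"
  by (rule continuous_on_compose2[OF chartD(8) contY]) (use YA in auto)
 have "connected (?P ` {0..<1})"
  by (rule connected_continuous_image[OF continuous_on_subset[OF contP]]) auto
 moreover have "?P ` {0..<1} <= A - C" using YA YC by force
 moreover have "q : ?P ` {0..<1}" using q_regular(1) by (auto simp: image_iff Y_def intro!: bexI[of _ 0])
 ultimately have sub: "?P ` {0..<1} <= connected_component_set (A - C) q"
  by (intro connected_component_maximal)
 have "?P 1 : closure (?P ` {0..<1})"
 proof -
  have "closure {0..<1::real} = {0..1}" by simp
  then have "?P ` {0..1} <= closure (?P ` {0..<1})"
   using image_closure_subset[of "{0..<1}" ?P "closure (?P ` {0..<1})"] contP closure_subset closed_closure by metis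
  then show ?thesis by auto
 qed
 then have "?P 1 : closure (connected_component_set (A - C) q)" using closure_mono[OF sub] by blast
 then show ?thesis by (simp add: Y_def)
qed

lemma arcs_on_closest_side:
 assumes arc: "geodesic_arc S A \<gamma> t1 t2" and t: "t1 <= 0" "0 <= t2" and \<gamma>0: "\<gamma> 0 = q"
 shows "\<gamma> ` {t1..t2} <= closest_side A C q"
proof clarify
 fix t assume tt: "t : {t1..t2}"
 then have inA: "\<gamma> t : A" using arc unfolding geodesic_arc_def by blast
 have "\<gamma> t : closure (connected_component_set (A - C) q)"
 proof (cases "t = 0")
  case True
  then show ?thesis using reachable_in_closure[OF q_regular(2)] \<gamma>0 q_regular(1) start_height by simp
 next
  case False
  obtain w where w: "w : Q" "\<phi> w $ k <= 1" "!!\<tau>. \<tau> : {0..1} ==> \<gamma> (\<tau> * t) = chart_inv c (F (\<tau> *R w))"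
   using arc_point[OF arc t tt False \<gamma>0] by metis
  then show ?thesis using reachable_in_closure[OF w(1,2)] w(3)[of 1] by simp
 qed
 then show "\<gamma> t : closest_side A C q" using inA by (simp add: closest_side_def)
qed

text \<open>On the brake ray \<kappa> crosses zero with negative slope. The signs slightly before
  and after the crossing persist for nearby rays, and the intermediate value theorem gives their
  fold points.\<close>

lemma downward_rays_reach_fold:
 obtains \<delta> where "0 < \<delta>" "!!u :: real^'n. dist u (- axis k 1) < \<delta> ==> \<exists>\<rho>>0. \<rho> *R u : KQ & \<phi> (\<rho> *R u) $ k <= 1"
proof -
 note wD = KQ_D[OF brake_fold]
 define \<rho>0 where "\<rho>0 = - p"
 have \<rho>0: "0 < \<rho>0" "wb = \<rho>0 *R (- e)" using brake_negative by (auto simp: \<rho>0_def wb_def)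
 have nwb: "norm wb = \<rho>0" unfolding \<rho>0(2) using \<rho>0(1) by simp
 have "continuous_on Q (%w. \<phi> w $ k)"
  using Q_norm(2) by (intro continuous_intros continuous_on_subset[OF smooth_on_continuous_on[OF smooth(1)]]) auto
 from continuous_open_preimage[OF this Q_open, of "{..<1}"]
 have "open (Q \<inter> (%w. \<phi> w $ k) -` {..<1})" by simp
 moreover have "wb : Q \<inter> (%w. \<phi> w $ k) -` {..<1}" using wD(1) brake_height by simp
 ultimately obtain r where r: "0 < r" "ball wb r <= Q \<inter> (%w. \<phi> w $ k) -` {..<1}" using openE by blast
 have "((%t. t *R wb) hvd wb) (at 1)" using line_has_vector_derivative[of 0 wb 1 UNIV] by simp
 moreover have "(\<kappa> has_derivative d\<kappa> wb) (at (1 *R wb))" using \<kappa>_derivative[OF wD(3)] by simp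
 ultimately have "(\<kappa> \<circ> (%t. t *R wb) hvd d\<kappa> wb wb) (at 1)" by (rule has_vector_derivative_compose_at)
 then have d: "((%t. \<kappa> (t *R wb)) has_real_derivative d\<kappa> wb wb) (at 1)"
  by (simp add: o_def has_real_derivative_iff_has_vector_derivative)
 have neg: "d\<kappa> wb wb < 0" by (rule crit_decreasing[OF wD(3,2)])
 obtain d1 where d1: "0 < d1" "!!h. 0 < h ==> h < d1 ==> \<kappa> ((1 + h) *R wb) < 0"
  using DERIV_neg_dec_right[OF d neg] wD(2) by auto
 obtain d2 where d2: "0 < d2" "!!h. 0 < h ==> h < d2 ==> 0 < \<kappa> ((1 - h) *R wb)"
  using DERIV_neg_dec_left[OF d neg] wD(2) by auto
 \<comment> \<open>Chosen so that 1 - \<eta> and 1 + \<eta> times the brake parameter lie on the two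
   sides of the sign change and within r / 2 of it.\<close>
 define \<eta> where "\<eta> = min (min d1 d2) (min 1 (r / (2 * \<rho>0))) / 2"
 have "0 < r / (2 * \<rho>0)" using r \<rho>0 by simp
 then have \<eta>: "0 < \<eta>" "\<eta> < d1" "\<eta> < d2" "\<eta> < 1" "\<eta> < r / (2 * \<rho>0)"
  using d1(1) d2(1) by (auto simp: \<eta>_def min_def)
 then have \<eta>r: "\<eta> * \<rho>0 < r / 2" using \<rho>0 by (simp add: field_simps)
 let ?w1 = "(1 - \<eta>) *R wb" and ?w2 = "(1 + \<eta>) *R wb"
 have diff: "norm (\<tau> *R wb - wb) < r / 2" if "\<tau> : {1 - \<eta>..1 + \<eta>}" for \<tau>
 proof -
  have "\<tau> *R wb - wb = (\<tau> - 1) *R wb" by (simp add: algebra_simps)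
  then have "norm (\<tau> *R wb - wb) = \<bar>\<tau> - 1\<bar> * \<rho>0" by (simp add: nwb)
  also have "\<dots> <= \<eta> * \<rho>0" using that \<rho>0 by (intro mult_right_mono) (auto simp: abs_le_iff)
  finally show ?thesis using \<eta>r by linarith
 qed
 have in_ball: "\<tau> *R wb : ball wb r" if "\<tau> : {1 - \<eta>..1 + \<eta>}" for \<tau>
  using diff[OF that] r(1) by (simp add: dist_norm norm_minus_commute)
 have \<kappa>c: "isCont \<kappa> (\<tau> *R wb)" if "\<tau> : {1 - \<eta>..1 + \<eta>}" for \<tau>
  using in_ball[OF that] r(2) Q_norm(1) \<kappa>_derivative has_derivative_continuous by blast
 have e1: "1 - \<eta> : {1 - \<eta>..1 + \<eta>}" and e2: "1 + \<eta> : {1 - \<eta>..1 + \<eta>}" using \<eta>(1) by auto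
 have "0 < \<kappa> ?w1" "\<kappa> ?w2 < 0" using d1(2)[OF \<eta>(1,2)] d2(2)[OF \<eta>(1,3)] by auto
 obtain \<delta>1 where \<delta>1: "0 < \<delta>1" "!!w. dist w ?w1 < \<delta>1 ==> dist (\<kappa> w) (\<kappa> ?w1) < \<kappa> ?w1"
  using \<kappa>c[OF e1, unfolded continuous_at_eps_delta, rule_format, OF \<open>0 < \<kappa> ?w1\<close>] unfolding dist_norm by blast
 have "0 < - \<kappa> ?w2" using \<open>\<kappa> ?w2 < 0\<close> by simp
 obtain \<delta>2 where \<delta>2: "0 < \<delta>2" "!!w. dist w ?w2 < \<delta>2 ==> dist (\<kappa> w) (\<kappa> ?w2) < - \<kappa> ?w2"
  using \<kappa>c[OF e2, unfolded continuous_at_eps_delta, rule_format, OF \<open>0 < - \<kappa> ?w2\<close>] unfolding dist_norm by blast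
 \<comment> \<open>Since \<tau> <= 1 + \<eta> < 2, the factor 2 \<rho>0 converts a deviation of the
   direction into one of the parameter.\<close>
 define \<delta> where "\<delta> = min (min \<delta>1 \<delta>2) (r / 2) / (2 * \<rho>0)"
 have \<delta>: "0 < \<delta>" "2 * \<rho>0 * \<delta> <= \<delta>1" "2 * \<rho>0 * \<delta> <= \<delta>2" "2 * \<rho>0 * \<delta> <= r / 2"
  using \<delta>1(1) \<delta>2(1) r(1) \<rho>0(1) by (auto simp: \<delta>_def)
 show ?thesis
 proof (rule that[OF \<delta>(1)])
  fix u :: "real^'n" assume u: "dist u (- axis k 1) < \<delta>"
  have close: "dist (\<tau> *R \<rho>0 *R u) (\<tau> *R wb) < 2 * \<rho>0 * \<delta>" if \<tau>: "\<tau> : {1 - \<eta>..1 + \<eta>}" for \<tau>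
  proof -
   have "\<tau> *R \<rho>0 *R u - \<tau> *R wb = (\<tau> * \<rho>0) *R (u - (- e))" unfolding \<rho>0(2) by (simp add: algebra_simps)
   then have "dist (\<tau> *R \<rho>0 *R u) (\<tau> *R wb) = \<bar>\<tau> * \<rho>0\<bar> * dist u (- e)" by (simp add: dist_norm)
   also have "\<dots> <= (2 * \<rho>0) * dist u (- e)"
    using \<tau> \<eta> \<rho>0(1) by (intro mult_right_mono) (auto simp: abs_mult)
   also have "\<dots> < (2 * \<rho>0) * \<delta>" using u \<rho>0(1) by (intro mult_strict_left_mono) auto
   finally show ?thesis .
  qed
  have inQ: "\<tau> *R \<rho>0 *R u : Q" "\<phi> (\<tau> *R \<rho>0 *R u) $ k < 1" if \<tau>: "\<tau> : {1 - \<eta>..1 + \<eta>}" for \<tau>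
  proof -
   have "dist (\<tau> *R \<rho>0 *R u) wb <= dist (\<tau> *R \<rho>0 *R u) (\<tau> *R wb) + dist (\<tau> *R wb) wb" by (rule dist_triangle)
   also have "\<dots> < r / 2 + r / 2" using close[OF \<tau>] diff[OF \<tau>] \<delta>(4) unfolding dist_norm by (intro add_strict_mono) auto
   finally have "\<tau> *R \<rho>0 *R u : ball wb r" by (simp add: dist_commute)
   then show "\<tau> *R \<rho>0 *R u : Q" "\<phi> (\<tau> *R \<rho>0 *R u) $ k < 1" using r(2) by auto
  qed
  have "0 <= \<kappa> ((1 - \<eta>) *R \<rho>0 *R u)"
   using \<delta>1(2)[OF less_le_trans[OF close[OF e1] \<delta>(2)]] by (simp add: dist_real_def abs_less_iff)
  moreover have "\<kappa> ((1 + \<eta>) *R \<rho>0 *R u) <= 0"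
   using \<delta>2(2)[OF less_le_trans[OF close[OF e2] \<delta>(3)]] by (simp add: dist_real_def abs_less_iff)
  moreover have "continuous_on {1 - \<eta>..1 + \<eta>} (%\<tau>. \<kappa> (\<tau> *R \<rho>0 *R u))"
  proof (rule continuous_on_compose2[OF \<kappa>_continuous])
   show "continuous_on {1 - \<eta>..1 + \<eta>} (%\<tau>. \<tau> *R \<rho>0 *R u)" by (intro continuous_intros)
   show "(%\<tau>. \<tau> *R \<rho>0 *R u) ` {1 - \<eta>..1 + \<eta>} <= cball 0 R"
    using inQ(1) Q_norm(1) by (simp only: image_subset_iff mem_cball_0) blast
  qed
  ultimately have "\<exists>\<tau>\<ge>1 - \<eta>. \<tau> <= 1 + \<eta> & \<kappa> (\<tau> *R \<rho>0 *R u) = 0" by (intro IVT2') (use \<eta> in auto)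
  then obtain \<tau> where \<tau>: "\<tau> : {1 - \<eta>..1 + \<eta>}" "\<kappa> (\<tau> *R \<rho>0 *R u) = 0" by auto
  have "0 < \<tau> * \<rho>0" using \<tau>(1) \<eta>(4) \<rho>0(1) by simp
  moreover have "(\<tau> * \<rho>0) *R u : KQ" "\<phi> ((\<tau> * \<rho>0) *R u) $ k <= 1" using inQ[OF \<tau>(1)] \<tau>(2) by (simp_all add: KQ_def)
  ultimately show "\<exists>\<rho>>0. \<rho> *R u : KQ & \<phi> (\<rho> *R u) $ k <= 1" by blast
 qed
qed

lemma downward_geodesics_touch:
 "\<exists>\<delta>>0. \<forall>v\<in>energy_sphere S c q. dist (sgn v) (- axis k 1) < \<delta> \<longrightarrow>
   (\<exists>t. (v,t) : exp_domain S c A q & newton_exp S c q (v,t) : C)"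
proof -
 obtain \<delta> where \<delta>: "0 < \<delta>" "!!u :: real^'n. dist u (- axis k 1) < \<delta> ==> \<exists>\<rho>>0. \<rho> *R u : KQ & \<phi> (\<rho> *R u) $ k <= 1"
  using downward_rays_reach_fold by metis
 have "\<exists>t. (v,t) : exp_domain S c A q & newton_exp S c q (v,t) : C"
  if v: "v : energy_sphere S c q" and d: "dist (sgn v) (- axis k 1) < \<delta>" for v
 proof -
  obtain \<rho> where \<rho>: "0 < \<rho>" "\<rho> *R sgn v : KQ" "\<phi> (\<rho> *R sgn v) $ k <= 1" using \<delta>(2)[OF d] by blast
  have v0: "v ~= 0" using KQ_D(5)[OF \<rho>(2)] by auto
  \<comment> \<open>Solves \<open>param (v,t) = \<rho> *R sgn v\<close> for t.\<close>
  define t where "t = \<rho> * (\<mu> * s) / norm v"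
  have t: "0 < t" using \<rho>(1) \<mu> s v0 by (simp add: t_def)
  have z: "(v,t) : X" using v t by (simp add: exp_manifold_def)
  have "t / (\<mu> * s) = \<rho> / norm v" using \<mu> s(1) by (simp add: t_def)
  then have pz: "param (v,t) = \<rho> *R sgn v" by (simp add: param_def sgn_div_norm divide_inverse)
  have "(v,t) : exp_domain S c A q" using z KQ_D(1)[OF \<rho>(2)] \<rho>(3) by (simp add: exp_domain_iff pz)
  moreover have "newton_exp S c q (v,t) : C"
   using newton_exp_param(1)[OF z] KQ_D(4)[OF \<rho>(2)] \<rho>(2,3) unfolding pz conjugate_locus_eq by auto
  ultimately show ?thesis by blast
 qed
 then show ?thesis using \<delta>(1) by blast
qed

end

theorem theorem2:
  fixes S :: "('p::{t2_space, second_countable_topology}, 'n::finite) mech_system"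
    and q0 :: 'p and k :: 'n and c :: "('p, 'n) chart" and W :: "(real ^ 'n) set"
  assumes "mechanical_system S"
    and "regular_boundary_point S q0"
    and "seifert_chart S q0 k c"
    and "cylinder_base c k W"
  shows "\<exists>\<epsilon>0>0. \<forall>\<epsilon> A q C qs. 0 < \<epsilon> \<and> \<epsilon> \<le> \<epsilon>0 \<and> cylinder_set c k W \<epsilon> A \<and>
      q \<in> A \<and> q \<notin> hill_boundary S \<and> C = conjugate_locus S c A q \<and> qs = brake_point c k q \<longrightarrow>
    \<comment> \<open>(i) and (iv), which share the tangent spaces of the hypersurface\<close>
    (\<exists>\<Sigma>. hypersurface_upto (chart_img c) (\<lambda>z. z $ k - \<epsilon>) (snd c ` C) \<Sigma> \<and>
       C \<inter> hill_boundary S = {qs} \<and>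
       tangent_space \<Sigma> (snd c qs) =
         tangent_space (snd c ` (fst c \<inter> hill_boundary S)) (snd c qs) \<and>
       (\<forall>\<gamma> a b. geodesic_arc S A \<gamma> a b \<and> a \<le> 0 \<and> 0 \<le> b \<and> \<gamma> 0 = q \<and>
          \<not> vertical_segment c k q \<subseteq> \<gamma> ` {a..b} \<longrightarrow>
          (\<forall>t\<in>{a..b}. \<gamma> t \<in> C \<longrightarrow>
             velocity c \<gamma> t \<noteq> 0 \<and> velocity c \<gamma> t \<in> tangent_space \<Sigma> (snd c (\<gamma> t))))) \<and>
    \<comment> \<open>(ii)\<close>
    (represents_fold (exp_manifold S c q) (exp_domain S c A q)
       (\<lambda>z. snd c (newton_exp S c q z) $ k - \<epsilon>) (snd c \<circ> newton_exp S c q) \<and>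
     C = newton_exp S c q ` exp_crit S c A q) \<and>
    \<comment> \<open>(iii)\<close>
    (\<forall>\<gamma> a b. geodesic_arc S A \<gamma> a b \<and> a \<le> 0 \<and> 0 \<le> b \<and> \<gamma> 0 = q \<longrightarrow>
       \<gamma> ` {a..b} \<subseteq> closest_side A C q) \<and>
    \<comment> \<open>(v)\<close>
    (\<exists>\<delta>>0. \<forall>v\<in>energy_sphere S c q. dist (sgn v) (- axis k 1) < \<delta> \<longrightarrow>
       (\<exists>t. (v, t) \<in> exp_domain S c A q \<and> newton_exp S c q (v, t) \<in> C))"
proof -
 have "c : charts S" using assms(3) by (simp add: seifert_chart_def)
 then interpret seifert S c q0 k W using assms by unfold_locales
 obtain \<mu>0 R cc \<Phi> a l \<kappa> where \<mu>0: "0 < \<mu>0"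
  and fold: "!!\<mu> x s. 0 < \<mu> ==> \<mu> <= \<mu>0 ==> x : Wc ==> 0 < s ==> s <= 1 ==> fold_map k R cc s (\<Phi> \<mu> x s) (a \<mu> x s) (l \<mu> x s) (\<kappa> \<mu> x s)"
  and G\<Phi>: "!!\<mu> x s w. 0 < \<mu> ==> \<mu> <= \<mu>0 ==> x : Wc ==> 0 < s ==> s <= 1 ==> norm w < R + 1 ==>
   (\<mu>,x,s,w) : Om & G (\<mu>,x,s,w) = (\<chi> i. if i = k then \<Phi> \<mu> x s w $ i else s * \<Phi> \<mu> x s w $ i)"
  by (rule fold_map_exists) blast
 obtain \<mu>3 where \<mu>3: "0 < \<mu>3"
  and brake: "!!\<mu> x s. 0 < \<mu> ==> \<mu> <= \<mu>3 ==> x : Wc ==> 0 < s ==> s <= 1 ==>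
   \<exists>p. p ~= 0 & (\<mu>,x,s,p *R e) : Om & G (\<mu>,x,s,p *R e) = 0 &
    (\<forall>\<tau>\<in>{0..1}. G (\<mu>,x,s,\<tau> *R p *R e) $ k <= s\<^sup>2 & (\<forall>i. i ~= k \<longrightarrow> G (\<mu>,x,s,\<tau> *R p *R e) $ i = 0))"
  by (rule brake_down) blast
 show ?thesis
 \<comment> \<open>The scale \<mu> is the height of the cylinder itself, so bounds on \<mu> are
   bounds on \<epsilon>.\<close>
 proof (intro exI[of _ "min \<mu>0 \<mu>3"] conjI[of "0 < min \<mu>0 \<mu>3"] allI impI, goal_cases)
  case 1
  show ?case using \<mu>0 \<mu>3 by simp
 next
  case (2 \<epsilon> A q C qs)
  then have \<epsilon>: "0 < \<epsilon>" "\<epsilon> <= min \<mu>0 \<mu>3" and A: "cylinder_set c k W \<epsilon> A" and q: "q : A" "q \<notin> hill_boundary S"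
   and C: "C = conjugate_locus S c A q" and qs: "qs = brake_point c k q"
   by blast+
  define x where "x = x_part k (snd c q)"
  \<comment> \<open>From y = \<epsilon> s^2; here s > 0 because q is off the Hill boundary and s <=
    1 because q lies in the cylinder.\<close>
  define s where "s = sqrt (snd c q $ k / \<epsilon>)"
  have "snd c q : {x + y *R e | x y. x : W & 0 <= y & y <= \<epsilon>}" and qc: "q : fst c"
   using A q(1) unfolding cylinder_set_def by blast+
  then obtain x' y where xy: "snd c q = x' + y *R e" "x' : W" "0 <= y" "y <= \<epsilon>" by blast
  have x'k: "x' $ k = 0" using xy(2) Wc(3,4) by blast
  have y: "snd c q $ k = y" and xx: "x = x'" using axis_decomposition[OF x'k] x_part_add_axis[OF x'k] by (simp_all add: xy(1) x_def)
  have "f (snd c q) = hill_fun S q" using chartD(4)[OF qc] by (simp add: f_def)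
  then have "y ~= 0" using f_sign(2)[OF chartD(3)[OF qc]] q(2) y by (simp add: hill_boundary_def)
  then have s: "0 < s" "s <= 1" "\<epsilon> * s\<^sup>2 = y" using xy(3,4) \<epsilon>(1) by (simp_all add: s_def y)
  have x: "x : W" "x : Wc" using xy(2) xx Wc(4) by auto
  have e0: "\<epsilon> <= \<mu>0" "\<epsilon> <= \<mu>3" using \<epsilon>(2) by auto
  obtain p where p: "p ~= 0" "(\<epsilon>,x,s,p *R e) : Om" "G (\<epsilon>,x,s,p *R e) = 0"
   "\<forall>\<tau>\<in>{0..1}. G (\<epsilon>,x,s,\<tau> *R p *R e) $ k <= s\<^sup>2 & (\<forall>i. i ~= k \<longrightarrow> G (\<epsilon>,x,s,\<tau> *R p *R e) $ i = 0)"
   using brake[OF \<epsilon>(1) e0(2) x(2) s(1,2)] by blast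
  interpret fm: fold_map k R cc s "\<Phi> \<epsilon> x s" "a \<epsilon> x s" "l \<epsilon> x s" "\<kappa> \<epsilon> x s"
   by (rule fold[OF \<epsilon>(1) e0(1) x(2) s(1,2)])
  interpret fold_point S c q0 k W R cc s "\<Phi> \<epsilon> x s" "a \<epsilon> x s" "l \<epsilon> x s" "\<kappa> \<epsilon> x s" \<epsilon> p x q A
  proof unfold_locales
   show "snd c q = x + (\<epsilon> * s\<^sup>2) *R axis k 1" using xy(1) xx s(3) by simp
   show "norm w < R + 1 ==> (\<epsilon>,x,s,w) : Om & G (\<epsilon>,x,s,w) = (\<chi> i. if i = k then \<Phi> \<epsilon> x s w $ i else s * \<Phi> \<epsilon> x s w $ i)" for w
    by (rule G\<Phi>[OF \<epsilon>(1) e0(1) x(2) s(1,2)])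
  qed (use \<epsilon>(1) x(1) qc A p in blast)+
  show ?case
   unfolding C qs
   by (intro conjI exI[of _ \<Sigma>]; (rule conjugate_hypersurface conjugate_locus_boundary \<Sigma>_tangent_boundary fold_singularity
     conjugate_locus_eq_crit downward_geodesics_touch | (use arcs_touch_tangentially arcs_on_closest_side in blast)))
 qed
qed

end
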